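(* Let $\mathcal{B}$ be a unital separable C*-algebra and let $\mathcal{A}$ be a unital C*-subalgebra of $\mathcal{B}$ with $\mathcal{Z}(\mathcal{B})\subseteq\mathcal{A}$. Suppose $\{\mathcal{J}_i:i\in I\}$ is a family of closed two-sided ideals of $\mathcal{B}$ such that 1. if $i\neq j$ are in $I$, then $(\mathcal{A}\cap\mathcal{J}_i)+(\mathcal{A}\cap\mathcal{J}_j)=\mathcal{A}$; 2. $\mathcal{A}/(\mathcal{A}\cap\mathcal{J}_i)$ is approximately normal in $\mathcal{B}/\mathcal{J}_i$ for each $i\in I$; 3. if $\mathcal{J}$ is a primitive ideal in $\mathcal{B}$, then there is an $i\in I$ such that $\mathcal{J}_i\subseteq\mathcal{J}$. Then $\mathcal{A}$ is approximately normal in $\mathcal{B}$.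
   Context: $\mathcal{Z}(\mathcal{B})$ is the center of $\mathcal{B}$; unital subalgebras contain the unit of $\mathcal{B}$. A primitive ideal is the kernel of an irreducible representation. $\mathcal{A}/(\mathcal{A}\cap\mathcal{J}_i)$ is identified with the image of $\mathcal{A}$ under the quotient map $\mathcal{B}\to\mathcal{B}/\mathcal{J}_i$. For a unital C*-algebra $\mathcal{B}$ and $\mathcal{S}\subseteq\mathcal{B}$, the relative approximate double commutant $\mathrm{Appr}(\mathcal{S},\mathcal{B})''$ is the set of all $T\in\mathcal{B}$ such that $\|TA_\lambda-A_\lambda T\|\to 0$ for every bounded net $\{A_\lambda\}$ in $\mathcal{B}$ for which $\|SA_\lambda-A_\lambda S\|\to 0$ for every $S\in\mathcal{S}$. A subalgebra $\mathcal{A}$ of $\mathcal{B}$ is approximately normal in $\mathcal{B}$ if $\mathcal{A}=\mathrm{Appr}(\mathcal{A},\mathcal{B})''$. *)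

theory Defs
  imports "HOL-Analysis.Analysis" "HOL-Algebra.QuotRing" "HOL-Algebra.Subrings"
begin

section \<open>Unital C*-algebras on carrier sets\<close>

text \<open>
  Everything is carrier-based, in the style of HOL-Algebra, so that quotients such as
  \<open>\<B>/\<J>\<close> are objects of the same kind as \<open>\<B>\<close>. In HOL-Analysis and HOL-Algebra together
  there are two different locales called \<open>module\<close>; here \<open>Module.module\<close> is the one of HOL-Algebra.
\<close>

definition complex_ring :: "complex ring" where
  "complex_ring = \<lparr>carrier = UNIV, mult = (*), one = 1, zero = 0, add = (+)\<rparr>"

text \<open>
  The value outside the carrier is irrelevant; it is \<open>0\<close> only because \<^locale>\<open>Metric_space\<close>
  asks for nonnegativity and symmetry on the whole type.
\<close>

definition norm_dist :: "('a, 'm) ring_scheme \<Rightarrow> ('a \<Rightarrow> real) \<Rightarrow> 'a \<Rightarrow> 'a \<Rightarrow> real" where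
  "norm_dist M n x y = (if x \<in> carrier M \<and> y \<in> carrier M then n (x \<ominus>\<^bsub>M\<^esub> y) else 0)"

definition norm_topology :: "('a, 'm) ring_scheme \<Rightarrow> ('a \<Rightarrow> real) \<Rightarrow> 'a topology" where
  "norm_topology M n = Metric_space.mtopology (carrier M) (norm_dist M n)"

record 'a star_alg = "(complex, 'a) module" +
  adj :: "'a \<Rightarrow> 'a"
  nrm :: "'a \<Rightarrow> real"

text \<open>The zero algebra is admitted (there \<open>\<one> = \<zero>\<close>).\<close>

locale unital_cstar_algebra = B?: ring B + V: Module.module complex_ring B
  for B :: "'a star_alg" (structure) +
  assumes smult_mult_left:
      "\<lbrakk>x \<in> carrier B; y \<in> carrier B\<rbrakk> \<Longrightarrow> (c \<odot> x) \<otimes> y = c \<odot> (x \<otimes> y)"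
    and smult_mult_right:
      "\<lbrakk>x \<in> carrier B; y \<in> carrier B\<rbrakk> \<Longrightarrow> x \<otimes> (c \<odot> y) = c \<odot> (x \<otimes> y)"
    and nrm_nonneg: "x \<in> carrier B \<Longrightarrow> 0 \<le> nrm B x"
    and nrm_eq_0: "x \<in> carrier B \<Longrightarrow> nrm B x = 0 \<longleftrightarrow> x = \<zero>"
    and nrm_triangle:
      "\<lbrakk>x \<in> carrier B; y \<in> carrier B\<rbrakk> \<Longrightarrow> nrm B (x \<oplus> y) \<le> nrm B x + nrm B y"
    and nrm_smult: "x \<in> carrier B \<Longrightarrow> nrm B (c \<odot> x) = cmod c * nrm B x"
    and nrm_mult:
      "\<lbrakk>x \<in> carrier B; y \<in> carrier B\<rbrakk> \<Longrightarrow> nrm B (x \<otimes> y) \<le> nrm B x * nrm B y"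
    and complete: "Metric_space.mcomplete (carrier B) (norm_dist B (nrm B))"
    and adj_closed: "x \<in> carrier B \<Longrightarrow> adj B x \<in> carrier B"
    and adj_adj: "x \<in> carrier B \<Longrightarrow> adj B (adj B x) = x"
    and adj_add:
      "\<lbrakk>x \<in> carrier B; y \<in> carrier B\<rbrakk> \<Longrightarrow> adj B (x \<oplus> y) = adj B x \<oplus> adj B y"
    and adj_smult: "x \<in> carrier B \<Longrightarrow> adj B (c \<odot> x) = cnj c \<odot> adj B x"
    and adj_mult:
      "\<lbrakk>x \<in> carrier B; y \<in> carrier B\<rbrakk> \<Longrightarrow> adj B (x \<otimes> y) = adj B y \<otimes> adj B x"
    and cstar_identity: "x \<in> carrier B \<Longrightarrow> nrm B (adj B x \<otimes> x) = (nrm B x)\<^sup>2"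

definition separable_star_alg :: "'a star_alg \<Rightarrow> bool" where
  "separable_star_alg B \<longleftrightarrow> separable_space (norm_topology B (nrm B))"

definition closed_ideal :: "'a star_alg \<Rightarrow> 'a set \<Rightarrow> bool" where
  "closed_ideal B J \<longleftrightarrow> ideal J B \<and> closedin (norm_topology B (nrm B)) J"

definition unital_cstar_subalgebra :: "'a star_alg \<Rightarrow> 'a set \<Rightarrow> bool" where
  "unital_cstar_subalgebra B A \<longleftrightarrow>
     subring A B \<and> (\<forall>c. \<forall>a\<in>A. c \<odot>\<^bsub>B\<^esub> a \<in> A) \<and> (\<forall>a\<in>A. adj B a \<in> A) \<and>
     closedin (norm_topology B (nrm B)) A"

definition alg_center :: "'a star_alg \<Rightarrow> 'a set" where
  "alg_center B = {z \<in> carrier B. \<forall>x\<in>carrier B. z \<otimes>\<^bsub>B\<^esub> x = x \<otimes>\<^bsub>B\<^esub> z}"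

text \<open>
  The ring \<open>B Quot J\<close> of cosets \<open>J +> x\<close>, with the operations induced from \<open>B\<close> and the
  quotient norm. The unions are over all representatives, as in \<^const>\<open>rcoset_mult\<close>.
\<close>

definition quotient_alg :: "'a star_alg \<Rightarrow> 'a set \<Rightarrow> 'a set star_alg" where
  "quotient_alg B J =
     \<lparr>carrier = carrier (B Quot J), mult = mult (B Quot J), one = one (B Quot J),
      zero = zero (B Quot J), add = add (B Quot J),
      smult = (\<lambda>c X. \<Union>x\<in>X. J +>\<^bsub>B\<^esub> (c \<odot>\<^bsub>B\<^esub> x)),
      adj = (\<lambda>X. \<Union>x\<in>X. J +>\<^bsub>B\<^esub> adj B x),
      nrm = (\<lambda>X. INF x\<in>X. nrm B x)\<rparr>"


section \<open>Irreducible representations and primitive ideals\<close>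

text \<open>
  As usual in HOL-Algebra, the ring fields \<open>mult\<close> and \<open>one\<close> of a module record play no role.
  Inner products are linear in the first argument.
\<close>

record 'h hilbert = "(complex, 'h) module" +
  ip :: "'h \<Rightarrow> 'h \<Rightarrow> complex"

definition hnorm :: "'h hilbert \<Rightarrow> 'h \<Rightarrow> real" where
  "hnorm H v = sqrt (Re (ip H v v))"

locale hilbert_space = Module.module complex_ring H
  for H :: "'h hilbert" (structure) +
  assumes ip_add_left:
      "\<lbrakk>u \<in> carrier H; v \<in> carrier H; w \<in> carrier H\<rbrakk> \<Longrightarrow>
       ip H (u \<oplus> v) w = ip H u w + ip H v w"
    and ip_smult_left:
      "\<lbrakk>v \<in> carrier H; w \<in> carrier H\<rbrakk> \<Longrightarrow> ip H (c \<odot> v) w = c * ip H v w"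
    and ip_commute: "\<lbrakk>v \<in> carrier H; w \<in> carrier H\<rbrakk> \<Longrightarrow> ip H w v = cnj (ip H v w)"
    and ip_nonneg: "v \<in> carrier H \<Longrightarrow> 0 \<le> Re (ip H v v)"
    and ip_definite: "\<lbrakk>v \<in> carrier H; ip H v v = 0\<rbrakk> \<Longrightarrow> v = \<zero>"
    and complete: "Metric_space.mcomplete (carrier H) (norm_dist H (hnorm H))"

definition closed_subspace :: "'h hilbert \<Rightarrow> 'h set \<Rightarrow> bool" where
  "closed_subspace H M \<longleftrightarrow> submodule M complex_ring H \<and> closedin (norm_topology H (hnorm H)) M"

definition bounded_operator :: "'h hilbert \<Rightarrow> ('h \<Rightarrow> 'h) \<Rightarrow> bool" where
  "bounded_operator H T \<longleftrightarrow>
     T \<in> carrier H \<rightarrow> carrier H \<and>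
     (\<forall>v\<in>carrier H. \<forall>w\<in>carrier H. T (v \<oplus>\<^bsub>H\<^esub> w) = T v \<oplus>\<^bsub>H\<^esub> T w) \<and>
     (\<forall>c. \<forall>v\<in>carrier H. T (c \<odot>\<^bsub>H\<^esub> v) = c \<odot>\<^bsub>H\<^esub> T v) \<and>
     (\<exists>K. \<forall>v\<in>carrier H. hnorm H (T v) \<le> K * hnorm H v)"

text \<open>Unital *-homomorphisms into the bounded operators on \<open>H\<close>.\<close>

definition representation :: "'a star_alg \<Rightarrow> 'h hilbert \<Rightarrow> ('a \<Rightarrow> 'h \<Rightarrow> 'h) \<Rightarrow> bool" where
  "representation B H \<pi> \<longleftrightarrow>
     hilbert_space H \<and>
     (\<forall>a\<in>carrier B. bounded_operator H (\<pi> a)) \<and>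
     (\<forall>v\<in>carrier H. \<pi> \<one>\<^bsub>B\<^esub> v = v) \<and>
     (\<forall>a\<in>carrier B. \<forall>b\<in>carrier B. \<forall>v\<in>carrier H. \<pi> (a \<oplus>\<^bsub>B\<^esub> b) v = \<pi> a v \<oplus>\<^bsub>H\<^esub> \<pi> b v) \<and>
     (\<forall>c. \<forall>a\<in>carrier B. \<forall>v\<in>carrier H. \<pi> (c \<odot>\<^bsub>B\<^esub> a) v = c \<odot>\<^bsub>H\<^esub> \<pi> a v) \<and>
     (\<forall>a\<in>carrier B. \<forall>b\<in>carrier B. \<forall>v\<in>carrier H. \<pi> (a \<otimes>\<^bsub>B\<^esub> b) v = \<pi> a (\<pi> b v)) \<and>
     (\<forall>a\<in>carrier B. \<forall>v\<in>carrier H. \<forall>w\<in>carrier H. ip H (\<pi> a v) w = ip H v (\<pi> (adj B a) w))"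

definition irreducible_representation ::
    "'a star_alg \<Rightarrow> 'h hilbert \<Rightarrow> ('a \<Rightarrow> 'h \<Rightarrow> 'h) \<Rightarrow> bool" where
  "irreducible_representation B H \<pi> \<longleftrightarrow>
     representation B H \<pi> \<and> carrier H \<noteq> {\<zero>\<^bsub>H\<^esub>} \<and>
     (\<forall>M. closed_subspace H M \<and> (\<forall>a\<in>carrier B. \<forall>v\<in>M. \<pi> a v \<in> M) \<longrightarrow>
        M = {\<zero>\<^bsub>H\<^esub>} \<or> M = carrier H)"

definition representation_kernel ::
    "'a star_alg \<Rightarrow> 'h hilbert \<Rightarrow> ('a \<Rightarrow> 'h \<Rightarrow> 'h) \<Rightarrow> 'a set" where
  "representation_kernel B H \<pi> = {a \<in> carrier B. \<forall>v\<in>carrier H. \<pi> a v = \<zero>\<^bsub>H\<^esub>}"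

text \<open>
  Hilbert spaces of all types cannot be quantified over inside a definition. The elements of
  \<open>H\<close> are taken from the type \<open>nat \<Rightarrow> 'a\<close>, which is no restriction: if \<open>\<pi>\<close> is irreducible on a
  Hilbert space \<open>H\<close> of any type and \<open>\<xi> \<in> H\<close> is nonzero, then the closure of \<open>\<pi>(B)\<xi>\<close> is \<open>H\<close>, so
  each element of \<open>H\<close> is the limit of \<open>\<pi>(b\<^sub>n)\<xi>\<close> for some sequence \<open>b\<close> in \<open>B\<close>. Choosing one such
  sequence for each element embeds \<open>H\<close> into \<open>nat \<Rightarrow> 'a\<close>, and the structure and \<open>\<pi>\<close> can be
  transported along this injection, with the same kernel.
\<close>

definition primitive_ideal :: "'a star_alg \<Rightarrow> 'a set \<Rightarrow> bool" where
  "primitive_ideal B J \<longleftrightarrow>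
     (\<exists>(H :: (nat \<Rightarrow> 'a) hilbert) \<pi>.
        irreducible_representation B H \<pi> \<and> J = representation_kernel B H \<pi>)"


section \<open>Approximate double commutants\<close>

definition directed_on :: "'d set \<Rightarrow> ('d \<Rightarrow> 'd \<Rightarrow> bool) \<Rightarrow> bool" where
  "directed_on D leq \<longleftrightarrow>
     D \<noteq> {} \<and> (\<forall>d\<in>D. leq d d) \<and>
     (\<forall>d\<in>D. \<forall>e\<in>D. \<forall>f\<in>D. leq d e \<and> leq e f \<longrightarrow> leq d f) \<and>
     (\<forall>d\<in>D. \<forall>e\<in>D. \<exists>f\<in>D. leq d f \<and> leq e f)"

definition net_filter :: "'d set \<Rightarrow> ('d \<Rightarrow> 'd \<Rightarrow> bool) \<Rightarrow> 'd filter" where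
  "net_filter D leq = (INF d\<in>D. principal {e\<in>D. leq d e})"

definition bounded_net :: "'a star_alg \<Rightarrow> 'd set \<Rightarrow> ('d \<Rightarrow> 'a) \<Rightarrow> bool" where
  "bounded_net B D X \<longleftrightarrow> (\<forall>d\<in>D. X d \<in> carrier B) \<and> (\<exists>K. \<forall>d\<in>D. nrm B (X d) \<le> K)"

definition asymp_commutes ::
    "'a star_alg \<Rightarrow> 'd set \<Rightarrow> ('d \<Rightarrow> 'd \<Rightarrow> bool) \<Rightarrow> ('d \<Rightarrow> 'a) \<Rightarrow> 'a \<Rightarrow> bool" where
  "asymp_commutes B D leq X S \<longleftrightarrow>
     ((\<lambda>d. nrm B (S \<otimes>\<^bsub>B\<^esub> X d \<ominus>\<^bsub>B\<^esub> X d \<otimes>\<^bsub>B\<^esub> S)) \<longlongrightarrow> 0) (net_filter D leq)"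

text \<open>
  Again the index sets of the nets need a fixed type. That \<open>'a \<times> 'a set\<close> is large enough to
  account for nets over directed sets of every type is lemma \<open>approx_double_commutant_net\<close>.
\<close>

definition approx_double_commutant :: "'a star_alg \<Rightarrow> 'a set \<Rightarrow> 'a set" where
  "approx_double_commutant B SS =
     {T \<in> carrier B. \<forall>(D :: ('a \<times> 'a set) set) leq X.
        directed_on D leq \<and> bounded_net B D X \<and> (\<forall>S\<in>SS. asymp_commutes B D leq X S) \<longrightarrow>
        asymp_commutes B D leq X T}"

definition approximately_normal :: "'a star_alg \<Rightarrow> 'a set \<Rightarrow> bool" where
  "approximately_normal B A \<longleftrightarrow> A = approx_double_commutant B A"

lemma eventually_net_filter:
  assumes "directed_on D leq"
  shows "eventually P (net_filter D leq) \<longleftrightarrow> (\<exists>d\<in>D. \<forall>e\<in>D. leq d e \<longrightarrow> P e)"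
proof -
  have "eventually P (net_filter D leq) \<longleftrightarrow>
      (\<exists>d\<in>D. eventually P (principal {e\<in>D. leq d e}))"
    unfolding net_filter_def
  proof (rule eventually_INF_base)
    show "D \<noteq> {}" using assms by (simp add: directed_on_def)
    fix a b assume ab: "a \<in> D" "b \<in> D"
    then obtain f where f: "f \<in> D" "leq a f" "leq b f"
      using assms unfolding directed_on_def by blast
    have "{e\<in>D. leq f e} \<subseteq> {e\<in>D. leq a e} \<inter> {e\<in>D. leq b e}"
      using assms ab f unfolding directed_on_def by blast
    then show "\<exists>x\<in>D. principal {e\<in>D. leq x e} \<le>
        inf (principal {e\<in>D. leq a e}) (principal {e\<in>D. leq b e})"
      using f by (intro bexI[of _ f]) simp_all
  qed
  then show ?thesis by (auto simp: eventually_principal)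
qed

lemma approx_double_commutant_net:
  fixes D :: "'d set" and B :: "'a star_alg"
  assumes T: "T \<in> approx_double_commutant B SS"
    and D: "directed_on D leq" and X: "bounded_net B D X"
    and S: "\<And>S. S \<in> SS \<Longrightarrow> asymp_commutes B D leq X S"
  shows "asymp_commutes B D leq X T"
proof -
  define tail where "tail d = X ` {e\<in>D. leq d e}" for d
  define D' where "D' = {(x, E). x \<in> E \<and> E \<in> tail ` D}"
  define leq' :: "'a \<times> 'a set \<Rightarrow> 'a \<times> 'a set \<Rightarrow> bool" where "leq' p q \<longleftrightarrow> snd q \<subseteq> snd p" for p q
  have tail_ne: "X d \<in> tail d" if "d \<in> D" for d
    using D that unfolding tail_def directed_on_def by blast
  have D': "directed_on D' leq'"
    unfolding directed_on_def
  proof (intro conjI ballI impI)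
    show "D' \<noteq> {}" using D tail_ne unfolding directed_on_def D'_def by blast
    fix p q assume "p \<in> D'" "q \<in> D'"
    then obtain a b where ab: "a \<in> D" "b \<in> D" "snd p = tail a" "snd q = tail b"
      by (auto simp: D'_def)
    then obtain f where f: "f \<in> D" "leq a f" "leq b f"
      using D unfolding directed_on_def by blast
    have "tail f \<subseteq> tail a" "tail f \<subseteq> tail b"
      using D ab f unfolding directed_on_def tail_def by blast+
    then show "\<exists>r\<in>D'. leq' p r \<and> leq' q r"
      using ab f tail_ne by (intro bexI[of _ "(X f, tail f)"]) (auto simp: leq'_def D'_def)
  qed (auto simp: leq'_def)
  have ev: "eventually (\<lambda>p. P (fst p)) (net_filter D' leq') \<longleftrightarrow>
      eventually (\<lambda>d. P (X d)) (net_filter D leq)" for P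
    unfolding eventually_net_filter[OF D] eventually_net_filter[OF D']
  proof
    assume "\<exists>p\<in>D'. \<forall>q\<in>D'. leq' p q \<longrightarrow> P (fst q)"
    then obtain p where p: "p \<in> D'" "\<And>q. q \<in> D' \<Longrightarrow> leq' p q \<Longrightarrow> P (fst q)" by blast
    then obtain d where d: "d \<in> D" "snd p = tail d" by (auto simp: D'_def)
    have "P (X e)" if "e \<in> D" "leq d e" for e
      using p(2)[of "(X e, tail d)"] that d by (auto simp: D'_def leq'_def tail_def)
    then show "\<exists>d\<in>D. \<forall>e\<in>D. leq d e \<longrightarrow> P (X e)" using d by blast
  next
    assume "\<exists>d\<in>D. \<forall>e\<in>D. leq d e \<longrightarrow> P (X e)"
    then obtain d where d: "d \<in> D" "\<And>e. e \<in> D \<Longrightarrow> leq d e \<Longrightarrow> P (X e)" by blast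
    have "P (fst q)" if "q \<in> D'" "leq' (X d, tail d) q" for q
    proof -
      have "fst q \<in> tail d" using that by (auto simp: D'_def leq'_def)
      then show ?thesis using d(2) by (auto simp: tail_def)
    qed
    moreover have "(X d, tail d) \<in> D'" using d tail_ne by (simp add: D'_def)
    ultimately show "\<exists>p\<in>D'. \<forall>q\<in>D'. leq' p q \<longrightarrow> P (fst q)" by blast
  qed
  have comm: "asymp_commutes B D' leq' fst S \<longleftrightarrow> asymp_commutes B D leq X S" for S
    unfolding asymp_commutes_def tendsto_iff
    by (simp add: ev[of "\<lambda>x. \<bar>nrm B (S \<otimes>\<^bsub>B\<^esub> x \<ominus>\<^bsub>B\<^esub> x \<otimes>\<^bsub>B\<^esub> S)\<bar> < e" for e])
  have "bounded_net B D' fst"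
    using X unfolding bounded_net_def D'_def tail_def by fastforce
  with T D' S show ?thesis
    unfolding approx_double_commutant_def by (auto simp: comm[symmetric])
qed

end

theory Submission
  imports Defs
begin

text \<open>
  \<^emph>\<open>Idea.\<close> Let \<open>T \<in> Appr(A,B)''\<close>. A net in \<open>B/J\<^sub>i\<close> that asymptotically commutes with the image of
  \<open>A\<close> lifts to a net in \<open>B\<close> that asymptotically commutes with \<open>A\<close>: multiply representatives by \<open>1 - e\<close>
  with \<open>e\<close> quasi-central in \<open>J\<^sub>i\<close>. Hence \<open>T \<in> A + J\<^sub>i\<close> for all \<open>i\<close>, and we may assume \<open>T\<close> self-adjoint.

  Suppose \<open>T\<close> has distance at least \<open>d > 0\<close> from \<open>A\<close>. Call an ideal \<open>K\<close> of \<open>A\<close> good if \<open>T\<close> is within \<open>d\<close> of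
  some \<open>a + k b k\<^sup>*\<close> with \<open>a \<in> A\<close>, \<open>k \<in> K\<close>, \<open>b \<in> B\<close>. The zero ideal is not good, so there is a maximal
  \<open>K\<close> that is not good. By coprimality and since every primitive ideal contains some \<open>J\<^sub>i\<close>, each \<open>A \<inter> J\<^sub>i\<close>
  contains approximate units for \<open>J\<^sub>i\<close> and \<open>T\<close> multiplies the hereditary subalgebra generated by any ideal
  of \<open>A\<close>. The first fact shows that every ideal containing some \<open>A \<inter> J\<^sub>i\<close> is good; the second yields
  approximate units almost commuting with \<open>T\<close>, with which approximations for \<open>K\<^sub>1\<close> and \<open>K\<^sub>2\<close> are glued to one
  for \<open>K\<^sub>1 \<inter> K\<^sub>2\<close>. Therefore \<open>K\<close> is prime. As \<open>A\<close> is separable, a nested sequence of positive elements outside \<open>K\<close>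
  then produces a pure state of \<open>B\<close> such that every ideal of \<open>A\<close> on which it vanishes is contained in \<open>K\<close>. Its
  GNS kernel is primitive and contains some \<open>J\<^sub>i\<close>, so \<open>A \<inter> J\<^sub>i \<subseteq> K\<close> and \<open>K\<close> is good, a contradiction.
\<close>

section \<open>C*-algebras as a type class\<close>

text \<open>The coprimality hypothesis concerns pairs, while \<open>I\<close> may be infinite, so
  approximations modulo the single \<open>J i\<close> cannot be patched in finitely many rounds.
  Zorn's lemma at one fixed error \<open>d\<close> takes the place of a compactness argument, and
  this is possible only because gluing loses nothing: two errors are combined as
  \<open>c * X1 * c + s * X2 * s\<close> with \<open>c * c + s * s = 1\<close>, and for self-adjoint
  errors the order structure bounds the result by the larger of the two norms. The commutator terms
  fit into the gap left by the strict inequality \<open>< d\<close>.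

  The maximal \<open>K\<close> is prime in \<open>A\<close>, whereas the hypothesis concerns
  primitive ideals of \<open>B\<close>. The pure state is therefore constructed on \<open>B\<close>
  itself, as an extreme point among the states vanishing on a cone that depends on \<open>K\<close>.

  To work in a type instead of on carriers, \<open>B\<close> is realised as a quotient of one large
  C*-algebra; all arguments run modulo the kernel \<open>Z\<close> of the quotient map, and
  separability is used only modulo \<open>Z\<close>.\<close>

text \<open>\<open>iu\<close> is the imaginary unit, so that only real scalars occur.\<close>

class cstar_alg = real_algebra_1 + real_normed_algebra + banach +
  fixes star :: "'a \<Rightarrow> 'a" and iu :: 'a
  assumes star_star [simp]: "star (star x) = x"
    and star_add: "star (x + y) = star x + star y"
    and star_mult: "star (x * y) = star y * star x"
    and star_scaleR: "star (r *\<^sub>R x) = r *\<^sub>R star x"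
    and norm_star_mult: "norm (star x * x) = (norm x)\<^sup>2"
    and iu_mult: "iu * iu = - 1"
    and iu_comm: "iu * x = x * iu"
    and star_iu: "star iu = - iu"

lemma star_0 [simp]: "star (0::'a::cstar_alg) = 0"
  using star_scaleR[of 0 "0::'a"] by simp

lemma star_minus: "star (- x::'a::cstar_alg) = - star x"
  using star_scaleR[of "-1" x] by simp

lemma star_diff: "star (x - y::'a::cstar_alg) = star x - star y"
  using star_add[of x "-y"] by (simp add: star_minus)

lemma star_1 [simp]: "star (1::'a::cstar_alg) = 1"
  by (metis mult.right_neutral mult.left_neutral star_mult star_star)

lemma star_of_real [simp]: "star (of_real r::'a::cstar_alg) = of_real r"
  by (simp add: of_real_def star_scaleR)

lemmas star_simps = star_add star_mult star_scaleR star_minus star_diff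

lemma norm_star [simp]: "norm (star x :: 'a::cstar_alg) = norm x"
proof -
  have le: "norm y \<le> norm (star y)" for y :: 'a
  proof (cases "norm y = 0")
    case False
    have "norm y * norm y = norm (star y * y)" by (simp add: norm_star_mult power2_eq_square)
    also have "\<dots> \<le> norm (star y) * norm y" by (rule norm_mult_ineq)
    finally show ?thesis using False
      by (simp add: mult_le_cancel_right)
  qed simp
  show ?thesis using le[of x] le[of "star x"] by simp
qed

lemma norm_mult_star: "norm (x * star x :: 'a::cstar_alg) = (norm x)\<^sup>2"
  using norm_star_mult[of "star x"] by simp

lemma norm_one_le: "norm (1::'a::cstar_alg) \<le> 1"
proof -
  have "norm (1::'a) = (norm (1::'a))\<^sup>2" using norm_star_mult[of "1::'a"] by simp
  then show ?thesis by (simp add: power2_eq_square)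
qed

lemma norm_of_real_le: "norm (of_real r::'a::cstar_alg) \<le> \<bar>r\<bar>"
  using mult_left_mono[OF norm_one_le[where 'a='a], of "\<bar>r\<bar>"] by (simp add: of_real_def)

lemma norm_iu_mult: "norm (iu * x :: 'a::cstar_alg) = norm x"
proof -
  have "star (iu * x) * (iu * x) = - (star x * (iu * iu) * x)"
    by (simp add: star_simps star_iu mult.assoc)
  also have "\<dots> = star x * x" by (simp add: iu_mult)
  finally have "(norm (iu * x))\<^sup>2 = (norm x)\<^sup>2" by (metis norm_star_mult)
  then show ?thesis by simp
qed

lemma norm_square_sa: "star x = x \<Longrightarrow> norm (x * x :: 'a::cstar_alg) = (norm x)\<^sup>2"
  using norm_star_mult[of x] by simp

lemma bounded_linear_star: "bounded_linear (star :: 'a::cstar_alg \<Rightarrow> 'a)"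
  by (rule bounded_linear_intro[where K=1]) (simp_all add: star_simps)

lemmas tendsto_star = bounded_linear.tendsto[OF bounded_linear_star]

section \<open>Closed unital subalgebras and the elements generated by one element\<close>

definition unital_subalg :: "'a::cstar_alg set \<Rightarrow> bool" where
  "unital_subalg A \<longleftrightarrow> closed A \<and> 1 \<in> A \<and> (\<forall>x\<in>A. \<forall>y\<in>A. x + y \<in> A \<and> x * y \<in> A) \<and>
     (\<forall>r. \<forall>x\<in>A. r *\<^sub>R x \<in> A) \<and> (\<forall>x\<in>A. star x \<in> A)"

lemma unital_subalg_UNIV [simp]: "unital_subalg UNIV"
  by (simp add: unital_subalg_def)

context
  fixes A :: "'a::cstar_alg set"
  assumes A: "unital_subalg A"
begin

lemma subalg_one: "1 \<in> A" and subalg_add: "x \<in> A \<Longrightarrow> y \<in> A \<Longrightarrow> x + y \<in> A"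
  and subalg_mult: "x \<in> A \<Longrightarrow> y \<in> A \<Longrightarrow> x * y \<in> A"
  and subalg_scaleR: "x \<in> A \<Longrightarrow> r *\<^sub>R x \<in> A"
  and subalg_star: "x \<in> A \<Longrightarrow> star x \<in> A"
  and subalg_closed: "closed A"
  using A by (auto simp: unital_subalg_def)

lemma subalg_minus: "x \<in> A \<Longrightarrow> - x \<in> A"
  using subalg_scaleR[of x "-1"] by simp

lemma subalg_diff: "x \<in> A \<Longrightarrow> y \<in> A \<Longrightarrow> x - y \<in> A"
  using subalg_add[of x "-y"] subalg_minus by simp

lemma subalg_zero: "0 \<in> A"
  using subalg_scaleR[OF subalg_one, of 0] by simp

lemma subalg_of_real: "of_real r \<in> A"
  using subalg_scaleR[OF subalg_one, of r] by (simp add: of_real_def)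

lemma subalg_power: "x \<in> A \<Longrightarrow> x ^ n \<in> A"
  by (induction n) (auto intro: subalg_one subalg_mult)

lemma subalg_sum: "(\<And>i. i \<in> S \<Longrightarrow> f i \<in> A) \<Longrightarrow> sum f S \<in> A"
  by (induction S rule: infinite_finite_induct) (auto intro: subalg_zero subalg_add)

lemmas subalg_intros = subalg_one subalg_add subalg_mult subalg_scaleR subalg_star subalg_minus
  subalg_diff subalg_zero subalg_of_real subalg_power subalg_sum

end

text \<open>Membership in the C*-algebra generated by \<open>1\<close> and \<open>x\<close>,
  standing in for a functional calculus. The clause on commutants is separate because the elements
  commuting with a fixed \<open>z\<close> form a closed subalgebra that need not be stable under
  \<open>star\<close>.\<close>

definition in_cstar :: "'a::cstar_alg \<Rightarrow> 'a \<Rightarrow> bool" where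
  "in_cstar x y \<longleftrightarrow> (\<forall>A. unital_subalg A \<longrightarrow> x \<in> A \<longrightarrow> y \<in> A) \<and> (\<forall>z. z * x = x * z \<longrightarrow> z * y = y * z)"

lemma in_cstar_self: "in_cstar x x"
  by (simp add: in_cstar_def)

lemma in_cstar_mem: "in_cstar x y \<Longrightarrow> unital_subalg A \<Longrightarrow> x \<in> A \<Longrightarrow> y \<in> A"
  unfolding in_cstar_def by blast

lemma in_cstar_comm: "in_cstar x y \<Longrightarrow> z * x = x * z \<Longrightarrow> z * y = y * z"
  unfolding in_cstar_def by blast

lemma in_cstarI:
  "(\<And>A. unital_subalg A \<Longrightarrow> x \<in> A \<Longrightarrow> y \<in> A) \<Longrightarrow> (\<And>z. z * x = x * z \<Longrightarrow> z * y = y * z) \<Longrightarrow> in_cstar x y"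
  unfolding in_cstar_def by blast

lemma in_cstar_const: "in_cstar x (of_real r)" "in_cstar x 1" "in_cstar x 0"
  by (rule in_cstarI; simp add: subalg_intros of_real_def)+

lemma in_cstar_add: assumes "in_cstar x y" "in_cstar x z" shows "in_cstar x (y + z)"
proof (rule in_cstarI)
  show "y + z \<in> A" if "unital_subalg A" "x \<in> A" for A
    using that assms by (blast intro: subalg_add in_cstar_mem)
  show "w * (y + z) = (y + z) * w" if "w * x = x * w" for w
    using that in_cstar_comm[OF assms(1) that] in_cstar_comm[OF assms(2) that]
    by (simp add: distrib_left distrib_right)
qed

lemma in_cstar_diff: assumes "in_cstar x y" "in_cstar x z" shows "in_cstar x (y - z)"
proof (rule in_cstarI)
  show "y - z \<in> A" if "unital_subalg A" "x \<in> A" for A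
    using that assms by (blast intro: subalg_diff in_cstar_mem)
  show "w * (y - z) = (y - z) * w" if "w * x = x * w" for w
    using that in_cstar_comm[OF assms(1) that] in_cstar_comm[OF assms(2) that]
    by (simp add: right_diff_distrib left_diff_distrib)
qed

lemma in_cstar_scaleR: "in_cstar x y \<Longrightarrow> in_cstar x (r *\<^sub>R y)"
  by (rule in_cstarI) (auto intro: subalg_scaleR in_cstar_mem dest: in_cstar_comm)

lemma in_cstar_mult: assumes "in_cstar x y" "in_cstar x z" shows "in_cstar x (y * z)"
proof (rule in_cstarI)
  show "y * z \<in> A" if "unital_subalg A" "x \<in> A" for A
    using that assms by (blast intro: subalg_mult in_cstar_mem)
  fix w assume "w * x = x * w"
  then have c: "w * y = y * w" "w * z = z * w" using assms in_cstar_comm by blast+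
  have "w * (y * z) = y * (w * z)" by (simp add: c(1) flip: mult.assoc)
  then show "w * (y * z) = y * z * w" by (simp add: c(2) mult.assoc)
qed

lemma in_cstar_commute: assumes "in_cstar x y" "in_cstar x z" shows "y * z = z * y"
proof -
  have "x * y = y * x" using in_cstar_comm[OF assms(1) refl] .
  then show ?thesis using in_cstar_comm[OF assms(2), of y] by simp
qed

lemma in_cstar_trans: assumes "in_cstar x y" "in_cstar y z" shows "in_cstar x z"
  using assms by (intro in_cstarI) (blast intro: in_cstar_mem in_cstar_comm)+

lemma in_cstar_lim:
  assumes "\<And>n. in_cstar x (f n)" "f \<longlonglongrightarrow> l"
  shows "in_cstar x l"
  unfolding in_cstar_def
proof (intro conjI allI impI)
  fix A :: "'a set" assume "unital_subalg A" "x \<in> A"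
  then show "l \<in> A"
    using closed_sequentially[OF subalg_closed _ assms(2)] in_cstar_mem[OF assms(1)] by blast
next
  fix z assume "z * x = x * z"
  then have "z * f n = f n * z" for n by (rule in_cstar_comm[OF assms(1)])
  then have "(\<lambda>n. z * f n) \<longlonglongrightarrow> l * z" using tendsto_mult_right[OF assms(2), of z] by simp
  then show "z * l = l * z" using LIMSEQ_unique tendsto_mult_left[OF assms(2), of z] by blast
qed

section \<open>Square roots\<close>

text \<open>The iteration \<open>p \<mapsto> (x + p\<^sup>2) / 2\<close> converges to \<open>1 - sqrt (1 - x)\<close>; its increments are
  dominated by those of the scalar iteration for \<open>x = 1\<close>.\<close>

lemma sqrt_one_minus:
  fixes x :: "'a::cstar_alg"
  assumes "star x = x" "norm x \<le> 1"
  shows "\<exists>s. star s = s \<and> s * s = 1 - x \<and> in_cstar x s \<and> norm (1 - s) \<le> 1"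
proof -
  define p where "p = rec_nat 0 (\<lambda>_ y. (1/2) *\<^sub>R (x + y * y))"
  define q where "q = rec_nat (0::real) (\<lambda>_ y. (1 + y * y) / 2)"
  have p: "p 0 = 0" "\<And>n. p (Suc n) = (1/2) *\<^sub>R (x + p n * p n)" by (auto simp: p_def)
  have q: "q 0 = 0" "\<And>n. q (Suc n) = (1 + q n * q n) / 2" by (auto simp: q_def)
  have q01: "0 \<le> q n \<and> q n \<le> 1" for n
    by (induction n) (auto simp: q mult_le_one)
  have pq: "norm (p n) \<le> q n" for n
  proof (induction n)
    case (Suc n)
    have "norm (x + p n * p n) \<le> norm x + norm (p n) * norm (p n)"
      by (meson add_left_mono norm_mult_ineq norm_triangle_ineq order_trans)
    also have "\<dots> \<le> 1 + q n * q n"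
      using Suc assms(2) q01[of n] by (intro add_mono mult_mono) auto
    finally show ?case by (simp add: p q)
  qed (simp add: p q)
  have inc: "norm (p (Suc n) - p n) \<le> q (Suc n) - q n" for n
  proof (induction n)
    case 0
    then show ?case using assms(2) by (simp add: p q)
  next
    case (Suc n)
    have "p (Suc (Suc n)) - p (Suc n) = (1/2) *\<^sub>R (p (Suc n) * p (Suc n) - p n * p n)"
      by (simp add: p(2)[of "Suc n"] p(2)[of n] scaleR_diff_right[symmetric])
    also have "\<dots> = (1/2) *\<^sub>R (p (Suc n) * (p (Suc n) - p n) + (p (Suc n) - p n) * p n)"
      by (simp add: algebra_simps)
    finally have "norm (p (Suc (Suc n)) - p (Suc n)) \<le>
       (1/2) * (norm (p (Suc n)) * norm (p (Suc n) - p n) + norm (p (Suc n) - p n) * norm (p n))"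
      by (simp, meson add_mono norm_mult_ineq norm_triangle_ineq order_trans)
    also have "\<dots> \<le> (1/2) * (q (Suc n) * (q (Suc n) - q n) + (q (Suc n) - q n) * q n)"
    proof -
      have "norm (p (Suc n)) * norm (p (Suc n) - p n) \<le> q (Suc n) * (q (Suc n) - q n)"
        by (rule mult_mono[OF pq Suc]) (simp_all add: q01)
      moreover have "norm (p (Suc n) - p n) * norm (p n) \<le> (q (Suc n) - q n) * q n"
        by (rule mult_mono[OF Suc pq]) (use order_trans[OF norm_ge_zero Suc] q01 in simp_all)
      ultimately show ?thesis by simp
    qed
    also have "\<dots> = q (Suc (Suc n)) - q (Suc n)"
      by (simp add: q(2)[of "Suc n"]) (simp add: q(2)[of n] field_simps)
    finally show ?case .
  qed
  have "incseq q" using order_trans[OF norm_ge_zero inc] by (intro incseq_SucI) simp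
  then obtain L where L: "q \<longlonglongrightarrow> L"
    using incseq_convergent[of q 1] q01 by blast
  have "summable (\<lambda>n. q (Suc n) - q n)" using telescope_summable[OF L] .
  then have "summable (\<lambda>n. p (Suc n) - p n)"
    by (rule summable_comparison_test'[where N=0]) (rule inc)
  then have "(\<lambda>n. \<Sum>k<n. p (Suc k) - p k) \<longlonglongrightarrow> (\<Sum>k. p (Suc k) - p k)"
    by (rule summable_LIMSEQ)
  then obtain l where l: "p \<longlonglongrightarrow> l"
    by (simp add: sum_lessThan_telescope p(1))
  have "(\<lambda>n. p (Suc n)) \<longlonglongrightarrow> (1/2) *\<^sub>R (x + l * l)"
    unfolding p(2) by (intro tendsto_intros l)
  then have fix_eq: "l = (1/2) *\<^sub>R (x + l * l)"
    using LIMSEQ_unique LIMSEQ_Suc[OF l] by blast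
  have "l + l = x + l * l" by (subst (1 2) fix_eq) (simp flip: scaleR_add_left)
  then have sq: "(1 - l) * (1 - l) = 1 - x" by (simp add: algebra_simps)
  have "star (p n) = p n" for n
    by (induction n) (simp_all add: p star_simps assms(1))
  then have "p \<longlonglongrightarrow> star l" using tendsto_star[OF l] by simp
  then have "star l = l" using LIMSEQ_unique l by blast
  moreover have "in_cstar x (p n)" for n
    by (induction n) (auto simp: p intro: in_cstar_const in_cstar_self in_cstar_scaleR in_cstar_add in_cstar_mult)
  then have "in_cstar x (1 - l)"
    using in_cstar_lim[OF _ l] in_cstar_const in_cstar_diff by blast
  moreover have "norm l \<le> 1"
    using LIMSEQ_le_const2[OF tendsto_norm[OF l], of 1] pq q01 order_trans by blast
  ultimately show ?thesis using sq by (intro exI[of _ "1 - l"]) (simp add: star_simps)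
qed

section \<open>Positive elements, without spectra\<close>

definition pos :: "'a::cstar_alg \<Rightarrow> bool" where
  "pos x \<longleftrightarrow> (\<exists>y. star y = y \<and> x = y * y)"

lemma pos_sa: "pos x \<Longrightarrow> star x = x"
  by (auto simp: pos_def star_simps)

lemma pos_square: "star y = y \<Longrightarrow> pos (y * y)"
  by (auto simp: pos_def)

text \<open>Rescaling reduces this to \<open>sqrt_one_minus\<close>. The ball returned for
  \<open>s\<close> shows, by the same criterion, that the square root is itself positive.\<close>

lemma sqrt_of_ball:
  fixes x :: "'a::cstar_alg"
  assumes "star x = x" "0 < t" "norm (of_real t - x) \<le> t"
  shows "\<exists>s. star s = s \<and> s * s = x \<and> in_cstar x s \<and> (\<exists>t>0. norm (of_real t - s) \<le> t)"
proof -
  let ?y = "1 - (1/t) *\<^sub>R x"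
  have "?y = (1/t) *\<^sub>R (of_real t - x)" using assms(2) by (simp add: scaleR_diff_right of_real_def)
  then have "norm ?y \<le> 1" using assms(2,3) by (simp add: divide_simps)
  moreover have "star ?y = ?y" by (simp add: star_simps assms(1))
  ultimately obtain s where s: "star s = s" "s * s = 1 - ?y" "in_cstar ?y s" "norm (1 - s) \<le> 1"
    using sqrt_one_minus by blast
  have "in_cstar x ?y" by (intro in_cstar_const in_cstar_diff in_cstar_scaleR in_cstar_self)
  then have "in_cstar x (sqrt t *\<^sub>R s)" using s(3) in_cstar_trans in_cstar_scaleR by blast
  moreover have "(sqrt t *\<^sub>R s) * (sqrt t *\<^sub>R s) = x" using s(2) assms(2) by simp
  moreover have "of_real (sqrt t) - sqrt t *\<^sub>R s = sqrt t *\<^sub>R (1 - s)"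
    by (simp add: of_real_def scaleR_diff_right)
  then have "norm (of_real (sqrt t) - sqrt t *\<^sub>R s) \<le> sqrt t"
    using s(4) assms(2) by (simp add: mult_left_le)
  ultimately show ?thesis using s(1) assms(2)
    by (intro exI[of _ "sqrt t *\<^sub>R s"]) (auto simp: star_simps intro!: exI[of _ "sqrt t"])
qed

lemma star_cartesian:
  fixes y s :: "'a::cstar_alg"
  assumes "star y = y" "star s = s" "y * s = s * y"
  shows "star (y + iu * s) = y - iu * s" "(y - iu * s) * (y + iu * s) = y * y + s * s"
proof -
  show "star (y + iu * s) = y - iu * s" using assms by (simp add: star_simps star_iu iu_comm)
  have "iu * s * (iu * s) = (iu * iu) * (s * s)" by (metis iu_comm mult.assoc)
  then have 1: "iu * s * (iu * s) = - (s * s)" by (simp add: iu_mult)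
  have 2: "y * (iu * s) = iu * s * y" by (metis iu_comm mult.assoc assms(3))
  have "(y - iu * s) * (y + iu * s) = y * y + y * (iu * s) - iu * s * y - iu * s * (iu * s)"
    by (simp only: left_diff_distrib distrib_left) simp
  then show "(y - iu * s) * (y + iu * s) = y * y + s * s" using 1 2 by simp
qed

text \<open>With \<open>s\<close> the root of \<open>1 - y * y\<close>, the element
  \<open>u = y + iu * s\<close> satisfies \<open>star u * u = 1\<close>, and \<open>iu * s\<close>
  is half the difference of \<open>u\<close> and \<open>star u\<close>; so
  \<open>norm s \<le> 1\<close>.\<close>

lemma norm_one_minus_square:
  fixes y :: "'a::cstar_alg"
  assumes "star y = y" "norm y \<le> 1"
  shows "norm (1 - y * y) \<le> 1"
proof -
  have "norm (y * y) \<le> 1" using assms norm_square_sa[of y] by (simp add: power_le_one)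
  then obtain s where s: "star s = s" "s * s = 1 - y * y" "in_cstar (y * y) s"
    using sqrt_one_minus[of "y * y"] assms by (auto simp: star_simps)
  have ys: "y * s = s * y" using in_cstar_comm[OF s(3), of y] by (simp add: mult.assoc)
  define u where "u = y + iu * s"
  have su: "star u = y - iu * s" "star u * u = 1"
    using star_cartesian[OF assms(1) s(1) ys] s(2) by (simp_all add: u_def)
  then have "(norm u)\<^sup>2 \<le> 1" using norm_star_mult[of u] norm_one_le[where 'a='a] by simp
  then have u1: "norm u \<le> 1" using power2_le_imp_le[of "norm u" 1] by simp
  have "u - star u = 2 *\<^sub>R (iu * s)" by (subst su(1)) (simp add: u_def scaleR_2)
  then have "iu * s = (1/2) *\<^sub>R (u - star u)" by simp
  then have "norm (iu * s) \<le> 1" using norm_triangle_ineq4[of u "star u"] u1 by simp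
  then have "norm s \<le> 1" by (simp add: norm_iu_mult)
  then show ?thesis using s by (metis norm_square_sa norm_ge_zero power_le_one)
qed

text \<open>Together with \<open>pos_ball\<close> this turns positivity of a self-adjoint element
  into a norm inequality; heuristically, the spectrum lies between \<open>0\<close> and
  \<open>2 * t\<close>. Closure of the cone under sums and limits, which is invisible for squares,
  comes from this form.\<close>

lemma pos_norm_diff:
  fixes x :: "'a::cstar_alg"
  assumes "pos x" "norm x \<le> t"
  shows "norm (of_real t - x) \<le> t"
proof (cases "t = 0")
  case False
  then have t: "0 < t" using assms norm_ge_zero[of x] by linarith
  obtain y where y: "star y = y" "x = y * y" using assms(1) by (auto simp: pos_def)
  let ?z = "(1 / sqrt t) *\<^sub>R y"
  have "(norm y)\<^sup>2 \<le> t" using y assms(2) norm_square_sa[of y] by simp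
  then have "norm ?z \<le> 1" using t by (simp add: divide_simps real_le_rsqrt)
  then have "norm (1 - ?z * ?z) \<le> 1" using norm_one_minus_square[of ?z] y by (simp add: star_simps)
  moreover have "of_real t - x = t *\<^sub>R (1 - ?z * ?z)"
    using t y by (simp add: scaleR_diff_right of_real_def)
  ultimately show ?thesis using t by (simp add: mult_left_le)
qed (use assms in auto)

lemma pos_ball:
  fixes x :: "'a::cstar_alg"
  shows "star x = x \<Longrightarrow> 0 < t \<Longrightarrow> norm (of_real t - x) \<le> t \<Longrightarrow> pos x"
  using sqrt_of_ball[of x t] by (auto simp: pos_def)

lemma pos_sqrt:
  fixes x :: "'a::cstar_alg"
  assumes "pos x"
  obtains s where "pos s" "star s = s" "s * s = x" "in_cstar x s"
  using sqrt_of_ball[of x "norm x + 1"] pos_norm_diff[OF assms, of "norm x + 1"] pos_sa[OF assms] pos_ball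
  by (smt (verit) add_nonneg_pos norm_ge_zero)

lemma pos_add:
  fixes x y :: "'a::cstar_alg"
  assumes "pos x" "pos y" shows "pos (x + y)"
proof (rule pos_ball)
  have "norm (of_real (norm x + 1) - x) \<le> norm x + 1" "norm (of_real (norm y + 1) - y) \<le> norm y + 1"
    by (intro pos_norm_diff assms; simp)+
  then have "norm ((of_real (norm x + 1) - x) + (of_real (norm y + 1) - y)) \<le> norm x + 1 + (norm y + 1)"
    by (meson norm_triangle_mono)
  then show "norm (of_real (norm x + 1 + (norm y + 1)) - (x + y)) \<le> norm x + 1 + (norm y + 1)"
    by (simp only: of_real_add add_diff_add)
  show "0 < norm x + 1 + (norm y + 1)" by (smt (verit) norm_ge_zero)
qed (simp add: star_simps assms[THEN pos_sa])

lemma pos_scaleR: assumes "pos x" "0 \<le> r" shows "pos (r *\<^sub>R x :: 'a::cstar_alg)"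
proof -
  obtain y where "star y = y" "x = y * y" using assms by (auto simp: pos_def)
  then show ?thesis using assms(2) by (auto simp: pos_def star_simps intro!: exI[of _ "sqrt r *\<^sub>R y"])
qed

lemma pos_0 [simp]: "pos (0::'a::cstar_alg)" and pos_1 [simp]: "pos (1::'a::cstar_alg)"
  using pos_square[of 0] pos_square[of 1] by simp_all

lemma pos_of_real: "0 \<le> r \<Longrightarrow> pos (of_real r::'a::cstar_alg)"
  by (simp add: of_real_def pos_scaleR)

lemma pos_sum: "(\<And>i. i \<in> S \<Longrightarrow> pos (f i :: 'a::cstar_alg)) \<Longrightarrow> pos (sum f S)"
  by (induction S rule: infinite_finite_induct) (auto intro: pos_add)

text \<open>The roots lie in the algebras generated by \<open>x\<close> and by \<open>y\<close>,
  hence commute, and \<open>r * s\<close> is a self-adjoint root of the product.\<close>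

lemma pos_mult:
  fixes x y :: "'a::cstar_alg"
  assumes "pos x" "pos y" "x * y = y * x"
  shows "pos (x * y)"
proof -
  obtain r s where r: "star r = r" "r * r = x" "in_cstar x r" and s: "star s = s" "s * s = y" "in_cstar y s"
    using pos_sqrt assms by meson
  have "y * r = r * y" using in_cstar_comm[OF r(3)] assms(3) by simp
  then have rs: "r * s = s * r" using in_cstar_comm[OF s(3)] by simp
  then have "x * y = (r * s) * (r * s)" using r s by (metis mult.assoc)
  moreover have "star (r * s) = r * s" using rs r s by (simp add: star_simps)
  ultimately show ?thesis unfolding pos_def by blast
qed

text \<open>The roots \<open>s\<close> of \<open>x\<close> and \<open>r\<close> of
  \<open>of_real t - x\<close> commute, so \<open>u = s + iu * r\<close> has
  \<open>star u * u = of_real t\<close>; and \<open>s\<close> is the mean of \<open>u\<close> and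
  \<open>star u\<close>.\<close>

lemma norm_le_of_pos:
  fixes x :: "'a::cstar_alg"
  assumes "pos x" "pos (of_real t - x)" "0 \<le> t"
  shows "norm x \<le> t"
proof -
  obtain r s where s: "star s = s" "s * s = x" "in_cstar x s"
    and r: "star r = r" "r * r = of_real t - x" "in_cstar (of_real t - x) r"
    using pos_sqrt assms by meson
  have "in_cstar x (of_real t - x)" by (intro in_cstar_const in_cstar_diff in_cstar_self)
  then have rs: "r * s = s * r" using in_cstar_commute in_cstar_trans r(3) s(3) by metis
  define u where "u = s + iu * r"
  have su: "star u = s - iu * r" "star u * u = of_real t"
    using star_cartesian[OF s(1) r(1)] rs s(2) r(2) by (simp_all add: u_def)
  then have "(norm u)\<^sup>2 \<le> t" using norm_star_mult[of u] norm_of_real_le[of t, where 'a='a] assms(3) by simp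
  then have u1: "norm u \<le> sqrt t" by (simp add: real_le_rsqrt)
  have "u + star u = 2 *\<^sub>R s" by (subst su(1)) (simp add: u_def scaleR_2)
  then have "s = (1/2) *\<^sub>R (u + star u)" by simp
  then have "norm s \<le> sqrt t" using norm_triangle_ineq[of u "star u"] u1 by simp
  then have "(norm s)\<^sup>2 \<le> t" using assms(3) by (simp add: sqrt_ge_absD)
  then show ?thesis using norm_square_sa[OF s(1)] s(2) by simp
qed

lemma pos_of_norm_le:
  fixes x :: "'a::cstar_alg"
  assumes "star x = x" "norm x \<le> t"
  shows "pos (of_real t - x)"
proof (cases "t = 0")
  case False
  then have "0 < t" using assms norm_ge_zero[of x] by linarith
  then show ?thesis using assms by (intro pos_ball[of _ t]) (simp_all add: star_simps)
qed (use assms in auto)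

text \<open>The product of \<open>t - x\<close> and \<open>t + x\<close> is positive, which reduces
  the claim to the bound for the positive element \<open>x * x\<close>.\<close>

lemma norm_le_of_pos_sa:
  fixes x :: "'a::cstar_alg"
  assumes "star x = x" "pos (of_real t - x)" "pos (of_real t + x)" "0 \<le> t"
  shows "norm x \<le> t"
proof -
  have "pos ((of_real t - x) * (of_real t + x))"
    using assms by (intro pos_mult) (auto simp: algebra_simps of_real_def)
  then have "pos (of_real (t * t) - x * x)" by (simp add: algebra_simps of_real_def)
  then have "norm (x * x) \<le> t * t"
    using assms by (intro norm_le_of_pos pos_square) auto
  then have "(norm x)\<^sup>2 \<le> t\<^sup>2" using norm_square_sa[OF assms(1)] by (simp add: power2_eq_square)
  then show ?thesis using assms(4) by (simp add: power2_le_iff_abs_le)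
qed

lemma pos_closed_sequentially:
  fixes x :: "'a::cstar_alg"
  assumes "\<And>e. e > 0 \<Longrightarrow> pos (x + of_real e)" "star x = x"
  shows "pos x"
proof (rule pos_ball)
  have "norm (of_real (norm x + 1) - x) \<le> norm x + 1 + e" if "e > 0" for e
  proof -
    have "norm (of_real (norm x + 1 + e) - (x + of_real e)) \<le> norm x + 1 + e"
      using assms(1)[OF that] that norm_triangle_ineq[of x "of_real e"] norm_of_real_le[of e, where 'a='a]
      by (intro pos_norm_diff) linarith+
    then show ?thesis by simp
  qed
  then show "norm (of_real (norm x + 1) - x) \<le> norm x + 1"
    using field_le_epsilon by blast
  show "0 < norm x + 1" by (smt (verit) norm_ge_zero)
qed fact

section \<open>Inverses, resolvents and positive parts\<close>

lemma inverse_of_ball: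
  fixes x :: "'a::cstar_alg"
  assumes "norm (1 - x) < 1"
  shows "\<exists>y. y * x = 1 \<and> x * y = 1 \<and> in_cstar x y"
proof -
  let ?z = "1 - x"
  have b: "norm (?z ^ n) \<le> norm ?z ^ n" for n
  proof (induction n)
    case (Suc n)
    have "norm (?z ^ Suc n) \<le> norm ?z * norm (?z ^ n)" by (simp add: norm_mult_ineq)
    also have "\<dots> \<le> norm ?z * norm ?z ^ n" using Suc by (intro mult_left_mono) auto
    finally show ?case by simp
  qed (simp add: norm_one_le)
  have s: "summable (\<lambda>n. ?z ^ n)"
    using summable_comparison_test[of "\<lambda>n. ?z ^ n" "\<lambda>n. norm ?z ^ n"] summable_geometric[of "norm ?z"] assms b
    by auto
  define S where "S = (\<Sum>n. ?z ^ n)"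
  have "?z * S = S - 1"
    using suminf_mult[OF s, of ?z] suminf_split_head[OF s] by (simp add: S_def)
  moreover have "S * ?z = S - 1"
    using suminf_mult2[OF s, of ?z] suminf_split_head[OF s] by (simp add: S_def flip: power_Suc2)
  moreover have "in_cstar x S"
  proof (rule in_cstar_lim)
    show "(\<lambda>n. \<Sum>k<n. ?z ^ k) \<longlonglongrightarrow> S" unfolding S_def by (rule summable_LIMSEQ[OF s])
    have "in_cstar x (?z ^ k)" for k
      by (induction k) (auto intro: in_cstar_const in_cstar_mult in_cstar_diff in_cstar_self)
    then show "in_cstar x (\<Sum>k<n. ?z ^ k)" for n
      by (induction n) (auto intro: in_cstar_const in_cstar_add)
  qed
  ultimately show ?thesis by (intro exI[of _ S]) (simp add: algebra_simps)
qed

text \<open>Approximate units, cut-offs and the rational weights are all built from this inverse.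
  Its norm bound is the positivity of
  \<open>(1/l) *\<^sub>R (x * y) = of_real (1/l) - y\<close>.\<close>

lemma pos_resolvent:
  fixes x :: "'a::cstar_alg"
  assumes "pos x" "0 < l"
  obtains y where "pos y" "y * (x + of_real l) = 1" "(x + of_real l) * y = 1" "norm y \<le> 1 / l" "in_cstar x y"
proof -
  define w where "w = x + of_real l"
  \<comment> \<open>With this scaling \<open>1 - (1/t) *\<^sub>R w\<close> is
    \<open>norm x - x\<close> divided by \<open>t\<close>, of norm at most
    \<open>norm x / t < 1\<close>, so \<open>w\<close> is invertible by a Neumann series.\<close>
  define t where "t = norm x + l"
  have t: "t > 0" using assms(2) by (simp add: t_def add_nonneg_pos)
  have xw: "in_cstar x w" unfolding w_def by (intro in_cstar_add in_cstar_const in_cstar_self)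
  have "1 - (1/t) *\<^sub>R w = (1/t) *\<^sub>R (of_real (norm x) - x)"
    using t by (simp add: w_def t_def of_real_def algebra_simps) (simp flip: scaleR_add_left add_divide_distrib)
  moreover have "norm (of_real (norm x) - x) < t"
    using pos_norm_diff[OF assms(1), of "norm x"] assms(2) by (simp add: t_def)
  ultimately have "norm (1 - (1/t) *\<^sub>R w) < 1" using t by simp
  then obtain v where v: "v * ((1/t) *\<^sub>R w) = 1" "((1/t) *\<^sub>R w) * v = 1" "in_cstar ((1/t) *\<^sub>R w) v"
    using inverse_of_ball by blast
  define y where "y = (1/t) *\<^sub>R v"
  have y: "y * w = 1" "w * y = 1" using v by (simp_all add: y_def)
  have xy: "in_cstar x y" unfolding y_def
    using v(3) xw in_cstar_scaleR in_cstar_trans by blast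
  have pw: "pos w" unfolding w_def using assms by (intro pos_add pos_of_real) auto
  then obtain r where r: "star r = r" "r * r = w" "in_cstar w r" using pos_sqrt by blast
  have ry: "r * y = y * r" using xy r(3) xw in_cstar_commute in_cstar_trans by metis
  have sy: "star y = y"
  proof -
    have "star y * w = 1" using arg_cong[OF y(2), of star] pos_sa[OF pw] by (simp add: star_simps)
    then show ?thesis by (metis mult.assoc mult.left_neutral mult.right_neutral y(2))
  qed
  have "y = (r * y) * (r * y)" by (metis mult.assoc mult.left_neutral r(2) ry y(1))
  then have py: "pos y" using r(1) sy ry by (metis pos_square star_mult)
  have "x * y = y * x" using xy in_cstar_self in_cstar_commute by blast
  then have "pos ((1/l) *\<^sub>R (x * y))" using pos_mult[OF assms(1) py] assms(2) by (intro pos_scaleR) auto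
  moreover have "(1/l) *\<^sub>R (x * y) = of_real (1/l) - y"
  proof -
    have xy': "x * y = 1 - l *\<^sub>R y" using y(2) by (simp add: w_def algebra_simps of_real_def)
    show ?thesis unfolding xy' using assms(2) by (simp add: of_real_def scaleR_diff_right)
  qed
  ultimately have "norm y \<le> 1 / l" using py assms(2) by (intro norm_le_of_pos) auto
  then show ?thesis using that py y xy unfolding w_def by blast
qed

lemma mult_commute_mult:
  fixes a b z :: "'a::semigroup_mult"
  assumes "a * z = z * a" "b * z = z * b"
  shows "(a * b) * z = z * (a * b)"
proof -
  have "(a * b) * z = a * (z * b)" by (simp add: mult.assoc assms(2))
  also have "\<dots> = z * (a * b)" by (simp add: assms(1) flip: mult.assoc)
  finally show ?thesis .
qed

lemma pos_closed:
  fixes x :: "'a::cstar_alg"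
  assumes "\<And>e. e > 0 \<Longrightarrow> \<exists>z. pos z \<and> norm (x - z) \<le> e" "star x = x"
  shows "pos x"
proof (rule pos_closed_sequentially)
  fix e :: real assume "e > 0"
  then obtain z where z: "pos z" "norm (x - z) \<le> e" using assms(1) by blast
  then have "pos (of_real e - (z - x))"
    using assms(2) pos_sa by (intro pos_of_norm_le) (auto simp: star_simps norm_minus_commute)
  then have "pos (z + (of_real e - (z - x)))" by (rule pos_add[OF z(1)])
  then show "pos (x + of_real e)" by (simp add: algebra_simps)
qed fact

text \<open>Formally \<open>v\<close> is \<open>v * v\<close> divided by \<open>s\<close>. With
  \<open>y\<close> the inverse of \<open>s + of_real e\<close>, the approximants
  \<open>(v * v) * y\<close> are positive as products of commuting positive elements, and the error
  \<open>e *\<^sub>R (v * y)\<close> has norm at most \<open>sqrt (e * norm v)\<close>.\<close>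

lemma pos_of_mult_self_eq:
  fixes v s :: "'a::cstar_alg"
  assumes s: "pos s" and v: "star v = v" "v * v = v * s" "s * v = v * s"
  shows "pos v"
proof (rule pos_closed)
  fix d :: real assume d: "d > 0"
  \<comment> \<open>Makes \<open>e * norm v \<le> d\<^sup>2\<close>; the summand \<open>1\<close>
    avoids a zero denominator.\<close>
  define e where "e = d\<^sup>2 / (norm v + 1)"
  have nv: "0 < norm v + 1" by (simp add: add_nonneg_pos)
  have e: "e > 0" using d nv by (simp add: e_def)
  obtain y where y: "pos y" "y * (s + of_real e) = 1" "(s + of_real e) * y = 1" "norm y \<le> 1 / e" "in_cstar s y"
    using pos_resolvent[OF s e] by blast
  have vy: "v * y = y * v" using in_cstar_comm[OF y(5)] v(3) by simp
  have sy: "s * y = 1 - e *\<^sub>R y" using y(3) by (simp add: algebra_simps of_real_def)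
  have ys: "y * s = s * y" using y(5) in_cstar_commute in_cstar_self by blast
  have "pos (s * y)" using s y(1) ys by (intro pos_mult) auto
  moreover have "of_real 1 - s * y = e *\<^sub>R y" by (simp add: sy)
  then have "pos (of_real 1 - s * y)" using pos_scaleR[OF y(1)] e by simp
  ultimately have nsy: "norm (s * y) \<le> 1" by (intro norm_le_of_pos) auto
  have "pos ((v * v) * y)" by (intro pos_mult pos_square v(1) y(1) mult_commute_mult vy)
  moreover have "norm (v - (v * v) * y) \<le> d"
  proof -
    have eq: "v - (v * v) * y = e *\<^sub>R (v * y)" by (simp add: v(2) mult.assoc sy algebra_simps)
    have "star (v * y) = v * y" using v(1) vy pos_sa[OF y(1)] by (simp add: star_simps)
    then have "(norm (v * y))\<^sup>2 = norm ((v * y) * (v * y))" using norm_square_sa by metis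
    also have "(v * y) * (v * y) = v * ((s * y) * y)" using v(2) vy by (metis mult.assoc)
    also have "norm \<dots> \<le> norm v * (norm (s * y) * norm y)"
      by (meson norm_mult_ineq mult_left_mono norm_ge_zero order_trans)
    also have "\<dots> \<le> norm v * (1 * (1 / e))" using nsy y(4) e by (intro mult_mono) auto
    finally have "e\<^sup>2 * (norm (v * y))\<^sup>2 \<le> e\<^sup>2 * (norm v * (1 / e))" by (intro mult_left_mono) auto
    also have "\<dots> = e * norm v" using e by (simp add: power2_eq_square)
    also have "\<dots> \<le> d\<^sup>2" using nv d by (simp add: e_def field_simps)
    finally have "(e * norm (v * y))\<^sup>2 \<le> d\<^sup>2" by (simp add: power_mult_distrib)
    then show ?thesis unfolding eq using d e by (simp add: power2_le_iff_abs_le abs_mult)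
  qed
  ultimately show "\<exists>z. pos z \<and> norm (v - z) \<le> d" by blast
qed fact

text \<open>The root \<open>s\<close> of \<open>x * x\<close> is the absolute value, and
  \<open>v\<close>, \<open>w\<close> are the halves of \<open>s + x\<close> and
  \<open>s - x\<close>. They annihilate each other because \<open>s * s = x * x\<close>; hence
  \<open>v * v = v * s\<close>, and positivity is an instance of
  \<open>pos_of_mult_self_eq\<close>.\<close>

lemma pos_part:
  fixes x :: "'a::cstar_alg"
  assumes "star x = x"
  obtains v w where "pos v" "pos w" "x = v - w" "v * w = 0" "w * v = 0" "in_cstar x v" "in_cstar x w"
proof -
  obtain s where s: "pos s" "star s = s" "s * s = x * x" "in_cstar (x * x) s"
    using pos_sqrt[OF pos_square[OF assms]] by blast
  have xs: "in_cstar x s" using s(4) in_cstar_trans in_cstar_mult in_cstar_self by blast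
  have c: "x * s = s * x" using xs in_cstar_commute in_cstar_self by blast
  define v where "v = (1/2) *\<^sub>R (s + x)"
  define w where "w = (1/2) *\<^sub>R (s - x)"
  have vw: "v * w = 0" "w * v = 0" by (simp_all add: v_def w_def algebra_simps s c)
  have sv: "s = v + w" by (simp add: v_def w_def scaleR_diff_right scaleR_add_right flip: scaleR_add_left)
  have sx: "x = v - w" by (simp add: v_def w_def scaleR_diff_right scaleR_add_right flip: scaleR_add_left)
  have "star v = v" "star w = w" by (simp_all add: v_def w_def star_simps assms s(2))
  then have "pos v" "pos w" using vw
    by (auto intro!: pos_of_mult_self_eq[OF s(1)] simp: sv distrib_left distrib_right)
  moreover have "in_cstar x v" "in_cstar x w" unfolding v_def w_def
    by (auto intro: in_cstar_scaleR in_cstar_add in_cstar_diff xs in_cstar_self)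
  ultimately show ?thesis using that vw sx by blast
qed

section \<open>Positivity of \<open>star a * a\<close>\<close>

text \<open>For \<open>b = h + iu * k\<close> with self-adjoint \<open>h\<close> and
  \<open>k\<close>, the sum is \<open>2 *\<^sub>R (h * h + k * k)\<close>.\<close>

lemma pos_star_mult_add:
  fixes b :: "'a::cstar_alg"
  shows "pos (star b * b + b * star b)"
proof -
  have c: "b * iu = iu * b" "star b * iu = iu * star b" by (simp_all add: iu_comm)
  have "(b + star b) * (b + star b) + (iu * (b - star b)) * (iu * (b - star b)) =
      (b + star b) * (b + star b) + (iu * iu) * ((b - star b) * (b - star b))"
    by (metis (no_types, lifting) iu_comm mult.assoc)
  also have "\<dots> = 2 *\<^sub>R (star b * b + b * star b)"
    by (simp add: iu_mult algebra_simps scaleR_2)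
  finally have eq: "star b * b + b * star b = (1/2) *\<^sub>R ((b + star b) * (b + star b) + (iu * (b - star b)) * (iu * (b - star b)))"
    by simp
  have "star (iu * (b - star b)) = iu * (b - star b)"
    by (simp add: star_simps star_iu c algebra_simps)
  then show ?thesis unfolding eq
    by (intro pos_scaleR pos_add pos_square) (simp_all add: star_simps add.commute)
qed

text \<open>A nonzero positive \<open>c\<close> has \<open>norm c\<close> in its spectrum: if
  \<open>z = norm c - c\<close> had an inverse of norm below \<open>M\<close>, then \<open>z\<close>
  would dominate \<open>1/M\<close>, so \<open>c\<close> would lie below
  \<open>norm c - 1/M\<close>.\<close>

lemma pos_eq_0_of_invertible:
  fixes c :: "'a::cstar_alg"
  assumes "pos c" and inv: "\<And>l. l > 0 \<Longrightarrow> \<exists>z. z * (of_real l - c) = 1 \<and> (of_real l - c) * z = 1"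
  shows "c = 0"
proof (rule ccontr)
  assume "c \<noteq> 0"
  define m where "m = norm c"
  have m: "m > 0" using \<open>c \<noteq> 0\<close> by (simp add: m_def)
  define z where "z = of_real m - c"
  obtain y where y: "y * z = 1" "z * y = 1" using inv[OF m] by (auto simp: z_def)
  have pz: "pos z" unfolding z_def m_def using pos_sa[OF assms(1)] by (intro pos_of_norm_le) auto
  have sy: "star y = y"
  proof -
    have "star y * z = 1" using arg_cong[OF y(2), of star] pos_sa[OF pz] by (simp add: star_simps)
    then show ?thesis by (metis mult.assoc mult.left_neutral mult.right_neutral y(2))
  qed
  define M where "M = norm y + 1"
  have M: "M > 0" by (simp add: M_def add_nonneg_pos)
  have "pos ((of_real M - y) * z)"
    using sy pz y by (intro pos_mult pos_of_norm_le) (auto simp: M_def algebra_simps of_real_def)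
  then have "pos ((1/M) *\<^sub>R ((of_real M - y) * z))" using M by (intro pos_scaleR) auto
  moreover have "(1/M) *\<^sub>R ((of_real M - y) * z) = of_real (m - 1/M) - c"
    using M y(1) by (simp add: algebra_simps of_real_def) (simp add: z_def of_real_def)
  \<comment> \<open>\<open>norm_le_of_pos\<close> asks for a nonnegative bound, and
    \<open>m - 1/M\<close> may be negative.\<close>
  ultimately have "pos (of_real (max 0 (m - 1/M) - (m - 1/M)) + (of_real (m - 1/M) - c))"
    by (intro pos_add pos_of_real) auto
  then have "pos (of_real (max 0 (m - 1/M)) - c)" by (simp add: algebra_simps)
  then have "norm c \<le> max 0 (m - 1/M)" by (intro norm_le_of_pos assms(1)) auto
  then show False using m M by (simp add: m_def max_def split: if_splits)
qed

text \<open>The negative part \<open>w\<close> of \<open>star a * a\<close> has to vanish. For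
  \<open>b = a * w\<close> the product \<open>star b * b\<close> is minus the cube of
  \<open>w\<close>, so \<open>b * star b\<close> is positive by \<open>pos_star_mult_add\<close>. As
  \<open>star b * b\<close> and \<open>b * star b\<close> share their nonzero spectrum, the cube of
  \<open>w\<close> has no positive spectrum and is zero.\<close>

lemma pos_star_mult:
  fixes a :: "'a::cstar_alg"
  shows "pos (star a * a)"
proof -
  define x where "x = star a * a"
  have "star x = x" by (simp add: x_def star_simps)
  then obtain v w where vw: "pos v" "pos w" "x = v - w" "v * w = 0" "w * v = 0" "in_cstar x v" "in_cstar x w"
    using pos_part by blast
  define b where "b = a * w"
  define c where "c = w * w * w"
  have "star b * b = w * x * w" using pos_sa[OF vw(2)] by (simp add: b_def x_def star_simps mult.assoc)
  also have "\<dots> = - c" using vw(4,5) by (simp add: vw(3) c_def algebra_simps)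
  finally have bb: "star b * b = - c" .
  have sw: "star w = w" using pos_sa[OF vw(2)] .
  have pc: "pos c" unfolding c_def using vw(2) pos_square[OF sw] by (intro pos_mult) (auto simp: mult.assoc)
  have pd: "pos (b * star b)" using pos_add[OF pos_star_mult_add[of b] pc] by (simp add: bb)
  have "c = 0"
  proof (rule pos_eq_0_of_invertible[OF pc])
    fix l :: real assume l: "l > 0"
    obtain y where y: "y * (b * star b + of_real l) = 1" "(b * star b + of_real l) * y = 1"
      using pos_resolvent[OF pd l] by metis
    have y1: "b * star b * y = 1 - l *\<^sub>R y" and y2: "y * b * star b = 1 - l *\<^sub>R y"
      using y by (simp_all add: algebra_simps of_real_def)
    \<comment> \<open>The inverse of \<open>of_real l + star b * b\<close>, expressed through the
      inverse \<open>y\<close> of \<open>of_real l + b * star b\<close>.\<close>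
    define z where "z = (1/l) *\<^sub>R (1 - star b * y * b)"
    have c: "of_real l - c = of_real l + star b * b" by (simp add: bb)
    have "(of_real l + star b * b) * (star b * y * b) = l *\<^sub>R (star b * y * b) + star b * (b * star b * y) * b"
      by (simp add: algebra_simps of_real_def)
    also have "\<dots> = star b * b" by (simp only: y1) (simp add: algebra_simps)
    finally have inv1: "(of_real l - c) * z = 1" using l
      by (simp add: z_def c right_diff_distrib) (simp add: of_real_def)
    have "(star b * y * b) * (of_real l + star b * b) = l *\<^sub>R (star b * y * b) + star b * (y * b * star b) * b"
      by (simp add: algebra_simps of_real_def)
    also have "\<dots> = star b * b" by (simp only: y2) (simp add: algebra_simps)
    finally have "z * (of_real l - c) = 1" using l
      by (simp add: z_def c left_diff_distrib) (simp add: of_real_def)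
    with inv1 show "\<exists>z. z * (of_real l - c) = 1 \<and> (of_real l - c) * z = 1" by blast
  qed
  then have "norm ((w * w) * (w * w)) = 0" by (simp add: c_def mult.assoc)
  then have "(norm (w * w))\<^sup>2 = 0" using norm_square_sa[of "w * w"] sw by (simp add: star_simps)
  then have "w * w = 0" by simp
  then have "w = 0" using norm_square_sa[OF sw] by simp
  then show ?thesis using vw(1,3) by (simp add: x_def)
qed

lemma pos_mult_star: "pos (a * star a :: 'a::cstar_alg)"
  using pos_star_mult[of "star a"] by simp

lemma pos_conj:
  fixes x :: "'a::cstar_alg"
  assumes "pos x" shows "pos (star c * x * c)"
proof -
  obtain y where "star y = y" "x = y * y" using assms by (auto simp: pos_def)
  then show ?thesis using pos_star_mult[of "y * c"] by (simp add: star_simps mult.assoc)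
qed

lemma pos_conj':
  fixes x :: "'a::cstar_alg"
  shows "pos x \<Longrightarrow> pos (c * x * star c)"
  using pos_conj[of x "star c"] by simp

lemma pos_conj_mono:
  fixes x :: "'a::cstar_alg"
  assumes "pos (y - x)" shows "pos (c * y * star c - c * x * star c)"
  using pos_conj'[OF assms, of c] by (simp add: algebra_simps)

lemma norm_mono_pos:
  fixes x :: "'a::cstar_alg"
  assumes "pos x" "pos (y - x)" shows "norm x \<le> norm y"
proof (rule norm_le_of_pos[OF assms(1)])
  have "pos y" using pos_add[OF assms] by simp
  then have "pos (of_real (norm y) - y)" by (intro pos_of_norm_le) (auto simp: pos_sa)
  then show "pos (of_real (norm y) - x)" using pos_add assms(2) by fastforce
qed simp

lemma norm_le_one_of_pos:
  fixes e :: "'a::cstar_alg"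
  shows "pos e \<Longrightarrow> pos (1 - e) \<Longrightarrow> norm e \<le> 1"
  using norm_le_of_pos[of e 1] by simp

section \<open>Approximate units and ideals\<close>

text \<open>\<open>e\<close> is \<open>h\<close> times the inverse \<open>q\<close> of
  \<open>h + of_real d\<close>. Then \<open>1 - e = d *\<^sub>R q\<close>, and the last norm is that
  of \<open>(d * d) *\<^sub>R (e * q)\<close>. The factorisation through \<open>h\<close> puts
  \<open>e\<close> into ideals that contain \<open>h\<close>.\<close>

lemma approx_unit:
  fixes h :: "'a::cstar_alg"
  assumes "pos h" "0 < d"
  obtains e q where "pos e" "pos (1 - e)" "e = h * q" "e = q * h" "in_cstar h q"
    "norm ((1 - e) * h * (1 - e)) \<le> d"
proof -
  obtain y where y: "pos y" "y * (h + of_real d) = 1" "(h + of_real d) * y = 1" "norm y \<le> 1 / d" "in_cstar h y"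
    using pos_resolvent[OF assms] by blast
  define e where "e = h * y"
  have hy: "h * y = y * h" using y(5) in_cstar_commute in_cstar_self by blast
  have e1: "1 - e = d *\<^sub>R y" using y(3) by (simp add: e_def algebra_simps of_real_def)
  have p: "pos e" "pos (1 - e)" using pos_mult[OF assms(1) y(1) hy] pos_scaleR[OF y(1), of d] assms(2)
    unfolding e1 by (simp_all add: e_def)
  have "(1 - e) * h * (1 - e) = (d * d) *\<^sub>R (e * y)" unfolding e1 by (simp add: e_def hy)
  then have "norm ((1 - e) * h * (1 - e)) \<le> (d * d) * (norm e * norm y)"
    by (simp add: norm_mult_ineq mult_left_mono)
  also have "\<dots> \<le> (d * d) * (1 * (1 / d))"
    using norm_le_one_of_pos[OF p] y(4) assms(2) by (intro mult_left_mono mult_mono) auto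
  also have "\<dots> = d" using assms(2) by simp
  finally show ?thesis using that[of e y] p hy y(5) e_def by blast
qed

text \<open>Conjugating \<open>v * star v \<le> h + d\<close> by \<open>1 - e\<close> transfers the
  smallness from \<open>h\<close> to \<open>v\<close>.\<close>

lemma approx_unit_dominated:
  fixes v h e :: "'a::cstar_alg"
  assumes "pos (h + of_real d - v * star v)" "star e = e" "norm (1 - e) \<le> 1" "norm ((1 - e) * h * (1 - e)) \<le> d"
  shows "(norm ((1 - e) * v))\<^sup>2 \<le> d + \<bar>d\<bar>"
proof -
  let ?f = "1 - e"
  have sf: "star ?f = ?f" using assms(2) by (simp add: star_simps)
  have "pos (?f * (h + of_real d) * ?f - ?f * (v * star v) * ?f)"
    using pos_conj_mono[OF assms(1), of ?f] by (simp only: sf)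
  moreover have "pos (?f * (v * star v) * ?f)" using pos_conj'[OF pos_mult_star, of ?f v] by (simp only: sf)
  ultimately have "norm (?f * (v * star v) * ?f) \<le> norm (?f * (h + of_real d) * ?f)"
    by (rule norm_mono_pos[rotated])
  also have "?f * (h + of_real d) * ?f = ?f * h * ?f + d *\<^sub>R (?f * ?f)"
    by (simp add: distrib_left distrib_right of_real_def)
  also have "norm \<dots> \<le> d + \<bar>d\<bar> * (norm ?f * norm ?f)"
    using norm_triangle_ineq[of "?f * h * ?f" "d *\<^sub>R (?f * ?f)"] assms(4)
      mult_left_mono[OF norm_mult_ineq[of ?f ?f], of "\<bar>d\<bar>"] by simp
  also have "\<dots> \<le> d + \<bar>d\<bar> * 1"
    using assms(3) by (intro add_left_mono mult_left_mono mult_le_one) auto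
  also have "norm (?f * (v * star v) * ?f) = (norm (?f * v))\<^sup>2"
    using norm_mult_star[of "?f * v"] sf by (simp add: star_mult mult.assoc)
  finally show ?thesis by simp
qed

text \<open>Neither closedness nor stability under \<open>star\<close> is required, so that unions
  of chains are covered; stability under real scalars follows when \<open>A\<close> is a unital
  subalgebra.\<close>

definition ideal_in :: "'a::cstar_alg set \<Rightarrow> 'a set \<Rightarrow> bool" where
  "ideal_in A K \<longleftrightarrow> K \<subseteq> A \<and> 0 \<in> K \<and> (\<forall>x\<in>K. \<forall>y\<in>K. x + y \<in> K) \<and> (\<forall>a\<in>A. \<forall>x\<in>K. a * x \<in> K \<and> x * a \<in> K)"

lemma ideal_subset: "ideal_in A K \<Longrightarrow> x \<in> K \<Longrightarrow> x \<in> A"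
  and ideal_zero: "ideal_in A K \<Longrightarrow> 0 \<in> K"
  and ideal_add: "ideal_in A K \<Longrightarrow> x \<in> K \<Longrightarrow> y \<in> K \<Longrightarrow> x + y \<in> K"
  and ideal_mult_left: "ideal_in A K \<Longrightarrow> a \<in> A \<Longrightarrow> x \<in> K \<Longrightarrow> a * x \<in> K"
  and ideal_mult_right: "ideal_in A K \<Longrightarrow> a \<in> A \<Longrightarrow> x \<in> K \<Longrightarrow> x * a \<in> K"
  unfolding ideal_in_def by auto

text \<open>For an ideal \<open>K\<close> and positive \<open>x\<close> this is membership in the
  closed hereditary subalgebra that \<open>K\<close> generates in the whole algebra, written as an
  order inequality so that a failure is detected by a state.\<close>

definition dominated :: "'a::cstar_alg set \<Rightarrow> 'a \<Rightarrow> bool" where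
  "dominated K x \<longleftrightarrow> (\<forall>d>0. \<exists>h\<in>K. pos h \<and> pos (h + of_real d - x))"

text \<open>One sum \<open>g\<close> of dominating elements serves all of \<open>V\<close>. The unit
  is found in \<open>K\<close> although the elements of \<open>V\<close> may lie outside
  \<open>A\<close>.\<close>

lemma dominated_approx_unit:
  fixes A :: "'a::cstar_alg set"
  assumes A: "unital_subalg A" and K: "ideal_in A K" and V: "finite V"
    and dom: "\<And>v. v \<in> V \<Longrightarrow> dominated K (v * star v)" and d: "d > 0"
  obtains e where "e \<in> K" "pos e" "pos (1 - e)" "\<And>v. v \<in> V \<Longrightarrow> norm ((1 - e) * v) \<le> d"
proof -
  \<comment> \<open>\<open>approx_unit_dominated\<close> bounds the squared norm by
    \<open>2 * d'\<close>.\<close>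
  define d' where "d' = d\<^sup>2 / 2"
  have d': "d' > 0" using d by (simp add: d'_def)
  obtain h where h: "\<And>v. v \<in> V \<Longrightarrow> h v \<in> K \<and> pos (h v) \<and> pos (h v + of_real d' - v * star v)"
    using bchoice[of V "\<lambda>v h. h \<in> K \<and> pos h \<and> pos (h + of_real d' - v * star v)"] dom d'
    unfolding dominated_def by blast
  define g where "g = sum h V"
  have "sum h V \<in> K" using V h K by (induction V) (auto simp: ideal_in_def)
  then have g: "g \<in> K" "pos g" using h by (auto simp: g_def intro: pos_sum)
  obtain e q where e: "pos e" "pos (1 - e)" "e = g * q" "in_cstar g q" "norm ((1 - e) * g * (1 - e)) \<le> d'"
    using approx_unit[OF g(2) d'] by metis
  have "g \<in> A" using g(1) K by (auto simp: ideal_in_def)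
  then have "q \<in> A" using in_cstar_mem[OF e(4) A] by simp
  then have "e \<in> K" using K g(1) e(3) by (auto simp: ideal_in_def)
  moreover have "norm ((1 - e) * v) \<le> d" if "v \<in> V" for v
  proof -
    have "g = h v + sum h (V - {v})" using V that by (simp add: g_def sum.remove)
    then have "pos (g - h v)" using h by (auto intro!: pos_sum)
    then have "pos ((g - h v) + (h v + of_real d' - v * star v))" using h[OF that] by (intro pos_add) auto
    then have "pos (g + of_real d' - v * star v)" by (simp add: algebra_simps)
    moreover have "norm (1 - e) \<le> 1" using norm_le_one_of_pos[of "1 - e"] e by simp
    ultimately have "(norm ((1 - e) * v))\<^sup>2 \<le> d' + \<bar>d'\<bar>"
      using e pos_sa by (intro approx_unit_dominated) auto
    then have "(norm ((1 - e) * v))\<^sup>2 \<le> d\<^sup>2" using d' by (simp add: d'_def)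
    then show ?thesis using d by (simp add: power2_le_iff_abs_le)
  qed
  ultimately show ?thesis using that e by blast
qed

text \<open>For \<open>v\<close> in \<open>A\<close> the products \<open>e * v\<close> with
  \<open>e\<close> in \<open>K\<close> remain in \<open>K\<close> and converge to \<open>v\<close>:
  inside \<open>A\<close>, the hereditary algebra of \<open>K\<close> gives back only
  \<open>K\<close>.\<close>

lemma dominated_mem:
  fixes A :: "'a::cstar_alg set"
  assumes A: "unital_subalg A" and K: "ideal_in A K" "closed K" and v: "v \<in> A" "dominated K (v * star v)"
  shows "v \<in> K"
proof -
  have "\<exists>y\<in>K. dist y v < d" if "d > 0" for d
  proof -
    have "dominated K (u * star u)" if "u \<in> {v}" for u using that v(2) by simp
    moreover have "d / 2 > 0" using that by simp
    ultimately obtain e where e: "e \<in> K" "\<And>u. u \<in> {v} \<Longrightarrow> norm ((1 - e) * u) \<le> d / 2"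
      using dominated_approx_unit[OF A K(1), of "{v}" "d/2"] by blast
    from e(2)[of v] have "norm (v - e * v) < d" using that by (simp add: left_diff_distrib)
    with e(1) show ?thesis using K v(1)
      by (intro bexI[of _ "e * v"]) (auto simp: ideal_in_def dist_norm norm_minus_commute)
  qed
  then show ?thesis using K(2) closed_approachable by blast
qed

lemma dominated_self: "x \<in> K \<Longrightarrow> pos x \<Longrightarrow> dominated K x"
  by (auto simp: dominated_def intro!: bexI[of _ x] pos_of_real)

lemma dominated_mono:
  assumes "pos (y - x)" "dominated K y" shows "dominated K x"
  unfolding dominated_def
proof (intro allI impI)
  fix d :: real assume "d > 0"
  then obtain h where h: "h \<in> K" "pos h" "pos (h + of_real d - y)" using assms(2) by (auto simp: dominated_def)
  then show "\<exists>h\<in>K. pos h \<and> pos (h + of_real d - x)"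
    using pos_add[OF h(3) assms(1)] by (intro bexI[of _ h]) auto
qed

text \<open>\<open>star x * x\<close> lies in \<open>K\<close> and dominates itself, which is the
  criterion of \<open>dominated_mem\<close> for \<open>star x\<close>.\<close>

lemma ideal_star:
  assumes "unital_subalg A" "ideal_in A K" "closed K" "x \<in> K"
  shows "star x \<in> K"
proof (rule dominated_mem[OF assms(1-3)])
  have "x \<in> A" using assms(2,4) by (auto simp: ideal_in_def)
  then show "star x \<in> A" by (rule subalg_star[OF assms(1)])
  then have "star x * x \<in> K" using assms(2,4) by (auto simp: ideal_in_def)
  then show "dominated K (star x * star (star x))" by (simp add: dominated_self pos_star_mult)
qed

lemma ideal_scaleR:
  assumes "unital_subalg A" "ideal_in A K" "x \<in> K"
  shows "r *\<^sub>R x \<in> K"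
  using ideal_mult_left[OF assms(2) subalg_of_real[OF assms(1), of r] assms(3)] by (simp add: of_real_def)

lemma ideal_diff:
  assumes "unital_subalg A" "ideal_in A K" "x \<in> K" "y \<in> K"
  shows "x - y \<in> K"
proof -
  have "x + (-1) *\<^sub>R y \<in> K" by (intro ideal_add[OF assms(2)] ideal_scaleR[OF assms(1,2)] assms)
  then show ?thesis by simp
qed

section \<open>Extreme Hahn-Banach functionals\<close>

definition sublinear :: "('v::real_vector \<Rightarrow> real) \<Rightarrow> bool" where
  "sublinear q \<longleftrightarrow> (\<forall>x y. q (x + y) \<le> q x + q y) \<and> (\<forall>r>0. \<forall>x. q (r *\<^sub>R x) \<le> r * q x)"

lemma sublinear_add: "sublinear q \<Longrightarrow> q (x + y) \<le> q x + q y"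
  and sublinear_scale_le: "sublinear q \<Longrightarrow> r > 0 \<Longrightarrow> q (r *\<^sub>R x) \<le> r * q x"
  by (auto simp: sublinear_def)

lemma sublinear_0:
  assumes "sublinear q" shows "q 0 = 0"
proof -
  have "q 0 \<le> q 0 + q 0" using sublinear_add[OF assms, of 0 0] by simp
  moreover have "q 0 \<le> (1/2) * q 0" using sublinear_scale_le[OF assms, of "1/2" 0] by simp
  ultimately show ?thesis by simp
qed

lemma sublinear_scale:
  assumes "sublinear q" "r \<ge> 0" shows "q (r *\<^sub>R x) = r * q x"
proof (cases "r = 0")
  case False
  then have r: "r > 0" using assms by simp
  have "q ((1/r) *\<^sub>R (r *\<^sub>R x)) \<le> (1/r) * q (r *\<^sub>R x)" using r by (intro sublinear_scale_le assms) simp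
  then have "r * q x \<le> q (r *\<^sub>R x)" using r by (simp add: field_simps)
  then show ?thesis using sublinear_scale_le[OF assms(1) r, of x] by simp
qed (simp add: sublinear_0 assms)

lemma sublinear_lower:
  assumes "sublinear q" shows "- q (- x) \<le> q x"
  using sublinear_add[OF assms, of x "-x"] sublinear_0[OF assms] by simp

lemma linear_of_sublinear_odd:
  assumes q: "sublinear q" and odd: "\<And>x. q (- x) \<le> - q x"
  shows "linear q"
proof (rule linearI)
  have neg: "q (- x) = - q x" for x using odd[of x] sublinear_lower[OF q, of x] by simp
  show "q (x + y) = q x + q y" for x y
    using sublinear_add[OF q, of x y] sublinear_add[OF q, of "-x" "-y"] neg[of "x + y"] neg[of x] neg[of y]
    by simp
  show "q (r *\<^sub>R x) = r *\<^sub>R q x" for r x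
  proof (cases "r \<ge> 0")
    case False
    then have "q ((- r) *\<^sub>R x) = - r * q x" by (intro sublinear_scale q) simp
    then show ?thesis using neg[of "r *\<^sub>R x"] by simp
  qed (simp add: sublinear_scale q)
qed

text \<open>\<open>q\<close> describes a face of the set of linear functionals below \<open>p\<close>.\<close>

definition face_of_dual :: "('v::real_vector \<Rightarrow> real) \<Rightarrow> ('v \<Rightarrow> real) \<Rightarrow> bool" where
  "face_of_dual p q \<longleftrightarrow> sublinear q \<and> q \<le> p \<and>
    (\<forall>g h t. linear g \<and> linear h \<and> g \<le> p \<and> h \<le> p \<and> 0 < t \<and> t < 1 \<and>
      (\<forall>x. t * g x + (1 - t) * h x \<le> q x) \<longrightarrow> g \<le> q \<and> h \<le> q)"

text \<open>The subface of functionals attaining at \<open>x\<close> the largest value that \<open>q\<close> allows.\<close>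

definition peak :: "('v::real_vector \<Rightarrow> real) \<Rightarrow> 'v \<Rightarrow> 'v \<Rightarrow> real" where
  "peak q x y = (INF t\<in>{0..}. q (y + t *\<^sub>R x) - t * q x)"

lemma peak_le:
  assumes q: "sublinear q" and "t \<ge> 0"
  shows "peak q x y \<le> q (y + t *\<^sub>R x) - t * q x"
  unfolding peak_def
proof (rule cINF_lower)
  show "bdd_below ((\<lambda>t. q (y + t *\<^sub>R x) - t * q x) ` {0..})"
  proof (rule bdd_belowI2)
    fix t :: real assume "t \<in> {0..}"
    then have "t * q x = q (t *\<^sub>R x)" using sublinear_scale[OF q] by simp
    also have "\<dots> \<le> q (y + t *\<^sub>R x) + q (- y)"
      using sublinear_add[OF q, of "y + t *\<^sub>R x" "-y"] by simp
    finally show "- q (- y) \<le> q (y + t *\<^sub>R x) - t * q x" by simp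
  qed
qed (use assms in simp)

lemma peak_greatest:
  "(\<And>t. t \<ge> 0 \<Longrightarrow> c \<le> q (y + t *\<^sub>R x) - t * q x) \<Longrightarrow> c \<le> peak q x y"
  unfolding peak_def by (rule cINF_greatest) auto

lemma peak_neg: "sublinear q \<Longrightarrow> peak q x (- x) \<le> - q x"
  using peak_le[of q 1 x "-x"] sublinear_0[of q] by simp

lemma sublinear_peak:
  assumes q: "sublinear q" shows "sublinear (peak q x)"
  unfolding sublinear_def
proof (intro conjI allI impI)
  fix y z
  have "peak q x (y + z) - (q (z + s *\<^sub>R x) - s * q x) \<le> q (y + t *\<^sub>R x) - t * q x"
    if "s \<ge> 0" "t \<ge> 0" for s t
  proof -
    have "peak q x (y + z) \<le> q (y + z + (s + t) *\<^sub>R x) - (s + t) * q x"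
      using that by (intro peak_le q) simp
    also have "q (y + z + (s + t) *\<^sub>R x) \<le> q (y + t *\<^sub>R x) + q (z + s *\<^sub>R x)"
      using sublinear_add[OF q, of "y + t *\<^sub>R x" "z + s *\<^sub>R x"] by (simp add: algebra_simps)
    finally show ?thesis by (simp add: algebra_simps)
  qed
  then have "peak q x (y + z) - (q (z + s *\<^sub>R x) - s * q x) \<le> peak q x y" if "s \<ge> 0" for s
    using that by (intro peak_greatest) auto
  then have "peak q x (y + z) - peak q x y \<le> q (z + s *\<^sub>R x) - s * q x" if "s \<ge> 0" for s
    using that by (simp add: algebra_simps)
  then have "peak q x (y + z) - peak q x y \<le> peak q x z" by (rule peak_greatest)
  then show "peak q x (y + z) \<le> peak q x y + peak q x z" by simp
next
  fix r :: real and y assume r: "r > 0"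
  have "peak q x (r *\<^sub>R y) / r \<le> peak q x y"
  proof (rule peak_greatest)
    fix t :: real assume "t \<ge> 0"
    then have "peak q x (r *\<^sub>R y) \<le> q (r *\<^sub>R y + (r * t) *\<^sub>R x) - (r * t) * q x"
      using r by (intro peak_le q) simp
    also have "q (r *\<^sub>R y + (r * t) *\<^sub>R x) = r * q (y + t *\<^sub>R x)"
      using sublinear_scale[OF q, of r "y + t *\<^sub>R x"] r by (simp add: scaleR_add_right)
    finally show "peak q x (r *\<^sub>R y) / r \<le> q (y + t *\<^sub>R x) - t * q x"
      using r by (simp add: field_simps)
  qed
  then show "peak q x (r *\<^sub>R y) \<le> r * peak q x y" using r by (simp add: field_simps)
qed

text \<open>As \<open>peak q x (- x) \<le> - q x\<close>, a convex combination below the peak is at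
  least \<open>q x\<close> at \<open>x\<close>. Both members are at most \<open>q x\<close> there,
  so both attain it; and a linear functional below \<open>q\<close> with value \<open>q x\<close> at
  \<open>x\<close> lies below the peak.\<close>

lemma face_peak:
  assumes "face_of_dual p q" shows "face_of_dual p (peak q x)"
  unfolding face_of_dual_def
proof (intro conjI allI impI)
  have q: "sublinear q" "q \<le> p" using assms by (auto simp: face_of_dual_def)
  have pq: "peak q x \<le> q" using peak_le[OF q(1), of 0 x] by (simp add: le_fun_def)
  show "sublinear (peak q x)" by (rule sublinear_peak[OF q(1)])
  show "peak q x \<le> p" using pq q(2) by simp
  fix g h t
  assume a: "linear g \<and> linear h \<and> g \<le> p \<and> h \<le> p \<and> 0 < t \<and> t < 1 \<and> (\<forall>y. t * g y + (1 - t) * h y \<le> peak q x y)"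
  then have "\<forall>y. t * g y + (1 - t) * h y \<le> q y" using pq by (meson le_funD order_trans)
  then have le: "g \<le> q" "h \<le> q" using assms a unfolding face_of_dual_def by blast+
  have "t * g (- x) + (1 - t) * h (- x) \<le> - q x"
    using a peak_neg[OF q(1), of x] order_trans by blast
  then have s: "q x \<le> t * g x + (1 - t) * h x" using a by (simp add: linear_neg)
  have gx: "g x \<le> q x" "h x \<le> q x" using le by (auto simp: le_fun_def)
  then have "t * g x \<le> t * q x" "(1 - t) * h x \<le> (1 - t) * q x" using a by (auto intro: mult_left_mono)
  then have "t * q x \<le> t * g x" "(1 - t) * q x \<le> (1 - t) * h x" using s by (simp_all add: algebra_simps)
  then have eq: "g x = q x" "h x = q x" using gx a by auto
  have ub: "k \<le> peak q x" if "linear k" "k \<le> q" "k x = q x" for k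
    unfolding le_fun_def
  proof (intro allI peak_greatest)
    fix y and s :: real
    have "k y + s * k x = k (y + s *\<^sub>R x)" using that(1) by (simp add: linear_add linear_scale)
    also have "\<dots> \<le> q (y + s *\<^sub>R x)" using that(2) by (simp add: le_fun_def)
    finally show "k y \<le> q (y + s *\<^sub>R x) - s * q x" using that(3) by simp
  qed
  show "g \<le> peak q x" "h \<le> peak q x" using ub a le eq by auto
qed

text \<open>Hahn-Banach and Krein-Milman in one application of Zorn's lemma, without a weak
  topology. A smallest face \<open>q\<close> equals each of its own peaks, so it is odd and hence
  linear: the face is a single point, and being a face makes this point extreme.\<close>

lemma extreme_hahn_banach:
  fixes p :: "'v::real_vector \<Rightarrow> real"
  assumes p: "sublinear p"
  obtains f where "linear f" "f \<le> p" "f x0 = p x0"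
    "\<And>g h t. linear g \<Longrightarrow> linear h \<Longrightarrow> g \<le> p \<Longrightarrow> h \<le> p \<Longrightarrow> 0 < t \<Longrightarrow> t < 1 \<Longrightarrow>
      (\<And>x. f x = t * g x + (1 - t) * h x) \<Longrightarrow> g \<le> f"
proof -
  \<comment> \<open>The bound on \<open>q (- x0)\<close> forces every linear functional below
    \<open>q\<close> to take the value \<open>p x0\<close> at \<open>x0\<close>.\<close>
  define Q where "Q = {q. face_of_dual p q \<and> q (- x0) \<le> - p x0}"
  have "face_of_dual p p" using p by (auto simp: face_of_dual_def)
  then have start: "peak p x0 \<in> Q" using face_peak peak_neg[OF p] by (auto simp: Q_def)
  have "\<exists>m\<in>Q. \<forall>a\<in>Q. m \<ge> a \<longrightarrow> a = m"
  proof (rule predicate_Zorn)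
    show "partial_order_on Q (relation_of (\<ge>) Q)"
      by (rule partial_order_on_relation_ofI) auto
    fix C assume C: "C \<in> Chains (relation_of (\<ge>) Q)"
    then have CQ: "C \<subseteq> Q" and chain: "\<And>a b. a \<in> C \<Longrightarrow> b \<in> C \<Longrightarrow> a \<le> b \<or> b \<le> a"
      by (auto simp: Chains_def relation_of_def)
    show "\<exists>u\<in>Q. \<forall>a\<in>C. a \<ge> u"
    proof (cases "C = {}")
      case True
      then show ?thesis using start by auto
    next
      case False
      define u where "u = (\<lambda>x. INF q\<in>C. q x)"
      have sub: "sublinear q" "q \<le> p" if "q \<in> C" for q
        using CQ that by (auto simp: Q_def face_of_dual_def)
      have bdd: "bdd_below ((\<lambda>q. q x) ` C)" for x
      proof (rule bdd_belowI2)
        fix q assume "q \<in> C"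
        then show "- p (- x) \<le> q x" using sublinear_lower[OF sub(1), of q x] sub(2)[of q]
          by (smt (verit) le_funD)
      qed
      have u_le: "u x \<le> q x" if "q \<in> C" for q x
        unfolding u_def by (rule cINF_lower[OF bdd that])
      have u_greatest: "c \<le> u x" if "\<And>q. q \<in> C \<Longrightarrow> c \<le> q x" for c x
        unfolding u_def using False that by (intro cINF_greatest) auto
      have "sublinear u"
        unfolding sublinear_def
      proof (intro conjI allI impI)
        fix x y
        have "u (x + y) - q1 x \<le> q2 y" if "q1 \<in> C" "q2 \<in> C" for q1 q2
        proof -
          \<comment> \<open>Subadditivity of the infimum needs one member of the chain below both
            \<open>q1\<close> and \<open>q2\<close>.\<close>
          have "\<exists>q\<in>C. q \<le> q1 \<and> q \<le> q2" using chain[OF that] that by auto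
          then obtain q where q: "q \<in> C" "q \<le> q1" "q \<le> q2" by blast
          have "u (x + y) \<le> q x + q y" using u_le[OF q(1), of "x + y"] sublinear_add[OF sub(1)[OF q(1)], of x y] by simp
          then show ?thesis using q(2,3) by (smt (verit) le_funD)
        qed
        then have "u (x + y) - q1 x \<le> u y" if "q1 \<in> C" for q1 using that by (intro u_greatest)
        then have "u (x + y) - u y \<le> q1 x" if "q1 \<in> C" for q1 using that by (simp add: algebra_simps)
        then have "u (x + y) - u y \<le> u x" by (rule u_greatest)
        then show "u (x + y) \<le> u x + u y" by simp
      next
        fix r :: real and x assume r: "r > 0"
        have "u (r *\<^sub>R x) / r \<le> u x"
        proof (rule u_greatest)
          fix q assume "q \<in> C"
          then have "u (r *\<^sub>R x) \<le> r * q x"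
            using u_le[of q "r *\<^sub>R x"] sublinear_scale_le[OF sub(1) r, of q x] by simp
          then show "u (r *\<^sub>R x) / r \<le> q x" using r by (simp add: field_simps)
        qed
        then show "u (r *\<^sub>R x) \<le> r * u x" using r by (simp add: field_simps)
      qed
      moreover obtain q0 where q0: "q0 \<in> C" using False by blast
      moreover have "u \<le> p" using u_le[OF q0] sub(2)[OF q0] by (meson le_fun_def order_trans)
      moreover have "g \<le> u \<and> h \<le> u" if a: "linear g \<and> linear h \<and> g \<le> p \<and> h \<le> p \<and> 0 < t \<and> t < 1 \<and>
          (\<forall>x. t * g x + (1 - t) * h x \<le> u x)" for g h t
      proof -
        have "g \<le> q \<and> h \<le> q" if "q \<in> C" for q
        proof -
          have "face_of_dual p q" using CQ that by (auto simp: Q_def)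
          moreover have "\<forall>x. t * g x + (1 - t) * h x \<le> q x" using a u_le[OF that] order_trans by blast
          ultimately show ?thesis using a unfolding face_of_dual_def by blast
        qed
        then show ?thesis by (auto simp: le_fun_def intro: u_greatest)
      qed
      ultimately have "face_of_dual p u" by (auto simp: face_of_dual_def)
      moreover have "u (- x0) \<le> - p x0" using u_le[OF q0, of "-x0"] q0 CQ by (auto simp: Q_def)
      ultimately show ?thesis using u_le by (auto simp: Q_def le_fun_def)
    qed
  qed
  then obtain q where q: "q \<in> Q" and min: "\<And>a. a \<in> Q \<Longrightarrow> a \<le> q \<Longrightarrow> a = q" by blast
  have qf: "face_of_dual p q" "sublinear q" "q \<le> p" using q by (auto simp: Q_def face_of_dual_def)
  have "q (- x) \<le> - q x" for x
  proof -
    have le: "peak q x \<le> q" using peak_le[OF qf(2), of 0 x] by (simp add: le_fun_def)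
    have "peak q x (- x0) \<le> - p x0" using le q by (auto simp: Q_def le_fun_def intro: order_trans)
    then have "peak q x \<in> Q" using face_peak[OF qf(1)] by (auto simp: Q_def)
    then have "peak q x = q" using min le by blast
    then show ?thesis using peak_neg[OF qf(2), of x] by simp
  qed
  then have lin: "linear q" using linear_of_sublinear_odd qf(2) by blast
  have "p x0 \<le> q x0" using q lin by (simp add: Q_def linear_neg)
  then have "q x0 = p x0" using qf(3) by (simp add: le_fun_def antisym)
  moreover have "g \<le> q" if "linear g" "linear h" "g \<le> p" "h \<le> p" "0 < t" "t < 1"
      "\<And>x. q x = t * g x + (1 - t) * h x" for g h t
    using qf(1) that unfolding face_of_dual_def by (metis order_refl)
  ultimately show ?thesis using that lin qf(3) by blast
qed

section \<open>States\<close>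

text \<open>The real part of a state in the usual sense. The complex functional is recovered in the
  locale \<open>gns\<close> as \<open>\<phi>\<close>.\<close>

definition state :: "('a::cstar_alg \<Rightarrow> real) \<Rightarrow> bool" where
  "state f \<longleftrightarrow> linear f \<and> (\<forall>x. pos x \<longrightarrow> 0 \<le> f x) \<and> (\<forall>x. f (star x) = f x) \<and> f 1 = 1"

definition pure_state :: "('a::cstar_alg \<Rightarrow> real) \<Rightarrow> bool" where
  "pure_state f \<longleftrightarrow> state f \<and>
    (\<forall>g h t. state g \<and> state h \<and> 0 < t \<and> t < 1 \<and> (\<forall>x. f x = t * g x + (1 - t) * h x) \<longrightarrow> g = f)"

lemma state_linear: "state f \<Longrightarrow> linear f"
  and state_pos: "state f \<Longrightarrow> pos x \<Longrightarrow> 0 \<le> f x"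
  and state_star: "state f \<Longrightarrow> f (star x) = f x"
  and state_one: "state f \<Longrightarrow> f 1 = 1"
  by (auto simp: state_def)

lemma state_add: "state f \<Longrightarrow> f (x + y) = f x + f y"
  and state_diff: "state f \<Longrightarrow> f (x - y) = f x - f y"
  and state_scaleR: "state f \<Longrightarrow> f (r *\<^sub>R x) = r * f x"
  and state_zero: "state f \<Longrightarrow> f 0 = 0"
  and state_minus: "state f \<Longrightarrow> f (- x) = - f x"
  using state_linear[of f] by (simp_all add: linear_add linear_diff linear_scale linear_0 linear_neg)

lemma state_mono: "state f \<Longrightarrow> pos (y - x) \<Longrightarrow> f x \<le> f y"
  using state_pos[of f "y - x"] state_diff[of f y x] by simp

lemma state_of_real: "state f \<Longrightarrow> f (of_real r) = r"
  by (simp add: of_real_def state_scaleR state_one)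

lemma state_cauchy_schwarz:
  fixes x y :: "'a::cstar_alg"
  assumes f: "state f"
  shows "(f (star y * x))\<^sup>2 \<le> f (star x * x) * f (star y * y)"
proof -
  define a b c where "a = f (star x * x)" "b = f (star y * x)" "c = f (star y * y)"
  have b': "f (star x * y) = b" using state_star[OF f, of "star y * x"] by (simp add: star_mult a_b_c_def)
  have quad: "0 \<le> a + 2 * r * b + r * r * c" for r
  proof -
    have "0 \<le> f (star (x + r *\<^sub>R y) * (x + r *\<^sub>R y))" by (rule state_pos[OF f pos_star_mult])
    also have "star (x + r *\<^sub>R y) * (x + r *\<^sub>R y) =
        star x * x + r *\<^sub>R (star y * x) + r *\<^sub>R (star x * y) + (r * r) *\<^sub>R (star y * y)"
      by (simp add: star_simps algebra_simps)
    finally show ?thesis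
      by (simp add: state_add[OF f] state_scaleR[OF f] b') (simp add: a_b_c_def)
  qed
  have c0: "c \<ge> 0" unfolding a_b_c_def by (rule state_pos[OF f pos_star_mult])
  show ?thesis
  proof (cases "c = 0")
    case True
    have "b = 0"
    proof (rule ccontr)
      assume "b \<noteq> 0"
      \<comment> \<open>With this \<open>r\<close> and \<open>c = 0\<close> the quadratic expression
        has the value \<open>- 1\<close>.\<close>
      then show False using quad[of "- (a + 1) / (2 * b)"] True by (simp add: field_simps)
    qed
    then show ?thesis using True by (simp add: a_b_c_def)
  next
    case False
    have "0 \<le> (a + 2 * (- b / c) * b + (- b / c) * (- b / c) * c) * c"
      using quad[of "- b / c"] c0 by (intro mult_nonneg_nonneg) auto
    also have "\<dots> = a * c - b * b" using False by (simp add: field_simps)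
    finally show ?thesis by (simp add: a_b_c_def power2_eq_square)
  qed
qed

lemma state_eq_0_of_square:
  assumes "state f" "f (x * star x) = 0" shows "f x = 0"
proof -
  have "(f (star (star x) * 1))\<^sup>2 \<le> f (star 1 * 1) * f (star (star x) * star x)"
    by (rule state_cauchy_schwarz[OF assms(1)])
  then show ?thesis using assms(2) by simp
qed

text \<open>\<open>p x\<close> is the infimum of the numbers \<open>t\<close> with
  \<open>re x \<le> h + t\<close> for some \<open>h\<close> in \<open>H\<close>. The linear
  functionals below \<open>p\<close> are exactly the states vanishing on \<open>H\<close>. These
  form a face of the state space because \<open>H\<close> consists of positive elements, so an
  extreme point among them is a pure state.\<close>

lemma pure_state_exists:
  fixes x0 :: "'a::cstar_alg"
  assumes H: "0 \<in> H" "\<And>h. h \<in> H \<Longrightarrow> pos h" "\<And>h k. h \<in> H \<Longrightarrow> k \<in> H \<Longrightarrow> h + k \<in> H"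
      "\<And>h r. h \<in> H \<Longrightarrow> r > 0 \<Longrightarrow> r *\<^sub>R h \<in> H"
    and x0: "star x0 = x0" and d: "d > 0" and not: "\<And>h. h \<in> H \<Longrightarrow> \<not> pos (h + of_real d - x0)"
  obtains f where "pure_state f" "\<And>h. h \<in> H \<Longrightarrow> f h = 0" "0 < f x0"
proof -
  define re where "re x = (1/2) *\<^sub>R (x + star x)" for x :: 'a
  have re_sa: "star (re x) = re x" for x by (simp add: re_def star_simps add.commute)
  have re_add: "re (x + y) = re x + re y" for x y by (simp add: re_def star_simps algebra_simps)
  have re_scale: "re (r *\<^sub>R x) = r *\<^sub>R re x" for r x by (simp add: re_def star_simps algebra_simps)
  have re_id: "re x = x" if "star x = x" for x using that by (simp add: re_def flip: scaleR_2)
  have re_norm: "norm (re x) \<le> norm x" for x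
    using norm_triangle_ineq[of x "star x"] by (simp add: re_def)
  define T where "T x = {t. \<exists>h\<in>H. pos (h + of_real t - re x)}" for x
  define p where "p x = Inf (T x)" for x
  \<comment> \<open>This keeps \<open>p\<close> bounded below: a negative \<open>t\<close> with
    \<open>h + t\<close> positive could be scaled up until a multiple of \<open>h\<close> exceeds
    \<open>x0\<close>, contrary to the hypothesis on \<open>H\<close>.\<close>
  have pos_T: "t \<ge> 0" if h: "h \<in> H" "pos (h + of_real t)" for h t
  proof (rule ccontr)
    assume "\<not> t \<ge> 0"
    then have t: "t < 0" by simp
    define r where "r = (norm x0 + 1) / (- t)"
    have r: "r > 0" using t by (simp add: r_def divide_pos_neg add_nonneg_pos zero_less_divide_iff)
    have "pos (r *\<^sub>R (h + of_real t))" using h(2) r by (intro pos_scaleR) auto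
    moreover have "r *\<^sub>R (h + of_real t) = r *\<^sub>R h - of_real (norm x0 + 1)"
      using t by (simp add: r_def of_real_def algebra_simps add_divide_distrib)
    moreover have "pos (of_real (norm x0) - x0)" using x0 by (intro pos_of_norm_le) auto
    moreover have "pos (of_real (1 + d) :: 'a)" using d by (intro pos_of_real) auto
    ultimately have "pos ((r *\<^sub>R h - of_real (norm x0 + 1)) + (of_real (norm x0) - x0) + of_real (1 + d))"
      by (intro pos_add) auto
    then have "pos (r *\<^sub>R h + of_real d - x0)" by (simp add: algebra_simps)
    then show False using not H(4)[OF h(1) r] by blast
  qed
  have T_lower: "- norm x \<le> t" if t: "t \<in> T x" for t x
  proof -
    obtain h where h: "h \<in> H" "pos (h + of_real t - re x)" using t by (auto simp: T_def)
    have "pos (of_real (norm x) - - re x)" using re_sa re_norm by (intro pos_of_norm_le) (auto simp: star_minus)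
    then have "pos ((h + of_real t - re x) + (of_real (norm x) - - re x))" by (intro pos_add h)
    then have "pos (h + of_real (t + norm x))" by (simp add: algebra_simps)
    then show ?thesis using pos_T h(1) by fastforce
  qed
  have bdd: "bdd_below (T x)" for x using T_lower by (meson bdd_below.I)
  have T_ne: "norm x \<in> T x" for x
    using H(1) re_sa re_norm unfolding T_def by (auto intro!: bexI[of _ 0] pos_of_norm_le)
  have p_le: "p x \<le> t" if "h \<in> H" "pos (h + of_real t - re x)" for x t h
    unfolding p_def using that by (intro cInf_lower bdd) (auto simp: T_def)
  have p_greatest: "c \<le> p x" if "\<And>t h. h \<in> H \<Longrightarrow> pos (h + of_real t - re x) \<Longrightarrow> c \<le> t" for c x
    unfolding p_def using T_ne[of x] that by (intro cInf_greatest) (auto simp: T_def)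
  have "sublinear p"
    unfolding sublinear_def
  proof (intro conjI allI impI)
    fix x y
    have "p (x + y) - t \<le> s" if "h \<in> H" "pos (h + of_real t - re x)" "k \<in> H" "pos (k + of_real s - re y)" for s t h k
    proof -
      have "pos ((h + of_real t - re x) + (k + of_real s - re y))" using that by (intro pos_add)
      then have "pos (h + k + of_real (t + s) - re (x + y))" by (simp add: re_add algebra_simps)
      then show ?thesis using p_le[OF H(3)[OF that(1,3)]] by fastforce
    qed
    then have "p (x + y) - t \<le> p y" if "h \<in> H" "pos (h + of_real t - re x)" for t h
      using that by (intro p_greatest) blast
    then have "p (x + y) - p y \<le> t" if "h \<in> H" "pos (h + of_real t - re x)" for t h
      using that by (metis diff_le_eq add.commute)
    then have "p (x + y) - p y \<le> p x" by (intro p_greatest) blast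
    then show "p (x + y) \<le> p x + p y" by simp
  next
    fix r :: real and x assume r: "r > 0"
    have "p (r *\<^sub>R x) / r \<le> p x"
    proof (rule p_greatest)
      fix t h assume a: "h \<in> H" "pos (h + of_real t - re x)"
      then have "pos (r *\<^sub>R (h + of_real t - re x))" using r by (intro pos_scaleR) auto
      then have "pos (r *\<^sub>R h + of_real (r * t) - re (r *\<^sub>R x))" by (simp add: re_scale algebra_simps of_real_def)
      then have "p (r *\<^sub>R x) \<le> r * t" using p_le H(4)[OF a(1) r] by blast
      then show "p (r *\<^sub>R x) / r \<le> t" using r by (simp add: field_simps)
    qed
    then show "p (r *\<^sub>R x) \<le> r * p x" using r by (simp add: field_simps)
  qed
  then obtain f where f: "linear f" "f \<le> p" "f x0 = p x0" and
    extr: "\<And>g h t. linear g \<Longrightarrow> linear h \<Longrightarrow> g \<le> p \<Longrightarrow> h \<le> p \<Longrightarrow> 0 < t \<Longrightarrow> t < 1 \<Longrightarrow>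
      (\<And>x. f x = t * g x + (1 - t) * h x) \<Longrightarrow> g \<le> f"
    using extreme_hahn_banach[of p x0] by metis
  have fp: "f x \<le> p x" for x using f(2) by (simp add: le_fun_def)
  have "d \<le> p x0"
  proof (rule p_greatest, rule ccontr)
    fix t h assume a: "h \<in> H" "pos (h + of_real t - re x0)" "\<not> d \<le> t"
    then have "pos ((h + of_real t - x0) + of_real (d - t))"
      using re_id[OF x0] by (intro pos_add pos_of_real) auto
    then have "pos (h + of_real d - x0)" by (simp add: algebra_simps)
    then show False using not a(1) by blast
  qed
  then have fx0: "0 < f x0" using f(3) d by simp
  have le0: "f x \<le> 0" if "h \<in> H" "pos (h - re x)" for x h
    using order_trans[OF fp p_le[of h 0 x]] that by simp
  have fpos: "0 \<le> f x" if "pos x" for x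
  proof -
    have "f (- x) \<le> 0" using H(1) re_id[of "-x"] that pos_sa[OF that] by (intro le0[of 0]) (auto simp: star_minus)
    then show ?thesis using f(1) by (simp add: linear_neg)
  qed
  have fstar: "f (star x) = f x" for x
  proof -
    have "re (x - star x) = 0" "re (star x - x) = 0" by (simp_all add: re_def star_diff)
    then have "f (x - star x) \<le> 0" "f (star x - x) \<le> 0" using H(1) by (auto intro: le0[of 0])
    then show ?thesis using f(1) by (simp add: linear_diff)
  qed
  have f1: "f 1 = 1"
  proof -
    have "f 1 \<le> 1" using order_trans[OF fp p_le[of 0 1 1]] H(1) re_id[of 1] by simp
    moreover have "f (- 1) \<le> - 1" using order_trans[OF fp p_le[of 0 "-1" "-1"]] H(1) re_id[of "-1"] by (simp add: star_minus)
    ultimately show ?thesis using f(1) by (simp add: linear_neg)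
  qed
  have st: "state f" using f(1) fpos fstar f1 by (simp add: state_def)
  have fH: "f h = 0" if "h \<in> H" for h
    using le0[OF that, of h] fpos[OF H(2)[OF that]] re_id[of h] pos_sa[OF H(2)[OF that]] by simp
  have below: "g \<le> p" if g: "state g" "\<And>h. h \<in> H \<Longrightarrow> g h = 0" for g
    unfolding le_fun_def
  proof (intro allI p_greatest)
    fix x t h assume a: "h \<in> H" "pos (h + of_real t - re x)"
    have "g (re x) \<le> g (h + of_real t)" using a(2) by (rule state_mono[OF g(1)])
    also have "\<dots> = t" using a(1) by (simp add: state_add[OF g(1)] state_of_real[OF g(1)] g(2))
    finally show "g x \<le> t" by (simp add: re_def state_scaleR[OF g(1)] state_add[OF g(1)] state_star[OF g(1)])
  qed
  have eq: "g = h" if "linear g" "linear h" "g \<le> h" for g h :: "'a \<Rightarrow> real"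
  proof (rule ext)
    fix x
    have "g x \<le> h x" "g (- x) \<le> h (- x)" using that(3) by (auto simp: le_fun_def)
    then show "g x = h x" using that by (simp add: linear_neg)
  qed
  have "pure_state f"
    unfolding pure_state_def
  proof (intro conjI allI impI st)
    fix g h t assume a: "state g \<and> state h \<and> 0 < t \<and> t < 1 \<and> (\<forall>x. f x = t * g x + (1 - t) * h x)"
    \<comment> \<open>The face property: two nonnegative numbers with a vanishing proper convex
      combination are zero.\<close>
    have gh: "g k = 0 \<and> h k = 0" if "k \<in> H" for k
    proof -
      have "t * g k + (1 - t) * h k = 0" using a fH[OF that] by auto
      moreover have "0 \<le> g k" "0 \<le> h k" using a H(2)[OF that] state_pos by blast+
      ultimately show ?thesis using a
        by (smt (verit) mult_nonneg_nonneg mult_pos_pos)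
    qed
    have "g \<le> f" using a gh by (intro extr[of g h t] below state_linear) auto
    then show "g = f" using a st
      by (intro eq state_linear) auto
  qed
  then show ?thesis using that fH fx0 by blast
qed

section \<open>Quasi-central approximate units\<close>

lemma dominated_add:
  assumes K: "ideal_in A K" and "dominated K x" "dominated K y"
  shows "dominated K (x + y)"
  unfolding dominated_def
proof (intro allI impI)
  fix d :: real assume "d > 0"
  then have d2: "d / 2 > 0" by simp
  obtain h where h: "h \<in> K" "pos h" "pos (h + of_real (d/2) - x)" using assms(2) d2 unfolding dominated_def by blast
  obtain k where k: "k \<in> K" "pos k" "pos (k + of_real (d/2) - y)" using assms(3) d2 unfolding dominated_def by blast
  have "pos ((h + of_real (d/2) - x) + (k + of_real (d/2) - y))" by (rule pos_add[OF h(3) k(3)])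
  moreover have "(h + of_real (d/2) - x) + (k + of_real (d/2) - y) = h + k + of_real (d/2 + d/2) - (x + y)"
    by (simp only: of_real_add) (simp add: algebra_simps)
  ultimately have "pos (h + k + of_real d - (x + y))" by simp
  then show "\<exists>h\<in>K. pos h \<and> pos (h + of_real d - (x + y))"
    using ideal_add[OF K h(1) k(1)] pos_add[OF h(2) k(2)] by blast
qed

lemma dominated_scaleR:
  assumes A: "unital_subalg A" and K: "ideal_in A K" and "dominated K x" "r \<ge> 0"
  shows "dominated K (r *\<^sub>R x)"
proof (cases "r = 0")
  case True
  then show ?thesis using dominated_self[OF ideal_zero[OF K]] by simp
next
  case False
  then have r: "r > 0" using assms by simp
  show ?thesis
    unfolding dominated_def
  proof (intro allI impI)
    fix d :: real assume "d > 0"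
    then have "d / r > 0" using r by simp
    then obtain h where h: "h \<in> K" "pos h" "pos (h + of_real (d/r) - x)" using assms(3) unfolding dominated_def by blast
    have "pos (r *\<^sub>R (h + of_real (d/r) - x))" using h(3) r by (intro pos_scaleR) auto
    then have "pos (r *\<^sub>R h + of_real d - r *\<^sub>R x)" using r by (simp add: of_real_def algebra_simps)
    then show "\<exists>h\<in>K. pos h \<and> pos (h + of_real d - r *\<^sub>R x)"
      using ideal_scaleR[OF A K h(1), of r] pos_scaleR[OF h(2), of r] r by (intro bexI[of _ "r *\<^sub>R h"]) auto
  qed
qed

text \<open>Says in effect that left multiplication by \<open>S\<close> preserves the right ideal of
  all \<open>v\<close> with \<open>dominated K (v * star v)\<close>; \<open>dominated_conj\<close>
  draws this conclusion.\<close>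

definition multiplier :: "'a::cstar_alg set \<Rightarrow> 'a \<Rightarrow> bool" where
  "multiplier K S \<longleftrightarrow> (\<forall>h\<in>K. pos h \<longrightarrow> dominated K (S * h * star S))"

lemma multiplier_mem:
  assumes A: "unital_subalg A" and K: "ideal_in A K" and "S \<in> A"
  shows "multiplier K S"
  unfolding multiplier_def
proof (intro ballI impI)
  fix h assume h: "h \<in> K" "pos h"
  have "S * h \<in> K" by (rule ideal_mult_left[OF K assms(3) h(1)])
  then have "S * h * star S \<in> K" by (rule ideal_mult_right[OF K subalg_star[OF A assms(3)]])
  then show "dominated K (S * h * star S)" using pos_conj'[OF h(2)] by (rule dominated_self)
qed

lemma star_mult_le: "pos (of_real ((norm b)\<^sup>2) - b * star b)" for b :: "'a::cstar_alg"
  by (intro pos_of_norm_le) (simp_all add: star_simps norm_mult_star)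

lemma dominated_conj:
  assumes A: "unital_subalg A" and K: "ideal_in A K" and S: "multiplier K S" and x: "dominated K x"
  shows "dominated K (S * x * star S)"
  unfolding dominated_def
proof (intro allI impI)
  fix d :: real assume d: "d > 0"
  \<comment> \<open>Conjugating the constant \<open>d/2/n\<close> by \<open>S\<close> then costs at
    most \<open>d/2\<close>; the summand \<open>1\<close> keeps \<open>n\<close> positive.\<close>
  define n where "n = (norm S)\<^sup>2 + 1"
  have n: "n > 0" by (simp add: n_def add_nonneg_pos)
  have "d / 2 / n > 0" using d n by simp
  then obtain h where h: "h \<in> K" "pos h" "pos (h + of_real (d/2/n) - x)" using x unfolding dominated_def by blast
  have "d / 2 > 0" using d by simp
  then obtain k where k: "k \<in> K" "pos k" "pos (k + of_real (d/2) - S * h * star S)"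
    using S h(1,2) unfolding multiplier_def dominated_def by blast
  have p1: "pos (S * (h + of_real (d/2/n) - x) * star S)" using h(3) by (rule pos_conj')
  have "pos (of_real n - S * star S)"
  proof -
    have "pos (of_real ((norm S)\<^sup>2) - S * star S + 1)" by (intro pos_add star_mult_le) simp
    then show ?thesis by (simp add: n_def algebra_simps)
  qed
  then have p2: "pos ((d/2/n) *\<^sub>R (of_real n - S * star S))" using d n by (intro pos_scaleR) auto
  have "pos ((k + of_real (d/2) - S * h * star S) + S * (h + of_real (d/2/n) - x) * star S
      + (d/2/n) *\<^sub>R (of_real n - S * star S))" by (intro pos_add k p1 p2)
  moreover have "(k + of_real (d/2) - S * h * star S) + S * (h + of_real (d/2/n) - x) * star S
      + (d/2/n) *\<^sub>R (of_real n - S * star S) = k + of_real (d/2) + of_real (d/2) - S * x * star S"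
    using n by (simp add: of_real_def algebra_simps)
  moreover have "of_real (d/2) + of_real (d/2) = (of_real d :: 'a)" by (simp flip: of_real_add)
  ultimately have "pos (k + of_real d - S * x * star S)" by (simp only: add.assoc)
  then show "\<exists>h\<in>K. pos h \<and> pos (h + of_real d - S * x * star S)" using k by blast
qed

lemma dominated_mult_right:
  assumes A: "unital_subalg A" and K: "ideal_in A K" and x: "dominated K (x * star x)"
  shows "dominated K ((x * b) * star (x * b))"
proof (rule dominated_mono)
  show "dominated K ((norm b)\<^sup>2 *\<^sub>R (x * star x))" by (intro dominated_scaleR[OF A K] x) simp
  have "pos (x * (of_real ((norm b)\<^sup>2) - b * star b) * star x)" by (intro pos_conj' star_mult_le)
  then show "pos ((norm b)\<^sup>2 *\<^sub>R (x * star x) - (x * b) * star (x * b))"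
    by (simp add: star_mult algebra_simps of_real_def)
qed

text \<open>Parallelogram identity: twice both squares minus the square of the difference is
  \<open>(x + y) * star (x + y)\<close>.\<close>

lemma dominated_diff_square:
  assumes A: "unital_subalg A" and K: "ideal_in A K"
    and x: "dominated K (x * star x)" and y: "dominated K (y * star y)"
  shows "dominated K ((x - y) * star (x - y))"
proof (rule dominated_mono)
  show "dominated K (2 *\<^sub>R (x * star x) + 2 *\<^sub>R (y * star y))"
    by (intro dominated_add[OF K] dominated_scaleR[OF A K] x y) auto
  show "pos (2 *\<^sub>R (x * star x) + 2 *\<^sub>R (y * star y) - (x - y) * star (x - y))"
    using pos_mult_star[of "x + y"] by (simp add: star_simps algebra_simps scaleR_2)
qed

text \<open>The average of elements \<open>u\<^sub>1, \<dots>, u\<^sub>n\<close> of an approximate unit whose commutators with \<open>S\<close> are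
  almost orthogonal to each other: the norm of the sum of the commutators is of order \<open>sqrt n\<close>.\<close>

lemma quasi_central:
  fixes A :: "'a::cstar_alg set"
  assumes A: "unital_subalg A" and K: "ideal_in A K"
    and F: "finite F" "\<And>S. S \<in> F \<Longrightarrow> multiplier K S" "\<And>S. S \<in> F \<Longrightarrow> multiplier K (star S)"
    and V: "finite V" "\<And>v. v \<in> V \<Longrightarrow> dominated K (v * star v)" and d: "d > 0"
  obtains e where "e \<in> K" "pos e" "pos (1 - e)" "\<And>v. v \<in> V \<Longrightarrow> norm ((1 - e) * v) \<le> d"
    "\<And>S. S \<in> F \<Longrightarrow> norm (S * e - e * S) \<le> d"
proof -
  define M where "M = (\<Sum>S\<in>F. norm S) + 1"
  have M: "M > 0" by (simp add: M_def add_nonneg_pos sum_nonneg)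
  have SM: "norm S \<le> M" if "S \<in> F" for S
    using member_le_sum[OF that, of norm] F(1) by (simp add: M_def)
  \<comment> \<open>Off-diagonal products of commutators are kept below half of
    \<open>d\<^sup>2\<close>; averaging brings the diagonal below the other half.\<close>
  define \<eta> where "\<eta> = d\<^sup>2 / 2"
  have \<eta>: "\<eta> > 0" using d by (simp add: \<eta>_def)
  define c where "c u S k = S * u k - u k * S" for u :: "nat \<Rightarrow> 'a" and S k
  define ok where "ok u k \<longleftrightarrow> u k \<in> K \<and> pos (u k) \<and> pos (1 - u k) \<and> (\<forall>v\<in>V. norm ((1 - u k) * v) \<le> d) \<and>
      (\<forall>S\<in>F. \<forall>j<k. norm (star (c u S k) * c u S j) \<le> \<eta>)" for u k
  have "\<exists>u. \<forall>k<n. ok u k" for n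
  proof (induction n)
    case 0
    then show ?case by simp
  next
    case (Suc n)
    then obtain u where u: "\<And>k. k < n \<Longrightarrow> ok u k" by blast
    \<comment> \<open>The next element has to act as a unit on all earlier commutators and on their
      multiples by \<open>star S\<close>. For these to be dominated by \<open>K\<close>, both
      \<open>S\<close> and \<open>star S\<close> must be multipliers.\<close>
    define W where "W = V \<union> (\<lambda>(S, j). c u S j) ` (F \<times> {..<n}) \<union> (\<lambda>(S, j). star S * c u S j) ` (F \<times> {..<n})"
    have fW: "finite W" using V(1) F(1) by (simp add: W_def)
    have cd: "dominated K (c u S j * star (c u S j))" if S: "S \<in> F" and j: "j < n" for S j
    proof -
      have uj: "u j \<in> K" "pos (u j)" "star (u j) = u j" using u[OF j] pos_sa by (auto simp: ok_def)
      then have uu: "u j * u j \<in> K" "pos (u j * u j)"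
        using ideal_mult_left[OF K ideal_subset[OF K]] pos_square by auto
      have "dominated K (S * (u j * u j) * star S)"
        using F(2)[OF S] uu by (simp add: multiplier_def)
      then have "dominated K ((S * u j) * star (S * u j))"
        using uj(3) by (simp add: star_mult mult.assoc)
      moreover have "dominated K ((u j * S) * star (u j * S))"
        using dominated_self[OF uu] uj(3) by (intro dominated_mult_right[OF A K]) simp
      ultimately show ?thesis unfolding c_def by (rule dominated_diff_square[OF A K])
    qed
    have Wd: "dominated K (w * star w)" if "w \<in> W" for w
    proof -
      have "dominated K ((star S * c u S j) * star (star S * c u S j))" if "S \<in> F" "j < n" for S j
        using dominated_conj[OF A K F(3)[OF that(1)] cd[OF that]] by (simp add: star_mult mult.assoc)
      then show ?thesis using that V(2) cd by (auto simp: W_def)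
    qed
    define \<delta> where "\<delta> = min d (\<eta> / (1 + M))"
    have \<delta>: "\<delta> > 0" using d \<eta> M by (simp add: \<delta>_def)
    obtain e where e: "e \<in> K" "pos e" "pos (1 - e)" "\<And>w. w \<in> W \<Longrightarrow> norm ((1 - e) * w) \<le> \<delta>"
      using dominated_approx_unit[OF A K fW Wd \<delta>] by blast
    define u' where "u' = u(n := e)"
    have u'n: "u' n = e" and u'k: "\<And>k. k < n \<Longrightarrow> u' k = u k" by (auto simp: u'_def)
    have c'k: "c u' S k = c u S k" if "k < n" for S k using u'k[OF that] by (simp add: c_def)
    have old: "ok u' k" if k: "k < n" for k
    proof -
      have "c u' S k = c u S k" "j < k \<Longrightarrow> c u' S j = c u S j" for S j
        using k by (auto intro: c'k)
      then show ?thesis using u[OF k] u'k[OF k] by (simp add: ok_def)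
    qed
    have off: "norm (star (c u' S n) * c u' S j) \<le> \<eta>" if S: "S \<in> F" and j: "j < n" for S j
    proof -
      \<comment> \<open>Since \<open>e\<close> itself cancels, only products of \<open>1 - e\<close>
        with elements of \<open>W\<close> remain.\<close>
      have "star (c u' S n) * c u S j = star S * ((1 - e) * c u S j) - (1 - e) * (star S * c u S j)"
        using pos_sa[OF e(2)] by (simp add: c_def u'n star_simps algebra_simps)
      also have "norm \<dots> \<le> norm (star S) * norm ((1 - e) * c u S j) + norm ((1 - e) * (star S * c u S j))"
        by (meson add_mono norm_mult_ineq norm_triangle_ineq4 order_refl order_trans)
      also have "\<dots> \<le> M * \<delta> + \<delta>"
        using S j SM[OF S] M by (intro add_mono mult_mono e(4)) (auto simp: W_def)
      also have "\<dots> = (1 + M) * \<delta>" by (simp add: algebra_simps)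
      also have "\<dots> \<le> (1 + M) * (\<eta> / (1 + M))" using M by (intro mult_left_mono) (auto simp: \<delta>_def)
      also have "\<dots> = \<eta>" using M by simp
      finally show ?thesis using c'k[OF j] by simp
    qed
    have unit: "norm ((1 - e) * v) \<le> d" if "v \<in> V" for v
      using e(4)[of v] that by (simp add: W_def \<delta>_def)
    have "ok u' n" unfolding ok_def u'n using e(1-3) off unit by blast
    then have "ok u' k" if "k < Suc n" for k
      using that old by (cases "k = n") auto
    then show ?case by blast
  qed
  note seq = this
  \<comment> \<open>Makes the diagonal contribution \<open>4 * M\<^sup>2 / n\<close> smaller than
    \<open>d\<^sup>2 / 2\<close>.\<close>
  obtain n :: nat where n: "8 * M\<^sup>2 / d\<^sup>2 < n" using reals_Archimedean2 by blast
  have "0 \<le> 8 * M\<^sup>2 / d\<^sup>2" by simp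
  then have "0 < real n" using n by linarith
  then have n0: "n > 0" by simp
  obtain u where u: "\<And>k. k < n \<Longrightarrow> ok u k" using seq[of n] by blast
  define e where "e = (1 / n) *\<^sub>R (\<Sum>k<n. u k)"
  have e1: "1 - e = (1 / n) *\<^sub>R (\<Sum>k<n. 1 - u k)"
  proof -
    have "(of_nat n :: 'a) = real n *\<^sub>R 1" by (simp add: scaleR_conv_of_real)
    then have "(1 / n) *\<^sub>R (of_nat n :: 'a) = 1" using n0 by simp
    then show ?thesis by (simp add: e_def sum_subtractf scaleR_diff_right)
  qed
  have "e \<in> K"
  proof -
    have "(\<Sum>k<m. u k) \<in> K" if "m \<le> n" for m
      using that u by (induction m) (auto simp: ok_def ideal_zero[OF K] intro: ideal_add[OF K])
    then show ?thesis unfolding e_def by (intro ideal_scaleR[OF A K]) simp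
  qed
  moreover have "pos e" "pos (1 - e)" unfolding e1 using u by (auto simp: e_def ok_def intro!: pos_scaleR pos_sum)
  moreover have "norm ((1 - e) * v) \<le> d" if "v \<in> V" for v
  proof -
    have "norm (\<Sum>k<n. (1 - u k) * v) \<le> (\<Sum>k<n. d)"
      using u that by (intro sum_norm_le) (auto simp: ok_def)
    then show ?thesis using n0 by (simp add: e1 sum_distrib_right field_simps)
  qed
  moreover have "norm (S * e - e * S) \<le> d" if S: "S \<in> F" for S
  proof -
    define X where "X = (\<Sum>k<n. c u S k)"
    have Se: "S * e - e * S = (1 / n) *\<^sub>R X"
      by (simp add: e_def X_def c_def sum_subtractf sum_distrib_left sum_distrib_right scaleR_diff_right)
    have off: "norm (star (c u S k) * c u S j) \<le> (if j = k then 4 * M\<^sup>2 else 0) + \<eta>" if k: "k < n" and j: "j < n" for j k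
    proof -
      consider "j < k" | "k < j" | "j = k" by linarith
      then show ?thesis
      proof cases
        case 1
        then show ?thesis using u[OF k] S by (auto simp: ok_def)
      next
        case 2
        have "norm (star (c u S k) * c u S j) = norm (star (star (c u S k) * c u S j))" by simp
        also have "star (star (c u S k) * c u S j) = star (c u S j) * c u S k" by (simp add: star_mult)
        finally show ?thesis using 2 u[OF j] S by (auto simp: ok_def)
      next
        case 3
        have u1: "norm (u k) \<le> 1" using u[OF k] norm_le_one_of_pos by (auto simp: ok_def)
        have "norm (c u S k) \<le> norm S * norm (u k) + norm (u k) * norm S"
          unfolding c_def by (meson add_mono norm_mult_ineq norm_triangle_ineq4 order_trans)
        also have "\<dots> \<le> M * 1 + 1 * M" using SM[OF S] u1 M by (intro add_mono mult_mono) auto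
        finally have "(norm (c u S k))\<^sup>2 \<le> (2 * M)\<^sup>2" by (intro power_mono) auto
        then show ?thesis using 3 \<eta> by (simp add: norm_star_mult power_mult_distrib)
      qed
    qed
    have "(norm X)\<^sup>2 = norm (\<Sum>k<n. \<Sum>j<n. star (c u S k) * c u S j)"
    proof -
      have "star (sum g R) = (\<Sum>k\<in>R. star (g k))" for g :: "nat \<Rightarrow> 'a" and R
        by (induction R rule: infinite_finite_induct) (auto simp: star_add)
      then have "star X * X = (\<Sum>k<n. \<Sum>j<n. star (c u S k) * c u S j)" by (simp add: X_def sum_product)
      then show ?thesis by (metis norm_star_mult)
    qed
    also have "\<dots> \<le> (\<Sum>k<n. \<Sum>j<n. (if j = k then 4 * M\<^sup>2 else 0) + \<eta>)"
      using off by (intro sum_norm_le) auto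
    also have "\<dots> = n * (4 * M\<^sup>2) + n * n * \<eta>"
      by (simp add: sum.distrib distrib_left)
    finally have X: "(norm X)\<^sup>2 \<le> n * (4 * M\<^sup>2) + n * n * \<eta>" .
    have "8 * M\<^sup>2 < n * d\<^sup>2" using n d by (simp add: field_simps)
    then have "n * (8 * M\<^sup>2) \<le> n * (n * d\<^sup>2)" by (intro mult_left_mono) auto
    then have "(norm X)\<^sup>2 \<le> (n * d)\<^sup>2" using X by (simp add: \<eta>_def power2_eq_square algebra_simps)
    then have "norm X \<le> n * d" using d by (intro power2_le_imp_le[of "norm X"]) auto
    then show ?thesis using n0 by (simp add: Se field_simps)
  qed
  ultimately show ?thesis using that by blast
qed

section \<open>Gluing local approximations\<close>

text \<open>The correction \<open>k * b * star k\<close> has a single witness \<open>k\<close> in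
  \<open>K\<close>, so a union of a chain of ideals is approximable only if some member is;
  conjugation by \<open>s\<close> merely changes \<open>k\<close> into \<open>s * k\<close>.
  Self-adjointness of \<open>a\<close> and \<open>b\<close> makes the remainder self-adjoint for
  self-adjoint \<open>T\<close>, as the order estimate in \<open>approximable_glue\<close>
  requires.\<close>

definition approximable :: "'a::cstar_alg set \<Rightarrow> 'a \<Rightarrow> real \<Rightarrow> 'a set \<Rightarrow> bool" where
  "approximable A T d K \<longleftrightarrow> (\<exists>a\<in>A. \<exists>k\<in>K. \<exists>b. star a = a \<and> star b = b \<and> norm (T - a - k * b * star k) < d)"

text \<open>The weights \<open>c = (1 - x\<^sup>2) / (1 + x\<^sup>2)\<close> and \<open>s = 2 x / (1 + x\<^sup>2)\<close> satisfy \<open>c\<^sup>2 + s\<^sup>2 = 1\<close>,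
  and being rational in \<open>x\<close> they almost commute with \<open>T\<close> if \<open>x\<close> does.\<close>

lemma rational_partition:
  fixes x :: "'a::cstar_alg"
  assumes x: "pos x" "pos (1 - x)" and T: "norm (T * x - x * T) \<le> d"
  obtains c s q where "star c = c" "star s = s" "c * c + s * s = 1" "in_cstar x c" "s = x * q" "in_cstar x q"
    "norm c \<le> 1" "norm s \<le> 1" "norm (T * c - c * T) \<le> 4 * d" "norm (T * s - s * T) \<le> 6 * d"
    "\<And>v. norm (c * v) \<le> 2 * norm ((1 - x) * v)"
proof -
  have sx: "star x = x" using pos_sa[OF x(1)] .
  have nx: "norm x \<le> 1" using norm_le_one_of_pos[OF x] .
  obtain y where y: "pos y" "y * (x * x + of_real 1) = 1" "(x * x + of_real 1) * y = 1" "norm y \<le> 1 / 1" "in_cstar (x * x) y"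
    using pos_resolvent[OF pos_square[OF sx], of 1] by (metis zero_less_one)
  have xy: "in_cstar x y" using y(5) in_cstar_trans in_cstar_mult in_cstar_self by blast
  have cxy: "x * y = y * x" using in_cstar_commute in_cstar_self xy by blast
  have sy: "star y = y" using pos_sa[OF y(1)] .
  have ny: "norm y \<le> 1" using y(4) by simp
  have y1: "y * (1 + x * x) = 1" and y2: "(1 + x * x) * y = 1" using y(2,3) by (simp_all add: add.commute)
  define c where "c = (1 - x * x) * y"
  define s where "s = x * (2 *\<^sub>R y)"
  have cc: "c = y * (1 - x * x)" using cxy by (simp add: c_def algebra_simps) (metis mult.assoc)
  have ss: "s = 2 *\<^sub>R (y * x)" by (simp add: s_def cxy)
  have "star c = c" by (simp add: c_def star_simps sx sy) (simp add: cc[unfolded c_def])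
  moreover have "star s = s" by (simp add: s_def star_simps sx sy cxy)
  moreover have cs1: "c * c + s * s = 1"
  proof -
    have "c * c + s * s = y * ((1 - x * x) * (1 - x * x)) * y + 4 *\<^sub>R (y * (x * x) * y)"
      unfolding cc[symmetric] by (subst (1) cc) (subst (1) ss, simp add: c_def s_def mult.assoc)
    also have "\<dots> = y * ((1 - x * x) * (1 - x * x) + 4 *\<^sub>R (x * x)) * y" by (simp add: distrib_left distrib_right)
    also have "4 *\<^sub>R (x * x) = (x * x + x * x) + (x * x + x * x)" by (simp flip: scaleR_2)
    also have "(1 - x * x) * (1 - x * x) + ((x * x + x * x) + (x * x + x * x)) = (1 + x * x) * (1 + x * x)"
      by (simp add: algebra_simps)
    also have "y * ((1 + x * x) * (1 + x * x)) * y = (y * (1 + x * x)) * ((1 + x * x) * y)" by (simp only: mult.assoc)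
    also have "\<dots> = 1" using y1 y2 by simp
    finally show ?thesis .
  qed
  moreover have "in_cstar x c" "in_cstar x (2 *\<^sub>R y)" unfolding c_def
    by (intro in_cstar_mult in_cstar_diff in_cstar_const in_cstar_self in_cstar_scaleR xy)+
  moreover have "norm c \<le> 1"
  proof -
    have "pos (of_real 1 - c * c)" using cs1 pos_square[OF \<open>star s = s\<close>] by (metis add_diff_cancel_left' of_real_1)
    then have "(norm c)\<^sup>2 \<le> 1"
      using norm_le_of_pos[OF pos_square[OF \<open>star c = c\<close>], of 1] norm_square_sa[OF \<open>star c = c\<close>] by simp
    then show ?thesis using power2_le_imp_le[of "norm c" 1] by simp
  qed
  moreover have "norm s \<le> 1"
  proof -
    have "pos (of_real 1 - s * s)" using cs1 pos_square[OF \<open>star c = c\<close>] by (metis add_diff_cancel_right' of_real_1)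
    then have "(norm s)\<^sup>2 \<le> 1"
      using norm_le_of_pos[OF pos_square[OF \<open>star s = s\<close>], of 1] norm_square_sa[OF \<open>star s = s\<close>] by simp
    then show ?thesis using power2_le_imp_le[of "norm s" 1] by simp
  qed
  moreover
  have d0: "0 \<le> d" using T norm_ge_zero order_trans by blast
  have Txx: "norm (T * (x * x) - (x * x) * T) \<le> 2 * d"
  proof -
    have "T * (x * x) - (x * x) * T = (T * x - x * T) * x + x * (T * x - x * T)" by (simp add: algebra_simps)
    also have "norm \<dots> \<le> norm (T * x - x * T) * norm x + norm x * norm (T * x - x * T)"
      by (meson add_mono norm_mult_ineq norm_triangle_ineq order_trans)
    also have "\<dots> \<le> d * 1 + 1 * d" using T nx d0 by (intro add_mono mult_mono) auto
    finally show ?thesis by simp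
  qed
  have Ty: "norm (T * y - y * T) \<le> 2 * d"
  proof -
    \<comment> \<open>The commutator with an inverse is the commutator with \<open>x * x\<close>
      between two factors \<open>y\<close>, up to sign.\<close>
    have "T * y - y * T = (y * (1 + x * x)) * T * y - y * T * ((1 + x * x) * y)" using y1 y2 by simp
    also have "\<dots> = - (y * ((T * (x * x) - (x * x) * T) * y))" by (simp add: algebra_simps)
    also have "norm \<dots> \<le> norm y * (norm (T * (x * x) - (x * x) * T) * norm y)"
      unfolding norm_minus_cancel by (meson norm_mult_ineq mult_left_mono norm_ge_zero order_trans)
    also have "\<dots> \<le> 1 * (2 * d * 1)" using ny Txx d0 by (intro mult_mono) auto
    finally show ?thesis by simp
  qed
  have "norm (T * c - c * T) \<le> 4 * d"
  proof -
    have "T * c - c * T = (1 - x * x) * (T * y - y * T) - (T * (x * x) - (x * x) * T) * y"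
      by (simp add: c_def algebra_simps)
    also have "norm \<dots> \<le> norm (1 - x * x) * norm (T * y - y * T) + norm (T * (x * x) - (x * x) * T) * norm y"
      by (meson add_mono norm_mult_ineq norm_triangle_ineq4 order_trans)
    also have "\<dots> \<le> 1 * (2 * d) + 2 * d * 1"
      using norm_one_minus_square[OF sx nx] ny Txx Ty d0 by (intro add_mono mult_mono) auto
    finally show ?thesis by simp
  qed
  moreover have "norm (T * s - s * T) \<le> 6 * d"
  proof -
    have "T * s - s * T = 2 *\<^sub>R ((T * x - x * T) * y + x * (T * y - y * T))"
      by (simp add: s_def algebra_simps)
    also have "norm \<dots> \<le> 2 * (norm (T * x - x * T) * norm y + norm x * norm (T * y - y * T))"
    proof -
      have "norm ((T * x - x * T) * y + x * (T * y - y * T)) \<le> norm (T * x - x * T) * norm y + norm x * norm (T * y - y * T)"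
        by (meson add_mono norm_mult_ineq norm_triangle_ineq order_trans)
      then show ?thesis by simp
    qed
    also have "\<dots> \<le> 2 * (d * 1 + 1 * (2 * d))"
      using T ny nx Ty d0 by (intro mult_left_mono add_mono mult_mono) auto
    finally show ?thesis by simp
  qed
  moreover have "norm (c * v) \<le> 2 * norm ((1 - x) * v)" for v
  proof -
    \<comment> \<open>\<open>c\<close> contains the factor \<open>1 - x\<close>, so it is small
      where \<open>x\<close> acts as a unit; the constant bounds
      \<open>norm (1 + x)\<close>.\<close>
    have "c * v = (y * (1 + x)) * ((1 - x) * v)" unfolding cc by (simp add: algebra_simps)
    also have "norm \<dots> \<le> (norm y * norm (1 + x)) * norm ((1 - x) * v)"
      by (meson norm_mult_ineq mult_right_mono norm_ge_zero order_trans)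
    also have "\<dots> \<le> (1 * 2) * norm ((1 - x) * v)"
    proof (intro mult_right_mono mult_mono)
      show "norm (1 + x) \<le> 2" using norm_triangle_ineq[of 1 x] nx norm_one_le[where 'a='a] by simp
    qed (use ny in auto)
    finally show ?thesis by simp
  qed
  moreover have "s = x * (2 *\<^sub>R y)" by (fact s_def)
  ultimately show ?thesis using that[of c s "2 *\<^sub>R y"] by blast
qed

text \<open>Up to commutators, \<open>T\<close> is \<open>s * T * s + c * T * c\<close>. The
  approximation for \<open>K2\<close> is inserted in the first term and that for \<open>K1\<close>
  in the second. As \<open>s\<close> lies in \<open>K1\<close>, the correction from
  \<open>K2\<close> acquires the witness \<open>s * k2\<close> in both ideals, while the correction
  from \<open>K1\<close> disappears because \<open>c * k1\<close> is small.\<close>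

lemma approximable_glue:
  fixes A :: "'a::cstar_alg set"
  assumes A: "unital_subalg A" and K1: "ideal_in A K1" and K2: "ideal_in A K2" and K: "K1 \<inter> K2 \<subseteq> K"
    and T: "star T = T" "multiplier K1 T"
    and a1: "approximable A T d K1" and a2: "approximable A T d K2"
  shows "approximable A T d K"
proof -
  obtain a1 k1 b1 where 1: "a1 \<in> A" "k1 \<in> K1" "star a1 = a1" "star b1 = b1" "norm (T - a1 - k1 * b1 * star k1) < d"
    using a1 by (auto simp: approximable_def)
  obtain a2 k2 b2 where 2: "a2 \<in> A" "k2 \<in> K2" "star a2 = a2" "star b2 = b2" "norm (T - a2 - k2 * b2 * star k2) < d"
    using a2 by (auto simp: approximable_def)
  define X1 X2 where "X1 = T - a1 - k1 * b1 * star k1" "X2 = T - a2 - k2 * b2 * star k2"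
  define m where "m = max (norm X1) (norm X2)"
  have m: "m < d" using 1(5) 2(5) by (simp add: m_def X1_X2_def)
  define L where "L = norm (b1 * star k1)"
  \<comment> \<open>\<open>10 * \<eta>\<close> comes from the commutators with \<open>s\<close> and
    \<open>c\<close>, and \<open>2 * L * \<eta>\<close> from \<open>c * k1\<close>; together they
    use half of the gap \<open>d - m\<close>.\<close>
  define \<eta> where "\<eta> = (d - m) / (2 * (10 + 2 * L))"
  have L: "L \<ge> 0" by (simp add: L_def)
  have P: "10 + 2 * L > 0" using L by simp
  then have eq: "\<eta> * (10 + 2 * L) = (d - m) / 2" by (simp add: \<eta>_def field_simps)
  have \<eta>: "\<eta> > 0" using m P by (simp add: \<eta>_def)
  have \<eta>': "\<eta> * (10 + 2 * L) < d - m" unfolding eq using m by simp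
  have "k1 * star k1 \<in> K1" using ideal_mult_right[OF K1 subalg_star[OF A ideal_subset[OF K1 1(2)]] 1(2)] .
  then have "dominated K1 (k1 * star k1)" using pos_mult_star by (intro dominated_self)
  then obtain x where x: "x \<in> K1" "pos x" "pos (1 - x)" "\<And>v. v \<in> {k1} \<Longrightarrow> norm ((1 - x) * v) \<le> \<eta>"
    "\<And>S. S \<in> {T} \<Longrightarrow> norm (S * x - x * S) \<le> \<eta>"
    using quasi_central[OF A K1, of "{T}" "{k1}" \<eta>] T \<eta> by auto
  have xk: "norm ((1 - x) * k1) \<le> \<eta>" "norm (T * x - x * T) \<le> \<eta>" using x(4,5) by auto
  obtain c s q where cs: "star c = c" "star s = s" "c * c + s * s = 1" "in_cstar x c" "s = x * q" "in_cstar x q"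
    "norm c \<le> 1" "norm s \<le> 1" "norm (T * c - c * T) \<le> 4 * \<eta>" "norm (T * s - s * T) \<le> 6 * \<eta>"
    "\<And>v. norm (c * v) \<le> 2 * norm ((1 - x) * v)"
    using rational_partition[OF x(2,3) xk(2)] by metis
  have xA: "x \<in> A" using ideal_subset[OF K1 x(1)] .
  have cA: "c \<in> A" "q \<in> A" using in_cstar_mem[OF _ A xA] cs(4,6) by auto
  have sK: "s \<in> K1" unfolding cs(5) by (rule ideal_mult_right[OF K1 cA(2) x(1)])
  have sA: "s \<in> A" using ideal_subset[OF K1 sK] .
  define v where "v = s * k2"
  have "v \<in> K1" "v \<in> K2" unfolding v_def
    using ideal_mult_right[OF K1 ideal_subset[OF K2 2(2)] sK] ideal_mult_left[OF K2 sA 2(2)] by auto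
  then have vK: "v \<in> K" using K by blast
  define a where "a = s * a2 * s + c * a1 * c"
  have aA: "a \<in> A" unfolding a_def using A cA sA 1(1) 2(1) by (intro subalg_add subalg_mult)
  have sa: "star a = a" by (simp add: a_def star_simps cs(1,2) 1(3) 2(3) mult.assoc)
  define Y where "Y = s * X2 * s + c * X1 * c"
  have decomp: "T - a - v * b2 * star v = Y + (s * (T * s - s * T) + c * (T * c - c * T)) * (-1)
      + c * k1 * (b1 * star k1) * c"
  proof -
    have "Y = s * T * s + c * T * c - a - v * b2 * star v - c * k1 * (b1 * star k1) * c"
      by (simp add: Y_def X1_X2_def a_def v_def star_simps cs(2) algebra_simps)
    moreover have "s * (T * s - s * T) + c * (T * c - c * T) = s * T * s + c * T * c - (c * c + s * s) * T"
      by (simp add: algebra_simps)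
    ultimately show ?thesis by (simp add: cs(3))
  qed
  \<comment> \<open>No factor \<open>2\<close> is lost: \<open>of_real m - Y\<close> and
    \<open>of_real m + Y\<close> are sums of conjugates of positive elements because
    \<open>c * c + s * s = 1\<close>.\<close>
  have "norm Y \<le> m"
  proof (rule norm_le_of_pos_sa)
    have m0: "0 \<le> m" by (simp add: m_def le_max_iff_disj)
    then show "0 \<le> m" .
    have sX: "star X1 = X1" "star X2 = X2"
      using 1(3,4) 2(3,4) T(1) by (simp_all add: X1_X2_def star_simps mult.assoc)
    then show "star Y = Y" by (simp add: Y_def star_simps cs(1,2) mult.assoc)
    have e: "of_real m = s * of_real m * s + c * of_real m * c"
    proof -
      have "s * of_real m * s + c * of_real m * c = m *\<^sub>R (c * c + s * s)" by (simp add: of_real_def algebra_simps)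
      then show ?thesis by (simp add: cs(3) of_real_def)
    qed
    have n: "norm X1 \<le> m" "norm X2 \<le> m" by (simp_all add: m_def)
    have p: "pos (s * P * star s + c * R * star c)" if "pos P" "pos R" for P R
      using that by (intro pos_add pos_conj')
    have "pos (s * (of_real m - X2) * star s + c * (of_real m - X1) * star c)"
      using sX n by (intro p pos_of_norm_le)
    then show "pos (of_real m - Y)" by (subst e) (simp add: Y_def cs(1,2) algebra_simps)
    have "pos (s * (of_real m - - X2) * star s + c * (of_real m - - X1) * star c)"
      using sX n by (intro p pos_of_norm_le) (auto simp: star_minus)
    then show "pos (of_real m + Y)" by (subst e) (simp add: Y_def cs(1,2) algebra_simps)
  qed
  moreover have "norm ((s * (T * s - s * T) + c * (T * c - c * T)) * (-1)) \<le> 10 * \<eta>"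
  proof -
    have "norm (s * (T * s - s * T) + c * (T * c - c * T)) \<le> norm s * norm (T * s - s * T) + norm c * norm (T * c - c * T)"
      by (meson add_mono norm_mult_ineq norm_triangle_ineq order_trans)
    also have "\<dots> \<le> 1 * (6 * \<eta>) + 1 * (4 * \<eta>)" using cs \<eta> by (intro add_mono mult_mono) auto
    also have "\<dots> = 10 * \<eta>" by simp
    finally show ?thesis by (simp only: mult_minus1_right norm_minus_cancel)
  qed
  moreover have "norm (c * k1 * (b1 * star k1) * c) \<le> 2 * L * \<eta>"
  proof -
    have "norm (c * k1 * (b1 * star k1) * c) \<le> (norm (c * k1) * L) * norm c"
      unfolding L_def by (meson norm_mult_ineq mult_right_mono norm_ge_zero order_trans)
    also have "\<dots> \<le> (2 * \<eta> * L) * 1"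
      using cs(11)[of k1] xk(1) cs(7) L \<eta> by (intro mult_mono) auto
    also have "\<dots> = 2 * L * \<eta>" by simp
    finally show ?thesis .
  qed
  ultimately have "norm (T - a - v * b2 * star v) \<le> m + 10 * \<eta> + 2 * L * \<eta>"
    unfolding decomp by (meson add_mono norm_triangle_ineq order_trans)
  also have "\<dots> < d" using \<eta>' by (simp add: algebra_simps)
  finally show ?thesis unfolding approximable_def using aA sa vK 2(4) by blast
qed

section \<open>Prime ideals and the main argument\<close>

lemma closed_distance:
  fixes x :: "'a::real_normed_vector"
  assumes "closed S" "x \<notin> S"
  shows "\<exists>d>0. \<forall>y\<in>S. d \<le> norm (x - y)"
proof -
  have "open (- S)" "x \<in> - S" using assms by auto
  then obtain d where d: "d > 0" "\<And>y. dist y x < d \<Longrightarrow> y \<in> - S" unfolding open_dist by blast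
  have "d \<le> norm (x - y)" if "y \<in> S" for y
    using d(2)[of y] that by (force simp: dist_norm norm_minus_commute not_less[symmetric])
  then show ?thesis using d(1) by blast
qed

text \<open>The defining inequality is strict, hence stable under small changes of
  \<open>k\<close>.\<close>

lemma approximable_closure:
  fixes A :: "'a::cstar_alg set"
  assumes "approximable A T d (closure K)"
  shows "approximable A T d K"
proof -
  obtain a k b where k: "a \<in> A" "k \<in> closure K" "star a = a" "star b = b" "norm (T - a - k * b * star k) < d"
    using assms by (auto simp: approximable_def)
  obtain s where s: "\<And>n. s n \<in> K" "s \<longlonglongrightarrow> k" using k(2) closure_sequential by metis
  have "(\<lambda>n. norm (T - a - s n * b * star (s n))) \<longlonglongrightarrow> norm (T - a - k * b * star k)"
    by (intro tendsto_intros tendsto_star s)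
  then have "eventually (\<lambda>n. norm (T - a - s n * b * star (s n)) < d) sequentially"
    using k(5) by (rule order_tendstoD)
  then obtain n where "norm (T - a - s n * b * star (s n)) < d" by (auto simp: eventually_sequentially)
  then show ?thesis unfolding approximable_def using k s(1) by blast
qed

lemma ideal_closure:
  fixes A :: "'a::cstar_alg set"
  assumes A: "unital_subalg A" and K: "ideal_in A K"
  shows "ideal_in A (closure K)"
  unfolding ideal_in_def
proof (intro conjI ballI)
  show "closure K \<subseteq> A" using K subalg_closed[OF A] by (intro closure_minimal) (auto simp: ideal_in_def)
  show "0 \<in> closure K" using ideal_zero[OF K] closure_subset by blast
  fix x assume x: "x \<in> closure K"
  then obtain s where s: "\<And>n. s n \<in> K" "s \<longlonglongrightarrow> x" using closure_sequential by metis
  show "x + y \<in> closure K" if y: "y \<in> closure K" for y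
  proof -
    obtain t where t: "\<And>n. t n \<in> K" "t \<longlonglongrightarrow> y" using y closure_sequential by metis
    show ?thesis unfolding closure_sequential
      using ideal_add[OF K s(1) t(1)] tendsto_add[OF s(2) t(2)] by (intro exI[of _ "\<lambda>n. s n + t n"]) auto
  qed
  fix a assume a: "a \<in> A"
  show "a * x \<in> closure K" unfolding closure_sequential
    using ideal_mult_left[OF K a s(1)] tendsto_mult_left[OF s(2), of a] by (intro exI[of _ "\<lambda>n. a * s n"]) auto
  show "x * a \<in> closure K" unfolding closure_sequential
    using ideal_mult_right[OF K a s(1)] tendsto_mult_right[OF s(2), of a] by (intro exI[of _ "\<lambda>n. s n * a"]) auto
qed

text \<open>\<open>v\<close> and \<open>w\<close> are the positive and negative parts of
  \<open>y - of_real s\<close>. Positivity of \<open>y * w = s *\<^sub>R w - w * w\<close> yields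
  \<open>norm w \<le> s\<close>, and \<open>y * v = v * (v + of_real s)\<close> exhibits
  \<open>v\<close> as a multiple of \<open>y\<close>.\<close>

lemma cut_off:
  fixes y :: "'a::cstar_alg"
  assumes y: "pos y" and s: "s > 0"
  obtains v w d where "pos v" "pos w" "y = of_real s + v - w" "v * w = 0" "w * v = 0" "in_cstar y v"
    "norm (y - v) \<le> s" "v = y * d" "in_cstar y d"
proof -
  have "star (y - of_real s) = y - of_real s" using pos_sa[OF y] by (simp add: star_simps)
  then obtain v w where vw: "pos v" "pos w" "y - of_real s = v - w" "v * w = 0" "w * v = 0"
      "in_cstar (y - of_real s) v" "in_cstar (y - of_real s) w"
    using pos_part by blast
  have "in_cstar y (y - of_real s)" by (intro in_cstar_diff in_cstar_const in_cstar_self)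
  then have yv: "in_cstar y v" "in_cstar y w" using vw(6,7) in_cstar_trans by blast+
  have yeq: "y = of_real s + v - w" using vw(3) by (simp add: algebra_simps)
  have wy: "w * y = s *\<^sub>R w - w * w" by (simp add: yeq algebra_simps vw(5) of_real_def)
  have "y * w = w * y" using yv(2) in_cstar_commute in_cstar_self by blast
  then have "pos (s *\<^sub>R w - w * w)" using pos_mult[OF vw(2) y] wy by simp
  then have "norm (w * w) \<le> norm (s *\<^sub>R w)" using pos_square[OF pos_sa[OF vw(2)]] by (intro norm_mono_pos)
  then have "norm w * norm w \<le> s * norm w"
    using norm_square_sa[OF pos_sa[OF vw(2)]] s by (simp add: power2_eq_square)
  then have nw: "norm w \<le> s" using s by (cases "norm w = 0") (auto simp: mult_le_cancel_right)
  have "norm (of_real s - w) \<le> s" using vw(2) nw by (rule pos_norm_diff)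
  then have n: "norm (y - v) \<le> s" by (simp add: yeq algebra_simps)
  obtain r where r: "(v + of_real s) * r = 1" "in_cstar v r" using pos_resolvent[OF vw(1) s] by metis
  have "y * v = v * (v + of_real s)" by (simp add: yeq algebra_simps vw(5) of_real_def)
  then have "y * (v * r) = v * ((v + of_real s) * r)" by (simp add: mult.assoc[symmetric])
  then have "v = y * (v * r)" by (simp add: r(1))
  moreover have "in_cstar y (v * r)" using yv(1) r(2) in_cstar_trans in_cstar_mult by blast
  ultimately show ?thesis using that[of v w "v * r"] vw yeq yv n by blast
qed

text \<open>Everything is relative to \<open>Z\<close>, which will be the kernel of the map onto
  \<open>B\<close>. Thus \<open>pure\<close> speaks of states vanishing on \<open>Z\<close>, and
  \<open>Q\<close> is dense in \<open>A\<close> modulo \<open>Z\<close>, since the preimage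
  \<open>A\<close> of a separable algebra need not be separable.\<close>

locale separated_ideals =
  fixes A Z :: "'a::cstar_alg set" and I :: "'i set" and J :: "'i \<Rightarrow> 'a set" and T :: 'a and Q :: "'a set"
  assumes A: "unital_subalg A" and Z: "ideal_in UNIV Z" "Z \<subseteq> A"
    and J: "\<And>i. i \<in> I \<Longrightarrow> ideal_in UNIV (J i)" "\<And>i. i \<in> I \<Longrightarrow> closed (J i)" "\<And>i. i \<in> I \<Longrightarrow> Z \<subseteq> J i"
    and coprime: "\<And>i j. i \<in> I \<Longrightarrow> j \<in> I \<Longrightarrow> i \<noteq> j \<Longrightarrow> \<exists>x\<in>A \<inter> J i. \<exists>y\<in>A \<inter> J j. x + y = 1"
    and pure: "\<And>f. pure_state f \<Longrightarrow> (\<And>z. z \<in> Z \<Longrightarrow> f z = 0) \<Longrightarrow> \<exists>i\<in>I. \<forall>x\<in>J i. f x = 0"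
    and dense: "countable Q" "Q \<subseteq> A" "\<And>a. a \<in> A \<Longrightarrow> \<exists>z\<in>Z. \<forall>e>0. \<exists>q\<in>Q. norm (a - z - q) < e"
    and T: "star T = T" "\<And>i. i \<in> I \<Longrightarrow> \<exists>a\<in>A. T - a \<in> J i"
begin

section \<open>Domination tested by states that live on one quotient\<close>

lemma ideal_Int: "i \<in> I \<Longrightarrow> ideal_in A (A \<inter> J i)"
  using J(1)[of i] A by (auto simp: ideal_in_def subalg_zero subalg_add subalg_mult)

lemma state_vanish_Z:
  assumes "state f" "\<And>z. z \<in> Z \<Longrightarrow> pos z \<Longrightarrow> f z = 0" "z \<in> Z"
  shows "f z = 0"
  using state_eq_0_of_square[OF assms(1)] assms(2) ideal_mult_right[OF Z(1) UNIV_I assms(3)] pos_mult_star by blast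

text \<open>A failure of domination is detected by a pure state, which vanishes on \<open>Z\<close>
  and therefore on some \<open>J i\<close>. So domination needs to be checked only under states that
  factor through one of the quotients.\<close>

lemma dominated_of_pure:
  assumes K: "ideal_in A K" "Z \<subseteq> K" and x: "star x = x"
    and le: "\<And>f i. state f \<Longrightarrow> i \<in> I \<Longrightarrow> (\<And>y. y \<in> J i \<Longrightarrow> f y = 0) \<Longrightarrow> (\<And>h. h \<in> K \<Longrightarrow> pos h \<Longrightarrow> f h = 0) \<Longrightarrow> f x \<le> 0"
  shows "dominated K x"
proof (rule ccontr)
  assume "\<not> dominated K x"
  then obtain d where d: "d > 0" "\<And>h. h \<in> K \<Longrightarrow> pos h \<Longrightarrow> \<not> pos (h + of_real d - x)"
    by (auto simp: dominated_def)
  let ?H = "{h\<in>K. pos h}"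
  obtain f where f: "pure_state f" "\<And>h. h \<in> ?H \<Longrightarrow> f h = 0" "0 < f x"
  proof (rule pure_state_exists[of ?H x d])
    show "0 \<in> ?H" using ideal_zero[OF K(1)] by simp
  qed (use d x ideal_add[OF K(1)] ideal_scaleR[OF A K(1)] in \<open>auto intro: pos_add pos_scaleR\<close>)
  have st: "state f" using f(1) by (simp add: pure_state_def)
  have "f z = 0" if "z \<in> Z" for z using state_vanish_Z[OF st _ that] f(2) K(2) by blast
  then obtain i where "i \<in> I" "\<And>y. y \<in> J i \<Longrightarrow> f y = 0" using pure[OF f(1)] by blast
  then have "f x \<le> 0" using le[OF st] f(2) by simp
  then show False using f(3) by simp
qed

text \<open>Under a state vanishing on \<open>J i\<close>, the element \<open>T\<close> in
  \<open>T * h * star T\<close> may be replaced by an element \<open>a\<close> of \<open>A\<close>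
  congruent to it, and \<open>a * h * star a\<close> lies in \<open>K\<close>.\<close>

lemma multiplier_T:
  assumes K: "ideal_in A K" "Z \<subseteq> K"
  shows "multiplier K T"
  unfolding multiplier_def
proof (intro ballI impI)
  fix h assume h: "h \<in> K" "pos h"
  show "dominated K (T * h * star T)"
  proof (rule dominated_of_pure[OF K])
    show "star (T * h * star T) = T * h * star T" using pos_sa[OF h(2)] by (simp add: star_simps mult.assoc)
    fix f i assume f: "state f" "i \<in> I" "\<And>y. y \<in> J i \<Longrightarrow> f y = 0" "\<And>h. h \<in> K \<Longrightarrow> pos h \<Longrightarrow> f h = 0"
    obtain a where a: "a \<in> A" "T - a \<in> J i" using T(2)[OF f(2)] by blast
    note Ji = J(1)[OF f(2)]
    have "star (T - a) \<in> J i" using ideal_star[OF unital_subalg_UNIV Ji J(2)[OF f(2)] a(2)] .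
    then have "(T - a) * (h * star T) + (a * h) * star (T - a) \<in> J i"
      by (intro ideal_add[OF Ji] ideal_mult_left[OF Ji] ideal_mult_right[OF Ji] a UNIV_I)
    also have "(T - a) * (h * star T) + (a * h) * star (T - a) = T * h * star T - a * h * star a"
      by (simp add: star_diff algebra_simps)
    finally have "f (T * h * star T) = f (a * h * star a)" using f(3) state_diff[OF f(1)] by fastforce
    moreover have "a * h * star a \<in> K"
      by (intro ideal_mult_right[OF K(1)] ideal_mult_left[OF K(1)] subalg_star[OF A] a h)
    ultimately show "f (T * h * star T) \<le> 0" using f(4) pos_conj'[OF h(2)] by simp
  qed
qed

text \<open>For \<open>k\<close> other than \<open>i\<close>, no state vanishes both on
  \<open>J k\<close> and on the positive elements of \<open>A \<inter> J i\<close>, because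
  coprimality writes \<open>1\<close> as a sum from the two ideals.\<close>

lemma dominated_J:
  assumes i: "i \<in> I" and j: "j \<in> J i"
  shows "dominated (A \<inter> J i) (j * star j)"
proof (rule dominated_of_pure[OF ideal_Int[OF i]])
  show "Z \<subseteq> A \<inter> J i" using Z J(3)[OF i] by blast
  fix f k assume f: "state f" "k \<in> I" "\<And>y. y \<in> J k \<Longrightarrow> f y = 0" "\<And>h. h \<in> A \<inter> J i \<Longrightarrow> pos h \<Longrightarrow> f h = 0"
  show "f (j * star j) \<le> 0"
  proof (cases "k = i")
    case True
    then show ?thesis using f(3) ideal_mult_right[OF J(1)[OF i] UNIV_I j] by simp
  next
    case False
    then obtain x y where xy: "x \<in> A \<inter> J i" "y \<in> A \<inter> J k" "x + y = 1" using coprime[OF i f(2)] by blast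
    have "x * star x \<in> A \<inter> J i"
      using ideal_mult_right[OF ideal_Int[OF i] _ xy(1)] subalg_star[OF A] xy(1) by blast
    then have "f x = 0" using f(4) pos_mult_star state_eq_0_of_square[OF f(1)] by blast
    moreover have "f y = 0" using f(3) xy(2) by simp
    ultimately have "f 1 = 0" using state_add[OF f(1), of x y] xy(3) by simp
    then show ?thesis using state_one[OF f(1)] by simp
  qed
qed (simp add: star_simps)

text \<open>An approximate unit \<open>e\<close> for the self-adjoint element
  \<open>j = T - a\<close> of \<open>J i\<close> can be taken from \<open>A \<inter> J i\<close> by
  \<open>dominated_J\<close>; the witnesses are \<open>k = e\<close> and
  \<open>b = j\<close>.\<close>

lemma approximable_J:
  assumes i: "i \<in> I" and K: "A \<inter> J i \<subseteq> K" and d: "d > 0"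
  shows "approximable A T d K"
proof -
  obtain a0 where a0: "a0 \<in> A" "T - a0 \<in> J i" using T(2)[OF i] by blast
  note Ji = J(1)[OF i]
  define a where "a = (1/2) *\<^sub>R (a0 + star a0)"
  define j where "j = T - a"
  have aA: "a \<in> A" using A a0(1) by (simp add: a_def subalg_scaleR subalg_add subalg_star)
  have sa: "star a = a" by (simp add: a_def star_simps add.commute)
  have sj: "star j = j" using T(1) sa by (simp add: j_def star_simps)
  have "star (T - a0) \<in> J i" using ideal_star[OF unital_subalg_UNIV Ji J(2)[OF i] a0(2)] .
  then have "(1/2) *\<^sub>R ((T - a0) + star (T - a0)) \<in> J i"
    by (intro ideal_scaleR[OF unital_subalg_UNIV Ji] ideal_add[OF Ji] a0)
  also have "(1/2) *\<^sub>R ((T - a0) + star (T - a0)) = j"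
    using T(1) by (simp add: j_def a_def star_simps algebra_simps) (simp flip: scaleR_add_left)
  finally have jJ: "j \<in> J i" .
  have d3: "d / 3 > 0" using d by simp
  obtain e where e: "e \<in> A \<inter> J i" "pos e" "pos (1 - e)" "\<And>v. v \<in> {j} \<Longrightarrow> norm ((1 - e) * v) \<le> d / 3"
    using dominated_approx_unit[OF A ideal_Int[OF i], of "{j}" "d/3"] dominated_J[OF i jJ] d3 by auto
  have se: "star e = e" using pos_sa[OF e(2)] .
  have ej: "norm ((1 - e) * j) \<le> d / 3" using e(4) by simp
  have "norm (j * (1 - e)) = norm (star (j * (1 - e)))" by simp
  also have "star (j * (1 - e)) = (1 - e) * j" by (simp add: star_simps se sj)
  finally have je: "norm (j * (1 - e)) \<le> d / 3" using ej by simp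
  have "T - a - e * j * star e = (1 - e) * j + e * (j * (1 - e))" by (simp add: j_def[symmetric] se algebra_simps)
  also have "norm \<dots> \<le> norm ((1 - e) * j) + norm e * norm (j * (1 - e))"
    by (meson add_left_mono norm_mult_ineq norm_triangle_ineq order_trans)
  also have "\<dots> \<le> d / 3 + 1 * (d / 3)"
    using ej je norm_le_one_of_pos[OF e(2,3)] d by (intro add_mono mult_mono) auto
  also have "\<dots> < d" using d by simp
  finally show ?thesis unfolding approximable_def using aA e(1) K sa sj by blast
qed

text \<open>Gluing makes such a maximal \<open>K\<close> prime.\<close>

context
  fixes K d
  assumes d: "d > 0" and K: "ideal_in A K" "Z \<subseteq> K" "\<not> approximable A T d K"
    and K_max: "\<And>L. ideal_in A L \<Longrightarrow> K \<subseteq> L \<Longrightarrow> \<not> approximable A T d L \<Longrightarrow> L = K"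
begin

lemma K_closed: "closed K"
proof -
  have "closure K = K"
    using approximable_closure K(3) by (intro K_max ideal_closure[OF A K(1)] closure_subset) blast
  then show ?thesis by (metis closed_closure)
qed

text \<open>For \<open>1\<close> in \<open>K\<close> the choice \<open>a = 0\<close>,
  \<open>k = 1\<close>, \<open>b = T\<close> approximates \<open>T\<close> exactly.\<close>

lemma K_proper: "1 \<notin> K"
proof
  assume "1 \<in> K"
  moreover have "norm (T - 0 - 1 * T * star 1) < d" using d by simp
  moreover have "(0::'a) \<in> A" by (rule subalg_zero[OF A])
  ultimately show False using K(3) T(1) unfolding approximable_def by (metis star_0)
qed

text \<open>\<open>K1\<close> and \<open>K2\<close> are chosen so that products
  \<open>x * b * y\<close> with \<open>x\<close> in \<open>K1\<close>, \<open>b\<close> in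
  \<open>A\<close> and \<open>y\<close> in \<open>K2\<close> lie in \<open>K\<close>. They contain
  \<open>K\<close>, and also \<open>g\<close> and \<open>a\<close> respectively, so maximality makes
  both approximable. Since \<open>K1 \<inter> K2\<close> lies in \<open>K\<close>, gluing would make
  \<open>K\<close> approximable.\<close>

lemma K_prime:
  assumes g: "g \<in> A" "g \<notin> K" and a: "a \<in> A" "a \<notin> K"
  obtains b where "b \<in> A" "g * b * a \<notin> K"
proof (rule ccontr)
  assume "\<not> thesis"
  then have gba: "\<And>b. b \<in> A \<Longrightarrow> g * b * a \<in> K" using that by blast
  define K1 where "K1 = {x\<in>A. \<forall>b\<in>A. x * b * a \<in> K}"
  define K2 where "K2 = {y\<in>A. \<forall>x\<in>K1. \<forall>b\<in>A. x * b * y \<in> K}"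
  have i1: "ideal_in A K1"
    unfolding ideal_in_def
  proof (intro conjI ballI)
    show "0 \<in> K1" using ideal_zero[OF K(1)] subalg_zero[OF A] by (simp add: K1_def)
    show "x + y \<in> K1" if "x \<in> K1" "y \<in> K1" for x y
      using that ideal_add[OF K(1)] subalg_add[OF A] by (simp add: K1_def distrib_right)
    fix c x assume c: "c \<in> A" and x: "x \<in> K1"
    show "c * x \<in> K1"
      using x c ideal_mult_left[OF K(1) c] subalg_mult[OF A] by (simp add: K1_def mult.assoc)
    have "(x * c) * b * a \<in> K" if "b \<in> A" for b
    proof -
      have "x * (c * b) * a \<in> K" using x that c subalg_mult[OF A] by (simp add: K1_def)
      then show ?thesis by (simp add: mult.assoc)
    qed
    then show "x * c \<in> K1" using c x subalg_mult[OF A] by (simp add: K1_def)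
  qed (auto simp: K1_def)
  have i2: "ideal_in A K2"
    unfolding ideal_in_def
  proof (intro conjI ballI)
    show "0 \<in> K2" using ideal_zero[OF K(1)] subalg_zero[OF A] by (simp add: K2_def)
    show "x + y \<in> K2" if "x \<in> K2" "y \<in> K2" for x y
      using that ideal_add[OF K(1)] subalg_add[OF A] by (simp add: K2_def distrib_left)
    fix c x assume c: "c \<in> A" and x: "x \<in> K2"
    have "u * b * (c * x) \<in> K" if "u \<in> K1" "b \<in> A" for u b
    proof -
      have "u * (b * c) * x \<in> K" using x that c subalg_mult[OF A] by (simp add: K2_def)
      then show ?thesis by (simp add: mult.assoc)
    qed
    then show "c * x \<in> K2" using c x subalg_mult[OF A] by (simp add: K2_def)
    have "u * b * (x * c) \<in> K" if "u \<in> K1" "b \<in> A" for u b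
    proof -
      have "(u * b * x) * c \<in> K" using x that by (intro ideal_mult_right[OF K(1) c]) (simp add: K2_def)
      then show ?thesis by (simp add: mult.assoc)
    qed
    then show "x * c \<in> K2" using c x subalg_mult[OF A] by (simp add: K2_def)
  qed (auto simp: K2_def)
  have "K \<subseteq> K1" unfolding K1_def using ideal_subset[OF K(1)] ideal_mult_right[OF K(1)] a(1) by blast
  moreover have "g \<in> K1" using g gba by (simp add: K1_def)
  ultimately have a1: "approximable A T d K1" using K_max[OF i1] g(2) by blast
  have "K \<subseteq> K2" unfolding K2_def
    using ideal_subset[OF K(1)] ideal_mult_left[OF K(1)] subalg_mult[OF A] by (auto simp: K1_def)
  moreover have "a \<in> K2" using a(1) by (simp add: K2_def K1_def)
  ultimately have a2: "approximable A T d K2" using K_max[OF i2] a(2) by blast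
  have "K1 \<inter> K2 \<subseteq> K"
  proof
    fix z assume z: "z \<in> K1 \<inter> K2"
    then have zA: "z \<in> A" by (simp add: K1_def)
    have "z * star z * z \<in> K" using z subalg_star[OF A zA] by (simp add: K2_def)
    then have "z * star z * z * star z \<in> K" by (rule ideal_mult_right[OF K(1) subalg_star[OF A zA]])
    then have hh: "(z * star z) * (z * star z) \<in> K" by (simp add: mult.assoc)
    have "dominated K (z * star z)"
      unfolding dominated_def
    proof (intro allI impI)
      fix r :: real assume r: "r > 0"
      define h where "h = z * star z"
      have sh: "star h = h" by (simp add: h_def star_simps)
      let ?k = "(1 / (4 * r)) *\<^sub>R (h * h)"
      \<comment> \<open>Completing the square: positivity of \<open>u * u\<close> is
        \<open>h \<le> h * h / (4 * r) + r\<close>, so \<open>h\<close> is dominated by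
        \<open>K\<close> as soon as its square lies in \<open>K\<close>.\<close>
      define u where "u = (1 / (2 * sqrt r)) *\<^sub>R h - of_real (sqrt r)"
      have "pos (u * u)" using sh by (intro pos_square) (simp add: u_def star_simps)
      moreover have "u * u = ?k + of_real r - h"
      proof -
        have "u * u = ((1 / (2 * sqrt r)) * (1 / (2 * sqrt r))) *\<^sub>R (h * h) - (2 * (1 / (2 * sqrt r)) * sqrt r) *\<^sub>R h + (sqrt r * sqrt r) *\<^sub>R 1"
          by (simp add: u_def of_real_def algebra_simps) (simp flip: scaleR_add_left)
        moreover have "(1 / (2 * sqrt r)) * (1 / (2 * sqrt r)) = 1 / (4 * r)" "2 * (1 / (2 * sqrt r)) * sqrt r = 1" "sqrt r * sqrt r = r"
          using r by (simp_all add: field_simps)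
        ultimately show ?thesis by (simp add: of_real_def)
      qed
      ultimately have "pos (?k + of_real r - h)" by simp
      moreover have "?k \<in> K" using ideal_scaleR[OF A K(1)] hh by (simp add: h_def)
      moreover have "pos ?k" using r pos_square[OF sh] by (intro pos_scaleR) auto
      ultimately show "\<exists>k\<in>K. pos k \<and> pos (k + of_real r - z * star z)" unfolding h_def by blast
    qed
    then show "z \<in> K" by (rule dominated_mem[OF A K(1) K_closed zA])
  qed
  then show False using approximable_glue[OF A i1 i2 _ T(1) multiplier_T[OF i1] a1 a2] \<open>K \<subseteq> K1\<close> K(2,3) by blast
qed

text \<open>Here \<open>g'\<close> and \<open>m\<close> are the positive and negative parts of \<open>y - s\<close> for some \<open>y = star c * p * c\<close>
  and \<open>s > 0\<close>, so that \<open>f m = 0\<close> implies \<open>f y \<ge> s\<close>.\<close>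

lemma K_step:
  assumes g: "g \<in> A" "pos g" "g \<notin> K" and p: "p \<in> A" "pos p" "p \<notin> K"
  obtains g' m where "g' \<in> A" "pos g'" "g' \<notin> K" "\<exists>d\<in>A. g' = g * d" "pos m" "m * g' = 0"
    "\<exists>c\<in>A. \<forall>f. state f \<longrightarrow> f m = 0 \<longrightarrow> 0 < f (star c * p * c)"
proof -
  obtain b where b: "b \<in> A" "g * b * p \<notin> K" using K_prime[OF g(1,3) p(1,3)] .
  obtain r where r: "star r = r" "r * r = p" "in_cstar p r" using pos_sqrt[OF p(2)] by metis
  have rA: "r \<in> A" using in_cstar_mem[OF r(3) A p(1)] .
  have sg: "star g = g" using pos_sa[OF g(2)] .
  define c where "c = star b * g"
  have cA: "c \<in> A" using A b(1) g(1) by (simp add: c_def subalg_mult subalg_star)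
  define y where "y = star c * p * c"
  have yc: "y = g * (b * p * star b * g)" by (simp add: y_def c_def star_simps sg mult.assoc)
  have py: "pos y" unfolding y_def by (rule pos_conj[OF p(2)])
  have yA: "y \<in> A" unfolding y_def using A cA p(1) by (intro subalg_mult subalg_star)
  have yK: "y \<notin> K"
  proof
    assume "y \<in> K"
    \<comment> \<open>If \<open>y\<close> were in \<open>K\<close>, then so would be
      \<open>g * b * r\<close>, and after one more factor \<open>r\<close> also
      \<open>g * b * p\<close>.\<close>
    moreover have "y = (g * b * r) * star (g * b * r)"
      by (simp add: yc star_simps sg r(1) mult.assoc) (simp add: r(2)[symmetric] mult.assoc)
    ultimately have "dominated K ((g * b * r) * star (g * b * r))" using py dominated_self by metis
    then have "g * b * r \<in> K"
      using A g(1) b(1) rA by (intro dominated_mem[OF A K(1) K_closed]) (auto intro: subalg_mult)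
    then have "g * b * r * r \<in> K" by (rule ideal_mult_right[OF K(1) rA])
    then show False using b(2) r(2) by (simp add: mult.assoc)
  qed
  \<comment> \<open>\<open>K\<close> is closed, so the cut-off of \<open>y\<close> at a small enough
    level still avoids \<open>K\<close>.\<close>
  have "\<exists>s>0. \<forall>v. norm (y - v) \<le> s \<longrightarrow> v \<notin> K"
  proof (rule ccontr)
    assume "\<not> ?thesis"
    then have near: "\<exists>v\<in>K. norm (y - v) \<le> s" if "s > 0" for s using that by blast
    have "\<exists>v\<in>K. dist v y < e" if e: "e > 0" for e
    proof -
      obtain v where "v \<in> K" "norm (y - v) \<le> e / 2" using near[of "e / 2"] e by auto
      then show ?thesis using e by (intro bexI[of _ v]) (auto simp: dist_norm norm_minus_commute)
    qed
    then show False using yK K_closed closed_approachable by blast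
  qed
  then obtain s where s: "s > 0" "\<And>v. norm (y - v) \<le> s \<Longrightarrow> v \<notin> K" by blast
  obtain v w d where vw: "pos v" "pos w" "y = of_real s + v - w" "v * w = 0" "w * v = 0" "in_cstar y v"
    "norm (y - v) \<le> s" "v = y * d" "in_cstar y d" using cut_off[OF py s(1)] by blast
  have dA: "d \<in> A" using in_cstar_mem[OF vw(9) A yA] .
  have "v = g * (b * p * star b * g * d)" using vw(8) by (simp add: yc mult.assoc)
  moreover have "b * p * star b * g * d \<in> A" using A b(1) p(1) g(1) dA by (intro subalg_mult subalg_star)
  moreover have "0 < f (star c * p * c)" if f: "state f" "f w = 0" for f
  proof -
    have "f y = s + f v" using f by (simp add: vw(3) state_add state_diff state_of_real)
    then show ?thesis using state_pos[OF f(1) vw(1)] s(1) by (simp add: y_def)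
  qed
  ultimately show ?thesis using that[of v w] vw s(2) cA in_cstar_mem[OF vw(6) A yA] by blast
qed

text \<open>Each \<open>g (Suc n)\<close> is a multiple of \<open>g n\<close>, so the positive
  \<open>h\<close> with \<open>g k * h * g k\<close> in \<open>K\<close> for some \<open>k\<close>
  form a cone \<open>H\<close>. It contains the positive elements of \<open>Z\<close> and every
  \<open>m\<close> supplied by \<open>K_step\<close>; a state vanishing on \<open>H\<close> is
  therefore positive at a conjugate of each \<open>p n\<close>.\<close>

lemma exists_pure_state_hitting:
  fixes p :: "nat \<Rightarrow> 'a"
  assumes p: "\<And>n. p n \<in> A" "\<And>n. pos (p n)" "\<And>n. p n \<notin> K"
  obtains f where "pure_state f" "\<And>z. z \<in> Z \<Longrightarrow> f z = 0" "\<And>n. \<exists>c\<in>A. 0 < f (star c * p n * c)"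
proof -
  have "\<exists>g. \<forall>n. (g n \<in> A \<and> pos (g n) \<and> g n \<notin> K) \<and> ((\<exists>d\<in>A. g (Suc n) = g n * d) \<and>
      (\<exists>m. pos m \<and> m * g (Suc n) = 0 \<and> (\<exists>c\<in>A. \<forall>f. state f \<longrightarrow> f m = 0 \<longrightarrow> 0 < f (star c * p n * c))))"
    (is "\<exists>g. \<forall>n. ?P (g n) \<and> ?R n (g n) (g (Suc n))")
  proof (rule dependent_nat_choice[where P = "\<lambda>_. ?P" and Q = ?R])
    show "\<exists>x. ?P x" using subalg_one[OF A] K_proper pos_1 by blast
    fix x n assume "?P x"
    then show "\<exists>y. ?P y \<and> ?R n x y" using K_step[of x "p n"] p[of n] by metis
  qed
  then obtain g where g: "\<And>n. g n \<in> A" "\<And>n. pos (g n)" "\<And>n. g n \<notin> K" "\<And>n. \<exists>d\<in>A. g (Suc n) = g n * d"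
    and gm: "\<And>n. \<exists>m. pos m \<and> m * g (Suc n) = 0 \<and> (\<exists>c\<in>A. \<forall>f. state f \<longrightarrow> f m = 0 \<longrightarrow> 0 < f (star c * p n * c))"
    by blast
  have sg: "star (g n) = g n" for n using pos_sa[OF g(2)] .
  have chain: "\<exists>d\<in>A. g (k + j) = g k * d" for k j
  proof (induction j)
    case 0
    then show ?case using subalg_one[OF A] by (intro bexI[of _ 1]) auto
  next
    case (Suc j)
    then obtain d1 where d1: "d1 \<in> A" "g (k + j) = g k * d1" by blast
    obtain d2 where d2: "d2 \<in> A" "g (Suc (k + j)) = g (k + j) * d2" using g(4) by blast
    show ?case using d1 d2 subalg_mult[OF A d1(1) d2(1)] by (intro bexI[of _ "d1 * d2"]) (auto simp: mult.assoc)
  qed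
  define H where "H = {h. pos h \<and> (\<exists>k. g k * h * g k \<in> K)}"
  have up: "g l * h * g l \<in> K" if gk: "g k * h * g k \<in> K" "k \<le> l" for k l h
  proof -
    obtain d where d: "d \<in> A" "g l = g k * d" using chain[of k "l - k"] gk(2) by auto
    then have "g l = star d * g k" using sg[of l] sg[of k] by (metis star_mult)
    then have "g l * h * g l = star d * (g k * h * g k) * d" using d(2) by (metis mult.assoc)
    also have "\<dots> \<in> K" by (intro ideal_mult_right[OF K(1) d(1)] ideal_mult_left[OF K(1) subalg_star[OF A d(1)]] gk)
    finally show ?thesis .
  qed
  obtain f where f: "pure_state f" "\<And>h. h \<in> H \<Longrightarrow> f h = 0" "0 < f 1"
  proof (rule pure_state_exists[of H 1 "1/2"])
    show "0 \<in> H" using ideal_zero[OF K(1)] by (simp add: H_def)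
    show "pos h" if "h \<in> H" for h using that by (simp add: H_def)
    show "h + k \<in> H" if hk: "h \<in> H" "k \<in> H" for h k
    proof -
      obtain i j where ij: "g i * h * g i \<in> K" "g j * k * g j \<in> K" using hk by (auto simp: H_def)
      have "g (max i j) * h * g (max i j) + g (max i j) * k * g (max i j) \<in> K"
        by (intro ideal_add[OF K(1)] up[OF ij(1)] up[OF ij(2)]) auto
      then have "g (max i j) * (h + k) * g (max i j) \<in> K" by (simp add: distrib_left distrib_right)
      then show ?thesis using hk by (auto simp: H_def intro: pos_add)
    qed
    show "r *\<^sub>R h \<in> H" if h: "h \<in> H" "r > 0" for h r
    proof -
      obtain i where "g i * h * g i \<in> K" using h by (auto simp: H_def)
      then have "g i * (r *\<^sub>R h) * g i \<in> K" using ideal_scaleR[OF A K(1)] by simp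
      then show ?thesis using h by (auto simp: H_def intro: pos_scaleR)
    qed
    \<comment> \<open>Otherwise the square of \<open>g i\<close> would lie below
      \<open>2 *\<^sub>R (g i * h * g i)\<close>, an element of \<open>K\<close>, which forces
      \<open>g i\<close> into \<open>K\<close>. The constant \<open>1/2\<close> could be any number
      strictly between \<open>0\<close> and \<open>1\<close>.\<close>
    show "\<not> pos (h + of_real (1/2) - 1)" if h: "h \<in> H" for h
    proof
      assume ph: "pos (h + of_real (1/2) - 1)"
      obtain i where i: "g i * h * g i \<in> K" using h by (auto simp: H_def)
      have "pos (2 *\<^sub>R (g i * (h + of_real (1/2) - 1) * star (g i)))" by (intro pos_scaleR pos_conj' ph) simp
      then have "pos (2 *\<^sub>R (g i * h * g i) - g i * star (g i))"
        by (simp add: sg algebra_simps of_real_def scaleR_2)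
      moreover have "dominated K (2 *\<^sub>R (g i * h * g i))"
        using h ideal_scaleR[OF A K(1) i] pos_conj'[of h "g i"] sg
        by (intro dominated_self pos_scaleR) (auto simp: H_def)
      ultimately have "dominated K (g i * star (g i))" by (rule dominated_mono)
      then show False using dominated_mem[OF A K(1) K_closed g(1)] g(3) by blast
    qed
  qed auto
  have st: "state f" using f(1) by (simp add: pure_state_def)
  have "z \<in> H" if "z \<in> Z" "pos z" for z
  proof -
    have "g 0 * z * g 0 \<in> Z" by (intro ideal_mult_right[OF Z(1) UNIV_I] ideal_mult_left[OF Z(1) UNIV_I] that)
    then show ?thesis using that K(2) by (auto simp: H_def)
  qed
  then have "f z = 0" if "z \<in> Z" for z using state_vanish_Z[OF st _ that] f(2) by blast
  moreover have "\<exists>c\<in>A. 0 < f (star c * p n * c)" for n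
  proof -
    obtain m where m: "pos m" "m * g (Suc n) = 0" "\<exists>c\<in>A. \<forall>f. state f \<longrightarrow> f m = 0 \<longrightarrow> 0 < f (star c * p n * c)"
      using gm by blast
    have "g (Suc n) * m * g (Suc n) = 0" by (simp add: mult.assoc m(2))
    then have "m \<in> H" using m(1) ideal_zero[OF K(1)] unfolding H_def by (metis (mono_tags, lifting) mem_Collect_eq)
    then show ?thesis using m(3) st f(2) by blast
  qed
  ultimately show ?thesis using that f(1) by blast
qed

end

text \<open>The \<open>p n\<close> are cut-offs of \<open>star q * q\<close> with \<open>q\<close>
  in the countable set \<open>Q\<close>. For \<open>r\<close> in \<open>A \<inter> J i\<close>
  outside \<open>K\<close>, some \<open>star q * q\<close> is within \<open>t/3\<close> of
  \<open>star r * r\<close> and has a cut-off \<open>v\<close> outside \<open>K\<close> at a level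
  above \<open>t/3\<close>. At vectors \<open>v * c\<close> the state sees \<open>star q * q\<close>
  at least at that level but \<open>star r * r\<close> as zero, which contradicts their
  distance.\<close>

lemma prime_ideal_contains:
  fixes K :: "'a set"
  assumes d: "d > 0" and K: "ideal_in A K" "Z \<subseteq> K" "\<not> approximable A T d K"
    and K_max: "\<And>L. ideal_in A L \<Longrightarrow> K \<subseteq> L \<Longrightarrow> \<not> approximable A T d L \<Longrightarrow> L = K"
  shows "\<exists>i\<in>I. A \<inter> J i \<subseteq> K"
proof -
  note K_closed = K_closed[OF assms] and K_proper = K_proper[OF assms]
  define cut where "cut x s = (SOME v. pos v \<and> v \<in> A \<and> norm (x - v) \<le> s \<and> (\<exists>w. x = of_real s + v - w \<and> v * w = 0))"
    for x :: 'a and s :: real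
  have cut: "pos (cut x s) \<and> cut x s \<in> A \<and> norm (x - cut x s) \<le> s \<and> (\<exists>w. x = of_real s + cut x s - w \<and> cut x s * w = 0)"
    if x: "pos x" "x \<in> A" and s: "s > 0" for x s
    unfolding cut_def
  proof (rule someI_ex)
    obtain v w where "pos v" "x = of_real s + v - w" "v * w = 0" "in_cstar x v" "norm (x - v) \<le> s"
      using cut_off[OF x(1) s] by blast
    then show "\<exists>v. pos v \<and> v \<in> A \<and> norm (x - v) \<le> s \<and> (\<exists>w. x = of_real s + v - w \<and> v * w = 0)"
      using in_cstar_mem[OF _ A x(2)] by blast
  qed
  have qA: "pos (star q * q)" "star q * q \<in> A" if "q \<in> Q" for q
    using pos_star_mult subalg_mult[OF A] subalg_star[OF A] dense(2) that by auto
  define N where "N = Q \<times> {s \<in> \<rat>. s > (0::real)}"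
  have "countable {s \<in> \<rat>. s > (0::real)}" using countable_rat by (rule countable_subset[rotated]) auto
  then have cN: "countable N" unfolding N_def using dense(1) by simp
  obtain q0 where "q0 \<in> Q" using dense(3)[OF subalg_one[OF A]] zero_less_one by blast
  moreover have "(1::real) \<in> \<rat>" by simp
  ultimately have N0: "N \<noteq> {}" by (auto simp: N_def intro: zero_less_one)
  \<comment> \<open>Cut-offs that fall into \<open>K\<close> are replaced by \<open>1\<close>, which
    lies outside \<open>K\<close> by \<open>K_proper\<close>.\<close>
  define p where "p n = (case from_nat_into N n of (q, s) \<Rightarrow> if cut (star q * q) s \<in> K then 1 else cut (star q * q) s)" for n
  have p: "p n \<in> A \<and> pos (p n) \<and> p n \<notin> K" for n
  proof -
    obtain q s where qs: "from_nat_into N n = (q, s)" by fastforce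
    then have "q \<in> Q" "s > 0" using from_nat_into[OF N0, of n] by (auto simp: N_def)
    then show ?thesis using cut[OF qA, of q s] K_proper subalg_one[OF A] by (auto simp: p_def qs)
  qed
  obtain f where f: "pure_state f" "\<And>z. z \<in> Z \<Longrightarrow> f z = 0" "\<And>n. \<exists>c\<in>A. 0 < f (star c * p n * c)"
    using exists_pure_state_hitting[OF assms, of p] p by blast
  have st: "state f" using f(1) by (simp add: pure_state_def)
  obtain i where i: "i \<in> I" "\<And>y. y \<in> J i \<Longrightarrow> f y = 0" using pure[OF f(1,2)] by blast
  have "A \<inter> J i \<subseteq> K"
  proof (rule ccontr)
    assume "\<not> A \<inter> J i \<subseteq> K"
    then obtain r0 where r0: "r0 \<in> A" "r0 \<in> J i" "r0 \<notin> K" by blast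
    obtain z where z: "z \<in> Z" "\<And>e. e > 0 \<Longrightarrow> \<exists>q\<in>Q. norm (r0 - z - q) < e" using dense(3)[OF r0(1)] by blast
    \<comment> \<open>\<open>Q\<close> approximates \<open>r0\<close> only modulo \<open>Z\<close>;
      subtracting \<open>z\<close> changes membership in none of \<open>A\<close>,
      \<open>J i\<close> and \<open>K\<close>.\<close>
    define r where "r = r0 - z"
    have rA: "r \<in> A" unfolding r_def using subalg_diff[OF A r0(1)] z(1) Z(2) by blast
    have rJ: "r \<in> J i" unfolding r_def
      using ideal_diff[OF unital_subalg_UNIV J(1)[OF i(1)] r0(2)] z(1) J(3)[OF i(1)] by blast
    have rK: "r \<notin> K"
    proof
      assume "r \<in> K"
      then have "r + z \<in> K" using ideal_add[OF K(1)] z(1) K(2) by blast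
      then show False using r0(3) by (simp add: r_def)
    qed
    have "star r * r \<notin> K"
    proof
      assume "star r * r \<in> K"
      then have "dominated K (star r * star (star r))" by (simp add: dominated_self pos_star_mult)
      with dominated_mem[OF A K(1) K_closed subalg_star[OF A rA]] have "star r \<in> K" by blast
      then show False using ideal_star[OF A K(1) K_closed] rK by fastforce
    qed
    then obtain t where t: "t > 0" "\<And>k. k \<in> K \<Longrightarrow> t \<le> norm (star r * r - k)"
      using closed_distance[OF K_closed] by blast
    \<comment> \<open>Chosen so that \<open>star q * q\<close> comes within \<open>t / 3\<close> of
      \<open>star r * r\<close>; the cap \<open>1\<close> bounds \<open>norm q\<close> by
      \<open>norm r + 1\<close>.\<close>
    define \<eta> where "\<eta> = min 1 (t / 3 / (2 * norm r + 1))"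
    have nr: "2 * norm r + 1 > 0" by (simp add: add_nonneg_pos)
    have "\<eta> * (2 * norm r + 1) \<le> t / 3 / (2 * norm r + 1) * (2 * norm r + 1)"
      using nr by (intro mult_right_mono) (auto simp: \<eta>_def)
    also have "\<dots> = t / 3" using nr by (simp del: divide_divide_eq_left)
    finally have "\<eta> * (2 * norm r + 1) \<le> t / 3" .
    moreover have "\<eta> > 0" "\<eta> \<le> 1" using t(1) nr by (auto simp: \<eta>_def)
    ultimately have \<eta>: "\<eta> > 0" "\<eta> \<le> 1" "\<eta> * (2 * norm r + 1) \<le> t / 3" by blast+
    obtain q where q: "q \<in> Q" "norm (r - q) < \<eta>" using z(2)[OF \<eta>(1)] by (auto simp: r_def)
    define x where "x = star q * q"
    have close: "norm (x - star r * r) \<le> t / 3"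
    proof -
      have "x - star r * r = star (q - r) * q + star r * (q - r)" by (simp add: x_def star_diff algebra_simps)
      also have "norm \<dots> \<le> norm (star (q - r)) * norm q + norm (star r) * norm (q - r)"
        by (meson add_mono norm_mult_ineq norm_triangle_ineq order_trans)
      also have "\<dots> = norm (r - q) * (norm q + norm r)" by (simp add: norm_minus_commute algebra_simps)
      also have "\<dots> \<le> \<eta> * (2 * norm r + 1)"
      proof (intro mult_mono)
        have "norm q \<le> norm r + norm (r - q)" by (metis norm_minus_commute norm_triangle_sub)
        then show "norm q + norm r \<le> 2 * norm r + 1" using q(2) \<eta>(2) by simp
      qed (use q(2) \<eta>(1) in auto)
      finally show ?thesis using \<eta>(3) by simp
    qed
    \<comment> \<open>A level below \<open>2 * t / 3\<close> keeps the cut-off outside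
      \<open>K\<close>; a level above \<open>t / 3\<close> exceeds the distance from
      \<open>star q * q\<close> to \<open>star r * r\<close>.\<close>
    obtain s where s: "s \<in> \<rat>" "t / 3 < s" "s < 2 * t / 3" using Rats_dense_in_real[of "t/3" "2*t/3"] t(1) by auto
    have s0: "s > 0" using s(2) t(1) by simp
    define v where "v = cut x s"
    obtain w where v: "pos v" "v \<in> A" "norm (x - v) \<le> s" "x = of_real s + v - w" "v * w = 0"
      using cut[OF qA[OF q(1)] s0] by (auto simp: v_def x_def)
    have vK: "v \<notin> K"
    proof
      assume "v \<in> K"
      then have "t \<le> norm (star r * r - v)" by (rule t(2))
      also have "\<dots> \<le> norm (x - star r * r) + norm (x - v)"
        using norm_triangle_ineq[of "star r * r - x" "x - v"] by (simp add: norm_minus_commute)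
      also have "\<dots> < t / 3 + 2 * t / 3" using close v(3) s(3) by linarith
      finally show False by simp
    qed
    have "(q, s) \<in> N" using q(1) s(1) s0 by (simp add: N_def)
    then obtain n where "from_nat_into N n = (q, s)" using from_nat_into_surj[OF cN] by blast
    then have "p n = v" using vK by (simp add: p_def v_def x_def)
    then obtain c where c: "c \<in> A" "0 < f (star c * v * c)" using f(3)[of n] by auto
    have sv: "star v = v" using pos_sa[OF v(1)] .
    define u where "u = v * c"
    \<comment> \<open>Cauchy-Schwarz for \<open>star c * u\<close>, at which the state is
      positive.\<close>
    have fu: "0 < f (star u * u)"
    proof -
      have "(f (star c * u))\<^sup>2 \<le> f (star u * u) * f (star c * c)" by (rule state_cauchy_schwarz[OF st])
      moreover have "0 < (f (star c * u))\<^sup>2" using c(2) by (simp add: u_def mult.assoc)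
      ultimately have "f (star u * u) \<noteq> 0" by auto
      then show ?thesis using state_pos[OF st pos_star_mult[of u]] by simp
    qed
    have "pos (star c * (v * v * v) * c)"
      using pos_mult[OF pos_square[OF sv] v(1)] by (intro pos_conj) (simp add: mult.assoc)
    moreover have "star c * (v * v * v) * c = star u * x * u - s *\<^sub>R (star u * u)"
    proof -
      \<comment> \<open>Because \<open>v * w = 0\<close>, the part of \<open>x\<close> below the
        level \<open>s\<close> is invisible to \<open>v\<close>.\<close>
      have "v * x * v = s *\<^sub>R (v * v) + v * v * v" by (simp add: v(4) algebra_simps of_real_def v(5) flip: mult.assoc)
      then have "star c * (v * x * v) * c = s *\<^sub>R (star c * (v * v) * c) + star c * (v * v * v) * c"
        by (simp add: distrib_left distrib_right)
      then show ?thesis by (simp add: u_def star_mult sv mult.assoc)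
    qed
    ultimately have "0 \<le> f (star u * x * u - s *\<^sub>R (star u * u))" using state_pos[OF st] by metis
    then have 1: "s * f (star u * u) \<le> f (star u * x * u)" by (simp add: state_diff[OF st] state_scaleR[OF st])
    have "pos (of_real (t / 3) - (x - star r * r))"
      using close by (intro pos_of_norm_le) (auto simp: x_def star_simps)
    then have "pos (star u * (of_real (t / 3) - (x - star r * r)) * u)" by (rule pos_conj)
    then have "0 \<le> f (star u * (of_real (t / 3) - (x - star r * r)) * u)" by (rule state_pos[OF st])
    also have "star u * (of_real (t / 3) - (x - star r * r)) * u =
        (t / 3) *\<^sub>R (star u * u) - star u * x * u + (star u * star r) * (r * u)"
      by (simp add: algebra_simps of_real_def)
    also have "f \<dots> = (t / 3) * f (star u * u) - f (star u * x * u) + f ((star u * star r) * (r * u))"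
      by (simp only: state_add[OF st] state_diff[OF st] state_scaleR[OF st])
    also have "f ((star u * star r) * (r * u)) = 0"
      by (intro i(2) ideal_mult_left[OF J(1)[OF i(1)]] ideal_mult_right[OF J(1)[OF i(1)]] rJ UNIV_I)
    finally have "s * f (star u * u) \<le> (t / 3) * f (star u * u)" using 1 by simp
    then show False using fu s(2) by simp
  qed
  then show ?thesis using i(1) by blast
qed

theorem mem_A: "T \<in> A"
proof (rule ccontr)
  assume "T \<notin> A"
  then obtain d where d: "d > 0" "\<And>a. a \<in> A \<Longrightarrow> d \<le> norm (T - a)"
    using closed_distance[OF subalg_closed[OF A]] by blast
  define \<K> where "\<K> = {K. ideal_in A K \<and> Z \<subseteq> K \<and> \<not> approximable A T d K}"
  have "\<exists>M\<in>\<K>. \<forall>X\<in>\<K>. M \<subseteq> X \<longrightarrow> X = M"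
  proof (rule subset_Zorn_nonempty)
    \<comment> \<open>\<open>Z\<close> is an ideal of the whole algebra and lies in
      \<open>A\<close>, so a correction from \<open>Z\<close> stays in \<open>A\<close>, at distance
      at least \<open>d\<close> from \<open>T\<close>.\<close>
    have "\<not> approximable A T d Z"
    proof
      assume "approximable A T d Z"
      then obtain a k b where k: "a \<in> A" "k \<in> Z" "norm (T - a - k * b * star k) < d" by (auto simp: approximable_def)
      have "k * b * star k \<in> Z" by (intro ideal_mult_right[OF Z(1) UNIV_I] k)
      then have "a + k * b * star k \<in> A" using subalg_add[OF A k(1)] Z(2) by blast
      then show False using d(2)[of "a + k * b * star k"] k(3) by (simp add: diff_diff_add)
    qed
    moreover have "ideal_in A Z" using Z by (auto simp: ideal_in_def)
    ultimately show "\<K> \<noteq> {}" by (auto simp: \<K>_def)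
    fix C assume C: "C \<noteq> {}" "subset.chain \<K> C"
    then have CK: "C \<subseteq> \<K>" and ch: "\<And>X Y. X \<in> C \<Longrightarrow> Y \<in> C \<Longrightarrow> X \<subseteq> Y \<or> Y \<subseteq> X"
      by (auto simp: subset_chain_def)
    have id: "ideal_in A X" if "X \<in> C" for X using CK that by (auto simp: \<K>_def)
    have "ideal_in A (\<Union>C)"
      unfolding ideal_in_def
    proof (intro conjI ballI)
      show "\<Union>C \<subseteq> A" using ideal_subset[OF id] by blast
      show "0 \<in> \<Union>C" using C(1) id ideal_zero by blast
      fix x assume "x \<in> \<Union>C"
      then obtain X where X: "X \<in> C" "x \<in> X" by blast
      show "x + y \<in> \<Union>C" if "y \<in> \<Union>C" for y
      proof -
        obtain Y where Y: "Y \<in> C" "y \<in> Y" using \<open>y \<in> \<Union>C\<close> by blast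
        then show ?thesis using ch[OF X(1) Y(1)] X ideal_add[OF id] by blast
      qed
      fix a assume "a \<in> A"
      then show "a * x \<in> \<Union>C" "x * a \<in> \<Union>C" using X ideal_mult_left[OF id] ideal_mult_right[OF id] by blast+
    qed
    moreover have "Z \<subseteq> \<Union>C" using C(1) CK by (auto simp: \<K>_def)
    moreover have "\<not> approximable A T d (\<Union>C)"
      using CK by (auto simp: \<K>_def approximable_def)
    ultimately show "\<Union>C \<in> \<K>" by (simp add: \<K>_def)
  qed
  then obtain K where K: "K \<in> \<K>" and max: "\<And>X. X \<in> \<K> \<Longrightarrow> K \<subseteq> X \<Longrightarrow> X = K" by blast
  have K': "ideal_in A K" "Z \<subseteq> K" "\<not> approximable A T d K" using K by (auto simp: \<K>_def)
  have "\<exists>i\<in>I. A \<inter> J i \<subseteq> K"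
    using K' max by (intro prime_ideal_contains[OF d(1)]) (auto simp: \<K>_def)
  then show False using approximable_J d(1) K'(3) by blast
qed

end

section \<open>From carrier sets to a type\<close>

text \<open>Serves \<open>B\<close> with \<open>nrm\<close> as well as the GNS space with
  \<open>hnorm\<close>: the topological notions defined through \<open>norm_topology\<close> and
  \<open>norm_dist\<close> become statements about sequences and norms.\<close>

locale normed_group = abelian_group M for M :: "('a, 'm) ring_scheme" (structure) and n :: "'a \<Rightarrow> real" +
  assumes n_nonneg: "x \<in> carrier M \<Longrightarrow> 0 \<le> n x"
    and n_eq_0: "x \<in> carrier M \<Longrightarrow> n x = 0 \<longleftrightarrow> x = \<zero>"
    and n_uminus: "x \<in> carrier M \<Longrightarrow> n (\<ominus> x) = n x"
    and n_triangle: "x \<in> carrier M \<Longrightarrow> y \<in> carrier M \<Longrightarrow> n (x \<oplus> y) \<le> n x + n y"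
begin

lemma n_minus_commute: "x \<in> carrier M \<Longrightarrow> y \<in> carrier M \<Longrightarrow> n (x \<ominus> y) = n (y \<ominus> x)"
  using n_uminus[of "x \<ominus> y"] by (simp add: minus_eq minus_add a_comm)

lemma n_triangle_minus:
  assumes "x \<in> carrier M" "y \<in> carrier M" "z \<in> carrier M"
  shows "n (x \<ominus> z) \<le> n (x \<ominus> y) + n (y \<ominus> z)"
proof -
  have "x \<ominus> z = (x \<ominus> y) \<oplus> (y \<ominus> z)"
    using assms by (simp add: minus_eq a_assoc r_neg2 r_neg1 a_lcomm)
  then show ?thesis using n_triangle[of "x \<ominus> y" "y \<ominus> z"] assms by simp
qed

lemma n_minus_eq_0: "x \<in> carrier M \<Longrightarrow> y \<in> carrier M \<Longrightarrow> n (x \<ominus> y) = 0 \<longleftrightarrow> x = y"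
  using minus_equality[of x "\<ominus> y"] by (auto simp: n_eq_0 minus_eq r_neg)

lemma metric: "Metric_space (carrier M) (norm_dist M n)"
proof
  show "0 \<le> norm_dist M n x y" for x y by (simp add: norm_dist_def n_nonneg)
  show "norm_dist M n x y = norm_dist M n y x" for x y by (auto simp: norm_dist_def n_minus_commute)
  show "norm_dist M n x y = 0 \<longleftrightarrow> x = y" if "x \<in> carrier M" "y \<in> carrier M" for x y
    using that by (simp add: norm_dist_def n_minus_eq_0)
  show "norm_dist M n x z \<le> norm_dist M n x y + norm_dist M n y z"
    if "x \<in> carrier M" "y \<in> carrier M" "z \<in> carrier M" for x y z
    using that by (simp add: norm_dist_def n_triangle_minus)
qed

definition conv :: "(nat \<Rightarrow> 'a) \<Rightarrow> 'a \<Rightarrow> bool" where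
  "conv s l \<longleftrightarrow> l \<in> carrier M \<and> (\<forall>k. s k \<in> carrier M) \<and> (\<forall>e>0. \<exists>N. \<forall>k\<ge>N. n (s k \<ominus> l) < e)"

lemma limitin_iff:
  assumes "\<And>k. s k \<in> carrier M"
  shows "limitin (norm_topology M n) s l sequentially \<longleftrightarrow> conv s l"
  using assms unfolding norm_topology_def Metric_space.limit_metric_sequentially[OF metric] conv_def
  by (auto simp: norm_dist_def)

lemma mcomplete_iff:
  "Metric_space.mcomplete (carrier M) (norm_dist M n) \<longleftrightarrow>
    (\<forall>s. (\<forall>k. s k \<in> carrier M) \<and> (\<forall>e>0. \<exists>N. \<forall>i\<ge>N. \<forall>j\<ge>N. n (s i \<ominus> s j) < e) \<longrightarrow> (\<exists>l. conv s l))"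
proof -
  have "Metric_space.MCauchy (carrier M) (norm_dist M n) s \<longleftrightarrow>
      (\<forall>k. s k \<in> carrier M) \<and> (\<forall>e>0. \<exists>N. \<forall>i\<ge>N. \<forall>j\<ge>N. n (s i \<ominus> s j) < e)" for s
  proof (cases "\<forall>k. s k \<in> carrier M")
    case True
    then have "norm_dist M n (s i) (s j) = n (s i \<ominus> s j)" for i j by (simp add: norm_dist_def)
    then show ?thesis using True by (auto simp: Metric_space.MCauchy_def[OF metric])
  qed (auto simp: Metric_space.MCauchy_def[OF metric])
  then show ?thesis
    unfolding Metric_space.mcomplete_def[OF metric]
    using limitin_iff by (auto simp: norm_topology_def)
qed

lemma closedin_iff:
  "closedin (norm_topology M n) S \<longleftrightarrow> S \<subseteq> carrier M \<and> (\<forall>s l. (\<forall>k. s k \<in> S) \<and> conv s l \<longrightarrow> l \<in> S)"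
proof (cases "S \<subseteq> carrier M")
  case True
  have "(\<forall>k. s k \<in> S) \<and> conv s l \<longleftrightarrow> range s \<subseteq> S \<and> limitin (norm_topology M n) s l sequentially" for s l
  proof (cases "range s \<subseteq> S")
    case range: True
    then have "s k \<in> carrier M" for k using True by auto
    then show ?thesis using limitin_iff[of s l] range by auto
  qed auto
  then show ?thesis
    using True unfolding norm_topology_def Metric_space.metric_closedin_iff_sequentially_closed[OF metric] by simp
next
  case False
  then show ?thesis
    unfolding norm_topology_def Metric_space.metric_closedin_iff_sequentially_closed[OF metric] by simp
qed

lemma separable_iff:
  "separable_space (norm_topology M n) \<longleftrightarrow>
    (\<exists>C. countable C \<and> C \<subseteq> carrier M \<and> (\<forall>x\<in>carrier M. \<forall>e>0. \<exists>c\<in>C. n (x \<ominus> c) < e))"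
proof -
  have "(norm_topology M n) closure_of C = carrier M \<longleftrightarrow> (\<forall>x\<in>carrier M. \<forall>e>0. \<exists>c\<in>C. n (x \<ominus> c) < e)"
    if C: "C \<subseteq> carrier M" for C
  proof -
    have "(\<exists>c\<in>C. c \<in> Metric_space.mball (carrier M) (norm_dist M n) x e) \<longleftrightarrow> (\<exists>c\<in>C. n (x \<ominus> c) < e)"
      if "x \<in> carrier M" for x e
      using that C by (intro bex_cong refl) (auto simp: Metric_space.in_mball[OF metric] norm_dist_def)
    then show ?thesis
      unfolding norm_topology_def Metric_space.metric_closure_of[OF metric] by blast
  qed
  moreover have "topspace (norm_topology M n) = carrier M"
    unfolding norm_topology_def by (rule Metric_space.topspace_mtopology[OF metric])
  ultimately show ?thesis unfolding separable_space_def by auto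
qed

end

context unital_cstar_algebra
begin

lemma smult_simps:
  assumes "x \<in> carrier B" "y \<in> carrier B"
  shows "c \<odot> x \<in> carrier B" "(c + d) \<odot> x = c \<odot> x \<oplus> d \<odot> x" "c \<odot> (x \<oplus> y) = c \<odot> x \<oplus> c \<odot> y"
    "(c * d) \<odot> x = c \<odot> (d \<odot> x)" "1 \<odot> x = x"
  using assms V.smult_closed[of c x] V.smult_l_distr[of c d x] V.smult_r_distr[of c x y]
    V.smult_assoc1[of c d x] V.smult_one[of x]
  by (simp_all add: complex_ring_def)

lemma smult_uminus: assumes "x \<in> carrier B" shows "(- 1) \<odot> x = \<ominus> x"
proof -
  have "0 \<odot> x = \<zero>" using V.smult_l_null[OF assms] by (simp add: complex_ring_def)
  then have "(- 1) \<odot> x \<oplus> x = \<zero>" using smult_simps(2)[OF assms assms, of "-1" 1] smult_simps(5)[OF assms assms] by simp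
  then show ?thesis using minus_equality assms smult_simps(1)[OF assms assms] by metis
qed

lemma nrm_uminus: "x \<in> carrier B \<Longrightarrow> nrm B (\<ominus> x) = nrm B x"
  using nrm_smult[of x "-1"] by (simp add: smult_uminus)

lemma nrm_zero: "nrm B \<zero> = 0"
  using nrm_eq_0[of \<zero>] by simp

lemma normed: "normed_group B (nrm B)"
  by unfold_locales (auto simp: nrm_nonneg nrm_eq_0 nrm_uminus nrm_triangle)

lemma adj_one: "adj B \<one> = \<one>"
  using adj_mult[of \<one> "adj B \<one>"] by (simp add: adj_closed adj_adj)

lemma nrm_one: "nrm B \<one> \<le> 1"
proof -
  have "nrm B \<one> = (nrm B \<one>)\<^sup>2" using cstar_identity[of \<one>] by (simp add: adj_one)
  then show ?thesis by (auto simp: power2_eq_square)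
qed

lemma nrm_minus_le: "x \<in> carrier B \<Longrightarrow> y \<in> carrier B \<Longrightarrow> nrm B (x \<ominus> y) \<le> nrm B x + nrm B y"
  using nrm_triangle[of x "\<ominus> y"] by (simp add: minus_eq nrm_uminus)

end

text \<open>The bounded families indexed by all unital C*-algebras \<open>B\<close> with elements in \<open>'a\<close> form a
  C*-algebra that is a type and has every such \<open>B\<close> as a quotient. The additional scalar
  component ensures \<open>0 \<noteq> 1\<close>, since all \<open>B\<close> are zero if \<open>'a\<close> has only one element.\<close>

definition bounded_family :: "('a star_alg \<Rightarrow> 'a) \<Rightarrow> bool" where
  "bounded_family f \<longleftrightarrow> (\<forall>B. unital_cstar_algebra B \<longrightarrow> f B \<in> carrier B) \<and>
     (\<forall>B. \<not> unital_cstar_algebra B \<longrightarrow> f B = undefined) \<and>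
     (\<exists>K. \<forall>B. unital_cstar_algebra B \<longrightarrow> nrm B (f B) \<le> K)"

text \<open>The fixed value off the C*-algebras normalises families, so that equality can be checked
  on components, as in \<open>component_eqI\<close>.\<close>

definition on_cstar :: "('a star_alg \<Rightarrow> 'a) \<Rightarrow> 'a star_alg \<Rightarrow> 'a" where
  "on_cstar f B = (if unital_cstar_algebra B then f B else undefined)"

lemma bounded_family_on_cstar:
  assumes "\<And>B. unital_cstar_algebra B \<Longrightarrow> f B \<in> carrier B \<and> nrm B (f B) \<le> K"
  shows "bounded_family (on_cstar f)"
  using assms by (auto simp: bounded_family_def on_cstar_def)

typedef 'a cstar_prod = "{p :: complex \<times> ('a star_alg \<Rightarrow> 'a). bounded_family (snd p)}"
proof -
  have "bounded_family (on_cstar (\<lambda>B :: 'a star_alg. \<zero>\<^bsub>B\<^esub>))"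
  proof (rule bounded_family_on_cstar[where K=0])
    fix B :: "'a star_alg" assume "unital_cstar_algebra B"
    then interpret unital_cstar_algebra B .
    show "\<zero>\<^bsub>B\<^esub> \<in> carrier B \<and> nrm B \<zero>\<^bsub>B\<^esub> \<le> 0" by (simp add: nrm_zero)
  qed
  then show ?thesis by (intro exI[of _ "(0, on_cstar (\<lambda>B. \<zero>\<^bsub>B\<^esub>))"]) simp
qed

definition scalar :: "'a cstar_prod \<Rightarrow> complex" where
  "scalar x = fst (Rep_cstar_prod x)"

definition component :: "'a cstar_prod \<Rightarrow> 'a star_alg \<Rightarrow> 'a" where
  "component x = snd (Rep_cstar_prod x)"

definition family :: "complex \<Rightarrow> ('a star_alg \<Rightarrow> 'a) \<Rightarrow> 'a cstar_prod" where
  "family z f = Abs_cstar_prod (z, on_cstar f)"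

lemma Rep_family:
  assumes "\<And>B. unital_cstar_algebra B \<Longrightarrow> f B \<in> carrier B \<and> nrm B (f B) \<le> K"
  shows "Rep_cstar_prod (family z f) = (z, on_cstar f)"
  using Abs_cstar_prod_inverse[of "(z, on_cstar f)"] bounded_family_on_cstar[of f K, OF assms] by (simp add: family_def)

lemma component_family:
  assumes "unital_cstar_algebra B" "\<And>B. unital_cstar_algebra B \<Longrightarrow> f B \<in> carrier B \<and> nrm B (f B) \<le> K"
  shows "component (family z f) B = f B"
  using assms(1) Rep_family[of f K z, OF assms(2)] by (simp add: component_def on_cstar_def)

lemma scalar_family:
  assumes "\<And>B. unital_cstar_algebra B \<Longrightarrow> f B \<in> carrier B \<and> nrm B (f B) \<le> K"
  shows "scalar (family z f) = z"
  using Rep_family[of f K z, OF assms] by (simp add: scalar_def)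

lemma bounded_family_component: "bounded_family (component x)"
  using Rep_cstar_prod[of x] by (simp add: component_def)

lemma component_closed: "unital_cstar_algebra B \<Longrightarrow> component x B \<in> carrier B"
  using bounded_family_component[of x] by (auto simp: bounded_family_def)

lemma component_eqI:
  assumes "scalar x = scalar y" "\<And>B. unital_cstar_algebra B \<Longrightarrow> component x B = component y B"
  shows "x = y"
proof -
  have "component x B = component y B" for B
    using assms(2)[of B] bounded_family_component[of x] bounded_family_component[of y]
    by (cases "unital_cstar_algebra B") (auto simp: bounded_family_def)
  then have "Rep_cstar_prod x = Rep_cstar_prod y"
    using assms(1) by (auto simp: component_def scalar_def intro: prod_eqI)
  then show ?thesis using Rep_cstar_prod_inject by blast
qed

section \<open>Pointwise operations and the supremum norm\<close>

instantiation cstar_prod :: (type) "{zero, one, plus, minus, uminus, times, scaleR}"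
begin

definition "0 = family 0 (\<lambda>B. \<zero>\<^bsub>B\<^esub>)"
definition "1 = family 1 (\<lambda>B. \<one>\<^bsub>B\<^esub>)"
definition "x + y = family (scalar x + scalar y) (\<lambda>B. component x B \<oplus>\<^bsub>B\<^esub> component y B)"
definition "x - y = family (scalar x - scalar y) (\<lambda>B. component x B \<ominus>\<^bsub>B\<^esub> component y B)"
definition "- x = family (- scalar x) (\<lambda>B. \<ominus>\<^bsub>B\<^esub> component x B)"
definition "x * y = family (scalar x * scalar y) (\<lambda>B. component x B \<otimes>\<^bsub>B\<^esub> component y B)"
definition "r *\<^sub>R x = family (complex_of_real r * scalar x) (\<lambda>B. complex_of_real r \<odot>\<^bsub>B\<^esub> component x B)"

instance ..

end

definition fam_norm :: "'a cstar_prod \<Rightarrow> real" where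
  "fam_norm x = Sup (insert (cmod (scalar x)) {nrm B (component x B) |B. unital_cstar_algebra B})"

lemma bdd_above_component:
  "bdd_above (insert (cmod (scalar x)) {nrm B (component x B) |B. unital_cstar_algebra B})"
proof -
  obtain K where "\<And>B. unital_cstar_algebra B \<Longrightarrow> nrm B (component x B) \<le> K"
    using bounded_family_component[of x] unfolding bounded_family_def by blast
  then show ?thesis by (intro bdd_aboveI[of _ "max (cmod (scalar x)) K"]) (auto simp: le_max_iff_disj)
qed

lemma component_fam_norm_le: "unital_cstar_algebra B \<Longrightarrow> nrm B (component x B) \<le> fam_norm x"
  unfolding fam_norm_def by (rule cSup_upper[OF _ bdd_above_component]) blast

lemma scalar_fam_norm_le: "cmod (scalar x) \<le> fam_norm x"
  unfolding fam_norm_def by (rule cSup_upper[OF _ bdd_above_component]) blast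

lemma fam_norm_nonneg: "0 \<le> fam_norm x"
  using scalar_fam_norm_le[of x] norm_ge_zero order_trans by blast

lemma fam_norm_leI:
  fixes x :: "'a cstar_prod"
  assumes "cmod (scalar x) \<le> c" "\<And>B. unital_cstar_algebra B \<Longrightarrow> nrm B (component x B) \<le> c"
  shows "fam_norm x \<le> c"
  unfolding fam_norm_def using assms by (intro cSup_least) auto

lemma component_zero: "unital_cstar_algebra B \<Longrightarrow> component (0 :: 'a cstar_prod) B = \<zero>\<^bsub>B\<^esub>"
  and scalar_zero: "scalar (0 :: 'a cstar_prod) = 0"
proof -
  have *: "\<zero>\<^bsub>B\<^esub> \<in> carrier B \<and> nrm B \<zero>\<^bsub>B\<^esub> \<le> 0" if B: "unital_cstar_algebra B" for B :: "'a star_alg"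
  proof -
    interpret unital_cstar_algebra B by fact
    show ?thesis by (simp add: nrm_zero)
  qed
  show "component (0 :: 'a cstar_prod) B = \<zero>\<^bsub>B\<^esub>" if "unital_cstar_algebra B"
    unfolding zero_cstar_prod_def using that * by (rule component_family)
  show "scalar (0 :: 'a cstar_prod) = 0"
    unfolding zero_cstar_prod_def using * by (rule scalar_family)
qed

lemma component_one: "unital_cstar_algebra B \<Longrightarrow> component (1 :: 'a cstar_prod) B = \<one>\<^bsub>B\<^esub>"
  and scalar_one: "scalar (1 :: 'a cstar_prod) = 1"
proof -
  have *: "\<one>\<^bsub>B\<^esub> \<in> carrier B \<and> nrm B \<one>\<^bsub>B\<^esub> \<le> 1" if B: "unital_cstar_algebra B" for B :: "'a star_alg"
  proof -
    interpret unital_cstar_algebra B by fact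
    show ?thesis by (simp add: nrm_one)
  qed
  show "component (1 :: 'a cstar_prod) B = \<one>\<^bsub>B\<^esub>" if "unital_cstar_algebra B"
    unfolding one_cstar_prod_def using that * by (rule component_family)
  show "scalar (1 :: 'a cstar_prod) = 1"
    unfolding one_cstar_prod_def using * by (rule scalar_family)
qed

lemma component_add: "unital_cstar_algebra B \<Longrightarrow> component (x + y) B = component x B \<oplus>\<^bsub>B\<^esub> component y B"
  and scalar_add: "scalar (x + y) = scalar x + scalar y"
proof -
  have *: "component x B \<oplus>\<^bsub>B\<^esub> component y B \<in> carrier B \<and> nrm B (component x B \<oplus>\<^bsub>B\<^esub> component y B) \<le> fam_norm x + fam_norm y" if B: "unital_cstar_algebra B" for B :: "'a star_alg"
  proof -
    interpret unital_cstar_algebra B by fact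
    note c = component_closed[OF B]
    show ?thesis
      using order_trans[OF nrm_triangle add_mono[OF component_fam_norm_le component_fam_norm_le]] c B by blast
  qed
  show "component (x + y) B = component x B \<oplus>\<^bsub>B\<^esub> component y B" if "unital_cstar_algebra B"
    unfolding plus_cstar_prod_def using that * by (rule component_family)
  show "scalar (x + y) = scalar x + scalar y"
    unfolding plus_cstar_prod_def using * by (rule scalar_family)
qed

lemma component_diff: "unital_cstar_algebra B \<Longrightarrow> component (x - y) B = component x B \<ominus>\<^bsub>B\<^esub> component y B"
  and scalar_diff: "scalar (x - y) = scalar x - scalar y"
proof -
  have *: "component x B \<ominus>\<^bsub>B\<^esub> component y B \<in> carrier B \<and> nrm B (component x B \<ominus>\<^bsub>B\<^esub> component y B) \<le> fam_norm x + fam_norm y" if B: "unital_cstar_algebra B" for B :: "'a star_alg"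
  proof -
    interpret unital_cstar_algebra B by fact
    note c = component_closed[OF B]
    show ?thesis
      using order_trans[OF nrm_minus_le add_mono[OF component_fam_norm_le component_fam_norm_le]] c B by blast
  qed
  show "component (x - y) B = component x B \<ominus>\<^bsub>B\<^esub> component y B" if "unital_cstar_algebra B"
    unfolding minus_cstar_prod_def using that * by (rule component_family)
  show "scalar (x - y) = scalar x - scalar y"
    unfolding minus_cstar_prod_def using * by (rule scalar_family)
qed

lemma component_minus: "unital_cstar_algebra B \<Longrightarrow> component (- x) B = \<ominus>\<^bsub>B\<^esub> component x B"
  and scalar_minus: "scalar (- x) = - scalar x"
proof -
  have *: "\<ominus>\<^bsub>B\<^esub> component x B \<in> carrier B \<and> nrm B (\<ominus>\<^bsub>B\<^esub> component x B) \<le> fam_norm x" if B: "unital_cstar_algebra B" for B :: "'a star_alg"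
  proof -
    interpret unital_cstar_algebra B by fact
    show ?thesis
      using component_fam_norm_le[OF B] component_closed[OF B] by (simp add: nrm_uminus)
  qed
  show "component (- x) B = \<ominus>\<^bsub>B\<^esub> component x B" if "unital_cstar_algebra B"
    unfolding uminus_cstar_prod_def using that * by (rule component_family)
  show "scalar (- x) = - scalar x"
    unfolding uminus_cstar_prod_def using * by (rule scalar_family)
qed

lemma component_mult: "unital_cstar_algebra B \<Longrightarrow> component (x * y) B = component x B \<otimes>\<^bsub>B\<^esub> component y B"
  and scalar_mult: "scalar (x * y) = scalar x * scalar y"
proof -
  have *: "component x B \<otimes>\<^bsub>B\<^esub> component y B \<in> carrier B \<and> nrm B (component x B \<otimes>\<^bsub>B\<^esub> component y B) \<le> fam_norm x * fam_norm y" if B: "unital_cstar_algebra B" for B :: "'a star_alg"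
  proof -
    interpret unital_cstar_algebra B by fact
    note c = component_closed[OF B]
    have "nrm B (component x B \<otimes>\<^bsub>B\<^esub> component y B) \<le> nrm B (component x B) * nrm B (component y B)"
      using c by (intro nrm_mult)
    also have "\<dots> \<le> fam_norm x * fam_norm y"
      using c by (intro mult_mono component_fam_norm_le B nrm_nonneg fam_norm_nonneg)
    finally show ?thesis
      using c by simp
  qed
  show "component (x * y) B = component x B \<otimes>\<^bsub>B\<^esub> component y B" if "unital_cstar_algebra B"
    unfolding times_cstar_prod_def using that * by (rule component_family)
  show "scalar (x * y) = scalar x * scalar y"
    unfolding times_cstar_prod_def using * by (rule scalar_family)
qed

lemma component_scaleR: "unital_cstar_algebra B \<Longrightarrow> component (r *\<^sub>R x) B = complex_of_real r \<odot>\<^bsub>B\<^esub> component x B"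
  and scalar_scaleR: "scalar (r *\<^sub>R x) = complex_of_real r * scalar x"
proof -
  have *: "complex_of_real r \<odot>\<^bsub>B\<^esub> component x B \<in> carrier B \<and> nrm B (complex_of_real r \<odot>\<^bsub>B\<^esub> component x B) \<le> \<bar>r\<bar> * fam_norm x" if B: "unital_cstar_algebra B" for B :: "'a star_alg"
  proof -
    interpret unital_cstar_algebra B by fact
    note c = component_closed[OF B]
    show ?thesis
      using smult_simps(1)[OF c c] by (simp add: nrm_smult c mult_left_mono component_fam_norm_le B)
  qed
  show "component (r *\<^sub>R x) B = complex_of_real r \<odot>\<^bsub>B\<^esub> component x B" if "unital_cstar_algebra B"
    unfolding scaleR_cstar_prod_def using that * by (rule component_family)
  show "scalar (r *\<^sub>R x) = complex_of_real r * scalar x"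
    unfolding scaleR_cstar_prod_def using * by (rule scalar_family)
qed

lemmas scalar_simps = scalar_zero scalar_one scalar_add scalar_diff scalar_minus scalar_mult scalar_scaleR

lemmas component_simps = component_zero component_one component_add component_diff component_minus
  component_mult component_scaleR

instantiation cstar_prod :: (type) "{real_normed_algebra, real_algebra_1}"
begin

definition "norm x = fam_norm x"
definition "dist (x :: 'a cstar_prod) y = fam_norm (x - y)"
definition "sgn (x :: 'a cstar_prod) = x /\<^sub>R fam_norm x"
definition [code del]: "(uniformity :: ('a cstar_prod \<times> 'a cstar_prod) filter) = (INF e\<in>{0<..}. principal {(x, y). dist x y < e})"
definition [code del]: "open (U :: 'a cstar_prod set) \<longleftrightarrow> (\<forall>x\<in>U. eventually (\<lambda>(x', y). x' = x \<longrightarrow> y \<in> U) uniformity)"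

instance
proof
  fix x y z :: "'a cstar_prod" and r s :: real
  show "x + y + z = x + (y + z)" "x + y = y + x" "0 + x = x" "- x + x = 0" "x - y = x + - y"
    "x * y * z = x * (y * z)" "1 * x = x" "x * 1 = x" "(x + y) * z = x * z + y * z" "x * (y + z) = x * y + x * z"
    "r *\<^sub>R (x + y) = r *\<^sub>R x + r *\<^sub>R y" "(r + s) *\<^sub>R x = r *\<^sub>R x + s *\<^sub>R x" "r *\<^sub>R s *\<^sub>R x = (r * s) *\<^sub>R x"
    "1 *\<^sub>R x = x" "r *\<^sub>R x * y = r *\<^sub>R (x * y)" "x * r *\<^sub>R y = r *\<^sub>R (x * y)"
  proof -
    have *: "component (x + y + z) B = component (x + (y + z)) B" "component (x + y) B = component (y + x) B"
       "component (0 + x) B = component x B" "component (- x + x) B = component 0 B" "component (x - y) B = component (x + - y) B"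
       "component (x * y * z) B = component (x * (y * z)) B" "component (1 * x) B = component x B" "component (x * 1) B = component x B"
       "component ((x + y) * z) B = component (x * z + y * z) B" "component (x * (y + z)) B = component (x * y + x * z) B"
       "component (r *\<^sub>R (x + y)) B = component (r *\<^sub>R x + r *\<^sub>R y) B" "component ((r + s) *\<^sub>R x) B = component (r *\<^sub>R x + s *\<^sub>R x) B"
       "component (r *\<^sub>R s *\<^sub>R x) B = component ((r * s) *\<^sub>R x) B" "component (1 *\<^sub>R x) B = component x B"
       "component (r *\<^sub>R x * y) B = component (r *\<^sub>R (x * y)) B" "component (x * r *\<^sub>R y) B = component (r *\<^sub>R (x * y)) B"
      if B: "unital_cstar_algebra B" for B
    proof -
      interpret unital_cstar_algebra B by fact
      note c = component_closed[OF B]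
      show "component (x + y + z) B = component (x + (y + z)) B" by (simp add: component_simps[OF B] c a_assoc)
      show "component (x + y) B = component (y + x) B" by (simp add: component_simps[OF B] c a_comm)
      note simps = component_simps[OF B] c smult_simps[OF c c] smult_mult_left[OF c c] smult_mult_right[OF c c]
        l_neg minus_eq m_assoc l_distr r_distr
      show "component (0 + x) B = component x B" "component (- x + x) B = component 0 B" "component (x - y) B = component (x + - y) B"
        "component (x * y * z) B = component (x * (y * z)) B" "component (1 * x) B = component x B" "component (x * 1) B = component x B"
        "component ((x + y) * z) B = component (x * z + y * z) B" "component (x * (y + z)) B = component (x * y + x * z) B"
        "component (r *\<^sub>R (x + y)) B = component (r *\<^sub>R x + r *\<^sub>R y) B" "component ((r + s) *\<^sub>R x) B = component (r *\<^sub>R x + s *\<^sub>R x) B"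
        "component (r *\<^sub>R s *\<^sub>R x) B = component ((r * s) *\<^sub>R x) B" "component (1 *\<^sub>R x) B = component x B"
        "component (r *\<^sub>R x * y) B = component (r *\<^sub>R (x * y)) B" "component (x * r *\<^sub>R y) B = component (r *\<^sub>R (x * y)) B"
        by (simp_all add: simps)
    qed
    show "x + y + z = x + (y + z)" "x + y = y + x" "0 + x = x" "- x + x = 0" "x - y = x + - y"
      "x * y * z = x * (y * z)" "1 * x = x" "x * 1 = x" "(x + y) * z = x * z + y * z" "x * (y + z) = x * y + x * z"
      "r *\<^sub>R (x + y) = r *\<^sub>R x + r *\<^sub>R y" "(r + s) *\<^sub>R x = r *\<^sub>R x + s *\<^sub>R x" "r *\<^sub>R s *\<^sub>R x = (r * s) *\<^sub>R x"
      "1 *\<^sub>R x = x" "r *\<^sub>R x * y = r *\<^sub>R (x * y)" "x * r *\<^sub>R y = r *\<^sub>R (x * y)"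
      by (rule component_eqI, simp add: scalar_simps algebra_simps, erule *)+
  qed
  have "fam_norm x = 0 \<longleftrightarrow> x = 0"
  proof
    assume n: "fam_norm x = 0"
    show "x = 0"
    proof (rule component_eqI)
      show "scalar x = scalar 0" using scalar_fam_norm_le[of x] n by (simp add: scalar_zero)
      fix B :: "'a star_alg" assume B: "unital_cstar_algebra B"
      interpret unital_cstar_algebra B by fact
      have "nrm B (component x B) = 0"
        using component_fam_norm_le[OF B, of x] nrm_nonneg[OF component_closed[OF B], of x] n by simp
      then show "component x B = component 0 B" using nrm_eq_0[OF component_closed[OF B]] by (simp add: component_zero[OF B])
    qed
  next
    assume "x = 0"
    have "fam_norm (0 :: 'a cstar_prod) \<le> 0"
    proof (rule fam_norm_leI)
      fix B :: "'a star_alg" assume B: "unital_cstar_algebra B"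
      then show "nrm B (component 0 B) \<le> 0" by (simp add: component_zero unital_cstar_algebra.nrm_zero)
    qed (simp add: scalar_zero)
    then show "fam_norm x = 0" using fam_norm_nonneg[of x] \<open>x = 0\<close> by simp
  qed
  then show "norm x = 0 \<longleftrightarrow> x = 0" by (simp add: norm_cstar_prod_def)
  show "norm (x + y) \<le> norm x + norm y"
    unfolding norm_cstar_prod_def
  proof (rule fam_norm_leI)
    fix B :: "'a star_alg" assume B: "unital_cstar_algebra B"
    show "nrm B (component (x + y) B) \<le> fam_norm x + fam_norm y"
      using unital_cstar_algebra.nrm_triangle[OF B component_closed[OF B] component_closed[OF B], of x y]
        component_fam_norm_le[OF B, of x] component_fam_norm_le[OF B, of y] by (simp add: component_add[OF B])
  next
    show "cmod (scalar (x + y)) \<le> fam_norm x + fam_norm y"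
      unfolding scalar_add by (intro norm_triangle_mono scalar_fam_norm_le)
  qed
  show "norm (r *\<^sub>R x) = \<bar>r\<bar> * norm x"
    unfolding norm_cstar_prod_def
  proof -
    have le: "fam_norm (r *\<^sub>R x) \<le> \<bar>r\<bar> * fam_norm x" for r and x :: "'a cstar_prod"
    proof (rule fam_norm_leI)
      fix B :: "'a star_alg" assume B: "unital_cstar_algebra B"
      show "nrm B (component (r *\<^sub>R x) B) \<le> \<bar>r\<bar> * fam_norm x"
        using unital_cstar_algebra.nrm_smult[OF B component_closed[OF B], of "complex_of_real r" x]
          component_fam_norm_le[OF B, of x] by (simp add: component_scaleR[OF B] mult_left_mono)
    qed (simp add: scalar_scaleR norm_mult mult_left_mono scalar_fam_norm_le)
    show "fam_norm (r *\<^sub>R x) = \<bar>r\<bar> * fam_norm x"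
    proof (cases "r = 0")
      case True
      then show ?thesis using le[of 0 x] fam_norm_nonneg[of "r *\<^sub>R x"] by simp
    next
      case False
      have "(1/r) *\<^sub>R r *\<^sub>R x = x"
      proof (rule component_eqI)
        fix B :: "'a star_alg" assume B: "unital_cstar_algebra B"
        interpret unital_cstar_algebra B by fact
        note c = component_closed[OF B, of x]
        show "component ((1/r) *\<^sub>R r *\<^sub>R x) B = component x B"
          using False smult_simps(4)[OF c c, of "complex_of_real (1/r)" "complex_of_real r"] smult_simps(5)[OF c c]
          by (simp add: component_scaleR[OF B])
      qed (use False in \<open>simp add: scalar_scaleR\<close>)
      then have "fam_norm x \<le> \<bar>1/r\<bar> * fam_norm (r *\<^sub>R x)" using le[of "1/r" "r *\<^sub>R x"] by simp
      then have "\<bar>r\<bar> * fam_norm x \<le> fam_norm (r *\<^sub>R x)" using False by (simp add: field_simps)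
      then show ?thesis using le[of r x] by simp
    qed
  qed
  show "norm (x * y) \<le> norm x * norm y"
    unfolding norm_cstar_prod_def
  proof (rule fam_norm_leI)
    fix B :: "'a star_alg" assume B: "unital_cstar_algebra B"
    interpret unital_cstar_algebra B by fact
    note c = component_closed[OF B]
    have "nrm B (component x B \<otimes>\<^bsub>B\<^esub> component y B) \<le> nrm B (component x B) * nrm B (component y B)"
      using c by (intro nrm_mult)
    also have "\<dots> \<le> fam_norm x * fam_norm y"
      using c by (intro mult_mono component_fam_norm_le B nrm_nonneg fam_norm_nonneg)
    finally show "nrm B (component (x * y) B) \<le> fam_norm x * fam_norm y" by (simp add: component_mult[OF B])
  next
    show "cmod (scalar (x * y)) \<le> fam_norm x * fam_norm y"
      unfolding scalar_mult norm_mult by (intro mult_mono scalar_fam_norm_le fam_norm_nonneg) auto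
  qed
  show "(0 :: 'a cstar_prod) \<noteq> 1"
    using scalar_zero scalar_one by (metis zero_neq_one)
qed (simp_all add: dist_cstar_prod_def sgn_cstar_prod_def uniformity_cstar_prod_def open_cstar_prod_def norm_cstar_prod_def)

end

lemma component_norm_le: "unital_cstar_algebra B \<Longrightarrow> nrm B (component x B) \<le> norm x"
  and scalar_norm_le: "cmod (scalar x) \<le> norm x"
  and norm_cstar_prod_leI: "cmod (scalar x) \<le> c \<Longrightarrow> (\<And>B. unital_cstar_algebra B \<Longrightarrow> nrm B (component x B) \<le> c) \<Longrightarrow> norm x \<le> c"
  by (simp_all add: norm_cstar_prod_def component_fam_norm_le scalar_fam_norm_le fam_norm_leI)

section \<open>Completeness and involution of the product algebra\<close>

instance cstar_prod :: (type) banach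
proof
  fix X :: "nat \<Rightarrow> 'a cstar_prod" assume X: "Cauchy X"
  have lim: "\<exists>l. normed_group.conv B (nrm B) (\<lambda>k. component (X k) B) l" if B: "unital_cstar_algebra B" for B
  proof -
    interpret unital_cstar_algebra B by fact
    interpret N: normed_group B "nrm B" by (rule normed)
    have "\<exists>N. \<forall>i\<ge>N. \<forall>j\<ge>N. nrm B (component (X i) B \<ominus>\<^bsub>B\<^esub> component (X j) B) < e" if e: "e > 0" for e
    proof -
      obtain N where "\<forall>i\<ge>N. \<forall>j\<ge>N. norm (X i - X j) < e" using X e by (auto simp: Cauchy_iff)
      moreover have "nrm B (component (X i) B \<ominus>\<^bsub>B\<^esub> component (X j) B) \<le> norm (X i - X j)" for i j
        using component_norm_le[OF B, of "X i - X j"] by (simp add: component_diff[OF B])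
      ultimately show ?thesis by (meson order_le_less_trans)
    qed
    then have "(\<forall>k. component (X k) B \<in> carrier B) \<and>
        (\<forall>e>0. \<exists>N. \<forall>i\<ge>N. \<forall>j\<ge>N. nrm B (component (X i) B \<ominus>\<^bsub>B\<^esub> component (X j) B) < e)"
      using component_closed[OF B] by blast
    then show ?thesis by (rule complete[unfolded N.mcomplete_iff, THEN spec, THEN mp])
  qed
  define l where "l B = (SOME y. normed_group.conv B (nrm B) (\<lambda>k. component (X k) B) y)" for B
  have l: "normed_group.conv B (nrm B) (\<lambda>k. component (X k) B) (l B)" if "unital_cstar_algebra B" for B
    unfolding l_def using someI_ex[OF lim[OF that]] .
  \<comment> \<open>The Cauchy estimate passes to the limit with the same \<open>N\<close> for all
    \<open>B\<close>; this gives both boundedness of the limit family and convergence in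
    norm.\<close>
  have bnd: "l B \<in> carrier B \<and> nrm B (component (X i) B \<ominus>\<^bsub>B\<^esub> l B) \<le> e"
    if B: "unital_cstar_algebra B" and N: "\<And>j. j \<ge> N \<Longrightarrow> norm (X i - X j) < e" for B i N e
  proof -
    interpret unital_cstar_algebra B by fact
    interpret N: normed_group B "nrm B" by (rule normed)
    have lB: "l B \<in> carrier B" using l[OF B] by (simp add: N.conv_def)
    note c = component_closed[OF B]
    have "nrm B (component (X i) B \<ominus>\<^bsub>B\<^esub> l B) \<le> e + d" if d: "d > 0" for d
    proof -
      obtain M where M: "\<And>k. k \<ge> M \<Longrightarrow> nrm B (component (X k) B \<ominus>\<^bsub>B\<^esub> l B) < d"
        using l[OF B] d unfolding N.conv_def by blast
      define j where "j = max M N"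
      have "nrm B (component (X i) B \<ominus>\<^bsub>B\<^esub> l B) \<le>
          nrm B (component (X i) B \<ominus>\<^bsub>B\<^esub> component (X j) B) + nrm B (component (X j) B \<ominus>\<^bsub>B\<^esub> l B)"
        by (intro N.n_triangle_minus c lB)
      moreover have "nrm B (component (X i) B \<ominus>\<^bsub>B\<^esub> component (X j) B) < e"
        using component_norm_le[OF B, of "X i - X j"] N[of j] by (simp add: component_diff[OF B] j_def)
      ultimately show ?thesis using M[of j] by (simp add: j_def)
    qed
    then show ?thesis using lB field_le_epsilon by blast
  qed
  obtain N1 where N1: "\<forall>i\<ge>N1. \<forall>j\<ge>N1. norm (X i - X j) < 1" using X unfolding Cauchy_iff by (metis zero_less_one)
  have "l B \<in> carrier B \<and> nrm B (l B) \<le> norm (X N1) + 1" if B: "unital_cstar_algebra B" for B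
  proof -
    interpret unital_cstar_algebra B by fact
    interpret N: normed_group B "nrm B" by (rule normed)
    have b: "l B \<in> carrier B" "nrm B (component (X N1) B \<ominus>\<^bsub>B\<^esub> l B) \<le> 1" using bnd[OF B, of N1 N1 1] N1 by auto
    note c = component_closed[OF B, of "X N1"]
    have "nrm B (l B \<ominus>\<^bsub>B\<^esub> \<zero>\<^bsub>B\<^esub>) \<le> nrm B (l B \<ominus>\<^bsub>B\<^esub> component (X N1) B) + nrm B (component (X N1) B \<ominus>\<^bsub>B\<^esub> \<zero>\<^bsub>B\<^esub>)"
      by (intro N.n_triangle_minus b c) simp
    moreover have "nrm B (l B \<ominus>\<^bsub>B\<^esub> component (X N1) B) \<le> 1" using b c by (simp add: N.n_minus_commute)
    moreover have "nrm B (component (X N1) B) \<le> norm (X N1)" by (rule component_norm_le[OF B])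
    moreover have "y \<ominus>\<^bsub>B\<^esub> \<zero>\<^bsub>B\<^esub> = y" if "y \<in> carrier B" for y using that by (simp add: minus_eq)
    ultimately show ?thesis using b c by simp
  qed
  note l_bounded = this
  have "Cauchy (\<lambda>k. scalar (X k))"
    unfolding Cauchy_iff
  proof (intro allI impI)
    fix e :: real assume "e > 0"
    then obtain N where "\<forall>i\<ge>N. \<forall>j\<ge>N. norm (X i - X j) < e" using X unfolding Cauchy_iff by blast
    then show "\<exists>M. \<forall>m\<ge>M. \<forall>n\<ge>M. cmod (scalar (X m) - scalar (X n)) < e"
      using scalar_norm_le[of "X i - X j" for i j] unfolding scalar_diff by (meson order_le_less_trans)
  qed
  then obtain z where z: "(\<lambda>k. scalar (X k)) \<longlonglongrightarrow> z" using Cauchy_convergent_iff convergent_def by blast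
  define L where "L = family z l"
  have comp: "component L B = l B" if "unital_cstar_algebra B" for B
    unfolding L_def using that l_bounded by (rule component_family)
  have sc: "scalar L = z" unfolding L_def using l_bounded by (rule scalar_family)
  have "X \<longlonglongrightarrow> L"
    unfolding LIMSEQ_iff
  proof (intro allI impI)
    fix e :: real assume e: "e > 0"
    then have "e / 2 > 0" by simp
    then obtain N where N: "\<forall>i\<ge>N. \<forall>j\<ge>N. norm (X i - X j) < e / 2" using X unfolding Cauchy_iff by blast
    obtain N' where N': "\<forall>i\<ge>N'. cmod (scalar (X i) - z) < e / 2" using z \<open>e / 2 > 0\<close> unfolding LIMSEQ_iff by blast
    have "norm (X i - L) < e" if i: "i \<ge> max N N'" for i
    proof -
      have "norm (X i - L) \<le> e / 2"
      proof (rule norm_cstar_prod_leI)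
        show "cmod (scalar (X i - L)) \<le> e / 2" using N' i by (simp add: scalar_diff sc less_imp_le)
        show "nrm B (component (X i - L) B) \<le> e / 2" if "unital_cstar_algebra B" for B
          using bnd[OF that, of N i "e/2"] N i by (simp add: component_diff comp that)
      qed
      then show ?thesis using e by simp
    qed
    then show "\<exists>N. \<forall>i\<ge>N. norm (X i - L) < e" by blast
  qed
  then show "convergent X" by (auto simp: convergent_def)
qed

instantiation cstar_prod :: (type) cstar_alg
begin

definition "star x = family (cnj (scalar x)) (\<lambda>B. adj B (component x B))"
definition "iu = family \<i> (\<lambda>B. \<i> \<odot>\<^bsub>B\<^esub> \<one>\<^bsub>B\<^esub>)"

lemma nrm_adj:
  assumes "unital_cstar_algebra B" "x \<in> carrier B"
  shows "nrm B (adj B x) = nrm B x"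
proof -
  interpret unital_cstar_algebra B by fact
  have le: "nrm B y \<le> nrm B (adj B y)" if "y \<in> carrier B" for y
  proof (cases "nrm B y = 0")
    case False
    have "nrm B y * nrm B y \<le> nrm B (adj B y) * nrm B y"
      using cstar_identity[OF that] nrm_mult[OF adj_closed[OF that] that] by (simp add: power2_eq_square)
    then show ?thesis using False nrm_nonneg[OF that] by (simp add: mult_le_cancel_right)
  qed (simp add: nrm_nonneg adj_closed that)
  show ?thesis using le[OF assms(2)] le[OF adj_closed[OF assms(2)]] adj_adj[OF assms(2)] by simp
qed

lemma component_star: "unital_cstar_algebra B \<Longrightarrow> component (star x) B = adj B (component x B)"
  and scalar_star: "scalar (star x) = cnj (scalar x)"
proof -
  have *: "adj B (component x B) \<in> carrier B \<and> nrm B (adj B (component x B)) \<le> norm x"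
    if "unital_cstar_algebra B" for B :: "'a star_alg"
    using that by (simp add: unital_cstar_algebra.adj_closed component_closed nrm_adj component_norm_le)
  show "component (star x) B = adj B (component x B)" if "unital_cstar_algebra B"
    unfolding star_cstar_prod_def using that * by (rule component_family)
  show "scalar (star x) = cnj (scalar x)"
    unfolding star_cstar_prod_def using * by (rule scalar_family)
qed

lemma component_iu: "unital_cstar_algebra B \<Longrightarrow> component iu B = \<i> \<odot>\<^bsub>B\<^esub> \<one>\<^bsub>B\<^esub>"
  and scalar_iu: "scalar (iu :: 'a cstar_prod) = \<i>"
proof -
  have *: "\<i> \<odot>\<^bsub>B\<^esub> \<one>\<^bsub>B\<^esub> \<in> carrier B \<and> nrm B (\<i> \<odot>\<^bsub>B\<^esub> \<one>\<^bsub>B\<^esub>) \<le> 1"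
    if B: "unital_cstar_algebra B" for B :: "'a star_alg"
  proof -
    interpret unital_cstar_algebra B by fact
    show ?thesis using smult_simps(1)[OF one_closed one_closed] by (simp add: nrm_smult nrm_one)
  qed
  show "component iu B = \<i> \<odot>\<^bsub>B\<^esub> \<one>\<^bsub>B\<^esub>" if "unital_cstar_algebra B"
    unfolding iu_cstar_prod_def using that * by (rule component_family)
  show "scalar (iu :: 'a cstar_prod) = \<i>"
    unfolding iu_cstar_prod_def using * by (rule scalar_family)
qed

instance
proof
  fix x y :: "'a cstar_prod" and r :: real
  have *: "component (star (star x)) B = component x B" "component (star (x + y)) B = component (star x + star y) B"
      "component (star (x * y)) B = component (star y * star x) B" "component (star (r *\<^sub>R x)) B = component (r *\<^sub>R star x) B"
      "component (iu * iu) B = component (- 1) B" "component (iu * x) B = component (x * iu) B" "component (star iu) B = component (- iu) B"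
    if B: "unital_cstar_algebra B" for B
  proof -
    interpret unital_cstar_algebra B by fact
    note c = component_closed[OF B]
    note o = one_closed
    have "(\<i> \<odot>\<^bsub>B\<^esub> \<one>\<^bsub>B\<^esub>) \<otimes>\<^bsub>B\<^esub> (\<i> \<odot>\<^bsub>B\<^esub> \<one>\<^bsub>B\<^esub>) = \<i> \<odot>\<^bsub>B\<^esub> (\<i> \<odot>\<^bsub>B\<^esub> \<one>\<^bsub>B\<^esub>)"
      by (simp add: smult_mult_left smult_simps(1)[OF o o])
    also have "\<dots> = (\<i> * \<i>) \<odot>\<^bsub>B\<^esub> \<one>\<^bsub>B\<^esub>" by (rule smult_simps(4)[OF o o, symmetric])
    finally have ii: "(\<i> \<odot>\<^bsub>B\<^esub> \<one>\<^bsub>B\<^esub>) \<otimes>\<^bsub>B\<^esub> (\<i> \<odot>\<^bsub>B\<^esub> \<one>\<^bsub>B\<^esub>) = \<ominus>\<^bsub>B\<^esub> \<one>\<^bsub>B\<^esub>" by (simp add: smult_uminus)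
    have "(- \<i>) \<odot>\<^bsub>B\<^esub> \<one>\<^bsub>B\<^esub> = (- 1) \<odot>\<^bsub>B\<^esub> (\<i> \<odot>\<^bsub>B\<^esub> \<one>\<^bsub>B\<^esub>)"
      using smult_simps(4)[OF o o, of "-1" \<i>] by simp
    then have mi: "(- \<i>) \<odot>\<^bsub>B\<^esub> \<one>\<^bsub>B\<^esub> = \<ominus>\<^bsub>B\<^esub> (\<i> \<odot>\<^bsub>B\<^esub> \<one>\<^bsub>B\<^esub>)" by (simp add: smult_uminus smult_simps(1)[OF o o])
    show "component (star (star x)) B = component x B" "component (star (x + y)) B = component (star x + star y) B"
      "component (star (x * y)) B = component (star y * star x) B" "component (star (r *\<^sub>R x)) B = component (r *\<^sub>R star x) B"
      "component (iu * iu) B = component (- 1) B" "component (iu * x) B = component (x * iu) B" "component (star iu) B = component (- iu) B"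
      by (simp_all add: component_simps[OF B] component_star[OF B] component_iu[OF B] c adj_adj adj_add adj_mult adj_smult adj_one
          ii mi smult_mult_left smult_mult_right)
  qed
  show "star (star x) = x" "star (x + y) = star x + star y" "star (x * y) = star y * star x"
    "star (r *\<^sub>R x) = r *\<^sub>R star x" "iu * iu = (- 1 :: 'a cstar_prod)" "iu * x = x * iu" "star iu = (- iu :: 'a cstar_prod)"
    by (rule component_eqI, simp add: scalar_simps scalar_star scalar_iu algebra_simps, erule *)+
  show "norm (star x * x) = (norm x)\<^sup>2"
  proof (rule antisym)
    have cs: "nrm B (component (star x * x) B) = (nrm B (component x B))\<^sup>2" if B: "unital_cstar_algebra B" for B
      using unital_cstar_algebra.cstar_identity[OF B component_closed[OF B]] by (simp add: component_mult[OF B] component_star[OF B])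
    show "norm (star x * x) \<le> (norm x)\<^sup>2"
    proof (rule norm_cstar_prod_leI)
      show "cmod (scalar (star x * x)) \<le> (norm x)\<^sup>2"
        using scalar_norm_le[of x] by (simp add: scalar_mult scalar_star norm_mult power2_eq_square mult_mono)
    qed (simp_all add: cs component_norm_le power_mono unital_cstar_algebra.nrm_nonneg component_closed)
    have "norm x \<le> sqrt (norm (star x * x))"
    proof (rule norm_cstar_prod_leI)
      fix B :: "'a star_alg" assume B: "unital_cstar_algebra B"
      show "nrm B (component x B) \<le> sqrt (norm (star x * x))"
        using component_norm_le[OF B, of "star x * x"] by (simp add: cs[OF B] real_le_rsqrt)
    next
      show "cmod (scalar x) \<le> sqrt (norm (star x * x))"
        using scalar_norm_le[of "star x * x"] by (simp add: scalar_mult scalar_star norm_mult power2_eq_square real_le_rsqrt)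
    qed
    then have "(norm x)\<^sup>2 \<le> (sqrt (norm (star x * x)))\<^sup>2" by (intro power_mono) auto
    then show "(norm x)\<^sup>2 \<le> norm (star x * x)" by simp
  qed
qed

end

section \<open>The GNS construction on Cauchy sequences\<close>

definition cscale :: "complex \<Rightarrow> 'a::cstar_alg \<Rightarrow> 'a" where
  "cscale c x = Re c *\<^sub>R x + Im c *\<^sub>R (iu * x)"

lemma iu_iu: "iu * (iu * x) = - (x :: 'a::cstar_alg)"
  by (simp add: iu_mult flip: mult.assoc)

lemma mult_iu: "x * (iu * y) = iu * (x * y :: 'a::cstar_alg)"
  by (metis iu_comm mult.assoc)

lemma star_iu_mult: "star (iu * x) = - (iu * star x :: 'a::cstar_alg)"
  by (simp add: star_mult star_iu iu_comm)

lemma cscale_add: "cscale c (x + y) = cscale c x + cscale c y"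
  and cscale_add_left: "cscale (c + d) x = cscale c x + cscale d x"
  and cscale_mult: "cscale (c * d) x = cscale c (cscale d x)"
  and cscale_one: "cscale 1 x = x"
  and cscale_minus_one: "cscale (- 1) x = - x"
  by (simp_all add: cscale_def distrib_left scaleR_add_left scaleR_add_right scaleR_diff_left scaleR_diff_right iu_iu)

lemma mult_cscale: "y * cscale c x = cscale c (y * x)"
  by (simp add: cscale_def distrib_left mult_iu[of y x])

locale gns =
  fixes f :: "'a::cstar_alg \<Rightarrow> real"
  assumes state: "state f"
begin

lemmas f_linear = state_add[OF state] state_diff[OF state] state_scaleR[OF state] state_zero[OF state]
  state_minus[OF state]

definition \<phi> :: "'a \<Rightarrow> complex" where "\<phi> x = Complex (f x) (- f (iu * x))"

definition \<nu> :: "'a \<Rightarrow> real" where "\<nu> x = sqrt (f (star x * x))"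

lemma \<phi>_add: "\<phi> (x + y) = \<phi> x + \<phi> y" and \<phi>_diff: "\<phi> (x - y) = \<phi> x - \<phi> y"
  by (simp_all add: \<phi>_def f_linear distrib_left right_diff_distrib complex_eq_iff)

lemma \<phi>_cscale: "\<phi> (cscale c x) = c * \<phi> x"
  by (simp add: \<phi>_def cscale_def f_linear distrib_left iu_iu complex_eq_iff algebra_simps)

lemma \<phi>_star: "\<phi> (star x) = cnj (\<phi> x)"
proof -
  have "f (iu * star x) = - f (star (iu * x))" by (simp add: star_iu_mult f_linear)
  then show ?thesis using state_star[OF state] by (simp add: \<phi>_def complex_eq_iff)
qed

lemma \<nu>_nonneg: "0 \<le> \<nu> x" and \<nu>_sq: "(\<nu> x)\<^sup>2 = f (star x * x)"
  using state_pos[OF state pos_star_mult[of x]] by (simp_all add: \<nu>_def)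

lemma \<phi>_self: "\<phi> (star x * x) = of_real ((\<nu> x)\<^sup>2)"
proof -
  have "cnj (\<phi> (star x * x)) = \<phi> (star x * x)" by (simp add: star_mult flip: \<phi>_star)
  then have "Im (\<phi> (star x * x)) = 0" by (simp add: complex_eq_iff)
  then show ?thesis unfolding \<nu>_sq by (simp add: \<phi>_def complex_eq_iff)
qed

lemma star_cscale: "star (cscale c x) = cscale (cnj c) (star x)"
  by (simp add: cscale_def star_simps star_iu_mult) (simp add: star_iu iu_comm)

lemma cscale_star_mult: "star (cscale c x) * cscale c x = ((cmod c)\<^sup>2) *\<^sub>R (star x * x)"
proof -
  have "star (cscale c x) * cscale c x = cscale c (cscale (cnj c) (star x * x))"
  proof -
    have "cscale (cnj c) (star x) * x = cscale (cnj c) (star x * x)"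
      by (simp add: cscale_def distrib_right left_diff_distrib mult.assoc)
    then show ?thesis by (simp only: star_cscale mult_cscale)
  qed
  also have "\<dots> = cscale (c * cnj c) (star x * x)" by (simp add: cscale_mult)
  also have "c * cnj c = of_real ((cmod c)\<^sup>2)" by (rule complex_norm_square[symmetric])
  finally show ?thesis by (simp add: cscale_def)
qed

lemma \<nu>_cscale: "\<nu> (cscale c x) = cmod c * \<nu> x"
  by (simp add: \<nu>_def cscale_star_mult f_linear real_sqrt_mult)

lemma f_cs: "\<bar>f (star y * x)\<bar> \<le> \<nu> x * \<nu> y"
  using real_sqrt_le_mono[OF state_cauchy_schwarz[OF state, of y x]] by (simp add: \<nu>_def real_sqrt_mult)

text \<open>A scalar \<open>c\<close> of modulus one rotates the value onto the positive real axis,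
  where the real inequality \<open>f_cs\<close> applies.\<close>

lemma \<phi>_cs: "cmod (\<phi> (star y * x)) \<le> \<nu> x * \<nu> y"
proof (cases "\<phi> (star y * x) = 0")
  case True
  then show ?thesis by (simp add: \<nu>_nonneg)
next
  case False
  define w where "w = \<phi> (star y * x)"
  define c where "c = cnj w / of_real (cmod w)"
  have c: "cmod c = 1" using False by (simp add: c_def w_def norm_divide)
  have "c * w = of_real (cmod w)"
  proof -
    have "w * cnj w = of_real ((cmod w)\<^sup>2)" by (rule complex_norm_square[symmetric])
    then show ?thesis using False by (simp add: c_def w_def power2_eq_square mult.commute)
  qed
  then have "cmod w = Re (\<phi> (star y * cscale c x))" by (simp add: mult_cscale \<phi>_cscale w_def[symmetric])
  also have "\<dots> = f (star y * cscale c x)" by (simp add: \<phi>_def)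
  also have "\<dots> \<le> \<nu> (cscale c x) * \<nu> y" using f_cs[of y "cscale c x"] by simp
  finally show ?thesis by (simp add: \<nu>_cscale c w_def)
qed

lemma \<nu>_triangle: "\<nu> (x + y) \<le> \<nu> x + \<nu> y"
proof (rule power2_le_imp_le)
  have "star (x + y) * (x + y) = star x * x + star y * y + star y * x + star x * y"
    by (simp add: star_add algebra_simps)
  then have "(\<nu> (x + y))\<^sup>2 = (\<nu> x)\<^sup>2 + (\<nu> y)\<^sup>2 + f (star y * x) + f (star x * y)"
    by (simp add: \<nu>_sq f_linear)
  also have "\<dots> \<le> (\<nu> x)\<^sup>2 + (\<nu> y)\<^sup>2 + \<nu> x * \<nu> y + \<nu> y * \<nu> x"
    using f_cs[of y x] f_cs[of x y] by linarith
  finally show "(\<nu> (x + y))\<^sup>2 \<le> (\<nu> x + \<nu> y)\<^sup>2" by (simp add: power2_sum)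
qed (simp add: \<nu>_nonneg)

lemma \<nu>_zero: "\<nu> 0 = 0" and \<nu>_minus: "\<nu> (- x) = \<nu> x" and \<nu>_one: "\<nu> 1 = 1"
  by (simp_all add: \<nu>_def f_linear star_minus state_one[OF state])

lemma \<nu>_minus_commute: "\<nu> (x - y) = \<nu> (y - x)"
  using \<nu>_minus[of "x - y"] by simp

lemma \<nu>_triangle_diff: "\<nu> (x - z) \<le> \<nu> (x - y) + \<nu> (y - z)"
  using \<nu>_triangle[of "x - y" "y - z"] by simp

lemma \<nu>_diff_le: "\<bar>\<nu> x - \<nu> y\<bar> \<le> \<nu> (x - y)"
  using \<nu>_triangle[of "x - y" y] \<nu>_triangle[of "y - x" x] \<nu>_minus_commute[of x y] by simp

text \<open>The inequality \<open>star a * a \<le> (norm a)\<^sup>2\<close> is conjugated by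
  \<open>x\<close> and evaluated under the state.\<close>

lemma \<nu>_mult: "\<nu> (a * x) \<le> norm a * \<nu> x"
proof (rule power2_le_imp_le)
  have "pos (of_real ((norm a)\<^sup>2) - star a * a)"
    by (intro pos_of_norm_le) (simp_all add: star_simps norm_star_mult)
  then have "0 \<le> f (star x * (of_real ((norm a)\<^sup>2) - star a * a) * x)"
    by (intro state_pos[OF state] pos_conj)
  also have "star x * (of_real ((norm a)\<^sup>2) - star a * a) * x = (norm a)\<^sup>2 *\<^sub>R (star x * x) - star (a * x) * (a * x)"
    by (simp add: of_real_def algebra_simps star_mult)
  finally have "(\<nu> (a * x))\<^sup>2 \<le> (norm a)\<^sup>2 * (\<nu> x)\<^sup>2" by (simp add: f_linear \<nu>_sq)
  then show "(\<nu> (a * x))\<^sup>2 \<le> (norm a * \<nu> x)\<^sup>2" by (simp add: power_mult_distrib)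
qed (simp add: \<nu>_nonneg)

lemma \<nu>_parallelogram: "(\<nu> (x + y))\<^sup>2 + (\<nu> (x - y))\<^sup>2 = 2 * (\<nu> x)\<^sup>2 + 2 * (\<nu> y)\<^sup>2"
  by (simp add: \<nu>_sq star_simps algebra_simps f_linear)

text \<open>Cauchy sequences represent the vectors of the completed GNS space. Null sequences are
  not yet divided out, so \<open>Nu\<close> is a seminorm here. Sequences suit the type
  \<open>nat \<Rightarrow> 'a\<close> of the vectors in \<open>primitive_ideal\<close>.\<close>

definition CS :: "(nat \<Rightarrow> 'a) set" where
  "CS = {s. \<forall>e>0. \<exists>N. \<forall>m\<ge>N. \<forall>n\<ge>N. \<nu> (s m - s n) < e}"

definition Nu :: "(nat \<Rightarrow> 'a) \<Rightarrow> real" where "Nu s = lim (\<lambda>n. \<nu> (s n))"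

definition IP :: "(nat \<Rightarrow> 'a) \<Rightarrow> (nat \<Rightarrow> 'a) \<Rightarrow> complex" where
  "IP s t = lim (\<lambda>n. \<phi> (star (t n) * s n))"

lemma CS_const: "(\<lambda>_. x) \<in> CS"
  by (auto simp: CS_def \<nu>_zero)

lemma CS_dominated:
  assumes "s \<in> CS" "t \<in> CS" and "\<And>m n. \<nu> (u m - u n) \<le> K * \<nu> (s m - s n) + L * \<nu> (t m - t n)" "K \<ge> 0" "L \<ge> 0"
  shows "u \<in> CS"
  unfolding CS_def
proof (intro CollectI allI impI)
  fix e :: real assume e: "e > 0"
  have d: "e / (2 * (K + 1)) > 0" "e / (2 * (L + 1)) > 0" using e assms by auto
  obtain N where N: "\<forall>m\<ge>N. \<forall>n\<ge>N. \<nu> (s m - s n) < e / (2 * (K + 1))" using assms(1) d(1) unfolding CS_def by blast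
  obtain N' where N': "\<forall>m\<ge>N'. \<forall>n\<ge>N'. \<nu> (t m - t n) < e / (2 * (L + 1))" using assms(2) d(2) unfolding CS_def by blast
  have "\<nu> (u m - u n) < e" if "m \<ge> max N N'" "n \<ge> max N N'" for m n
  proof -
    have half: "(K + 1) * a < e / 2" if "0 \<le> K" "a < e / (2 * (K + 1))" for K a :: real
    proof -
      have "(K + 1) * a < (K + 1) * (e / (2 * (K + 1)))" using that by (intro mult_strict_left_mono) auto
      also have "\<dots> = e / 2" using that(1) by (simp add: field_simps)
      finally show ?thesis .
    qed
    have "K * \<nu> (s m - s n) \<le> (K + 1) * \<nu> (s m - s n)" "L * \<nu> (t m - t n) \<le> (L + 1) * \<nu> (t m - t n)"
      by (intro mult_right_mono; simp add: \<nu>_nonneg)+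
    moreover have "\<nu> (s m - s n) < e / (2 * (K + 1))" "\<nu> (t m - t n) < e / (2 * (L + 1))"
      using N N' that by auto
    then have "(K + 1) * \<nu> (s m - s n) < e / 2" "(L + 1) * \<nu> (t m - t n) < e / 2"
      using half[OF assms(4)] half[OF assms(5)] by blast+
    ultimately show ?thesis using assms(3)[of m n] by linarith
  qed
  then show "\<exists>N. \<forall>m\<ge>N. \<forall>n\<ge>N. \<nu> (u m - u n) < e" by blast
qed

lemma CS_add: assumes "s \<in> CS" "t \<in> CS" shows "(\<lambda>n. s n + t n) \<in> CS"
proof (rule CS_dominated[OF assms, where K=1 and L=1])
  show "\<nu> (s m + t m - (s n + t n)) \<le> 1 * \<nu> (s m - s n) + 1 * \<nu> (t m - t n)" for m n
    using \<nu>_triangle[of "s m - s n" "t m - t n"] by (simp add: algebra_simps)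
qed auto

lemma CS_mult: assumes "s \<in> CS" shows "(\<lambda>n. x * s n) \<in> CS"
proof (rule CS_dominated[OF assms assms, where K="norm x" and L=0])
  show "\<nu> (x * s m - x * s n) \<le> norm x * \<nu> (s m - s n) + 0 * \<nu> (s m - s n)" for m n
    using \<nu>_mult[of x "s m - s n"] by (simp add: right_diff_distrib)
qed auto

lemma cscale_diff: "cscale c (x - y) = cscale c x - cscale c (y::'a)"
  by (simp add: cscale_def right_diff_distrib scaleR_diff_right)

lemma CS_cscale: assumes "s \<in> CS" shows "(\<lambda>n. cscale c (s n)) \<in> CS"
proof (rule CS_dominated[OF assms assms, where K="cmod c" and L=0])
  show "\<nu> (cscale c (s m) - cscale c (s n)) \<le> cmod c * \<nu> (s m - s n) + 0 * \<nu> (s m - s n)" for m n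
    by (simp add: \<nu>_cscale flip: cscale_diff)
qed auto

lemma CS_minus: "s \<in> CS \<Longrightarrow> (\<lambda>n. - s n) \<in> CS"
  using CS_cscale[of s "-1"] by (simp add: cscale_minus_one)

lemma CS_diff: "s \<in> CS \<Longrightarrow> t \<in> CS \<Longrightarrow> (\<lambda>n. s n - t n) \<in> CS"
  using CS_add[OF _ CS_minus, of s t] by simp

lemma Nu_lim: assumes "s \<in> CS" shows "(\<lambda>n. \<nu> (s n)) \<longlonglongrightarrow> Nu s"
proof -
  have "Cauchy (\<lambda>n. \<nu> (s n))"
    unfolding Cauchy_iff
  proof (intro allI impI)
    fix e :: real assume "e > 0"
    then obtain N where "\<forall>m\<ge>N. \<forall>n\<ge>N. \<nu> (s m - s n) < e" using assms unfolding CS_def by blast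
    then show "\<exists>M. \<forall>m\<ge>M. \<forall>n\<ge>M. norm (\<nu> (s m) - \<nu> (s n)) < e"
      using \<nu>_diff_le unfolding real_norm_def by (meson order_le_less_trans)
  qed
  then show ?thesis unfolding Nu_def by (simp add: Cauchy_convergent_iff convergent_LIMSEQ_iff)
qed

lemma Nu_const: "Nu (\<lambda>_. x) = \<nu> x"
  by (simp add: Nu_def)

lemma IP_lim: assumes s: "s \<in> CS" and t: "t \<in> CS" shows "(\<lambda>n. \<phi> (star (t n) * s n)) \<longlonglongrightarrow> IP s t"
proof -
  obtain K where K: "\<And>n. \<nu> (s n) \<le> K"
    using Bseq_eq_bounded[of "\<lambda>n. \<nu> (s n)"] convergent_imp_Bseq[OF convergentI[OF Nu_lim[OF s]]]
    by (metis BseqE abs_le_D1 real_norm_def)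
  obtain L where L: "\<And>n. \<nu> (t n) \<le> L"
    using Bseq_eq_bounded[of "\<lambda>n. \<nu> (t n)"] convergent_imp_Bseq[OF convergentI[OF Nu_lim[OF t]]]
    by (metis BseqE abs_le_D1 real_norm_def)
  have K0: "K \<ge> 0" "L \<ge> 0" using K L \<nu>_nonneg order_trans by blast+
  have bound: "cmod (\<phi> (star (t m) * s m) - \<phi> (star (t n) * s n)) \<le> L * \<nu> (s m - s n) + K * \<nu> (t m - t n)" for m n
  proof -
    have "\<phi> (star (t m) * s m) - \<phi> (star (t n) * s n) = \<phi> (star (t m) * (s m - s n)) + \<phi> (star (t m - t n) * s n)"
      by (simp add: star_diff algebra_simps \<phi>_diff)
    then have "cmod (\<phi> (star (t m) * s m) - \<phi> (star (t n) * s n)) \<le> \<nu> (s m - s n) * \<nu> (t m) + \<nu> (s n) * \<nu> (t m - t n)"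
      using norm_triangle_mono[OF \<phi>_cs \<phi>_cs] by metis
    also have "\<dots> \<le> \<nu> (s m - s n) * L + K * \<nu> (t m - t n)"
      by (intro add_mono mult_left_mono mult_right_mono K L \<nu>_nonneg)
    finally show ?thesis by (simp add: mult.commute)
  qed
  have "Cauchy (\<lambda>n. \<phi> (star (t n) * s n))"
    unfolding Cauchy_iff
  proof (intro allI impI)
    fix e :: real assume e: "e > 0"
    have d: "e / (2 * (L + 1)) > 0" "e / (2 * (K + 1)) > 0" using e K0 by auto
    obtain N where N: "\<forall>m\<ge>N. \<forall>n\<ge>N. \<nu> (s m - s n) < e / (2 * (L + 1))" using s d(1) unfolding CS_def by blast
    obtain N' where N': "\<forall>m\<ge>N'. \<forall>n\<ge>N'. \<nu> (t m - t n) < e / (2 * (K + 1))" using t d(2) unfolding CS_def by blast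
    have half: "K * a < e / 2" if "0 \<le> K" "0 \<le> a" "a < e / (2 * (K + 1))" for K a :: real
    proof -
      have "K * a \<le> (K + 1) * a" using that by (intro mult_right_mono) auto
      also have "(K + 1) * a < (K + 1) * (e / (2 * (K + 1)))" using that by (intro mult_strict_left_mono) auto
      also have "\<dots> = e / 2" using that(1) by (simp add: field_simps)
      finally show ?thesis .
    qed
    have "norm (\<phi> (star (t m) * s m) - \<phi> (star (t n) * s n)) < e" if "m \<ge> max N N'" "n \<ge> max N N'" for m n
    proof -
      have "\<nu> (s m - s n) < e / (2 * (L + 1))" "\<nu> (t m - t n) < e / (2 * (K + 1))"
        using N N' that by auto
      then have "L * \<nu> (s m - s n) < e / 2" "K * \<nu> (t m - t n) < e / 2"
        using half[OF K0(2) \<nu>_nonneg] half[OF K0(1) \<nu>_nonneg] by blast+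
      then show ?thesis using bound[of m n] by linarith
    qed
    then show "\<exists>M. \<forall>m\<ge>M. \<forall>n\<ge>M. norm (\<phi> (star (t m) * s m) - \<phi> (star (t n) * s n)) < e" by blast
  qed
  then show ?thesis unfolding IP_def by (simp add: Cauchy_convergent_iff convergent_LIMSEQ_iff)
qed

section \<open>The inner product on Cauchy sequences\<close>

lemma IP_add: "s \<in> CS \<Longrightarrow> t \<in> CS \<Longrightarrow> u \<in> CS \<Longrightarrow> IP (\<lambda>n. s n + t n) u = IP s u + IP t u"
  using LIMSEQ_unique[OF IP_lim[OF CS_add, of s t u]] tendsto_add[OF IP_lim[of s u] IP_lim[of t u]]
  by (simp add: distrib_left \<phi>_add)

lemma IP_cscale: "s \<in> CS \<Longrightarrow> u \<in> CS \<Longrightarrow> IP (\<lambda>n. cscale c (s n)) u = c * IP s u"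
  using LIMSEQ_unique[OF IP_lim[OF CS_cscale, of s u c]] tendsto_mult_left[OF IP_lim[of s u], of c]
  by (simp add: mult_cscale \<phi>_cscale)

lemma IP_minus: "s \<in> CS \<Longrightarrow> u \<in> CS \<Longrightarrow> IP (\<lambda>n. - s n) u = - IP s u"
  using IP_cscale[of s u "-1"] by (simp add: cscale_minus_one)

lemma IP_diff: "s \<in> CS \<Longrightarrow> t \<in> CS \<Longrightarrow> u \<in> CS \<Longrightarrow> IP (\<lambda>n. s n - t n) u = IP s u - IP t u"
  using IP_add[OF _ CS_minus, of s t u] IP_minus[of t u] by simp

lemma IP_cnj: assumes "s \<in> CS" "t \<in> CS" shows "IP t s = cnj (IP s t)"
proof -
  have "(\<lambda>n. cnj (\<phi> (star (t n) * s n))) \<longlonglongrightarrow> cnj (IP s t)" by (intro tendsto_cnj IP_lim assms)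
  then have "(\<lambda>n. \<phi> (star (s n) * t n)) \<longlonglongrightarrow> cnj (IP s t)" by (simp add: star_mult flip: \<phi>_star)
  then show ?thesis using LIMSEQ_unique IP_lim[OF assms(2,1)] by blast
qed

lemma IP_add_right: "s \<in> CS \<Longrightarrow> t \<in> CS \<Longrightarrow> u \<in> CS \<Longrightarrow> IP u (\<lambda>n. s n + t n) = IP u s + IP u t"
  using IP_cnj[OF CS_add, of s t u] IP_cnj[of s u] IP_cnj[of t u] by (simp add: IP_add)

lemma IP_diff_right: "s \<in> CS \<Longrightarrow> t \<in> CS \<Longrightarrow> u \<in> CS \<Longrightarrow> IP u (\<lambda>n. s n - t n) = IP u s - IP u t"
  using IP_cnj[OF CS_diff, of s t u] IP_cnj[of s u] IP_cnj[of t u] by (simp add: IP_diff)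

lemma IP_cscale_right: "s \<in> CS \<Longrightarrow> u \<in> CS \<Longrightarrow> IP u (\<lambda>n. cscale c (s n)) = cnj c * IP u s"
  using IP_cnj[OF CS_cscale, of s u c] IP_cnj[of s u] by (simp add: IP_cscale)

lemma IP_mult: "s \<in> CS \<Longrightarrow> t \<in> CS \<Longrightarrow> IP (\<lambda>n. x * s n) t = IP s (\<lambda>n. star x * t n)"
  unfolding IP_def by (simp add: star_mult mult.assoc)

lemma IP_self: assumes "s \<in> CS" shows "IP s s = of_real ((Nu s)\<^sup>2)"
proof -
  have "(\<lambda>n. complex_of_real ((\<nu> (s n))\<^sup>2)) \<longlonglongrightarrow> of_real ((Nu s)\<^sup>2)"
    by (intro tendsto_of_real tendsto_power Nu_lim assms)
  then show ?thesis using LIMSEQ_unique IP_lim[OF assms assms] by (simp only: \<phi>_self)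
qed

lemma Nu_nonneg: "s \<in> CS \<Longrightarrow> 0 \<le> Nu s"
  by (rule LIMSEQ_le_const[OF Nu_lim]) (auto simp: \<nu>_nonneg)

lemma IP_cs: assumes "s \<in> CS" "t \<in> CS" shows "cmod (IP s t) \<le> Nu s * Nu t"
proof (rule LIMSEQ_le)
  show "(\<lambda>n. cmod (\<phi> (star (t n) * s n))) \<longlonglongrightarrow> cmod (IP s t)" by (intro tendsto_norm IP_lim assms)
  show "(\<lambda>n. \<nu> (s n) * \<nu> (t n)) \<longlonglongrightarrow> Nu s * Nu t" by (intro tendsto_mult Nu_lim assms)
qed (auto simp: \<phi>_cs)

lemma Nu_triangle: assumes "s \<in> CS" "t \<in> CS" shows "Nu (\<lambda>n. s n + t n) \<le> Nu s + Nu t"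
  by (rule LIMSEQ_le[OF Nu_lim[OF CS_add] tendsto_add[OF Nu_lim Nu_lim]]) (auto simp: assms \<nu>_triangle)

lemma Nu_triangle_diff:
  assumes "s \<in> CS" "t \<in> CS" "u \<in> CS"
  shows "Nu (\<lambda>n. s n - u n) \<le> Nu (\<lambda>n. s n - t n) + Nu (\<lambda>n. t n - u n)"
  using Nu_triangle[OF CS_diff CS_diff, of s t t u] assms by simp

lemma Nu_minus_commute: "Nu (\<lambda>n. s n - t n) = Nu (\<lambda>n. t n - s n)"
  unfolding Nu_def by (simp add: \<nu>_minus_commute)

lemma Nu_cscale: assumes "s \<in> CS" shows "Nu (\<lambda>n. cscale c (s n)) = cmod c * Nu s"
  using LIMSEQ_unique[OF Nu_lim[OF CS_cscale[OF assms]] ] tendsto_mult_left[OF Nu_lim[OF assms], of "cmod c"]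
  by (simp add: \<nu>_cscale)

lemma Nu_mult_le: assumes "s \<in> CS" shows "Nu (\<lambda>n. x * s n) \<le> norm x * Nu s"
  by (rule LIMSEQ_le[OF Nu_lim[OF CS_mult] tendsto_mult_left[OF Nu_lim]]) (auto simp: assms \<nu>_mult)

lemma Nu_parallelogram:
  assumes "s \<in> CS" "t \<in> CS"
  shows "(Nu (\<lambda>n. s n + t n))\<^sup>2 + (Nu (\<lambda>n. s n - t n))\<^sup>2 = 2 * (Nu s)\<^sup>2 + 2 * (Nu t)\<^sup>2"
proof -
  have "(\<lambda>n. (\<nu> (s n + t n))\<^sup>2 + (\<nu> (s n - t n))\<^sup>2) \<longlonglongrightarrow> (Nu (\<lambda>n. s n + t n))\<^sup>2 + (Nu (\<lambda>n. s n - t n))\<^sup>2"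
    by (intro tendsto_add tendsto_power Nu_lim CS_add CS_diff assms)
  moreover have "(\<lambda>n. 2 * (\<nu> (s n))\<^sup>2 + 2 * (\<nu> (t n))\<^sup>2) \<longlonglongrightarrow> 2 * (Nu s)\<^sup>2 + 2 * (Nu t)\<^sup>2"
    by (intro tendsto_intros Nu_lim assms)
  ultimately show ?thesis unfolding \<nu>_parallelogram using LIMSEQ_unique by blast
qed

text \<open>Density of the algebra in its completion: \<open>s\<close> is approximated by the
  constant sequences with value \<open>s k\<close>.\<close>

lemma Nu_tail:
  assumes s: "s \<in> CS" and e: "e > 0"
  shows "\<exists>N. \<forall>k\<ge>N. Nu (\<lambda>n. s n - s k) < e"
proof -
  have "e / 2 > 0" using e by simp
  then obtain N where N: "\<forall>m\<ge>N. \<forall>n\<ge>N. \<nu> (s m - s n) < e / 2" using s unfolding CS_def by blast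
  have "Nu (\<lambda>n. s n - s k) < e" if "k \<ge> N" for k
  proof -
    have "Nu (\<lambda>n. s n - s k) \<le> e / 2"
      using N that by (intro LIMSEQ_le_const2[OF Nu_lim[OF CS_diff[OF s CS_const]]] exI[of _ N]) (auto simp: less_imp_le)
    then show ?thesis using e by simp
  qed
  then show ?thesis by blast
qed

text \<open>Diagonal argument: \<open>t k\<close> is a single algebra element within
  \<open>1 / (k + 1)\<close> of the vector \<open>v k\<close>.\<close>

lemma CS_complete:
  fixes v :: "nat \<Rightarrow> nat \<Rightarrow> 'a"
  assumes v: "\<And>k. v k \<in> CS" and cauchy: "\<And>e. e > 0 \<Longrightarrow> \<exists>N. \<forall>i\<ge>N. \<forall>j\<ge>N. Nu (\<lambda>n. v i n - v j n) < e"
  shows "\<exists>t\<in>CS. \<forall>e>0. \<exists>N. \<forall>k\<ge>N. Nu (\<lambda>n. v k n - t n) < e"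
proof -
  have "\<exists>y. Nu (\<lambda>n. v k n - y) < 1 / (real k + 1)" for k
    using Nu_tail[OF v[of k], of "1 / (real k + 1)"] by fastforce
  then obtain t where t: "\<And>k. Nu (\<lambda>n. v k n - t k) < 1 / (real k + 1)" by metis
  have small: "\<exists>N. \<forall>k\<ge>N. 1 / (real k + 1) < e" if "e > 0" for e :: real
  proof -
    obtain N :: nat where "1 / e < N" using reals_Archimedean2 by blast
    then have "1 / (real k + 1) < e" if "k \<ge> N" for k
    proof -
      have "1 / e < real k + 1" using \<open>1 / e < N\<close> that by linarith
      then show ?thesis using \<open>e > 0\<close> by (simp add: field_simps)
    qed
    then show ?thesis by blast
  qed
  have tt: "\<nu> (t i - t j) \<le> 1 / (real i + 1) + Nu (\<lambda>n. v i n - v j n) + 1 / (real j + 1)" for i j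
  proof -
    have "Nu (\<lambda>n. t i - t j) \<le> Nu (\<lambda>n. t i - v i n) + Nu (\<lambda>n. v i n - t j)"
      by (intro Nu_triangle_diff CS_const v)
    also have "Nu (\<lambda>n. v i n - t j) \<le> Nu (\<lambda>n. v i n - v j n) + Nu (\<lambda>n. v j n - t j)"
      by (intro Nu_triangle_diff CS_const v)
    also have "Nu (\<lambda>n. t i - v i n) = Nu (\<lambda>n. v i n - t i)" by (rule Nu_minus_commute)
    finally show ?thesis using t[of i] t[of j] by (simp add: Nu_const)
  qed
  have tCS: "t \<in> CS"
    unfolding CS_def
  proof (intro CollectI allI impI)
    fix e :: real assume "e > 0"
    then have e3: "e / 3 > 0" by simp
    obtain N where N: "\<forall>i\<ge>N. \<forall>j\<ge>N. Nu (\<lambda>n. v i n - v j n) < e / 3" using cauchy[OF e3] by blast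
    obtain N' where N': "\<forall>k\<ge>N'. 1 / (real k + 1) < e / 3" using small[OF e3] by blast
    have "\<nu> (t i - t j) < e" if "i \<ge> max N N'" "j \<ge> max N N'" for i j
    proof -
      have "Nu (\<lambda>n. v i n - v j n) < e / 3" "1 / (real i + 1) < e / 3" "1 / (real j + 1) < e / 3"
        using N N' that by auto
      then show ?thesis using tt[of i j] by linarith
    qed
    then show "\<exists>N. \<forall>m\<ge>N. \<forall>n\<ge>N. \<nu> (t m - t n) < e" by blast
  qed
  moreover have "\<exists>N. \<forall>k\<ge>N. Nu (\<lambda>n. v k n - t n) < e" if "e > 0" for e
  proof -
    have e2: "e / 2 > 0" using that by simp
    obtain N where N: "\<forall>k\<ge>N. Nu (\<lambda>n. t n - t k) < e / 2" using Nu_tail[OF tCS e2] by blast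
    obtain N' where N': "\<forall>k\<ge>N'. 1 / (real k + 1) < e / 2" using small[OF e2] by blast
    have "Nu (\<lambda>n. v k n - t n) < e" if "k \<ge> max N N'" for k
    proof -
      have "Nu (\<lambda>n. v k n - t n) \<le> Nu (\<lambda>n. v k n - t k) + Nu (\<lambda>n. t k - t n)"
        by (intro Nu_triangle_diff CS_const v tCS)
      also have "Nu (\<lambda>n. t k - t n) = Nu (\<lambda>n. t n - t k)" by (rule Nu_minus_commute)
      finally have "Nu (\<lambda>n. v k n - t n) < 1 / (real k + 1) + Nu (\<lambda>n. t n - t k)" using t[of k] by simp
      moreover have "Nu (\<lambda>n. t n - t k) < e / 2" "1 / (real k + 1) < e / 2"
        using N[rule_format, of k] N'[rule_format, of k] that by simp_all
      ultimately show ?thesis by linarith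
    qed
    then show ?thesis by blast
  qed
  ultimately show ?thesis by blast
qed

text \<open>Pairing \<open>w\<close> with itself is the same as pairing it with
  \<open>w - w N\<close>, which differs from \<open>w\<close> by a constant and is small.\<close>

lemma IP_eq_0:
  assumes w: "w \<in> CS" and z: "\<And>x. IP (\<lambda>_. x) w = 0"
  shows "Nu w = 0"
proof -
  have "(Nu w)\<^sup>2 \<le> e * Nu w" if e: "e > 0" for e
  proof -
    obtain N where N: "Nu (\<lambda>n. w n - w N) < e" using Nu_tail[OF w e] by blast
    have "IP w w = IP (\<lambda>n. w n - w N) w" using z by (simp add: IP_diff CS_const w)
    then have "cmod (IP w w) \<le> Nu (\<lambda>n. w n - w N) * Nu w" using IP_cs[OF CS_diff[OF w CS_const] w] by simp
    also have "\<dots> \<le> e * Nu w" using N Nu_nonneg[OF w] by (intro mult_right_mono) auto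
    finally show ?thesis by (simp add: IP_self[OF w] norm_power)
  qed
  \<comment> \<open>For nonzero \<open>Nu w\<close>, the choice \<open>e = Nu w / 2\<close> would
    bound \<open>(Nu w)\<^sup>2\<close> by half of itself.\<close>
  from this[of "Nu w / 2"] Nu_nonneg[OF w] show ?thesis
    by (cases "Nu w = 0") (auto simp: power2_eq_square field_simps)
qed

text \<open>The unit vector is projected onto an invariant subspace \<open>M\<close>; the two components split the state.\<close>

lemma irreducible:
  assumes pure: "pure_state f"
    and M: "M \<subseteq> CS" "(\<lambda>_. 0) \<in> M" and M_add: "\<And>s t. s \<in> M \<Longrightarrow> t \<in> M \<Longrightarrow> (\<lambda>n. s n + t n) \<in> M"
    and M_cscale: "\<And>s c. s \<in> M \<Longrightarrow> (\<lambda>n. cscale c (s n)) \<in> M"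
    and M_mult: "\<And>s x. s \<in> M \<Longrightarrow> (\<lambda>n. x * s n) \<in> M"
    and M_closed: "\<And>(v :: nat \<Rightarrow> nat \<Rightarrow> 'a) t. (\<And>k. v k \<in> M) \<Longrightarrow> t \<in> CS \<Longrightarrow> (\<And>e. e > 0 \<Longrightarrow> \<exists>N. \<forall>k\<ge>N. Nu (\<lambda>n. v k n - t n) < e) \<Longrightarrow> t \<in> M"
  shows "(\<forall>v\<in>M. Nu v = 0) \<or> M = CS"
proof -
  have MC: "v \<in> CS" if "v \<in> M" for v using M(1) that by blast
  have M_eqv: "t \<in> M" if "s \<in> M" "t \<in> CS" "Nu (\<lambda>n. s n - t n) = 0" for s t
    using M_closed[of "\<lambda>_. s" t] that by auto
  define \<xi> where "\<xi> = (\<lambda>_::nat. 1::'a)"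
  have \<xi>: "\<xi> \<in> CS" by (simp add: \<xi>_def CS_const)
  define D where "D = (INF v\<in>M. (Nu (\<lambda>n. \<xi> n - v n))\<^sup>2)"
  have D_le: "D \<le> (Nu (\<lambda>n. \<xi> n - v n))\<^sup>2" if "v \<in> M" for v
    unfolding D_def by (rule cINF_lower[OF _ that]) (auto intro!: bdd_belowI2[of _ 0])
  have "\<exists>v\<in>M. (Nu (\<lambda>n. \<xi> n - v n))\<^sup>2 < D + e" if "e > 0" for e
  proof -
    have "D < D + e" using that by simp
    then show ?thesis unfolding D_def using M(2) by (subst (asm) (1) cINF_less_iff) (auto intro!: bdd_belowI2[of _ 0])
  qed
  then have "\<exists>v\<in>M. (Nu (\<lambda>n. \<xi> n - v n))\<^sup>2 < D + 1 / (real k + 1)" for k by simp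
  then obtain v where v: "\<And>k. v k \<in> M" "\<And>k. (Nu (\<lambda>n. \<xi> n - v k n))\<^sup>2 < D + 1 / (real k + 1)" by metis
  have vC: "v k \<in> CS" for k using MC v(1) by blast
  have par: "(Nu (\<lambda>n. v i n - v j n))\<^sup>2 \<le> 2 / (real i + 1) + 2 / (real j + 1)" for i j
  proof -
    let ?s = "\<lambda>n. \<xi> n - v i n" and ?t = "\<lambda>n. \<xi> n - v j n"
    have p: "(Nu (\<lambda>n. ?s n + ?t n))\<^sup>2 + (Nu (\<lambda>n. ?s n - ?t n))\<^sup>2 = 2 * (Nu ?s)\<^sup>2 + 2 * (Nu ?t)\<^sup>2"
      by (intro Nu_parallelogram CS_diff \<xi> vC)
    \<comment> \<open>Midpoints of near-minimisers are again in \<open>M\<close>, so the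
      parallelogram law makes the minimising sequence Cauchy.\<close>
    have "(\<lambda>n. cscale (1/2) (v i n + v j n)) \<in> M" by (intro M_cscale M_add v)
    then have "D \<le> (Nu (\<lambda>n. \<xi> n - cscale (1/2) (v i n + v j n)))\<^sup>2" by (rule D_le)
    also have "(\<lambda>n. \<xi> n - cscale (1/2) (v i n + v j n)) = (\<lambda>n. cscale (1/2) (?s n + ?t n))"
    proof
      fix n
      have "cscale (1/2) (\<xi> n + \<xi> n) = \<xi> n" by (simp add: cscale_def flip: scaleR_2)
      then show "\<xi> n - cscale (1/2) (v i n + v j n) = cscale (1/2) (?s n + ?t n)"
        by (simp add: cscale_add cscale_diff algebra_simps)
    qed
    also have "Nu \<dots> = (1/2) * Nu (\<lambda>n. ?s n + ?t n)" 
      unfolding Nu_cscale[OF CS_add[OF CS_diff[OF \<xi> vC] CS_diff[OF \<xi> vC]]] by simp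
    finally have "4 * D \<le> (Nu (\<lambda>n. ?s n + ?t n))\<^sup>2" by (simp add: power2_eq_square)
    moreover have "(\<lambda>n. ?s n - ?t n) = (\<lambda>n. v j n - v i n)" by auto
    ultimately show ?thesis using p v(2)[of i] v(2)[of j] Nu_minus_commute[of "v i" "v j"] by simp
  qed
  have "\<exists>N. \<forall>i\<ge>N. \<forall>j\<ge>N. Nu (\<lambda>n. v i n - v j n) < e" if e: "e > 0" for e
  proof -
    obtain N :: nat where N: "4 / e\<^sup>2 < N" using reals_Archimedean2 by blast
    have "Nu (\<lambda>n. v i n - v j n) < e" if "i \<ge> N" "j \<ge> N" for i j
    proof -
      have b: "2 / (real k + 1) < e\<^sup>2 / 2" if "k \<ge> N" for k
      proof -
        have "4 / e\<^sup>2 < real k + 1" using N that by linarith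
        then show ?thesis using e by (simp add: field_simps)
      qed
      have "(Nu (\<lambda>n. v i n - v j n))\<^sup>2 < e\<^sup>2" using par[of i j] b[OF that(1)] b[OF that(2)] by linarith
      then show ?thesis using e by (intro power2_less_imp_less[of _ e]) auto
    qed
    then show ?thesis by blast
  qed
  note cauchy = this
  obtain m where m: "m \<in> CS" "\<And>e. e > 0 \<Longrightarrow> \<exists>N. \<forall>k\<ge>N. Nu (\<lambda>n. v k n - m n) < e"
    using CS_complete[where v=v, OF vC cauchy] by metis
  have mM: "m \<in> M" by (rule M_closed[where v=v], rule v(1), rule m(1), rule m(2))
  define r where "r = (\<lambda>n. \<xi> n - m n)"
  have r: "r \<in> CS" unfolding r_def by (intro CS_diff \<xi> m)
  have "(Nu r)\<^sup>2 \<le> D"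
  proof (rule field_le_epsilon)
    fix e :: real assume e: "e > 0"
    have D0: "0 \<le> D" unfolding D_def using M(2) by (intro cINF_greatest) auto
    \<comment> \<open>Small enough for the cross term \<open>2 * sqrt (D + 1) * d\<close> and the
      remaining terms in \<open>d\<close> to stay below \<open>e\<close> together.\<close>
    define d where "d = min 1 (e / (2 * (sqrt (D + 1) + 1) + 2))"
    have den: "2 * (sqrt (D + 1) + 1) + 2 > 0" using D0 by (simp add: add_nonneg_pos)
    have d: "d > 0" "d \<le> 1" "d * (2 * (sqrt (D + 1) + 1) + 2) \<le> e"
    proof -
      show "d > 0" "d \<le> 1" using e den by (auto simp: d_def)
      have "d * (2 * (sqrt (D + 1) + 1) + 2) \<le> e / (2 * (sqrt (D + 1) + 1) + 2) * (2 * (sqrt (D + 1) + 1) + 2)"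
        using den by (intro mult_right_mono) (auto simp: d_def)
      then show "d * (2 * (sqrt (D + 1) + 1) + 2) \<le> e" using den by simp
    qed
    obtain N where N: "\<forall>k\<ge>N. Nu (\<lambda>n. v k n - m n) < d" using m(2)[OF d(1)] by blast
    obtain N' :: nat where N': "1 / d < N'" using reals_Archimedean2 by blast
    define k where "k = max N N'"
    have "1 / d < real k + 1" using N' by (simp add: k_def)
    then have k1: "1 / (real k + 1) < d" using d(1) by (simp add: field_simps)
    let ?a = "Nu (\<lambda>n. \<xi> n - v k n)"
    have a0: "0 \<le> ?a" by (intro Nu_nonneg CS_diff \<xi> vC)
    have a: "?a\<^sup>2 \<le> D + d" using v(2)[of k] k1 by simp
    then have "?a\<^sup>2 \<le> D + 1" using d(2) by simp
    then have "?a \<le> sqrt (D + 1)" by (rule real_le_rsqrt)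
    moreover have "Nu r \<le> ?a + d"
    proof -
      have "Nu r \<le> ?a + Nu (\<lambda>n. v k n - m n)" unfolding r_def by (intro Nu_triangle_diff \<xi> vC m)
      moreover have "Nu (\<lambda>n. v k n - m n) < d" using N[rule_format, of k] by (simp add: k_def)
      ultimately show ?thesis by simp
    qed
    ultimately have "(Nu r)\<^sup>2 \<le> (?a + d)\<^sup>2" using Nu_nonneg[OF r] by (intro power_mono) auto
    also have "\<dots> = ?a\<^sup>2 + 2 * ?a * d + d * d" by (simp add: power2_eq_square algebra_simps)
    also have "\<dots> \<le> (D + d) + 2 * sqrt (D + 1) * d + 1 * d"
      using a \<open>?a \<le> sqrt (D + 1)\<close> d by (intro add_mono mult_right_mono mult_left_mono) auto
    also have "\<dots> \<le> D + d * (2 * (sqrt (D + 1) + 1) + 2)" using d(1) by (simp add: algebra_simps)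
    also have "\<dots> \<le> D + e" using d(3) by simp
    finally show "(Nu r)\<^sup>2 \<le> D + e" .
  qed
  have orth: "IP r w = 0" if w: "w \<in> M" for w
  proof -
    have wC: "w \<in> CS" using MC[OF w] .
    define z where "z = IP r w"
    \<comment> \<open>If \<open>z\<close> were nonzero, moving \<open>m\<close> by
      \<open>\<tau> * z\<close> times \<open>w\<close> would lower the distance to
      \<open>\<xi>\<close>. As \<open>\<tau> * (Nu w)\<^sup>2 \<le> 1\<close>, the second order term
      is at most half of the first order gain.\<close>
    define \<tau> where "\<tau> = 1 / ((Nu w)\<^sup>2 + 1)"
    have "(Nu w)\<^sup>2 + 1 > 0" by (simp add: add_nonneg_pos)
    then have tau: "\<tau> > 0" "\<tau> * (Nu w)\<^sup>2 \<le> 1" by (simp_all add: \<tau>_def divide_le_eq_1)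
    define c where "c = of_real \<tau> * z"
    define u where "u = (\<lambda>n. cscale c (w n))"
    have u: "u \<in> CS" "u \<in> M" unfolding u_def using w wC by (auto intro: CS_cscale M_cscale)
    have "complex_of_real ((Nu (\<lambda>n. r n - u n))\<^sup>2) = IP (\<lambda>n. r n - u n) (\<lambda>n. r n - u n)"
      by (rule IP_self[OF CS_diff[OF r u(1)], symmetric])
    also have "\<dots> = IP r r - IP r u - IP u r + IP u u"
      using r u by (simp add: IP_diff IP_diff_right CS_diff)
    finally have expand: "(Nu (\<lambda>n. r n - u n))\<^sup>2 = Re (IP r r) - Re (IP r u) - Re (IP u r) + Re (IP u u)"
      by (metis Re_complex_of_real minus_complex.sel(1) plus_complex.sel(1))
    have "(\<lambda>n. m n + u n) \<in> M" by (intro M_add mM u)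
    then have "D \<le> (Nu (\<lambda>n. \<xi> n - (m n + u n)))\<^sup>2" by (rule D_le)
    also have "(\<lambda>n. \<xi> n - (m n + u n)) = (\<lambda>n. r n - u n)" by (auto simp: r_def)
    also note expand
    also have "Re (IP r r) = (Nu r)\<^sup>2" by (simp add: IP_self[OF r])
    also have "IP r u = cnj c * z" using r wC by (simp add: u_def IP_cscale_right z_def)
    also have "IP u r = c * cnj z" using r wC by (simp add: u_def IP_cscale z_def IP_cnj[of r w])
    also have "Re (IP u u) = (cmod c)\<^sup>2 * (Nu w)\<^sup>2"
    proof -
      have "Nu u = cmod c * Nu w" unfolding u_def by (rule Nu_cscale[OF wC])
      then show ?thesis by (simp add: IP_self[OF u(1)] power_mult_distrib)
    qed
    finally have "0 \<le> - Re (cnj c * z) - Re (c * cnj z) + (cmod c)\<^sup>2 * (Nu w)\<^sup>2" using \<open>(Nu r)\<^sup>2 \<le> D\<close> by simp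
    moreover have "Re (cnj c * z) = \<tau> * (cmod z)\<^sup>2" "Re (c * cnj z) = \<tau> * (cmod z)\<^sup>2"
      by (simp_all add: c_def cmod_power2 algebra_simps power2_eq_square[of "Re z"] power2_eq_square[of "Im z"])
    moreover have "(cmod c)\<^sup>2 = \<tau> * (\<tau> * (cmod z)\<^sup>2)" by (simp add: c_def norm_mult power_mult_distrib power2_eq_square)
    ultimately have "0 \<le> \<tau> * (cmod z)\<^sup>2 * (\<tau> * (Nu w)\<^sup>2 - 2)" by (simp add: algebra_simps)
    moreover have "\<tau> * (cmod z)\<^sup>2 * (\<tau> * (Nu w)\<^sup>2 - 2) \<le> \<tau> * (cmod z)\<^sup>2 * (- 1)"
      using tau by (intro mult_left_mono) auto
    ultimately have "\<tau> * (cmod z)\<^sup>2 \<le> 0" by simp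
    then have "(cmod z)\<^sup>2 \<le> 0" using tau(1) by (simp add: mult_le_0_iff)
    then show ?thesis by (simp add: z_def)
  qed
  have orth': "IP w r = 0" if "w \<in> M" for w using IP_cnj[OF r MC[OF that]] orth[OF that] by simp
  have \<xi>eq: "\<xi> = (\<lambda>n. m n + r n)" by (simp add: r_def)
  have x\<xi>: "(\<lambda>_. x) = (\<lambda>n. x * m n + x * r n)" for x
    using \<xi>eq by (auto simp: \<xi>_def fun_eq_iff simp flip: distrib_left)
  have xm: "(\<lambda>n. x * m n) \<in> M" "(\<lambda>n. x * m n) \<in> CS" "(\<lambda>n. x * r n) \<in> CS" for x
    using M_mult[OF mM] MC CS_mult[OF r] by auto
  \<comment> \<open>\<open>M\<close> is invariant under multiplication by \<open>star x\<close> for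
    every \<open>x\<close>, so the orthogonal complement is invariant as well.\<close>
  have cross: "IP (\<lambda>n. x * r n) w = 0" if "w \<in> M" for x w
    using IP_mult[OF r MC[OF that]] orth[OF M_mult[OF that]] by simp
  define h where "h s x = Re (IP (\<lambda>n. x * s n) s)" for s x
  have h_st: "linear (h s) \<and> (\<forall>x. pos x \<longrightarrow> 0 \<le> h s x) \<and> (\<forall>x. h s (star x) = h s x) \<and> h s 1 = (Nu s)\<^sup>2"
    if s: "s \<in> CS" for s
  proof (intro conjI allI impI)
    show "linear (h s)"
    proof (rule linearI)
      show "h s (x + y) = h s x + h s y" for x y
        using IP_add[OF CS_mult[OF s] CS_mult[OF s] s] by (simp add: h_def distrib_right)
      show "h s (c *\<^sub>R x) = c *\<^sub>R h s x" for c x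
      proof -
        have "(\<lambda>n. c *\<^sub>R x * s n) = (\<lambda>n. cscale (of_real c) (x * s n))" by (simp add: cscale_def)
        then show ?thesis using IP_cscale[OF CS_mult[OF s] s, of "of_real c" x] by (simp add: h_def)
      qed
    qed
    show "0 \<le> h s x" if px: "pos x" for x
    proof -
      obtain y where y: "star y = y" "x = y * y" using px by (auto simp: pos_def)
      have "IP (\<lambda>n. x * s n) s = IP (\<lambda>n. y * s n) (\<lambda>n. y * s n)"
        using IP_mult[OF CS_mult[OF s] s, of y y] y by (simp add: mult.assoc)
      then show ?thesis by (simp add: h_def IP_self CS_mult s)
    qed
    show "h s (star x) = h s x" for x
      using IP_mult[OF s s, of x] IP_cnj[OF s CS_mult[OF s], of "star x"] by (simp add: h_def)
    show "h s 1 = (Nu s)\<^sup>2" by (simp add: h_def IP_self[OF s])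
  qed
  \<comment> \<open>The cross terms vanish, so the state is the sum of the positive functionals
    given by the vectors \<open>m\<close> and \<open>r\<close>.\<close>
  have f_split: "f x = h m x + h r x" for x
  proof -
    have "IP (\<lambda>_. x) \<xi> = IP (\<lambda>n. x * m n) m + IP (\<lambda>n. x * r n) r"
      unfolding x\<xi>[of x] by (subst \<xi>eq)
        (simp add: IP_add IP_add_right CS_add xm m(1) r orth'[OF xm(1)] cross[OF mM])
    moreover have "IP (\<lambda>_. x) \<xi> = \<phi> x" by (simp add: IP_def \<xi>_def)
    ultimately show ?thesis by (simp add: h_def \<phi>_def complex_eq_iff)
  qed
  have one: "(Nu m)\<^sup>2 + (Nu r)\<^sup>2 = 1" using f_split[of 1] h_st[OF m(1)] h_st[OF r] state_one[OF state] by simp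
  consider "Nu m = 0" | "Nu r = 0" | "Nu m \<noteq> 0" "Nu r \<noteq> 0" by blast
  then show ?thesis
  proof cases
    case 1
    \<comment> \<open>With \<open>m\<close> null, the cyclic vector and its whole orbit are
      orthogonal to \<open>M\<close>, and the orbit is dense.\<close>
    have "Nu w = 0" if w: "w \<in> M" for w
    proof (rule IP_eq_0[OF MC[OF w]])
      fix x
      have "cmod (IP (\<lambda>n. x * m n) w) \<le> Nu (\<lambda>n. x * m n) * Nu w" by (rule IP_cs[OF xm(2) MC[OF w]])
      also have "Nu (\<lambda>n. x * m n) = 0" using Nu_mult_le[OF m(1), of x] Nu_nonneg[OF xm(2)[of x]] 1 by simp
      finally have "IP (\<lambda>n. x * m n) w = 0" by simp
      then show "IP (\<lambda>_. x) w = 0"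
        unfolding x\<xi>[of x] using IP_add[OF xm(2,3) MC[OF w]] cross[OF w] by simp
    qed
    then show ?thesis by blast
  next
    case 2
    have "(\<lambda>n. m n - \<xi> n) = (\<lambda>n. - r n)" by (auto simp: r_def)
    then have "Nu (\<lambda>n. m n - \<xi> n) = 0" using Nu_cscale[OF r, of "-1"] 2 by (simp add: cscale_minus_one)
    \<comment> \<open>With the cyclic vector, \<open>M\<close> contains all constants, and these are
      dense.\<close>
    then have "\<xi> \<in> M" using M_eqv[OF mM \<xi>] by simp
    then have const: "(\<lambda>_. x) \<in> M" for x using M_mult[of \<xi> x] by (simp add: \<xi>_def)
    have "s \<in> M" if s: "s \<in> CS" for s
    proof (rule M_closed[of "\<lambda>k _. s k"])
      show "\<exists>N. \<forall>k\<ge>N. Nu (\<lambda>n. s k - s n) < e" if "e > 0" for e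
        unfolding Nu_minus_commute[of "\<lambda>_. s k" for k] by (rule Nu_tail[OF s that])
    qed (use const s in auto)
    then show ?thesis using M(1) by blast
  next
    case 3
    define lam where "lam = (Nu m)\<^sup>2"
    have l: "0 < lam" "lam < 1" "1 - lam = (Nu r)\<^sup>2" using 3 one by (auto simp: lam_def) (smt (verit) zero_less_power2)
    have st: "state (\<lambda>x. h s x / (Nu s)\<^sup>2)" if s: "s \<in> CS" "Nu s \<noteq> 0" for s
    proof -
      note hs = h_st[OF s(1)]
      have "linear (\<lambda>x. h s x / (Nu s)\<^sup>2)"
        using hs by (intro linearI) (simp_all add: linear_add linear_scale add_divide_distrib)
      then show ?thesis using hs s(2) by (simp add: state_def)
    qed
    have "f x = lam * (h m x / (Nu m)\<^sup>2) + (1 - lam) * (h r x / (Nu r)\<^sup>2)" for x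
      using 3 f_split[of x] l(3) by (simp add: lam_def)
    then have "(\<lambda>x. h m x / (Nu m)\<^sup>2) = f"
      using pure st[OF m(1) 3(1)] st[OF r 3(2)] l unfolding pure_state_def by blast
    then have hm: "h m x = lam * f x" for x using 3(1) by (auto simp: lam_def fun_eq_iff field_simps)
    \<comment> \<open>Purity makes \<open>h m\<close> the multiple \<open>lam\<close> of
      \<open>f\<close>, so \<open>w\<close> is orthogonal to all constants and hence null. Pairing
      \<open>w\<close> with \<open>r\<close> then gives
      \<open>lam * (Nu r)\<^sup>2 = 0\<close>.\<close>
    define w where "w = (\<lambda>n. m n - cscale (of_real lam) (\<xi> n))"
    have w: "w \<in> CS" unfolding w_def by (intro CS_diff CS_cscale m \<xi>)
    have Re0: "Re (IP (\<lambda>_. x) w) = 0" for x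
    proof -
      have "IP (\<lambda>_. x) m = IP (\<lambda>n. x * m n) m"
        unfolding x\<xi>[of x] using IP_add[OF xm(2,3) m(1)] cross[OF mM] by simp
      moreover have "IP (\<lambda>_. x) \<xi> = \<phi> x" by (simp add: IP_def \<xi>_def)
      moreover have "IP (\<lambda>_. x) w = IP (\<lambda>_. x) m - of_real lam * IP (\<lambda>_. x) \<xi>"
        unfolding w_def by (simp add: IP_diff_right IP_cscale_right CS_const CS_cscale m(1) \<xi>)
      ultimately show ?thesis using hm[of x] by (simp add: h_def \<phi>_def)
    qed
    have "IP (\<lambda>_. x) w = 0" for x
    proof -
      have "IP (\<lambda>_. cscale \<i> x) w = \<i> * IP (\<lambda>_. x) w" by (rule IP_cscale[OF CS_const w])
      then have "Im (IP (\<lambda>_. x) w) = 0" using Re0[of "cscale \<i> x"] by simp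
      then show ?thesis using Re0[of x] by (simp add: complex_eq_iff)
    qed
    then have Nw: "Nu w = 0" by (rule IP_eq_0[OF w])
    have "cmod (IP w r) \<le> Nu w * Nu r" by (rule IP_cs[OF w r])
    then have "IP w r = 0" using Nw by simp
    moreover have "IP w r = IP m r - of_real lam * IP \<xi> r"
      unfolding w_def by (simp add: IP_diff IP_cscale CS_cscale m(1) \<xi> r)
    moreover have "IP \<xi> r = IP r r" by (subst \<xi>eq) (simp add: IP_add m(1) r orth'[OF mM])
    ultimately have "IP r r = 0" using orth'[OF mM] l(1) by simp
    then show ?thesis using 3(2) by (simp add: IP_self[OF r])
  qed
qed

end

section \<open>Pure states and primitive ideals\<close>

lemma complex_ring_cring: "cring complex_ring"
proof (rule cringI)
  show "abelian_group complex_ring"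
    by (rule abelian_groupI) (auto simp: complex_ring_def intro: exI[of _ "- x" for x])
  show "Group.comm_monoid complex_ring"
    by (rule comm_monoidI) (auto simp: complex_ring_def)
qed (auto simp: complex_ring_def distrib_right)

text \<open>A section of the component map that does not increase norms. It is not unital, as the
  scalar is zero; homomorphism properties are always read off after taking components.\<close>

definition lift :: "'a star_alg \<Rightarrow> 'a \<Rightarrow> 'a cstar_prod" where
  "lift B b = family 0 (\<lambda>C. if C = B then b else \<zero>\<^bsub>C\<^esub>)"

lemma lift_bounded:
  assumes B: "unital_cstar_algebra B" and b: "b \<in> carrier B" and C: "unital_cstar_algebra C"
  shows "(if C = B then b else \<zero>\<^bsub>C\<^esub>) \<in> carrier C \<and> nrm C (if C = B then b else \<zero>\<^bsub>C\<^esub>) \<le> nrm B b"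
proof -
  interpret C: unital_cstar_algebra C by fact
  show ?thesis using b unital_cstar_algebra.nrm_nonneg[OF B b] by (auto simp: C.nrm_zero)
qed

lemma component_lift:
  assumes B: "unital_cstar_algebra B" and b: "b \<in> carrier B"
  shows "component (lift B b) B = b"
  using component_family[OF B, of "\<lambda>C. if C = B then b else \<zero>\<^bsub>C\<^esub>", OF lift_bounded[OF B b]] by (simp add: lift_def)

lemma component_cscale:
  assumes B: "unital_cstar_algebra B"
  shows "component (cscale c x) B = c \<odot>\<^bsub>B\<^esub> component x B"
proof -
  interpret unital_cstar_algebra B by fact
  note k = component_closed[OF B, of x]
  have "component (iu * x) B = \<i> \<odot>\<^bsub>B\<^esub> component x B"
    by (simp add: component_simps[OF B] component_iu[OF B] smult_mult_left k)
  then have "component (cscale c x) B = complex_of_real (Re c) \<odot>\<^bsub>B\<^esub> component x B \<oplus>\<^bsub>B\<^esub>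
      complex_of_real (Im c) \<odot>\<^bsub>B\<^esub> (\<i> \<odot>\<^bsub>B\<^esub> component x B)"
    by (simp add: cscale_def component_simps[OF B])
  also have "\<dots> = (complex_of_real (Re c) + complex_of_real (Im c) * \<i>) \<odot>\<^bsub>B\<^esub> component x B"
    by (simp only: smult_simps(2,4)[OF k k])
  also have "complex_of_real (Re c) + complex_of_real (Im c) * \<i> = c" by (simp add: complex_eq_iff)
  finally show ?thesis .
qed

text \<open>\<open>f\<close> is a state of the product algebra. Vanishing on the kernel of the
  component map, it amounts to a state of \<open>B\<close>, and its GNS space carries a
  representation of \<open>B\<close>.\<close>

locale gns_component = gns f for f :: "'a cstar_prod \<Rightarrow> real" +
  fixes B :: "'a star_alg"
  assumes B: "unital_cstar_algebra B" and f_zero: "\<And>z. component z B = \<zero>\<^bsub>B\<^esub> \<Longrightarrow> f z = 0"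
begin

interpretation B: unital_cstar_algebra B by (rule B)

lemma component_in [simp, intro]: "component x B \<in> carrier B"
  by (rule component_closed[OF B])

lemma \<nu>_component_zero:
  assumes "component z B = \<zero>\<^bsub>B\<^esub>" shows "\<nu> z = 0"
proof -
  have "component (star z * z) B = \<zero>\<^bsub>B\<^esub>"
    using assms by (simp add: component_mult[OF B] component_star[OF B] B.adj_closed)
  then show ?thesis by (simp add: \<nu>_def f_zero)
qed

lemma component_diff_zero: "component x B = component y B \<Longrightarrow> component (x - y) B = \<zero>\<^bsub>B\<^esub>"
  by (simp add: component_diff[OF B] B.minus_eq B.r_neg)

lemma \<nu>_lift_component: "\<nu> (lift B (component x B) - x) = 0"
  by (intro \<nu>_component_zero component_diff_zero component_lift[OF B] component_in)

section \<open>Vectors coded by sequences in the carrier of \<open>B\<close>\<close>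

definition dec :: "(nat \<Rightarrow> 'a) \<Rightarrow> nat \<Rightarrow> 'a cstar_prod" where "dec r = (\<lambda>n. lift B (r n))"

definition codes :: "(nat \<Rightarrow> 'a cstar_prod) \<Rightarrow> (nat \<Rightarrow> 'a) \<Rightarrow> bool" where
  "codes s r \<longleftrightarrow> (\<forall>n. r n \<in> carrier B) \<and> dec r \<in> CS \<and> Nu (\<lambda>n. dec r n - s n) = 0"

definition enc :: "(nat \<Rightarrow> 'a cstar_prod) \<Rightarrow> nat \<Rightarrow> 'a" where "enc s = (SOME r. codes s r)"

lemma Nu_eq_0I: "(\<And>n. \<nu> (s n) = 0) \<Longrightarrow> Nu s = 0"
  by (simp add: Nu_def)

lemma codes_enc: assumes "s \<in> CS" shows "codes s (enc s)"
  unfolding enc_def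
proof (rule someI[of "codes s"])
  let ?r = "\<lambda>n. component (s n) B"
  have z: "\<nu> (dec ?r n - s n) = 0" for n by (simp add: dec_def \<nu>_lift_component)
  have "dec ?r \<in> CS"
  proof (rule CS_dominated[OF assms assms, where K=1 and L=0])
    show "\<nu> (dec ?r m - dec ?r n) \<le> 1 * \<nu> (s m - s n) + 0 * \<nu> (s m - s n)" for m n
      using \<nu>_triangle_diff[of "dec ?r m" "dec ?r n" "s m"] \<nu>_triangle_diff[of "s m" "dec ?r n" "s n"]
        z[of m] z[of n] \<nu>_minus_commute[of "s n" "dec ?r n"] by simp
  qed auto
  then show "codes s ?r" using z by (simp add: codes_def Nu_eq_0I)
qed

lemma dec_enc: "s \<in> CS \<Longrightarrow> dec (enc s) \<in> CS" "s \<in> CS \<Longrightarrow> Nu (\<lambda>n. dec (enc s) n - s n) = 0"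
  using codes_enc[of s] by (auto simp: codes_def)

lemma Nu_trans_0:
  assumes "s \<in> CS" "t \<in> CS" "u \<in> CS" "Nu (\<lambda>n. s n - t n) = 0" "Nu (\<lambda>n. t n - u n) = 0"
  shows "Nu (\<lambda>n. s n - u n) = 0"
  using Nu_triangle_diff[OF assms(1-3)] Nu_nonneg[OF CS_diff[OF assms(1,3)]] assms(4,5) by simp

text \<open>Equivalent sequences have the same predicate \<open>codes\<close>, so the choice in
  \<open>enc\<close> returns the same code for both. Thus \<open>enc\<close> is the quotient map
  modulo null sequences, with values of type \<open>nat \<Rightarrow> 'a\<close>.\<close>

lemma enc_eq_iff:
  assumes s: "s \<in> CS" and t: "t \<in> CS"
  shows "enc s = enc t \<longleftrightarrow> Nu (\<lambda>n. s n - t n) = 0"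
proof
  assume e: "enc s = enc t"
  have "Nu (\<lambda>n. s n - dec (enc s) n) = 0" using dec_enc(2)[OF s] Nu_minus_commute[of s] by simp
  then show "Nu (\<lambda>n. s n - t n) = 0"
    using Nu_trans_0[OF s dec_enc(1)[OF s] t] dec_enc(2)[OF t] e by simp
next
  assume z: "Nu (\<lambda>n. s n - t n) = 0"
  have z': "Nu (\<lambda>n. t n - s n) = 0" using z Nu_minus_commute[of s t] by simp
  have "codes s r \<longleftrightarrow> codes t r" for r
    unfolding codes_def using Nu_trans_0[OF _ s t _ z, of "dec r"] Nu_trans_0[OF _ t s _ z', of "dec r"] by blast
  then have "codes s = codes t" by blast
  then show "enc s = enc t" by (simp add: enc_def)
qed

lemma enc_eqI:
  assumes "s \<in> CS" "t \<in> CS" "\<And>n. \<nu> (s n - t n) = 0"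
  shows "enc s = enc t"
  using assms by (simp add: enc_eq_iff Nu_eq_0I)

definition HS :: "(nat \<Rightarrow> 'a) hilbert" where
  "HS = \<lparr>carrier = enc ` CS, mult = (\<lambda>a b. a), one = enc (\<lambda>_. 0), zero = enc (\<lambda>_. 0),
     add = (\<lambda>a b. enc (\<lambda>n. dec a n + dec b n)), smult = (\<lambda>c a. enc (\<lambda>n. cscale c (dec a n))),
     ip = (\<lambda>a b. IP (dec a) (dec b))\<rparr>"

definition rep :: "'a \<Rightarrow> (nat \<Rightarrow> 'a) \<Rightarrow> nat \<Rightarrow> 'a" where
  "rep b a = enc (\<lambda>n. lift B b * dec a n)"

lemma carrier_HS: "carrier HS = enc ` CS" and zero_HS: "\<zero>\<^bsub>HS\<^esub> = enc (\<lambda>_. 0)"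
  by (simp_all add: HS_def)

lemma enc_carrier: "s \<in> CS \<Longrightarrow> enc s \<in> carrier HS"
  by (simp add: carrier_HS)

lemma add_HS: assumes "s \<in> CS" "t \<in> CS" shows "enc s \<oplus>\<^bsub>HS\<^esub> enc t = enc (\<lambda>n. s n + t n)"
proof -
  note d = dec_enc[OF assms(1)] dec_enc[OF assms(2)]
  have "(\<lambda>n. (dec (enc s) n + dec (enc t) n) - (s n + t n)) = (\<lambda>n. (dec (enc s) n - s n) + (dec (enc t) n - t n))"
    by (simp add: algebra_simps)
  then have "Nu (\<lambda>n. (dec (enc s) n + dec (enc t) n) - (s n + t n)) \<le> 0"
    using Nu_triangle[OF CS_diff[OF d(1) assms(1)] CS_diff[OF d(3) assms(2)]] d(2,4) by simp
  then have "Nu (\<lambda>n. (dec (enc s) n + dec (enc t) n) - (s n + t n)) = 0"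
    using Nu_nonneg[OF CS_diff[OF CS_add[OF d(1,3)] CS_add[OF assms]]] by simp
  then show ?thesis by (simp add: HS_def enc_eq_iff CS_add d assms)
qed

lemma smult_HS: assumes "s \<in> CS" shows "c \<odot>\<^bsub>HS\<^esub> enc s = enc (\<lambda>n. cscale c (s n))"
proof -
  note d = dec_enc[OF assms]
  have "Nu (\<lambda>n. cscale c (dec (enc s) n) - cscale c (s n)) = 0"
    using Nu_cscale[OF CS_diff[OF d(1) assms], of c] d(2) by (simp add: cscale_diff)
  then show ?thesis by (simp add: HS_def enc_eq_iff CS_cscale d assms)
qed

lemma IP_cong:
  assumes "s \<in> CS" "s' \<in> CS" "t \<in> CS" "Nu (\<lambda>n. s n - s' n) = 0"
  shows "IP s t = IP s' t"
proof -
  have "cmod (IP (\<lambda>n. s n - s' n) t) \<le> 0"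
    using IP_cs[OF CS_diff[OF assms(1,2)] assms(3)] assms(4) by simp
  then show ?thesis using IP_diff[OF assms(1-3)] by simp
qed

lemma ip_HS: assumes s: "s \<in> CS" and t: "t \<in> CS" shows "ip HS (enc s) (enc t) = IP s t"
proof -
  note ds = dec_enc[OF s] and dt = dec_enc[OF t]
  have "IP (dec (enc s)) (dec (enc t)) = IP s (dec (enc t))" by (rule IP_cong[OF ds(1) s dt(1) ds(2)])
  also have "\<dots> = cnj (IP (dec (enc t)) s)" by (rule IP_cnj[OF dt(1) s])
  also have "IP (dec (enc t)) s = IP t s" by (rule IP_cong[OF dt(1) t s dt(2)])
  also have "cnj (IP t s) = IP s t" by (rule IP_cnj[OF t s, symmetric])
  finally show ?thesis by (simp add: HS_def)
qed

lemma \<nu>_mult_zero: assumes "component x B = component y B" shows "\<nu> (x * z - y * z) = 0"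
proof -
  have "component (x * z - y * z) B = \<zero>\<^bsub>B\<^esub>"
    using assms by (intro component_diff_zero) (simp add: component_mult[OF B])
  then show ?thesis by (rule \<nu>_component_zero)
qed

text \<open>All preimages of \<open>b\<close> act alike, since the difference of two of them is
  annihilated by \<open>\<nu>\<close>, also after multiplication on the right. The laws of a
  representation can therefore be checked with \<open>x + y\<close>, \<open>x * y\<close>,
  \<open>star x\<close> and \<open>1\<close> as preimages.\<close>

lemma rep_enc:
  assumes s: "s \<in> CS" and x: "component x B = b"
  shows "rep b (enc s) = enc (\<lambda>n. x * s n)"
proof -
  note d = dec_enc[OF s]
  have b: "component (lift B b) B = component x B" using x component_lift[OF B] component_in by metis
  have "enc (\<lambda>n. lift B b * dec (enc s) n) = enc (\<lambda>n. x * dec (enc s) n)"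
    by (intro enc_eqI CS_mult d \<nu>_mult_zero b)
  also have "\<dots> = enc (\<lambda>n. x * s n)"
  proof -
    have "Nu (\<lambda>n. x * dec (enc s) n - x * s n) \<le> 0"
      using Nu_mult_le[OF CS_diff[OF d(1) s], of x] d(2) by (simp add: right_diff_distrib)
    then have "Nu (\<lambda>n. x * dec (enc s) n - x * s n) = 0"
      using Nu_nonneg[OF CS_diff[OF CS_mult[OF d(1)] CS_mult[OF s]], of x x] by simp
    then show ?thesis by (simp add: enc_eq_iff CS_mult d s)
  qed
  finally show ?thesis by (simp add: rep_def)
qed

lemma HS_E: assumes "a \<in> carrier HS" obtains s where "s \<in> CS" "a = enc s"
  using assms by (auto simp: carrier_HS)

section \<open>The GNS Hilbert space and the representation of \<open>B\<close>\<close>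

lemma abelian_group_HS: "abelian_group HS"
proof (rule abelian_groupI)
  fix x assume "x \<in> carrier HS"
  then obtain s where s: "s \<in> CS" "x = enc s" by (rule HS_E)
  show "\<zero>\<^bsub>HS\<^esub> \<oplus>\<^bsub>HS\<^esub> x = x" by (simp add: s zero_HS add_HS CS_const)
  show "\<exists>y\<in>carrier HS. y \<oplus>\<^bsub>HS\<^esub> x = \<zero>\<^bsub>HS\<^esub>"
    by (intro bexI[of _ "enc (\<lambda>n. - s n)"]) (simp_all add: s zero_HS add_HS CS_minus enc_carrier)
  fix y assume "y \<in> carrier HS"
  then obtain t where t: "t \<in> CS" "y = enc t" by (rule HS_E)
  show "x \<oplus>\<^bsub>HS\<^esub> y \<in> carrier HS" by (simp add: s t add_HS CS_add enc_carrier)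
  show "x \<oplus>\<^bsub>HS\<^esub> y = y \<oplus>\<^bsub>HS\<^esub> x" by (simp add: s t add_HS add.commute)
  fix z assume "z \<in> carrier HS"
  then obtain u where u: "u \<in> CS" "z = enc u" by (rule HS_E)
  show "(x \<oplus>\<^bsub>HS\<^esub> y) \<oplus>\<^bsub>HS\<^esub> z = x \<oplus>\<^bsub>HS\<^esub> (y \<oplus>\<^bsub>HS\<^esub> z)" by (simp add: s t u add_HS CS_add add.assoc)
qed (simp add: zero_HS enc_carrier CS_const)

interpretation H: abelian_group HS by (rule abelian_group_HS)

lemma uminus_HS: "s \<in> CS \<Longrightarrow> \<ominus>\<^bsub>HS\<^esub> enc s = enc (\<lambda>n. - s n)"
  by (intro H.minus_equality) (simp_all add: add_HS CS_minus enc_carrier zero_HS)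

lemma minus_HS: "s \<in> CS \<Longrightarrow> t \<in> CS \<Longrightarrow> enc s \<ominus>\<^bsub>HS\<^esub> enc t = enc (\<lambda>n. s n - t n)"
  by (simp add: H.minus_eq uminus_HS add_HS CS_minus)

lemma hnorm_HS: "s \<in> CS \<Longrightarrow> hnorm HS (enc s) = Nu s"
  by (simp add: hnorm_def ip_HS IP_self Nu_nonneg)

lemma enc_eq_zero: "s \<in> CS \<Longrightarrow> enc s = \<zero>\<^bsub>HS\<^esub> \<longleftrightarrow> Nu s = 0"
  by (simp add: zero_HS enc_eq_iff CS_const)

lemma normed_HS: "normed_group HS (hnorm HS)"
proof unfold_locales
  fix x assume "x \<in> carrier HS"
  then obtain s where s: "s \<in> CS" "x = enc s" by (rule HS_E)
  show "0 \<le> hnorm HS x" by (simp add: s hnorm_HS Nu_nonneg)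
  show "hnorm HS x = 0 \<longleftrightarrow> x = \<zero>\<^bsub>HS\<^esub>" by (simp add: s hnorm_HS enc_eq_zero)
  show "hnorm HS (\<ominus>\<^bsub>HS\<^esub> x) = hnorm HS x"
    using Nu_cscale[OF s(1), of "-1"] by (simp add: s uminus_HS hnorm_HS CS_minus cscale_minus_one)
  fix y assume "y \<in> carrier HS"
  then obtain t where t: "t \<in> CS" "y = enc t" by (rule HS_E)
  show "hnorm HS (x \<oplus>\<^bsub>HS\<^esub> y) \<le> hnorm HS x + hnorm HS y"
    by (simp add: s t add_HS hnorm_HS CS_add Nu_triangle)
qed

interpretation N: normed_group HS "hnorm HS" by (rule normed_HS)

lemma complete_HS: "Metric_space.mcomplete (carrier HS) (norm_dist HS (hnorm HS))"
  unfolding N.mcomplete_iff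
proof (intro allI impI)
  fix h :: "nat \<Rightarrow> nat \<Rightarrow> 'a"
  assume h: "(\<forall>k. h k \<in> carrier HS) \<and> (\<forall>e>0. \<exists>N. \<forall>i\<ge>N. \<forall>j\<ge>N. hnorm HS (h i \<ominus>\<^bsub>HS\<^esub> h j) < e)"
  then have "\<exists>s. s \<in> CS \<and> h k = enc s" for k using HS_E by metis
  then obtain v where v: "\<And>k. v k \<in> CS" "\<And>k. h k = enc (v k)" by metis
  have "\<exists>N. \<forall>i\<ge>N. \<forall>j\<ge>N. Nu (\<lambda>n. v i n - v j n) < e" if "e > 0" for e
    using h that by (simp add: v minus_HS hnorm_HS CS_diff)
  then obtain t where t: "t \<in> CS" "\<forall>e>0. \<exists>N. \<forall>k\<ge>N. Nu (\<lambda>n. v k n - t n) < e"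
    using CS_complete[of v] v(1) by blast
  then have "N.conv h (enc t)"
    by (simp add: N.conv_def v minus_HS hnorm_HS CS_diff enc_carrier)
  then show "\<exists>l. N.conv h l" by blast
qed

lemma module_HS: "Module.module complex_ring HS"
proof (rule moduleI[OF complex_ring_cring abelian_group_HS])
  fix x assume "x \<in> carrier HS"
  then obtain s where s: "s \<in> CS" "x = enc s" by (rule HS_E)
  show "\<one>\<^bsub>complex_ring\<^esub> \<odot>\<^bsub>HS\<^esub> x = x" by (simp add: s smult_HS complex_ring_def cscale_one)
  fix a :: complex
  show "a \<odot>\<^bsub>HS\<^esub> x \<in> carrier HS" by (simp add: s smult_HS CS_cscale enc_carrier)
  fix b :: complex
  show "(a \<oplus>\<^bsub>complex_ring\<^esub> b) \<odot>\<^bsub>HS\<^esub> x = a \<odot>\<^bsub>HS\<^esub> x \<oplus>\<^bsub>HS\<^esub> b \<odot>\<^bsub>HS\<^esub> x"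
    by (simp add: s smult_HS complex_ring_def CS_cscale add_HS cscale_add_left)
  show "(a \<otimes>\<^bsub>complex_ring\<^esub> b) \<odot>\<^bsub>HS\<^esub> x = a \<odot>\<^bsub>HS\<^esub> (b \<odot>\<^bsub>HS\<^esub> x)"
    by (simp add: s smult_HS complex_ring_def CS_cscale cscale_mult)
next
  fix a x y assume "x \<in> carrier HS" "y \<in> carrier HS"
  then obtain s t where s: "s \<in> CS" "x = enc s" and t: "t \<in> CS" "y = enc t" by (metis HS_E)
  show "a \<odot>\<^bsub>HS\<^esub> (x \<oplus>\<^bsub>HS\<^esub> y) = a \<odot>\<^bsub>HS\<^esub> x \<oplus>\<^bsub>HS\<^esub> a \<odot>\<^bsub>HS\<^esub> y"
    by (simp add: s t smult_HS CS_cscale CS_add add_HS cscale_add)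
qed

lemma hilbert_HS: "hilbert_space HS"
proof (rule hilbert_space.intro[OF module_HS hilbert_space_axioms.intro])
  fix u v w assume "u \<in> carrier HS" "v \<in> carrier HS" "w \<in> carrier HS"
  then show "ip HS (u \<oplus>\<^bsub>HS\<^esub> v) w = ip HS u w + ip HS v w"
    by (elim HS_E) (simp add: add_HS ip_HS CS_add IP_add)
next
  fix v w c assume "v \<in> carrier HS" "w \<in> carrier HS"
  then obtain s t where s: "s \<in> CS" "v = enc s" and t: "t \<in> CS" "w = enc t" by (metis HS_E)
  show "ip HS (c \<odot>\<^bsub>HS\<^esub> v) w = c * ip HS v w" by (simp add: s t smult_HS ip_HS CS_cscale IP_cscale)
  show "ip HS w v = cnj (ip HS v w)" using IP_cnj[OF s(1) t(1)] by (simp add: s t ip_HS)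
next
  fix v assume "v \<in> carrier HS"
  then obtain s where s: "s \<in> CS" "v = enc s" by (rule HS_E)
  show "0 \<le> Re (ip HS v v)" by (simp add: s ip_HS IP_self)
  show "v = \<zero>\<^bsub>HS\<^esub>" if "ip HS v v = 0" using that by (simp add: s ip_HS IP_self enc_eq_zero)
qed (rule complete_HS)

lemma representation_HS: "representation B HS rep"
  unfolding representation_def
proof (intro conjI ballI allI)
  show "hilbert_space HS" by (rule hilbert_HS)
  fix a assume a: "a \<in> carrier B"
  define x where "x = lift B a"
  have x: "component x B = a" unfolding x_def by (rule component_lift[OF B a])
  note ra = rep_enc[OF _ x]
  show "bounded_operator HS (rep a)"
    unfolding bounded_operator_def
  proof (intro conjI ballI allI)
    show "rep a \<in> carrier HS \<rightarrow> carrier HS" by (auto elim!: HS_E simp: ra CS_mult enc_carrier)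
    show "\<exists>K. \<forall>v\<in>carrier HS. hnorm HS (rep a v) \<le> K * hnorm HS v"
      by (intro exI[of _ "norm x"] ballI) (auto elim!: HS_E simp: ra CS_mult hnorm_HS Nu_mult_le)
    fix v w assume "v \<in> carrier HS" "w \<in> carrier HS"
    then show "rep a (v \<oplus>\<^bsub>HS\<^esub> w) = rep a v \<oplus>\<^bsub>HS\<^esub> rep a w"
      by (elim HS_E) (simp add: ra add_HS CS_add CS_mult distrib_left)
  next
    fix c v assume "v \<in> carrier HS"
    then show "rep a (c \<odot>\<^bsub>HS\<^esub> v) = c \<odot>\<^bsub>HS\<^esub> rep a v"
      by (elim HS_E) (simp add: ra smult_HS CS_cscale CS_mult mult_cscale)
  qed
  fix v assume "v \<in> carrier HS"
  then obtain s where s: "s \<in> CS" "v = enc s" by (rule HS_E)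
  have "component (cscale c x) B = c \<odot>\<^bsub>B\<^esub> a" for c by (simp add: component_cscale[OF B] x)
  then show "rep (c \<odot>\<^bsub>B\<^esub> a) v = c \<odot>\<^bsub>HS\<^esub> rep a v" for c
  proof -
    have "cscale c x * y = cscale c (x * y)" for y :: "'a cstar_prod"
      by (simp add: cscale_def distrib_right mult.assoc)
    then show ?thesis using rep_enc[OF s(1) \<open>component (cscale c x) B = c \<odot>\<^bsub>B\<^esub> a\<close>] by (simp add: s ra smult_HS CS_mult)
  qed
  fix w assume "w \<in> carrier HS"
  then obtain t where t: "t \<in> CS" "w = enc t" by (rule HS_E)
  have "component (star x) B = adj B a" by (simp add: component_star[OF B] x)
  then have "rep (adj B a) w = enc (\<lambda>n. star x * t n)" using rep_enc[OF t(1)] t(2) by blast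
  then show "ip HS (rep a v) w = ip HS v (rep (adj B a) w)"
    by (simp add: s t ra ip_HS CS_mult IP_mult)
next
  fix a b v assume a: "a \<in> carrier B" and b: "b \<in> carrier B" and "v \<in> carrier HS"
  then obtain s where s: "s \<in> CS" "v = enc s" by (blast elim: HS_E)
  define x y where "x = lift B a" "y = lift B b"
  have x: "component x B = a" and y: "component y B = b"
    unfolding x_y_def by (rule component_lift[OF B] a b)+
  have xy: "component (x + y) B = a \<oplus>\<^bsub>B\<^esub> b" "component (x * y) B = a \<otimes>\<^bsub>B\<^esub> b"
    by (simp_all add: component_simps[OF B] x y)
  show "rep (a \<oplus>\<^bsub>B\<^esub> b) v = rep a v \<oplus>\<^bsub>HS\<^esub> rep b v"
    by (simp add: s rep_enc[OF s(1) xy(1)] rep_enc[OF s(1) x] rep_enc[OF s(1) y] add_HS CS_mult s(1) distrib_right)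
  show "rep (a \<otimes>\<^bsub>B\<^esub> b) v = rep a (rep b v)"
    by (simp add: s rep_enc[OF s(1) xy(2)] rep_enc[OF s(1) y] rep_enc[OF CS_mult[OF s(1)] x] mult.assoc)
next
  fix v assume "v \<in> carrier HS"
  then show "rep \<one>\<^bsub>B\<^esub> v = v"
    by (elim HS_E) (simp add: rep_enc[OF _ component_one[OF B]])
qed

lemma irreducible_HS:
  assumes pure: "pure_state f"
  shows "irreducible_representation B HS rep"
  unfolding irreducible_representation_def
proof (intro conjI allI impI)
  show "representation B HS rep" by (rule representation_HS)
  have "enc (\<lambda>_. 1) \<noteq> \<zero>\<^bsub>HS\<^esub>" by (simp add: enc_eq_zero CS_const Nu_const \<nu>_one)
  then show "carrier HS \<noteq> {\<zero>\<^bsub>HS\<^esub>}" using enc_carrier[OF CS_const, of 1] by blast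
  fix M assume M: "closed_subspace HS M \<and> (\<forall>a\<in>carrier B. \<forall>v\<in>M. rep a v \<in> M)"
  then have sub: "submodule M complex_ring HS" and cl: "closedin (norm_topology HS (hnorm HS)) M"
    by (auto simp: closed_subspace_def)
  have Mc: "M \<subseteq> carrier HS" and M_lim: "\<And>s l. \<forall>k. s k \<in> M \<Longrightarrow> N.conv s l \<Longrightarrow> l \<in> M"
    using cl unfolding N.closedin_iff by blast+
  have sg: "subgroup M (add_monoid HS)" using sub by (simp add: submodule_def)
  have M0: "\<zero>\<^bsub>HS\<^esub> \<in> M" using subgroup.one_closed[OF sg] by simp
  have Madd: "x \<oplus>\<^bsub>HS\<^esub> y \<in> M" if "x \<in> M" "y \<in> M" for x y using subgroup.m_closed[OF sg that] by simp
  have Msm: "c \<odot>\<^bsub>HS\<^esub> x \<in> M" if "x \<in> M" for c x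
    using submodule.smult_closed[OF sub _ that, of c] by (simp add: complex_ring_def)
  \<comment> \<open>The closed subspace is pulled back to the Cauchy sequences representing it,
    which is the setting of \<open>irreducible\<close>.\<close>
  define S where "S = {s \<in> CS. enc s \<in> M}"
  have "(\<forall>v\<in>S. Nu v = 0) \<or> S = CS"
  proof (rule irreducible[OF pure])
    show "(\<lambda>_. 0) \<in> S" using M0 by (simp add: S_def CS_const zero_HS)
    show "(\<lambda>n. s n + t n) \<in> S" if "s \<in> S" "t \<in> S" for s t
      using that Madd[of "enc s" "enc t"] by (simp add: S_def CS_add add_HS)
    show "(\<lambda>n. cscale c (s n)) \<in> S" if "s \<in> S" for s c
      using that Msm[of "enc s" c] by (simp add: S_def CS_cscale smult_HS)
    show "(\<lambda>n. x * s n) \<in> S" if "s \<in> S" for s x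
    proof -
      have "rep (component x B) (enc s) \<in> M" using M that component_in by (auto simp: S_def)
      then show ?thesis using that rep_enc[of s x] by (simp add: S_def CS_mult)
    qed
    fix v :: "nat \<Rightarrow> nat \<Rightarrow> 'a cstar_prod" and t
    assume v: "\<And>k. v k \<in> S" and t: "t \<in> CS" and lim: "\<And>e. e > 0 \<Longrightarrow> \<exists>N. \<forall>k\<ge>N. Nu (\<lambda>n. v k n - t n) < e"
    have "N.conv (\<lambda>k. enc (v k)) (enc t)"
      using v t lim by (simp add: N.conv_def S_def minus_HS hnorm_HS CS_diff enc_carrier)
    moreover have "\<forall>k. enc (v k) \<in> M" using v by (simp add: S_def)
    ultimately have "enc t \<in> M" by (rule M_lim[rotated])
    then show "t \<in> S" using t by (simp add: S_def)
  qed (auto simp: S_def)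
  then show "M = {\<zero>\<^bsub>HS\<^esub>} \<or> M = carrier HS"
  proof
    assume z: "\<forall>v\<in>S. Nu v = 0"
    have "x = \<zero>\<^bsub>HS\<^esub>" if x: "x \<in> M" for x
    proof -
      have "x \<in> carrier HS" using Mc x by blast
      then obtain s where "s \<in> CS" "x = enc s" by (rule HS_E)
      then show ?thesis using z x by (simp add: S_def enc_eq_zero)
    qed
    then show ?thesis using M0 by blast
  next
    assume "S = CS"
    then have "carrier HS \<subseteq> M" by (auto simp: S_def carrier_HS)
    then show ?thesis using Mc by blast
  qed
qed

text \<open>The kernel annihilates the class of \<open>1\<close>, so \<open>\<nu> x = 0\<close>, and
  Cauchy-Schwarz against \<open>1\<close> gives the claim.\<close>

lemma f_zero_on_kernel:
  assumes "component x B \<in> representation_kernel B HS rep"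
  shows "f x = 0"
proof -
  have "rep (component x B) (enc (\<lambda>_. 1)) = \<zero>\<^bsub>HS\<^esub>"
    using assms enc_carrier[OF CS_const] by (simp add: representation_kernel_def)
  then have "enc (\<lambda>_. x) = \<zero>\<^bsub>HS\<^esub>" by (simp add: rep_enc[OF CS_const refl])
  then have "\<nu> x = 0" by (simp add: enc_eq_zero CS_const Nu_const)
  then show ?thesis using f_cs[of 1 x] by simp
qed

end

text \<open>Connects pure states with the hypothesis on primitive ideals: \<open>P\<close> is the
  kernel of the GNS representation, which purity makes irreducible.\<close>

lemma pure_state_vanishes_on_primitive:
  assumes B: "unital_cstar_algebra B" and f: "pure_state f" "\<And>z. component z B = \<zero>\<^bsub>B\<^esub> \<Longrightarrow> f z = 0"
  obtains P where "primitive_ideal B P" "\<And>x. component x B \<in> P \<Longrightarrow> f x = 0"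
proof -
  interpret gns_component f B
    using f(1) by (intro gns_component.intro gns.intro gns_component_axioms.intro B f(2)) (auto simp: pure_state_def)
  have "primitive_ideal B (representation_kernel B HS rep)"
    unfolding primitive_ideal_def using irreducible_HS[OF f(1)] by blast
  then show ?thesis using that f_zero_on_kernel by blast
qed

section \<open>Subsets of one component\<close>

lemma component_lift_other:
  assumes B: "unital_cstar_algebra B" and b: "b \<in> carrier B" and C: "unital_cstar_algebra C"
  shows "component (lift B b) C = (if C = B then b else \<zero>\<^bsub>C\<^esub>)"
  unfolding lift_def by (rule component_family[OF C lift_bounded[OF B b]])

lemma scalar_lift:
  assumes B: "unital_cstar_algebra B" and b: "b \<in> carrier B"
  shows "scalar (lift B b) = 0"
  unfolding lift_def by (rule scalar_family[OF lift_bounded[OF B b]])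

lemma lift_diff:
  assumes B: "unital_cstar_algebra B" and a: "a \<in> carrier B" and b: "b \<in> carrier B"
  shows "lift B a - lift B b = lift B (a \<ominus>\<^bsub>B\<^esub> b)"
proof (rule component_eqI)
  interpret B: unital_cstar_algebra B by (rule B)
  have ab: "a \<ominus>\<^bsub>B\<^esub> b \<in> carrier B" using a b by simp
  show "scalar (lift B a - lift B b) = scalar (lift B (a \<ominus>\<^bsub>B\<^esub> b))"
    by (simp add: scalar_simps scalar_lift[OF B] a b)
  fix C :: "'a star_alg" assume C: "unital_cstar_algebra C"
  interpret C: unital_cstar_algebra C by (rule C)
  show "component (lift B a - lift B b) C = component (lift B (a \<ominus>\<^bsub>B\<^esub> b)) C"
    unfolding component_diff[OF C] component_lift_other[OF B a C] component_lift_other[OF B b C]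
      component_lift_other[OF B ab C]
    by (cases "C = B") (simp_all add: C.minus_eq)
qed

lemma norm_lift:
  assumes B: "unital_cstar_algebra B" and b: "b \<in> carrier B"
  shows "norm (lift B b) \<le> nrm B b"
proof (rule norm_cstar_prod_leI)
  show "cmod (scalar (lift B b)) \<le> nrm B b"
    using unital_cstar_algebra.nrm_nonneg[OF B b] by (simp add: scalar_lift[OF B b])
  show "nrm C (component (lift B b) C) \<le> nrm B b" if C: "unital_cstar_algebra C" for C
    using lift_bounded[OF B b C] by (simp add: component_lift_other[OF B b C])
qed

context
  fixes B :: "'a star_alg"
  assumes B: "unital_cstar_algebra B"
begin

interpretation B: unital_cstar_algebra B by (rule B)
interpretation N: normed_group B "nrm B" by (rule B.normed)

text \<open>The component map does not increase norms, so it is continuous.\<close>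

lemma closed_component:
  assumes "closedin (norm_topology B (nrm B)) S"
  shows "closed {x. component x B \<in> S}"
  unfolding closed_sequential_limits
proof (intro allI impI, elim conjE)
  fix s l assume s: "\<forall>n. s n \<in> {x. component x B \<in> S}" and lim: "s \<longlonglongrightarrow> l"
  have "N.conv (\<lambda>n. component (s n) B) (component l B)"
    unfolding N.conv_def
  proof (intro conjI allI impI)
    fix e :: real assume "e > 0"
    then obtain M where M: "\<forall>n\<ge>M. norm (s n - l) < e" using LIMSEQ_D[OF lim] by blast
    show "\<exists>M. \<forall>n\<ge>M. nrm B (component (s n) B \<ominus>\<^bsub>B\<^esub> component l B) < e"
    proof (intro exI[of _ M] allI impI)
      fix n assume "n \<ge> M"
      then have "norm (s n - l) < e" by (rule M[rule_format])
      then show "nrm B (component (s n) B \<ominus>\<^bsub>B\<^esub> component l B) < e"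
        by (rule le_less_trans[OF component_norm_le[OF B, of "s n - l", unfolded component_diff[OF B]]])
    qed
  qed (rule component_closed[OF B])+
  moreover have "\<forall>k. component (s k) B \<in> S" using s by simp
  moreover have "\<forall>s l. (\<forall>k. s k \<in> S) \<and> N.conv s l \<longrightarrow> l \<in> S"
    using assms unfolding N.closedin_iff by (rule conjunct2)
  ultimately have "component l B \<in> S" by (elim allE[of _ "\<lambda>k. component (s k) B"] allE[of _ "component l B"] impE) simp_all
  then show "l \<in> {x. component x B \<in> S}" by simp
qed

lemma ideal_component:
  assumes "ideal J B" shows "ideal_in UNIV {x. component x B \<in> J}"
proof -
  interpret ideal J B by (rule assms)
  show ?thesis
    by (auto simp: ideal_in_def component_simps[OF B] component_closed[OF B] I_l_closed I_r_closed)
qed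

lemma subalg_component:
  assumes "unital_cstar_subalgebra B A"
  shows "unital_subalg {x. component x B \<in> A}"
proof -
  have "subring A B" using assms by (simp add: unital_cstar_subalgebra_def)
  then show ?thesis
    using assms closed_component[of A] unfolding unital_subalg_def unital_cstar_subalgebra_def
    by (auto simp: component_simps[OF B] component_star[OF B] subringE)
qed

section \<open>Cosets and the quotient norm\<close>

lemma coset_cases:
  assumes J: "ideal J B" and X: "X \<in> carrier (quotient_alg B J)"
  obtains x where "x \<in> carrier B" "X = J +>\<^bsub>B\<^esub> x"
  using X by (auto simp: quotient_alg_def FactRing_simps)

lemma quotient_alg_simps:
  assumes J: "ideal J B" and x: "x \<in> carrier B" and y: "y \<in> carrier B"
  shows "J +>\<^bsub>B\<^esub> x \<in> carrier (quotient_alg B J)"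
    "(J +>\<^bsub>B\<^esub> x) \<otimes>\<^bsub>quotient_alg B J\<^esub> (J +>\<^bsub>B\<^esub> y) = J +>\<^bsub>B\<^esub> (x \<otimes>\<^bsub>B\<^esub> y)"
    "(J +>\<^bsub>B\<^esub> x) \<ominus>\<^bsub>quotient_alg B J\<^esub> (J +>\<^bsub>B\<^esub> y) = J +>\<^bsub>B\<^esub> (x \<ominus>\<^bsub>B\<^esub> y)"
proof -
  interpret ideal J B by (rule J)
  interpret h: ring_hom_ring B "B Quot J" "(+>\<^bsub>B\<^esub>) J" by (rule rcos_ring_hom_ring)
  show "J +>\<^bsub>B\<^esub> x \<in> carrier (quotient_alg B J)"
    using h.hom_closed[OF x] by (simp add: quotient_alg_def)
  show "(J +>\<^bsub>B\<^esub> x) \<otimes>\<^bsub>quotient_alg B J\<^esub> (J +>\<^bsub>B\<^esub> y) = J +>\<^bsub>B\<^esub> (x \<otimes>\<^bsub>B\<^esub> y)"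
    using h.hom_mult[OF x y] by (simp add: quotient_alg_def)
  have "X \<ominus>\<^bsub>quotient_alg B J\<^esub> Y = X \<ominus>\<^bsub>B Quot J\<^esub> Y" for X Y
    by (simp add: a_minus_def a_inv_def m_inv_def quotient_alg_def)
  then show "(J +>\<^bsub>B\<^esub> x) \<ominus>\<^bsub>quotient_alg B J\<^esub> (J +>\<^bsub>B\<^esub> y) = J +>\<^bsub>B\<^esub> (x \<ominus>\<^bsub>B\<^esub> y)"
    using h.hom_add[OF x, of "\<ominus>\<^bsub>B\<^esub> y"] h.hom_a_inv[OF y] y by (simp add: a_minus_def)
qed

text \<open>The quotient norm is an infimum, so representatives are optimal only up to
  \<open>e\<close>. That they differ from \<open>x\<close> by an element of \<open>J\<close> is what
  lifting commutators requires.\<close>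

lemma
  assumes J: "ideal J B" and x: "x \<in> carrier B"
  shows nrm_quotient_nonneg: "0 \<le> nrm (quotient_alg B J) (J +>\<^bsub>B\<^esub> x)"
    and nrm_quotient_le: "nrm (quotient_alg B J) (J +>\<^bsub>B\<^esub> x) \<le> nrm B x"
    and nrm_quotient_repr: "e > 0 \<Longrightarrow> \<exists>y\<in>carrier B. y \<ominus>\<^bsub>B\<^esub> x \<in> J \<and> J +>\<^bsub>B\<^esub> y = J +>\<^bsub>B\<^esub> x \<and>
      nrm B y < nrm (quotient_alg B J) (J +>\<^bsub>B\<^esub> x) + e"
proof -
  interpret ideal J B by (rule J)
  have X: "nrm (quotient_alg B J) (J +>\<^bsub>B\<^esub> x) = (INF y\<in>J +>\<^bsub>B\<^esub> x. nrm B y)" by (simp add: quotient_alg_def)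
  have self: "x \<in> J +>\<^bsub>B\<^esub> x" by (rule a_rcos_self[OF x])
  have car: "y \<in> carrier B" if "y \<in> J +>\<^bsub>B\<^esub> x" for y by (rule a_elemrcos_carrier[OF x that])
  show "0 \<le> nrm (quotient_alg B J) (J +>\<^bsub>B\<^esub> x)"
    unfolding X using self by (intro cINF_greatest) (blast, simp add: car B.nrm_nonneg)
  have bdd: "bdd_below (nrm B ` (J +>\<^bsub>B\<^esub> x))" by (rule bdd_belowI2[of _ 0]) (simp add: B.nrm_nonneg car)
  then show "nrm (quotient_alg B J) (J +>\<^bsub>B\<^esub> x) \<le> nrm B x"
    unfolding X using self by (intro cINF_lower)
  assume "e > 0"
  then have "(INF y\<in>J +>\<^bsub>B\<^esub> x. nrm B y) < nrm (quotient_alg B J) (J +>\<^bsub>B\<^esub> x) + e" by (simp add: X)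
  then obtain y where y: "y \<in> J +>\<^bsub>B\<^esub> x" "nrm B y < nrm (quotient_alg B J) (J +>\<^bsub>B\<^esub> x) + e"
    using self by (subst (asm) cINF_less_iff[OF _ bdd]) auto
  moreover have "y \<ominus>\<^bsub>B\<^esub> x \<in> J" using a_rcos_module_minus[OF B.ring_axioms x car] y(1) by blast
  moreover have "J +>\<^bsub>B\<^esub> y = J +>\<^bsub>B\<^esub> x" using a_repr_independence'[OF y(1) x] by simp
  ultimately show "\<exists>y\<in>carrier B. y \<ominus>\<^bsub>B\<^esub> x \<in> J \<and> J +>\<^bsub>B\<^esub> y = J +>\<^bsub>B\<^esub> x \<and>
      nrm B y < nrm (quotient_alg B J) (J +>\<^bsub>B\<^esub> x) + e" using car by blast
qed

end

section \<open>Lifting asymptotically commuting nets\<close>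

text \<open>Since \<open>s(1-e)y - (1-e)ys = (1-e)(sy-ys) - (se-es)y\<close>, multiplication by \<open>1-e\<close> for a quasi-central
  \<open>e\<close> reduces the commutators of \<open>y\<close> to their size modulo the ideal \<open>K\<close>.\<close>

lemma quasi_central_commutator:
  fixes K :: "'a::cstar_alg set"
  assumes K: "ideal_in UNIV K" and F: "finite F"
    and jc: "\<And>s. s \<in> F \<Longrightarrow> s * y - y * s - c s \<in> K" and d: "d > 0"
  obtains e where "e \<in> K" "norm ((1 - e) * y) \<le> norm y"
    "\<And>s. s \<in> F \<Longrightarrow> norm (s * ((1 - e) * y) - (1 - e) * y * s) \<le> norm (c s) + d"
proof -
  \<comment> \<open>The total error is \<open>d'\<close> from the approximate unit plus
    \<open>d' * norm y\<close> from the commutators with \<open>e\<close>.\<close>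
  define d' where "d' = d / (1 + norm y)"
  have n1: "1 + norm y > 0" by (simp add: add_pos_nonneg)
  have d': "d' > 0" "d' * (1 + norm y) = d" using d n1 by (simp_all add: d'_def)
  define V where "V = (\<lambda>s. s * y - y * s - c s) ` F"
  have V: "dominated K (v * star v)" if "v \<in> V" for v
    using that jc ideal_mult_right[OF K UNIV_I] by (auto simp: V_def intro!: dominated_self pos_mult_star)
  have m: "multiplier K s" for s by (rule multiplier_mem[OF unital_subalg_UNIV K UNIV_I])
  have "finite V" using F by (simp add: V_def)
  obtain e where e: "e \<in> K" "pos e" "pos (1 - e)" "\<And>v. v \<in> V \<Longrightarrow> norm ((1 - e) * v) \<le> d'"
    "\<And>s. s \<in> F \<Longrightarrow> norm (s * e - e * s) \<le> d'"
    by (rule quasi_central[OF unital_subalg_UNIV K F m m \<open>finite V\<close> _ d'(1)]) (erule V, (rule that; blast))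
  have "pos (1 - (1 - e))" using e(2) by simp
  then have n: "norm (1 - e) \<le> 1" by (rule norm_le_one_of_pos[OF e(3)])
  have nm: "norm ((1 - e) * x) \<le> norm x" for x
    using order_trans[OF norm_mult_ineq mult_right_mono[OF n norm_ge_zero]] by simp
  have "norm (s * ((1 - e) * y) - (1 - e) * y * s) \<le> norm (c s) + d" if s: "s \<in> F" for s
  proof -
    define j where "j = s * y - y * s - c s"
    have "j \<in> V" using s by (simp add: V_def j_def)
    have eq: "s * ((1 - e) * y) - (1 - e) * y * s = (1 - e) * j + (1 - e) * c s - (s * e - e * s) * y"
      by (simp add: j_def algebra_simps)
    have "norm (s * ((1 - e) * y) - (1 - e) * y * s) \<le> norm ((1 - e) * j) + norm ((1 - e) * c s) + norm ((s * e - e * s) * y)"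
      unfolding eq by (intro order_trans[OF norm_triangle_ineq4] add_mono norm_triangle_ineq order_refl)
    also have "norm ((1 - e) * j) \<le> d'" by (rule e(4)[OF \<open>j \<in> V\<close>])
    also have "norm ((1 - e) * c s) \<le> norm (c s)" by (rule nm)
    also have "norm ((s * e - e * s) * y) \<le> d' * norm y"
      by (rule order_trans[OF norm_mult_ineq mult_right_mono[OF e(5)[OF s] norm_ge_zero]])
    finally show ?thesis using d'(2) by (simp add: algebra_simps)
  qed
  then show ?thesis using that[OF e(1) nm] by blast
qed

context
  fixes B :: "'a star_alg"
  assumes B: "unital_cstar_algebra B"
begin

interpretation B: unital_cstar_algebra B by (rule B)

text \<open>Each commutator is compared with a near-optimal representative \<open>c s\<close> of its
  coset; the difference lies in \<open>J\<close>. \<open>quasi_central_commutator\<close> is applied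
  in the product algebra to the preimage of \<open>J\<close>, and the result is projected back to
  \<open>B\<close>.\<close>

lemma quotient_commutator_repr:
  assumes J: "ideal J B" and y: "y \<in> carrier B" and F: "finite F" "F \<subseteq> carrier B" and d: "d > 0"
  obtains x where "x \<in> carrier B" "J +>\<^bsub>B\<^esub> x = J +>\<^bsub>B\<^esub> y" "nrm B x \<le> nrm B y"
    "\<And>s. s \<in> F \<Longrightarrow> nrm B (s \<otimes>\<^bsub>B\<^esub> x \<ominus>\<^bsub>B\<^esub> x \<otimes>\<^bsub>B\<^esub> s) \<le>
      nrm (quotient_alg B J) (J +>\<^bsub>B\<^esub> (s \<otimes>\<^bsub>B\<^esub> y \<ominus>\<^bsub>B\<^esub> y \<otimes>\<^bsub>B\<^esub> s)) + d"
proof -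
  interpret ideal J B by (rule J)
  note cl = component_lift[OF B]
  have d2: "d / 2 > 0" using d by simp
  have "\<exists>c\<in>carrier B. c \<ominus>\<^bsub>B\<^esub> (s \<otimes>\<^bsub>B\<^esub> y \<ominus>\<^bsub>B\<^esub> y \<otimes>\<^bsub>B\<^esub> s) \<in> J \<and>
      nrm B c < nrm (quotient_alg B J) (J +>\<^bsub>B\<^esub> (s \<otimes>\<^bsub>B\<^esub> y \<ominus>\<^bsub>B\<^esub> y \<otimes>\<^bsub>B\<^esub> s)) + d / 2" if "s \<in> F" for s
  proof -
    have "s \<otimes>\<^bsub>B\<^esub> y \<ominus>\<^bsub>B\<^esub> y \<otimes>\<^bsub>B\<^esub> s \<in> carrier B" using that F(2) y by auto
    then show ?thesis using nrm_quotient_repr[OF B J _ d2] by blast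
  qed
  then obtain c where c: "\<forall>s\<in>F. c s \<in> carrier B \<and> c s \<ominus>\<^bsub>B\<^esub> (s \<otimes>\<^bsub>B\<^esub> y \<ominus>\<^bsub>B\<^esub> y \<otimes>\<^bsub>B\<^esub> s) \<in> J \<and>
      nrm B (c s) < nrm (quotient_alg B J) (J +>\<^bsub>B\<^esub> (s \<otimes>\<^bsub>B\<^esub> y \<ominus>\<^bsub>B\<^esub> y \<otimes>\<^bsub>B\<^esub> s)) + d / 2" by metis
  define K where "K = {x. component x B \<in> J}"
  have K: "ideal_in UNIV K" unfolding K_def by (rule ideal_component[OF B J])
  define y' where "y' = lift B y"
  have y': "component y' B = y" unfolding y'_def by (rule cl[OF y])
  define g where "g s = lift B (c (component s B))" for s
  have jc: "s * y' - y' * s - g s \<in> K" if "s \<in> lift B ` F" for s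
  proof -
    obtain t where t: "t \<in> F" "s = lift B t" using \<open>s \<in> lift B ` F\<close> by blast
    have tc: "t \<in> carrier B" "c t \<in> carrier B" using t F(2) c by auto
    have "\<ominus>\<^bsub>B\<^esub> (c t \<ominus>\<^bsub>B\<^esub> (t \<otimes>\<^bsub>B\<^esub> y \<ominus>\<^bsub>B\<^esub> y \<otimes>\<^bsub>B\<^esub> t)) \<in> J" using c t by (simp add: a_inv_closed)
    moreover have "\<ominus>\<^bsub>B\<^esub> (c t \<ominus>\<^bsub>B\<^esub> (t \<otimes>\<^bsub>B\<^esub> y \<ominus>\<^bsub>B\<^esub> y \<otimes>\<^bsub>B\<^esub> t)) = (t \<otimes>\<^bsub>B\<^esub> y \<ominus>\<^bsub>B\<^esub> y \<otimes>\<^bsub>B\<^esub> t) \<ominus>\<^bsub>B\<^esub> c t"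
      using tc y by (simp add: B.minus_eq B.minus_add B.a_ac)
    ultimately show ?thesis
      by (simp add: K_def g_def t component_simps[OF B] cl tc y')
  qed
  have "finite (lift B ` F)" using F(1) by simp
  obtain e where e: "e \<in> K" "norm ((1 - e) * y') \<le> norm y'"
    "\<And>s. s \<in> lift B ` F \<Longrightarrow> norm (s * ((1 - e) * y') - (1 - e) * y' * s) \<le> norm (g s) + d / 2"
    by (rule quasi_central_commutator[OF K \<open>finite (lift B ` F)\<close> _ d2]) (erule jc, (rule that; blast))
  define x where "x = component ((1 - e) * y') B"
  have x: "x \<in> carrier B" unfolding x_def by (rule component_closed[OF B])
  have eJ: "component e B \<in> J" using e(1) by (simp add: K_def)
  then have ec: "component e B \<in> carrier B" by (rule a_Hcarr)
  have "x = y \<ominus>\<^bsub>B\<^esub> component e B \<otimes>\<^bsub>B\<^esub> y"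
    using y ec by (simp add: x_def component_simps[OF B] y' B.minus_eq B.l_distr B.l_minus)
  then have "x \<ominus>\<^bsub>B\<^esub> y = \<ominus>\<^bsub>B\<^esub> (component e B \<otimes>\<^bsub>B\<^esub> y)"
    using y ec by (simp add: B.minus_eq B.a_ac B.r_neg2 B.r_neg1 B.r_neg)
  then have "x \<ominus>\<^bsub>B\<^esub> y \<in> J" using eJ y by (simp add: I_r_closed a_inv_closed)
  then have "x \<in> J +>\<^bsub>B\<^esub> y" using a_rcos_module_minus[OF B.ring_axioms y x] by blast
  then have coset: "J +>\<^bsub>B\<^esub> x = J +>\<^bsub>B\<^esub> y" using a_repr_independence' y by metis
  have "nrm B x \<le> norm ((1 - e) * y')" unfolding x_def by (rule component_norm_le[OF B])
  also have "\<dots> \<le> norm y'" by (rule e(2))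
  also have "\<dots> \<le> nrm B y" unfolding y'_def by (rule norm_lift[OF B y])
  finally have nx: "nrm B x \<le> nrm B y" .
  have "nrm B (s \<otimes>\<^bsub>B\<^esub> x \<ominus>\<^bsub>B\<^esub> x \<otimes>\<^bsub>B\<^esub> s) \<le>
      nrm (quotient_alg B J) (J +>\<^bsub>B\<^esub> (s \<otimes>\<^bsub>B\<^esub> y \<ominus>\<^bsub>B\<^esub> y \<otimes>\<^bsub>B\<^esub> s)) + d" if s: "s \<in> F" for s
  proof -
    have sc: "s \<in> carrier B" "c s \<in> carrier B" using s F(2) c by auto
    have "s \<otimes>\<^bsub>B\<^esub> x \<ominus>\<^bsub>B\<^esub> x \<otimes>\<^bsub>B\<^esub> s = component (lift B s * ((1 - e) * y') - (1 - e) * y' * lift B s) B"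
      by (simp only: component_diff[OF B] component_mult[OF B, of "lift B s"] component_mult[OF B, of _ "lift B s"] x_def cl[OF sc(1)])
    then have "nrm B (s \<otimes>\<^bsub>B\<^esub> x \<ominus>\<^bsub>B\<^esub> x \<otimes>\<^bsub>B\<^esub> s) \<le> norm (lift B s * ((1 - e) * y') - (1 - e) * y' * lift B s)"
      using component_norm_le[OF B] by (simp only:)
    also have "\<dots> \<le> norm (g (lift B s)) + d / 2" using s by (intro e(3) imageI)
    also have "norm (g (lift B s)) \<le> nrm B (c s)"
      using norm_lift[OF B sc(2)] by (simp only: g_def cl[OF sc(1)])
    also have "nrm B (c s) \<le> nrm (quotient_alg B J) (J +>\<^bsub>B\<^esub> (s \<otimes>\<^bsub>B\<^esub> y \<ominus>\<^bsub>B\<^esub> y \<otimes>\<^bsub>B\<^esub> s)) + d / 2" using c s by (simp add: less_imp_le)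
    finally show ?thesis by simp
  qed
  then show ?thesis using that[OF x coset nx] by blast
qed

end

lemma asymp_commutes_iff:
  assumes D: "directed_on D leq"
    and nn: "\<And>d. d \<in> D \<Longrightarrow> 0 \<le> nrm B (S \<otimes>\<^bsub>B\<^esub> X d \<ominus>\<^bsub>B\<^esub> X d \<otimes>\<^bsub>B\<^esub> S)"
  shows "asymp_commutes B D leq X S \<longleftrightarrow>
    (\<forall>\<epsilon>>0. \<exists>d\<in>D. \<forall>d'\<in>D. leq d d' \<longrightarrow> nrm B (S \<otimes>\<^bsub>B\<^esub> X d' \<ominus>\<^bsub>B\<^esub> X d' \<otimes>\<^bsub>B\<^esub> S) < \<epsilon>)"
  unfolding asymp_commutes_def tendsto_iff eventually_net_filter[OF D] dist_real_def
  using nn by simp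

text \<open>A net in the quotient cannot be lifted index by index, because the quasi-central element
  depends on finitely many elements of \<open>A\<close> and on a tolerance. The lifted net is
  therefore indexed by triples \<open>(d, F, k)\<close>, with commutators controlled on
  \<open>F\<close> up to \<open>inverse (real (Suc k))\<close>.\<close>

lemma approx_double_commutant_quotient:
  fixes B :: "'a star_alg"
  assumes B: "unital_cstar_algebra B" and J: "ideal J B" and A: "A \<subseteq> carrier B"
    and T: "T \<in> approx_double_commutant B A"
  shows "J +>\<^bsub>B\<^esub> T \<in> approx_double_commutant (quotient_alg B J) ((\<lambda>a. J +>\<^bsub>B\<^esub> a) ` A)"
proof -
  interpret B: unital_cstar_algebra B by (rule B)
  define Q where "Q = quotient_alg B J"
  define q where "q x = J +>\<^bsub>B\<^esub> x" for x
  have qin: "q x \<in> carrier Q" if "x \<in> carrier B" for x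
    unfolding Q_def q_def by (rule quotient_alg_simps(1)[OF B J that that])
  have qcomm: "q s \<otimes>\<^bsub>Q\<^esub> q x \<ominus>\<^bsub>Q\<^esub> q x \<otimes>\<^bsub>Q\<^esub> q s = q (s \<otimes>\<^bsub>B\<^esub> x \<ominus>\<^bsub>B\<^esub> x \<otimes>\<^bsub>B\<^esub> s)" if "s \<in> carrier B" "x \<in> carrier B" for s x
    unfolding Q_def q_def using quotient_alg_simps[OF B J] that by simp
  have Tc: "T \<in> carrier B" using T by (simp add: approx_double_commutant_def)
  have "asymp_commutes Q D leq X (q T)"
    if D: "directed_on D leq" and X: "bounded_net Q D X"
      and comm: "\<And>S. S \<in> q ` A \<Longrightarrow> asymp_commutes Q D leq X S"
    for D :: "('a set \<times> 'a set set) set" and leq X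
  proof -
    have D_refl: "\<And>d. d \<in> D \<Longrightarrow> leq d d"
      and D_trans: "\<And>d e f. d \<in> D \<Longrightarrow> e \<in> D \<Longrightarrow> f \<in> D \<Longrightarrow> leq d e \<Longrightarrow> leq e f \<Longrightarrow> leq d f"
      and D_dir: "\<And>d e. d \<in> D \<Longrightarrow> e \<in> D \<Longrightarrow> \<exists>f\<in>D. leq d f \<and> leq e f"
      and D_ne: "D \<noteq> {}"
      using D unfolding directed_on_def by blast+
    obtain K where K: "\<forall>d\<in>D. X d \<in> carrier Q \<and> nrm Q (X d) \<le> K" using X unfolding bounded_net_def by blast
    have "\<exists>y\<in>carrier B. q y = X d \<and> nrm B y \<le> K + 1" if d: "d \<in> D" for d
    proof -
      have "X d \<in> carrier (quotient_alg B J)" using K d by (simp add: Q_def)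
      then obtain x where x: "x \<in> carrier B" "X d = J +>\<^bsub>B\<^esub> x" by (rule coset_cases[OF B J])
      obtain y where "y \<in> carrier B" "q y = q x" "nrm B y < nrm Q (q x) + 1"
        using nrm_quotient_repr[OF B J x(1) zero_less_one] unfolding q_def Q_def by blast
      moreover have "nrm Q (q x) \<le> K" using K d unfolding q_def x(2)[symmetric] by blast
      ultimately show ?thesis using x by (intro bexI[of _ y]) (auto simp: q_def)
    qed
    then obtain Y where Y: "\<forall>d\<in>D. Y d \<in> carrier B \<and> q (Y d) = X d \<and> nrm B (Y d) \<le> K + 1" by metis
    define E where "E = {(d, F, k :: nat). d \<in> D \<and> finite F \<and> F \<subseteq> A}"
    define le where "le p p' \<longleftrightarrow> leq (fst p) (fst p') \<and> fst (snd p) \<subseteq> fst (snd p') \<and> snd (snd p) \<le> snd (snd p')"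
      for p p' :: "('a set \<times> 'a set set) \<times> 'a set \<times> nat"
    have E: "directed_on E le"
      unfolding directed_on_def
    proof (intro conjI ballI impI)
      obtain d where "d \<in> D" using D_ne by blast
      then have "(d, {}, 0) \<in> E" by (simp add: E_def)
      then show "E \<noteq> {}" by blast
      show "le p p" if "p \<in> E" for p using that D_refl by (auto simp: E_def le_def)
      show "le p r" if "p \<in> E" "p' \<in> E" "r \<in> E" "le p p' \<and> le p' r" for p p' r
        using that D_trans[of "fst p" "fst p'" "fst r"] by (auto simp: E_def le_def)
      fix p p' assume p: "p \<in> E" "p' \<in> E"
      then obtain f where f: "f \<in> D" "leq (fst p) f" "leq (fst p') f" using D_dir[of "fst p" "fst p'"] by (auto simp: E_def)
      then show "\<exists>r\<in>E. le p r \<and> le p' r"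
        using p by (intro bexI[of _ "(f, fst (snd p) \<union> fst (snd p'), max (snd (snd p)) (snd (snd p')))"]) (auto simp: E_def le_def)
    qed
    have ex: "\<exists>x. x \<in> carrier B \<and> q x = X d \<and> nrm B x \<le> K + 1 \<and>
        (\<forall>s\<in>F. nrm B (s \<otimes>\<^bsub>B\<^esub> x \<ominus>\<^bsub>B\<^esub> x \<otimes>\<^bsub>B\<^esub> s) \<le> nrm Q (q s \<otimes>\<^bsub>Q\<^esub> X d \<ominus>\<^bsub>Q\<^esub> X d \<otimes>\<^bsub>Q\<^esub> q s) + inverse (real (Suc k)))"
      if "(d, F, k) \<in> E" for d F k
    proof -
      have d: "d \<in> D" "finite F" "F \<subseteq> carrier B" using that A by (auto simp: E_def)
      have y: "Y d \<in> carrier B" "q (Y d) = X d" "nrm B (Y d) \<le> K + 1" using Y d(1) by auto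
      have pos: "inverse (real (Suc k)) > 0" by simp
      obtain x where x: "x \<in> carrier B" "q x = q (Y d)" "nrm B x \<le> nrm B (Y d)"
        "\<forall>s\<in>F. nrm B (s \<otimes>\<^bsub>B\<^esub> x \<ominus>\<^bsub>B\<^esub> x \<otimes>\<^bsub>B\<^esub> s) \<le> nrm Q (q (s \<otimes>\<^bsub>B\<^esub> Y d \<ominus>\<^bsub>B\<^esub> Y d \<otimes>\<^bsub>B\<^esub> s)) + inverse (real (Suc k))"
        using quotient_commutator_repr[OF B J y(1) d(2,3) pos] unfolding q_def Q_def by metis
      show ?thesis
      proof (intro exI[of _ x] conjI ballI)
        fix s assume s: "s \<in> F"
        then have "q (s \<otimes>\<^bsub>B\<^esub> Y d \<ominus>\<^bsub>B\<^esub> Y d \<otimes>\<^bsub>B\<^esub> s) = q s \<otimes>\<^bsub>Q\<^esub> X d \<ominus>\<^bsub>Q\<^esub> X d \<otimes>\<^bsub>Q\<^esub> q s"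
          using qcomm[of s "Y d"] d y by auto
        then show "nrm B (s \<otimes>\<^bsub>B\<^esub> x \<ominus>\<^bsub>B\<^esub> x \<otimes>\<^bsub>B\<^esub> s) \<le> nrm Q (q s \<otimes>\<^bsub>Q\<^esub> X d \<ominus>\<^bsub>Q\<^esub> X d \<otimes>\<^bsub>Q\<^esub> q s) + inverse (real (Suc k))"
          using x(4) s by auto
      qed (use x y in auto)
    qed
    define x where "x p = (SOME x. x \<in> carrier B \<and> q x = X (fst p) \<and> nrm B x \<le> K + 1 \<and>
        (\<forall>s\<in>fst (snd p). nrm B (s \<otimes>\<^bsub>B\<^esub> x \<ominus>\<^bsub>B\<^esub> x \<otimes>\<^bsub>B\<^esub> s) \<le>
          nrm Q (q s \<otimes>\<^bsub>Q\<^esub> X (fst p) \<ominus>\<^bsub>Q\<^esub> X (fst p) \<otimes>\<^bsub>Q\<^esub> q s) + inverse (real (Suc (snd (snd p))))))" for p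
    have x: "x (d, F, k) \<in> carrier B \<and> q (x (d, F, k)) = X d \<and> nrm B (x (d, F, k)) \<le> K + 1 \<and>
        (\<forall>s\<in>F. nrm B (s \<otimes>\<^bsub>B\<^esub> x (d, F, k) \<ominus>\<^bsub>B\<^esub> x (d, F, k) \<otimes>\<^bsub>B\<^esub> s) \<le>
          nrm Q (q s \<otimes>\<^bsub>Q\<^esub> X d \<ominus>\<^bsub>Q\<^esub> X d \<otimes>\<^bsub>Q\<^esub> q s) + inverse (real (Suc k)))"
      if "(d, F, k) \<in> E" for d F k
      unfolding x_def fst_conv snd_conv by (rule someI_ex[OF ex[OF that]])
    have xc: "x p \<in> carrier B" "nrm B (x p) \<le> K + 1" if "p \<in> E" for p
      using that x[of "fst p" "fst (snd p)" "snd (snd p)"] by simp_all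
    have bdd: "bounded_net B E x" unfolding bounded_net_def using xc by blast
    have nn: "0 \<le> nrm B (s \<otimes>\<^bsub>B\<^esub> x p \<ominus>\<^bsub>B\<^esub> x p \<otimes>\<^bsub>B\<^esub> s)" if "s \<in> carrier B" "p \<in> E" for s p
      using that xc by (simp add: B.nrm_nonneg)
    have nnQ: "0 \<le> nrm Q (q s \<otimes>\<^bsub>Q\<^esub> X d \<ominus>\<^bsub>Q\<^esub> X d \<otimes>\<^bsub>Q\<^esub> q s)" if s: "s \<in> carrier B" and d: "d \<in> D" for s d
    proof -
      have y: "Y d \<in> carrier B" "q (Y d) = X d" using Y d by auto
      show ?thesis
        using nrm_quotient_nonneg[OF B J, of "s \<otimes>\<^bsub>B\<^esub> Y d \<ominus>\<^bsub>B\<^esub> Y d \<otimes>\<^bsub>B\<^esub> s"] qcomm[OF s y(1)] s y by (simp add: Q_def q_def)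
    qed
    have commB: "asymp_commutes B E le x s \<longleftrightarrow>
        (\<forall>\<epsilon>>0. \<exists>p\<in>E. \<forall>p'\<in>E. le p p' \<longrightarrow> nrm B (s \<otimes>\<^bsub>B\<^esub> x p' \<ominus>\<^bsub>B\<^esub> x p' \<otimes>\<^bsub>B\<^esub> s) < \<epsilon>)"
      if "s \<in> carrier B" for s
      by (rule asymp_commutes_iff[OF E]) (rule nn[OF that])
    have commQ: "asymp_commutes Q D leq X (q s) \<longleftrightarrow>
        (\<forall>\<epsilon>>0. \<exists>d\<in>D. \<forall>d'\<in>D. leq d d' \<longrightarrow> nrm Q (q s \<otimes>\<^bsub>Q\<^esub> X d' \<ominus>\<^bsub>Q\<^esub> X d' \<otimes>\<^bsub>Q\<^esub> q s) < \<epsilon>)"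
      if "s \<in> carrier B" for s
      by (rule asymp_commutes_iff[OF D]) (rule nnQ[OF that])
    have "asymp_commutes B E le x S" if S: "S \<in> A" for S
    proof -
      have Sc: "S \<in> carrier B" using S A by blast
      show ?thesis
        unfolding commB[OF Sc]
      proof (intro allI impI)
        fix \<epsilon> :: real assume \<epsilon>: "\<epsilon> > 0"
        have "asymp_commutes Q D leq X (q S)" using comm S by blast
        then obtain d where d: "d \<in> D" and dS: "\<forall>d'\<in>D. leq d d' \<longrightarrow> nrm Q (q S \<otimes>\<^bsub>Q\<^esub> X d' \<ominus>\<^bsub>Q\<^esub> X d' \<otimes>\<^bsub>Q\<^esub> q S) < \<epsilon> / 2"
          unfolding commQ[OF Sc] using half_gt_zero[OF \<epsilon>] by blast
        obtain k where k: "inverse (real (Suc k)) < \<epsilon> / 2" using reals_Archimedean[OF half_gt_zero[OF \<epsilon>]] by blast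
        show "\<exists>p\<in>E. \<forall>p'\<in>E. le p p' \<longrightarrow> nrm B (S \<otimes>\<^bsub>B\<^esub> x p' \<ominus>\<^bsub>B\<^esub> x p' \<otimes>\<^bsub>B\<^esub> S) < \<epsilon>"
        proof (intro bexI[of _ "(d, {S}, k)"] ballI impI)
          show "(d, {S}, k) \<in> E" using d S by (simp add: E_def)
          fix p' assume p': "p' \<in> E" "le (d, {S}, k) p'"
          obtain d' F k' where p'_eq: "p' = (d', F, k')" by (cases p')
          have le: "d' \<in> D" "leq d d'" "S \<in> F" "k \<le> k'" using p' by (auto simp: p'_eq E_def le_def)
          have "nrm B (S \<otimes>\<^bsub>B\<^esub> x p' \<ominus>\<^bsub>B\<^esub> x p' \<otimes>\<^bsub>B\<^esub> S) \<le> nrm Q (q S \<otimes>\<^bsub>Q\<^esub> X d' \<ominus>\<^bsub>Q\<^esub> X d' \<otimes>\<^bsub>Q\<^esub> q S) + inverse (real (Suc k'))"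
            using x p' le(3) unfolding p'_eq by blast
          also have "\<dots> < \<epsilon> / 2 + \<epsilon> / 2"
          proof (rule add_strict_mono)
            show "nrm Q (q S \<otimes>\<^bsub>Q\<^esub> X d' \<ominus>\<^bsub>Q\<^esub> X d' \<otimes>\<^bsub>Q\<^esub> q S) < \<epsilon> / 2" using dS le by blast
            have "inverse (real (Suc k')) \<le> inverse (real (Suc k))" using le(4) by (intro le_imp_inverse_le) auto
            then show "inverse (real (Suc k')) < \<epsilon> / 2" using k by (rule le_less_trans)
          qed
          finally show "nrm B (S \<otimes>\<^bsub>B\<^esub> x p' \<ominus>\<^bsub>B\<^esub> x p' \<otimes>\<^bsub>B\<^esub> S) < \<epsilon>" by simp
        qed
      qed
    qed
    \<comment> \<open>The index type of \<open>E\<close> is not the one in the definition of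
      \<open>approx_double_commutant\<close>, hence the version for arbitrary index types.\<close>
    then have TE: "asymp_commutes B E le x T" by (rule approx_double_commutant_net[OF T E bdd])
    show ?thesis
      unfolding commQ[OF Tc]
    proof (intro allI impI)
      fix \<epsilon> :: real assume \<epsilon>: "\<epsilon> > 0"
      obtain p where p: "p \<in> E" "\<forall>p'\<in>E. le p p' \<longrightarrow> nrm B (T \<otimes>\<^bsub>B\<^esub> x p' \<ominus>\<^bsub>B\<^esub> x p' \<otimes>\<^bsub>B\<^esub> T) < \<epsilon>"
        using TE \<epsilon> unfolding commB[OF Tc] by blast
      obtain d F k where p_eq: "p = (d, F, k)" by (cases p)
      have d: "d \<in> D" using p(1) by (simp add: p_eq E_def)
      show "\<exists>d\<in>D. \<forall>d'\<in>D. leq d d' \<longrightarrow> nrm Q (q T \<otimes>\<^bsub>Q\<^esub> X d' \<ominus>\<^bsub>Q\<^esub> X d' \<otimes>\<^bsub>Q\<^esub> q T) < \<epsilon>"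
      proof (intro bexI[OF _ d] ballI impI)
        fix d' assume d': "d' \<in> D" "leq d d'"
        \<comment> \<open>\<open>F\<close> and \<open>k\<close> stay fixed, since
          \<open>x p'\<close> represents \<open>X d'\<close> whatever they are.\<close>
        define p' where "p' = (d', F, k)"
        have p': "p' \<in> E" "le p p'" using p(1) d' by (auto simp: p'_def p_eq E_def le_def)
        have xd: "x p' \<in> carrier B" "q (x p') = X d'" using x p'(1) by (auto simp: p'_def)
        have "nrm Q (q T \<otimes>\<^bsub>Q\<^esub> X d' \<ominus>\<^bsub>Q\<^esub> X d' \<otimes>\<^bsub>Q\<^esub> q T) = nrm Q (q (T \<otimes>\<^bsub>B\<^esub> x p' \<ominus>\<^bsub>B\<^esub> x p' \<otimes>\<^bsub>B\<^esub> T))"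
          using qcomm[OF Tc xd(1)] by (simp add: xd(2))
        also have "\<dots> \<le> nrm B (T \<otimes>\<^bsub>B\<^esub> x p' \<ominus>\<^bsub>B\<^esub> x p' \<otimes>\<^bsub>B\<^esub> T)"
          unfolding Q_def q_def using Tc xd(1) by (intro nrm_quotient_le[OF B J]) simp
        also have "\<dots> < \<epsilon>" using p(2) p' by blast
        finally show "nrm Q (q T \<otimes>\<^bsub>Q\<^esub> X d' \<ominus>\<^bsub>Q\<^esub> X d' \<otimes>\<^bsub>Q\<^esub> q T) < \<epsilon>" .
      qed
    qed
  qed
  then show ?thesis
    using qin[OF Tc] unfolding approx_double_commutant_def Q_def q_def by blast
qed

text \<open>The dense set of the carrier may miss \<open>A\<close>; for each of its points and each
  radius \<open>1 / (n + 1)\<close>, one point of \<open>A\<close> within that radius is chosen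
  whenever there is one.\<close>

lemma dense_subset:
  fixes B :: "'a star_alg"
  assumes B: "unital_cstar_algebra B" and sep: "separable_star_alg B" and A: "A \<subseteq> carrier B"
  obtains G where "countable G" "G \<subseteq> A" "\<And>a e. a \<in> A \<Longrightarrow> e > 0 \<Longrightarrow> \<exists>g\<in>G. nrm B (a \<ominus>\<^bsub>B\<^esub> g) < e"
proof -
  interpret B: unital_cstar_algebra B by (rule B)
  interpret N: normed_group B "nrm B" by (rule B.normed)
  obtain C where C: "countable C" "C \<subseteq> carrier B" "\<forall>x\<in>carrier B. \<forall>e>0. \<exists>c\<in>C. nrm B (x \<ominus>\<^bsub>B\<^esub> c) < e"
    using sep unfolding separable_star_alg_def N.separable_iff by blast
  define P where "P c n a \<longleftrightarrow> a \<in> A \<and> nrm B (a \<ominus>\<^bsub>B\<^esub> c) < inverse (real (Suc n))" for c n a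
  define g where "g = (\<lambda>(c, n). SOME a. P c n a)"
  define G where "G = g ` {(c, n). c \<in> C \<and> (\<exists>a. P c n a)}"
  have gP: "P c n (g (c, n))" if "P c n a" for c n a
    using someI[of "P c n", OF that] by (simp add: g_def)
  show ?thesis
  proof (rule that)
    have "countable {(c, n). c \<in> C \<and> (\<exists>a. P c n a)}"
      by (rule countable_subset[of _ "C \<times> UNIV"]) (use C(1) in auto)
    then show "countable G" unfolding G_def by (rule countable_image)
    show "G \<subseteq> A" using gP unfolding G_def by (auto simp: P_def)
    fix a and e :: real assume a: "a \<in> A" and e: "e > 0"
    obtain n where n: "inverse (real (Suc n)) < e / 2" using reals_Archimedean[OF half_gt_zero[OF e]] by blast
    have "inverse (real (Suc n)) > 0" by simp
    then obtain c where c: "c \<in> C" "nrm B (a \<ominus>\<^bsub>B\<^esub> c) < inverse (real (Suc n))" using C(3) a A by blast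
    have "P c n a" using a c by (simp add: P_def)
    then have g: "P c n (g (c, n))" by (rule gP)
    have "g (c, n) \<in> G" unfolding G_def using c \<open>P c n a\<close> by blast
    moreover have "nrm B (a \<ominus>\<^bsub>B\<^esub> g (c, n)) \<le> nrm B (a \<ominus>\<^bsub>B\<^esub> c) + nrm B (c \<ominus>\<^bsub>B\<^esub> g (c, n))"
      using a c(1) g A C(2) by (intro N.n_triangle_minus) (auto simp: P_def)
    moreover have "nrm B (c \<ominus>\<^bsub>B\<^esub> g (c, n)) = nrm B (g (c, n) \<ominus>\<^bsub>B\<^esub> c)"
      using c(1) g A C(2) by (intro N.n_minus_commute) (auto simp: P_def)
    moreover have "nrm B (g (c, n) \<ominus>\<^bsub>B\<^esub> c) < inverse (real (Suc n))" using g by (simp add: P_def)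
    ultimately show "\<exists>g\<in>G. nrm B (a \<ominus>\<^bsub>B\<^esub> g) < e" using c(2) n by (intro bexI[of _ "g (c, n)"]) auto
  qed
qed

theorem theorem21:
  fixes B :: "'a star_alg" and A :: "'a set" and I :: "'i set" and J :: "'i \<Rightarrow> 'a set"
  assumes "unital_cstar_algebra B" and "separable_star_alg B"
    and "unital_cstar_subalgebra B A" and "alg_center B \<subseteq> A"
    and "\<And>i. i \<in> I \<Longrightarrow> closed_ideal B (J i)"
    and "\<And>i j. \<lbrakk>i \<in> I; j \<in> I; i \<noteq> j\<rbrakk> \<Longrightarrow> (A \<inter> J i) <+>\<^bsub>B\<^esub> (A \<inter> J j) = A"
    and "\<And>i. i \<in> I \<Longrightarrow>
           approximately_normal (quotient_alg B (J i)) ((\<lambda>a. J i +>\<^bsub>B\<^esub> a) ` A)"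
    and "\<And>P. primitive_ideal B P \<Longrightarrow> \<exists>i\<in>I. J i \<subseteq> P"
  shows "approximately_normal B A"
proof -
  note B = assms(1) and sub = assms(3)
  interpret B: unital_cstar_algebra B by (rule B)
  have sr: "subring A B" using sub by (simp add: unital_cstar_subalgebra_def)
  have Ac: "A \<subseteq> carrier B" using subringE(1)[OF sr] .
  have J: "ideal (J i) B" "closedin (norm_topology B (nrm B)) (J i)" if "i \<in> I" for i
    using assms(5)[OF that] by (auto simp: closed_ideal_def)
  have J_carrier: "x \<in> carrier B" if "i \<in> I" "x \<in> J i" for i x
    using additive_subgroup.a_subset[OF ideal.axioms(1)[OF J(1)[OF that(1)]]] that(2) by blast
  define A' where "A' = {x. component x B \<in> A}"
  \<comment> \<open>The kernel of the component map, which makes \<open>B\<close> the product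
    algebra modulo \<open>Z\<close>.\<close>
  define Z where "Z = {x. component x B \<in> {\<zero>\<^bsub>B\<^esub>}}"
  define J' where "J' i = {x. component x B \<in> J i}" for i
  have A': "unital_subalg A'" unfolding A'_def by (rule subalg_component[OF B sub])
  have Z: "ideal_in UNIV Z" unfolding Z_def by (rule ideal_component[OF B B.zeroideal])
  have ZA: "Z \<subseteq> A'" using subringE(2)[OF sr] by (auto simp: Z_def A'_def)
  have J': "ideal_in UNIV (J' i)" "closed (J' i)" "Z \<subseteq> J' i" if "i \<in> I" for i
  proof -
    show "ideal_in UNIV (J' i)" unfolding J'_def by (rule ideal_component[OF B J(1)[OF that]])
    show "closed (J' i)" unfolding J'_def by (rule closed_component[OF B J(2)[OF that]])
    show "Z \<subseteq> J' i"
      using additive_subgroup.zero_closed[OF ideal.axioms(1)[OF J(1)[OF that]]] by (auto simp: Z_def J'_def)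
  qed
  have coprime: "\<exists>x\<in>A' \<inter> J' i. \<exists>y\<in>A' \<inter> J' j. x + y = 1" if ij: "i \<in> I" "j \<in> I" "i \<noteq> j" for i j
  proof -
    have "\<one>\<^bsub>B\<^esub> \<in> (A \<inter> J i) <+>\<^bsub>B\<^esub> (A \<inter> J j)" using assms(6)[OF ij] subringE(3)[OF sr] by simp
    then obtain x y where xy: "x \<in> A" "x \<in> J i" "y \<in> A" "y \<in> J j" "\<one>\<^bsub>B\<^esub> = x \<oplus>\<^bsub>B\<^esub> y"
      by (auto simp: set_add_def')
    have car: "x \<in> carrier B" "y \<in> carrier B" using xy Ac by blast+
    \<comment> \<open>The second summand is \<open>1 - lift B x\<close> and not
      \<open>lift B y\<close>, because the two must add up to \<open>1\<close> in the product
      algebra and \<open>lift\<close> is not unital.\<close>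
    have "component (1 - lift B x) B = y"
      using car xy(5) by (simp add: component_simps[OF B] component_lift[OF B] B.minus_eq B.a_lcomm[of x y] B.a_assoc B.r_neg)
    then have "lift B x \<in> A' \<inter> J' i" "1 - lift B x \<in> A' \<inter> J' j" "lift B x + (1 - lift B x) = 1"
      using xy car by (simp_all add: A'_def J'_def component_lift[OF B])
    then show ?thesis by blast
  qed
  have pure: "\<exists>i\<in>I. \<forall>x\<in>J' i. f x = 0" if f: "pure_state f" and fz: "\<And>z. z \<in> Z \<Longrightarrow> f z = 0" for f
  proof -
    have "f z = 0" if "component z B = \<zero>\<^bsub>B\<^esub>" for z using fz that by (simp add: Z_def)
    then obtain P where P: "primitive_ideal B P" "\<And>x. component x B \<in> P \<Longrightarrow> f x = 0"
      using pure_state_vanishes_on_primitive[OF B f] by blast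
    obtain i where "i \<in> I" "J i \<subseteq> P" using assms(8)[OF P(1)] by blast
    then show ?thesis using P(2) by (intro bexI[of _ i]) (auto simp: J'_def)
  qed
  obtain G where G: "countable G" "G \<subseteq> A" "\<And>a e. a \<in> A \<Longrightarrow> e > 0 \<Longrightarrow> \<exists>g\<in>G. nrm B (a \<ominus>\<^bsub>B\<^esub> g) < e"
    by (rule dense_subset[OF B assms(2) Ac]) (rule that; blast)
  have Q: "countable (lift B ` G)" "lift B ` G \<subseteq> A'"
    using G(1,2) Ac by (auto simp: A'_def component_lift[OF B subsetD[OF Ac subsetD[OF G(2)]]])
  have dense: "\<exists>z\<in>Z. \<forall>e>0. \<exists>q\<in>lift B ` G. norm (x - z - q) < e" if x: "x \<in> A'" for x
  proof -
    define a where "a = component x B"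
    have a: "a \<in> A" "a \<in> carrier B" using x Ac by (auto simp: a_def A'_def)
    \<comment> \<open>An element and the lift of its component agree modulo \<open>Z\<close>; in
      this way separability of \<open>B\<close> gives density modulo \<open>Z\<close>.\<close>
    have "x - lift B a \<in> Z"
      using a(2) component_lift[OF B a(2)] component_diff[OF B, of x "lift B a"] by (simp add: Z_def a_def[symmetric] B.minus_eq B.r_neg)
    moreover have "\<exists>q\<in>lift B ` G. norm (x - (x - lift B a) - q) < e" if e: "e > 0" for e
    proof -
      obtain g where g: "g \<in> G" "nrm B (a \<ominus>\<^bsub>B\<^esub> g) < e" using G(3)[OF a(1) e] by blast
      have gc: "g \<in> carrier B" using g(1) G(2) Ac by blast
      have "a \<ominus>\<^bsub>B\<^esub> g \<in> carrier B" using a gc by simp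
      then have "norm (lift B a - lift B g) < e"
        unfolding lift_diff[OF B a(2) gc] by (rule le_less_trans[OF norm_lift[OF B] g(2)])
      then show ?thesis using g(1) by (intro bexI[of _ "lift B g"]) auto
    qed
    ultimately show ?thesis by blast
  qed
  have mem: "t \<in> A'" if t: "star t = t" "\<And>i. i \<in> I \<Longrightarrow> \<exists>a\<in>A'. t - a \<in> J' i" for t
    by (rule separated_ideals.mem_A[where I=I and J=J' and Q="lift B ` G"])
      (rule separated_ideals.intro[OF A' Z ZA J' coprime pure Q dense t]; assumption)
  have "T \<in> A" if T: "T \<in> approx_double_commutant B A" for T
  proof -
    have Tc: "T \<in> carrier B" using T by (simp add: approx_double_commutant_def)
    define t where "t = lift B T"
    have tT: "component t B = T" unfolding t_def by (rule component_lift[OF B Tc])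
    have t: "\<exists>a\<in>A'. t - a \<in> J' i" if i: "i \<in> I" for i
    proof -
      have "J i +>\<^bsub>B\<^esub> T \<in> (\<lambda>a. J i +>\<^bsub>B\<^esub> a) ` A"
        using approx_double_commutant_quotient[OF B J(1)[OF i] Ac T] assms(7)[OF i]
        by (simp add: approximately_normal_def)
      then obtain a where a: "a \<in> A" "J i +>\<^bsub>B\<^esub> T = J i +>\<^bsub>B\<^esub> a" by blast
      interpret Ji: ideal "J i" B by (rule J(1)[OF i])
      have ac: "a \<in> carrier B" using a Ac by blast
      have "T \<in> J i +>\<^bsub>B\<^esub> a" using Ji.a_rcos_self[OF Tc] a(2) by simp
      then have "T \<ominus>\<^bsub>B\<^esub> a \<in> J i" using Ji.a_rcos_module_minus[OF B.ring_axioms ac Tc] by simp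
      then show ?thesis
        using a ac by (intro bexI[of _ "lift B a"]) (simp_all add: J'_def A'_def component_diff[OF B] component_lift[OF B] tT)
    qed
    have iu: "iu \<in> A'"
      using sub subringE(3)[OF sr] by (simp add: A'_def component_iu[OF B] unital_cstar_subalgebra_def)
    \<comment> \<open>\<open>mem\<close> applies to self-adjoint elements. Congruence to elements of
      \<open>A'\<close> passes to real and imaginary parts because each \<open>J' i\<close> is
      stable under \<open>star\<close>.\<close>
    define re im where "re x = (1/2) *\<^sub>R (x + star x)" and "im x = (1/2) *\<^sub>R (iu * (star x - x))" for x :: "'a cstar_prod"
    have sa: "star (re t) = re t" "star (im t) = im t"
      by (simp_all add: re_def im_def star_scaleR star_add star_mult star_diff star_iu iu_comm add.commute algebra_simps)
    have reim: "re x \<in> A'" "im x \<in> A'" if "x \<in> A'" for x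
      unfolding re_def im_def
      by (intro subalg_scaleR[OF A'] subalg_add[OF A'] subalg_mult[OF A'] subalg_diff[OF A'] subalg_star[OF A'] iu that)+
    have diff: "re t - re a = re (t - a)" "im t - im a = im (t - a)" for a
      by (simp_all add: re_def im_def star_diff algebra_simps)
    have reimJ: "re x \<in> J' i" "im x \<in> J' i" if i: "i \<in> I" and x: "x \<in> J' i" for i x
    proof -
      note K = J'(1)[OF i]
      have sx: "star x \<in> J' i" by (rule ideal_star[OF unital_subalg_UNIV K J'(2)[OF i] x])
      show "re x \<in> J' i" unfolding re_def by (intro ideal_scaleR[OF unital_subalg_UNIV K] ideal_add[OF K] x sx)
      show "im x \<in> J' i" unfolding im_def
        by (intro ideal_scaleR[OF unital_subalg_UNIV K] ideal_mult_left[OF K] UNIV_I ideal_diff[OF unital_subalg_UNIV K] x sx)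
    qed
    have "re t \<in> A'"
    proof (rule mem[OF sa(1)])
      fix i assume i: "i \<in> I"
      obtain a where "a \<in> A'" "t - a \<in> J' i" using t[OF i] by blast
      then show "\<exists>a\<in>A'. re t - a \<in> J' i" using reim reimJ[OF i] by (intro bexI[of _ "re a"]) (simp_all add: diff)
    qed
    moreover have "im t \<in> A'"
    proof (rule mem[OF sa(2)])
      fix i assume i: "i \<in> I"
      obtain a where "a \<in> A'" "t - a \<in> J' i" using t[OF i] by blast
      then show "\<exists>a\<in>A'. im t - a \<in> J' i" using reim reimJ[OF i] by (intro bexI[of _ "im a"]) (simp_all add: diff)
    qed
    ultimately have "re t + iu * im t \<in> A'" by (intro subalg_add[OF A'] subalg_mult[OF A'] iu)
    moreover have "re t + iu * im t = t"
    proof -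
      have "iu * im t = (1/2) *\<^sub>R (iu * iu * (star t - t))" by (simp add: im_def mult.assoc)
      then have "re t + iu * im t = (1/2) *\<^sub>R t + (1/2) *\<^sub>R t" by (simp add: re_def iu_mult algebra_simps)
      then show ?thesis by (simp add: scaleR_add_left[symmetric])
    qed
    ultimately show "T \<in> A" by (simp add: A'_def tT)
  qed
  moreover have "A \<subseteq> approx_double_commutant B A" using Ac by (auto simp: approx_double_commutant_def)
  ultimately show ?thesis unfolding approximately_normal_def by blast
qed

end
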